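(* Let $\vec r,\vec s\in\{0,\dots,p-1\}^f$ and $\mathcal H(\vec r,\vec s)=\mathrm{Hom}_{\widetilde G}(\mathrm{ind}_{\widetilde K}^{\widetilde G}\tilde\sigma_{\vec r},\mathrm{ind}_{\widetilde K}^{\widetilde G}\tilde\sigma_{\vec s})$. (1) If $\vec r\neq\vec s$ and $\{\vec r,\vec s\}\neq\{\vec0,\overrightarrow{p-1}\}$, then $\mathcal H(\vec r,\vec s)=0$. (2) The $E$-algebra $\mathcal H(\vec r,\vec r)=\mathrm{End}_{\widetilde G}(\mathrm{ind}_{\widetilde K}^{\widetilde G}\tilde\sigma_{\vec r})$ is isomorphic to a polynomial algebra over $E$ in the single operator $\mathcal T^{\vec r}_1$. (3) If $\{\vec r,\vec s\}=\{\vec0,\overrightarrow{p-1}\}$, then $\mathcal H(\vec r,\vec s)$ is an infinite-dimensional $E$-vector space with basis $\{\mathcal T^{\vec r,\vec s}_n:n>0\}$, and for all $n>0$, $m\geq0$: $\mathcal T^{\vec r,\vec s}_n\circ\mathcal T^{\vec r}_m=\mathcal T^{\vec s}_m\circ\mathcal T^{\vec r,\vec s}_n=\mathcal T^{\vec r,\vec s}_{n+m}$, and for all $n>0$, $m>0$: $\mathcal T^{\vec r,\vec s}_n\circ\mathcal T^{\vec s,\vec r}_m=\mathcal T^{\vec s}_{n+m}$ and $\mathcal T^{\vec s,\vec r}_m\circ\mathcal T^{\vec r,\vec s}_n=\mathcal T^{\vec r}_{n+m}$.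
   Context: Let $p\neq 2$ be a prime and $F$ a finite extension of $\mathbb{Q}_p$ with ring of integers $\mathcal{O}_F$, uniformizer $\varpi$, residue field $\mathfrak{k}$ of order $q=p^f$. $(\cdot,\cdot)_F$ is the quadratic Hilbert symbol. $E$ is an algebraically closed field of characteristic $p$ with a fixed embedding $\mathfrak{k}\hookrightarrow E$. $G=SL_2(F)$; for $g=\begin{pmatrix}a&b\\c&d\end{pmatrix}$, $X(g)=c$ if $c\neq0$ and $d$ otherwise; $\widetilde G=G\times\mu_2$ with $(g,\zeta)(g',\zeta')=(gg',\zeta\zeta'(\frac{X(gg')}{X(g)},\frac{X(gg')}{X(g')})_F)$. $h(x)=\mathrm{diag}(x,x^{-1})$, $\tilde h(x)=(h(x),(-1,x)_F)$; $T$ diagonal torus, $\widetilde T$ its preimage. $K=SL_2(\mathcal O_F)$; $K^*=\{(k,\theta(k))\}$ with $\theta(k)=1$ if the bottom-left entry $c$ is $0$ or a unit, else $(c,d)_F$; $\widetilde K=K^*\times\{(1,\pm1)\}$. $\mathrm{ind}$ is compact induction (functions $f$ with $f(kg)=\sigma(k)f(g)$). For $\vec r\in\{0,\dots,p-1\}^f$, $\sigma_{\vec r}=\bigotimes_{i=0}^{f-1}(\mathrm{Sym}^{r_i}E^2)^{Fr^i}$ on $V_{\vec r}$ (a representation of $SL_2(\mathfrak k)$, $Fr^i$ raising entries to the $p^i$-th power), inflated to $K$; $\tilde\sigma_{\vec r}((k,\theta(k))(1,\zeta))=\zeta\sigma_{\vec r}(k)$. Let $U(\mathfrak k),\overline U(\mathfrak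 k)$ be the upper/lower unipotent subgroups of $SL_2(\mathfrak k)$, $p_{\vec r}:V_{\vec r}\to(V_{\vec r})_{\overline U(\mathfrak k)}$ the projection, $i_{\vec r}:V_{\vec r}^{U(\mathfrak k)}\hookrightarrow V_{\vec r}$ the inclusion, and $j_{\vec r}=p_{\vec r}\circ i_{\vec r}$, an isomorphism of one-dimensional spaces; $\widetilde T\cap\widetilde K$ acts on $(V_{\vec r})_{\overline U(\mathfrak k)}$. Fix a $\widetilde T\cap\widetilde K$-linear isomorphism $\iota:(V_{\vec0})_{\overline U(\mathfrak k)}\to(V_{\overrightarrow{p-1}})_{\overline U(\mathfrak k)}$ (here $\overrightarrow{c}$ is the constant vector with entries $c$), and set $\iota_{\vec r,\vec s}=\mathrm{id}$ if $\vec r=\vec s$, $\iota$ if $(\vec r,\vec s)=(\vec0,\overrightarrow{p-1})$, $\iota^{-1}$ if $(\vec r,\vec s)=(\overrightarrow{p-1},\vec0)$, and $0$ otherwise. Let $\rho_{\vec r,\vec s}=i_{\vec s}\circ j_{\vec s}^{-1}\circ\iota_{\vec r,\vec s}\circ p_{\vec r}:V_{\vec r}\to V_{\vec s}$. For $n>0$ let $\varphi^{\vec r,\vec s}_n:\widetilde G\to\mathrm{Hom}_E(V_{\vec r},V_{\vec s})$ be the unique function supported on $\widetilde K\tilde h(\varpi)^{-n}\widetilde K$ with $\varphi(k_1gk_2)=\tilde\sigma_{\vec s}(k_1)\varphi(g)\tilde\sigma_{\vec r}(k_2)$ ($k_i\in\widetilde K$) and $\varphi(\tilde h(\varpi)^{-n})=\rho_{\vec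 r,\vec s}$; let $\varphi^{\vec r,\vec r}_0$ be the function supported on $\widetilde K$ with $\varphi^{\vec r,\vec r}_0(k)=\tilde\sigma_{\vec r}(k)$. Let $\mathcal T^{\vec r,\vec s}_n\in\mathcal H(\vec r,\vec s)$ be defined by $(\mathcal T^{\vec r,\vec s}_nf)(g)=\sum_{x\in\widetilde K\backslash\widetilde G}\varphi^{\vec r,\vec s}_n(gx^{-1})(f(x))$, and $\mathcal T^{\vec r}_n=\mathcal T^{\vec r,\vec r}_n$ (so $\mathcal T^{\vec r}_0$ is the identity). *)

theory Defs
  imports
    "HOL-Analysis.Determinants"
    "HOL-Analysis.Abstract_Metric_Spaces"
    "HOL-Library.Function_Algebras"
    "HOL-Algebra.Algebraic_Closure_Type"
begin

section \<open>Finite extensions of the field of p-adic numbers\<close>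

definition padic_norm :: "nat \<Rightarrow> rat \<Rightarrow> real" where
  "padic_norm p x =
     (if x = 0 then 0
      else real p powi (int (multiplicity (int p) (snd (quotient_of x)))
                      - int (multiplicity (int p) (fst (quotient_of x)))))"

text \<open>
  The subfield \<open>Q\<close> of the ambient field, with the absolute value \<open>av\<close> on it, is the completion
  of the rational numbers for the \<open>p\<close>-adic absolute value, i.e. a copy of the field of \<open>p\<close>-adic
  numbers. Outside \<open>Q\<close> the function \<open>av\<close> is \<open>0\<close> by convention, so that
  \<open>\<lambda>x y. av (x - y)\<close> satisfies the axioms of \<^locale>\<open>Metric_space\<close>, which are partly global.
\<close>

definition is_Qp :: "nat \<Rightarrow> 'f::field_char_0 set \<Rightarrow> ('f \<Rightarrow> real) \<Rightarrow> bool" where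
  "is_Qp p Q av \<longleftrightarrow>
     subfield Q ring_of_type_algebra \<and>
     (\<forall>x. x \<notin> Q \<longrightarrow> av x = 0) \<and>
     (\<forall>x\<in>Q. 0 \<le> av x \<and> (av x = 0 \<longleftrightarrow> x = 0)) \<and>
     (\<forall>x\<in>Q. \<forall>y\<in>Q. av (x * y) = av x * av y \<and> av (x + y) \<le> max (av x) (av y)) \<and>
     (\<forall>x. av (of_rat x) = padic_norm p x) \<and>
     Metric_space.mtopology Q (\<lambda>x y. av (x - y)) closure_of \<rat> = Q \<and>
     Metric_space.mcomplete Q (\<lambda>x y. av (x - y))"

definition finite_extension :: "'f::field set \<Rightarrow> bool" where
  "finite_extension Q \<longleftrightarrow>
     ring.finite_dimension (ring_of_type_algebra :: 'f ring) Q UNIV"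

text \<open>The ring of integers is the integral closure of the \<open>p\<close>-adic integers.\<close>

definition ring_of_integers :: "'f::field set \<Rightarrow> ('f \<Rightarrow> real) \<Rightarrow> 'f set" where
  "ring_of_integers Q av =
     {x. \<exists>P. Polynomial.lead_coeff P = 1 \<and>
             (\<forall>i. Polynomial.coeff P i \<in> Q \<and> av (Polynomial.coeff P i) \<le> 1) \<and> poly P x = 0}"

definition units_of_integers :: "'f::field set \<Rightarrow> 'f set" where
  "units_of_integers R = {x \<in> R. \<exists>y\<in>R. x * y = 1}"

definition max_ideal :: "'f::field set \<Rightarrow> 'f set" where
  "max_ideal R = R - units_of_integers R"

definition is_uniformizer :: "'f::field set \<Rightarrow> 'f \<Rightarrow> bool" where
  "is_uniformizer R w \<longleftrightarrow> w \<in> R \<and> max_ideal R = {w * x | x. x \<in> R}"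

abbreviation integers_ring :: "'f::field set \<Rightarrow> 'f ring" where
  "integers_ring R \<equiv> ring_of_type_algebra\<lparr>carrier := R\<rparr>"

definition residue_field :: "'f::field set \<Rightarrow> 'f set ring" where
  "residue_field R = integers_ring R Quot max_ideal R"


section \<open>The metaplectic double cover of the special linear group\<close>

definition hilbert_symbol :: "'f::field \<Rightarrow> 'f \<Rightarrow> int" where
  "hilbert_symbol a b =
     (if \<exists>x y z. (x, y, z) \<noteq> (0, 0, 0) \<and> z\<^sup>2 = a * x\<^sup>2 + b * y\<^sup>2 then 1 else - 1)"

definition mat2 :: "'a \<Rightarrow> 'a \<Rightarrow> 'a \<Rightarrow> 'a \<Rightarrow> 'a^2^2" where
  "mat2 a b c d =
     (\<chi> i j. if i = 1 then (if j = 1 then a else b) else (if j = 1 then c else d))"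

type_synonym 'f mp = "('f^2^2) \<times> int"

definition Xfun :: "'f::field^2^2 \<Rightarrow> 'f" where
  "Xfun g = (if g $ 2 $ 1 \<noteq> 0 then g $ 2 $ 1 else g $ 2 $ 2)"

definition Mp :: "'f::field mp monoid" where
  "Mp = \<lparr>carrier = {g. det g = 1} \<times> {1, - 1},
         monoid.mult = (\<lambda>(g, e) (g', e').
           (g ** g', e * e' * hilbert_symbol (Xfun (g ** g') / Xfun g) (Xfun (g ** g') / Xfun g'))),
         one = (mat 1, 1)\<rparr>"

definition h_tilde :: "'f::field \<Rightarrow> 'f mp" where
  "h_tilde x = (mat2 x 0 0 (inverse x), hilbert_symbol (- 1) x)"

definition T_tilde :: "'f::field mp set" where
  "T_tilde = {(mat2 a 0 0 (inverse a), e) | a e. a \<noteq> 0 \<and> e \<in> {1, - 1}}"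

definition SL2_int :: "'f::field set \<Rightarrow> ('f^2^2) set" where
  "SL2_int R = {k. det k = 1 \<and> (\<forall>i j. k $ i $ j \<in> R)}"

definition theta :: "'f::field set \<Rightarrow> 'f^2^2 \<Rightarrow> int" where
  "theta R k =
     (if k $ 2 $ 1 = 0 \<or> k $ 2 $ 1 \<in> units_of_integers R then 1
      else hilbert_symbol (k $ 2 $ 1) (k $ 2 $ 2))"

definition K_star :: "'f::field set \<Rightarrow> 'f mp set" where
  "K_star R = {(k, theta R k) | k. k \<in> SL2_int R}"

definition K_tilde :: "'f::field set \<Rightarrow> 'f mp set" where
  "K_tilde R = K_star R <#>\<^bsub>Mp\<^esub> {(mat 1, 1), (mat 1, - 1)}"


section \<open>Symmetric powers and their twisted tensor products\<close>

text \<open>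
  \<open>Sym\<^sup>n E\<^sup>2\<close> has the basis \<open>e\<^sub>1\<^sup>i e\<^sub>2\<^sup>n\<^sup>-\<^sup>i\<close> with \<open>i \<le> n\<close>, and a matrix with rows
  \<open>(a, b)\<close> and \<open>(c, d)\<close> sends this basis vector to
  \<open>(a e\<^sub>1 + c e\<^sub>2)\<^sup>i (b e\<^sub>1 + d e\<^sub>2)\<^sup>n\<^sup>-\<^sup>i\<close>. The number below is the coefficient of
  \<open>e\<^sub>1\<^sup>j e\<^sub>2\<^sup>n\<^sup>-\<^sup>j\<close> in it, read off after setting \<open>e\<^sub>2 = 1\<close>.
\<close>

definition sym_entry :: "nat \<Rightarrow> 'e::field^2^2 \<Rightarrow> nat \<Rightarrow> nat \<Rightarrow> 'e" where
  "sym_entry n M j i =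
     Polynomial.coeff ([:M $ 2 $ 1, M $ 1 $ 1:] ^ i * [:M $ 2 $ 2, M $ 1 $ 2:] ^ (n - i)) j"

text \<open>
  The tensor product over \<open>i < length r\<close> of the spaces \<open>Sym^(r ! i) E\<^sup>2\<close> has as basis the pure tensors
  of basis vectors, indexed by the lists \<open>J\<close> of the same length with \<open>J ! i \<le> r ! i\<close>. A vector is
  its coordinate function, extended by \<open>0\<close> to all lists.
\<close>

type_synonym 'e tvec = "nat list \<Rightarrow> 'e"

definition index_set :: "nat list \<Rightarrow> nat list set" where
  "index_set r = {J. list_all2 (\<le>) J r}"

definition V :: "nat list \<Rightarrow> 'e::field tvec set" where
  "V r = {v. \<forall>J. J \<notin> index_set r \<longrightarrow> v J = 0}"

definition vscale :: "'e::field \<Rightarrow> 'e tvec \<Rightarrow> 'e tvec" where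
  "vscale c v = (\<lambda>J. c * v J)"

definition tensor_act :: "nat \<Rightarrow> nat list \<Rightarrow> 'e::field^2^2 \<Rightarrow> 'e tvec \<Rightarrow> 'e tvec" where
  "tensor_act p r M v =
     (\<lambda>J. if J \<in> index_set r
          then \<Sum>I\<in>index_set r.
                 (\<Prod>i<length r. sym_entry (r ! i) (\<chi> a b. (M $ a $ b) ^ (p ^ i)) (J ! i) (I ! i)) * v I
          else 0)"

definition weights :: "nat \<Rightarrow> nat \<Rightarrow> nat list set" where
  "weights p f = {r. length r = f \<and> set r \<subseteq> {0..p - 1}}"

text \<open>
  Addition of operators is the pointwise one of \<^theory>\<open>HOL-Library.Function_Algebras\<close>.
\<close>

type_synonym ('f, 'e) operator = "('f mp \<Rightarrow> 'e tvec) \<Rightarrow> 'f mp \<Rightarrow> 'e tvec"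

definition oscale :: "'e::field \<Rightarrow> ('f, 'e) operator \<Rightarrow> ('f, 'e) operator" where
  "oscale c A = (\<lambda>\<phi> g. vscale c (A \<phi> g))"

lemma vector_space_vscale: "vector_space vscale"
  by unfold_locales (auto simp: vscale_def algebra_simps)

lemma vector_space_oscale: "vector_space oscale"
  by unfold_locales (auto simp: oscale_def vscale_def fun_eq_iff algebra_simps)


section \<open>Weights, compact induction and Hecke operators\<close>

text \<open>
  Parameters: the residue characteristic \<open>p\<close>, the residue degree \<open>f\<close>, the ring of integers \<open>R\<close>,
  the uniformizer \<open>w\<close>, the embedding \<open>emb\<close> of the residue field into \<open>E\<close>, and the isomorphism
  \<open>iota\<close> between the spaces of coinvariants of the weights \<open>(0, \<dots>, 0)\<close> and
  \<open>(p - 1, \<dots>, p - 1)\<close>. The hypotheses on them are part of the theorem.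
\<close>

locale genuine_data =
  fixes p f :: nat
    and R :: "'f::field set"
    and w :: 'f
    and emb :: "'f set \<Rightarrow> 'e::field"
    and iota :: "'e tvec set \<Rightarrow> 'e tvec set"
begin

definition sigma :: "nat list \<Rightarrow> ('f set)^2^2 \<Rightarrow> 'e tvec \<Rightarrow> 'e tvec" where
  "sigma r M = tensor_act p r (\<chi> i j. emb (M $ i $ j))"

definition reduction :: "'f^2^2 \<Rightarrow> ('f set)^2^2" where
  "reduction k = (\<chi> i j. max_ideal R +>\<^bsub>integers_ring R\<^esub> (k $ i $ j))"

text \<open>
  The element \<open>(k, e)\<close> equals \<open>(k, theta R k) (1, e * theta R k)\<close> in the double cover.
\<close>

definition sigma_tilde :: "nat list \<Rightarrow> 'f mp \<Rightarrow> 'e tvec \<Rightarrow> 'e tvec" where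
  "sigma_tilde r = (\<lambda>(k, e) v. vscale (of_int (e * theta R k)) (sigma r (reduction k) v))"

definition U_k :: "(('f set)^2^2) set" where
  "U_k = {mat2 \<one>\<^bsub>residue_field R\<^esub> x \<zero>\<^bsub>residue_field R\<^esub> \<one>\<^bsub>residue_field R\<^esub> | x.
            x \<in> carrier (residue_field R)}"

definition Ubar_k :: "(('f set)^2^2) set" where
  "Ubar_k = {mat2 \<one>\<^bsub>residue_field R\<^esub> \<zero>\<^bsub>residue_field R\<^esub> x \<one>\<^bsub>residue_field R\<^esub> | x.
               x \<in> carrier (residue_field R)}"

definition invariants :: "nat list \<Rightarrow> 'e tvec set" where
  "invariants r = {v \<in> V r. \<forall>u\<in>U_k. sigma r u v = v}"

definition coinv_rel :: "nat list \<Rightarrow> ('e tvec \<times> 'e tvec) set" where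
  "coinv_rel r =
     {(v, v'). v \<in> V r \<and> v' \<in> V r \<and>
        v - v' \<in> module.span vscale {sigma r u x - x | u x. u \<in> Ubar_k \<and> x \<in> V r}}"

definition coinvariants :: "nat list \<Rightarrow> 'e tvec set set" where
  "coinvariants r = V r // coinv_rel r"

definition proj :: "nat list \<Rightarrow> 'e tvec \<Rightarrow> 'e tvec set" where
  "proj r v = coinv_rel r `` {v}"

text \<open>
  The vector space structure and the action of \<open>T_tilde \<inter> K_tilde R\<close> on coinvariants are induced
  from \<open>V r\<close>, so linearity and equivariance of a map on coinvariants are expressed through
  representatives.
\<close>

definition coinv_isomorphism :: bool where
  "coinv_isomorphism \<longleftrightarrow>
     (let z = replicate f 0; m = replicate f (p - 1) in
       bij_betw iota (coinvariants z) (coinvariants m) \<and>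
       (\<forall>v\<in>V z. \<forall>v'\<in>V z. \<forall>x\<in>V m. \<forall>x'\<in>V m. \<forall>c.
          iota (proj z v) = proj m x \<longrightarrow> iota (proj z v') = proj m x' \<longrightarrow>
          iota (proj z (vscale c v + v')) = proj m (vscale c x + x')) \<and>
       (\<forall>t\<in>T_tilde \<inter> K_tilde R. \<forall>v\<in>V z. \<forall>x\<in>V m.
          iota (proj z v) = proj m x \<longrightarrow>
          iota (proj z (sigma_tilde z t v)) = proj m (sigma_tilde m t x)))"

definition iota_map :: "nat list \<Rightarrow> nat list \<Rightarrow> 'e tvec set \<Rightarrow> 'e tvec set" where
  "iota_map r s A =
     (if r = s then A
      else if r = replicate f 0 \<and> s = replicate f (p - 1) then iota A
      else if r = replicate f (p - 1) \<and> s = replicate f 0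
        then inv_into (coinvariants (replicate f 0)) iota A
      else proj s 0)"

definition rho :: "nat list \<Rightarrow> nat list \<Rightarrow> 'e tvec \<Rightarrow> 'e tvec" where
  "rho r s v = inv_into (invariants s) (proj s) (iota_map r s (proj r v))"

text \<open>Linear maps are extended by \<open>0\<close> outside their domain, so that equality is equality on it.\<close>

definition Hom_V :: "nat list \<Rightarrow> nat list \<Rightarrow> ('e tvec \<Rightarrow> 'e tvec) set" where
  "Hom_V r s =
     {A. (\<forall>v\<in>V r. A v \<in> V s) \<and>
         (\<forall>c. \<forall>v\<in>V r. \<forall>v'\<in>V r. A (vscale c v + v') = vscale c (A v) + A v') \<and>
         (\<forall>v. v \<notin> V r \<longrightarrow> A v = 0)}"

definition is_phi ::
    "nat list \<Rightarrow> nat list \<Rightarrow> nat \<Rightarrow> ('f mp \<Rightarrow> 'e tvec \<Rightarrow> 'e tvec) \<Rightarrow> bool" where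
  "is_phi r s n \<phi> \<longleftrightarrow>
     (let h = h_tilde w [^]\<^bsub>Mp\<^esub> (- int n) in
       (\<forall>g. \<phi> g \<in> Hom_V r s) \<and>
       (\<forall>g. g \<notin> K_tilde R <#>\<^bsub>Mp\<^esub> {h} <#>\<^bsub>Mp\<^esub> K_tilde R \<longrightarrow> \<phi> g = 0) \<and>
       (\<forall>k\<in>K_tilde R. \<forall>k'\<in>K_tilde R. \<forall>g\<in>carrier Mp. \<forall>v\<in>V r.
          \<phi> (k \<otimes>\<^bsub>Mp\<^esub> g \<otimes>\<^bsub>Mp\<^esub> k') v = sigma_tilde s k (\<phi> g (sigma_tilde r k' v))) \<and>
       (\<forall>v\<in>V r. \<phi> h v = rho r s v))"

text \<open>For \<open>n = 0\<close> this is only meaningful, and only used, when \<open>r = s\<close>.\<close>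

definition phi :: "nat list \<Rightarrow> nat list \<Rightarrow> nat \<Rightarrow> 'f mp \<Rightarrow> 'e tvec \<Rightarrow> 'e tvec" where
  "phi r s n =
     (if n = 0 then (\<lambda>g v. if g \<in> K_tilde R \<and> v \<in> V r then sigma_tilde r g v else 0)
      else (THE \<phi>. is_phi r s n \<phi>))"

text \<open>
  As \<open>K_tilde R\<close> is open and compact, compact support means support in finitely many right
  cosets of it. Smoothness of such functions under right translation is then automatic, because
  \<open>sigma_tilde r\<close> is trivial on an open subgroup.
\<close>

definition ind :: "nat list \<Rightarrow> ('f mp \<Rightarrow> 'e tvec) set" where
  "ind r =
     {\<phi>. (\<forall>g\<in>carrier Mp. \<phi> g \<in> V r) \<and> (\<forall>g. g \<notin> carrier Mp \<longrightarrow> \<phi> g = 0) \<and>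
         (\<forall>k\<in>K_tilde R. \<forall>g\<in>carrier Mp. \<phi> (k \<otimes>\<^bsub>Mp\<^esub> g) = sigma_tilde r k (\<phi> g)) \<and>
         (\<exists>S. finite S \<and> S \<subseteq> carrier Mp \<and>
              {g. \<phi> g \<noteq> 0} \<subseteq> (\<Union>x\<in>S. K_tilde R #>\<^bsub>Mp\<^esub> x))}"

definition translate :: "'f mp \<Rightarrow> ('f mp \<Rightarrow> 'e tvec) \<Rightarrow> 'f mp \<Rightarrow> 'e tvec" where
  "translate y \<phi> = (\<lambda>g. if g \<in> carrier Mp then \<phi> (g \<otimes>\<^bsub>Mp\<^esub> y) else 0)"

text \<open>
  Intertwining operators are extended by \<open>0\<close> outside \<open>ind r\<close>; the zero function lies in every
  \<open>ind r\<close>, so this convention is stable under sums, scalar multiples and composition.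
\<close>

definition hecke :: "nat list \<Rightarrow> nat list \<Rightarrow> ('f, 'e) operator set" where
  "hecke r s =
     {A. (\<forall>\<phi>\<in>ind r. A \<phi> \<in> ind s) \<and>
         (\<forall>c. \<forall>\<phi>\<in>ind r. \<forall>\<psi>\<in>ind r. A ((\<lambda>g. vscale c (\<phi> g)) + \<psi>) = (\<lambda>g. vscale c (A \<phi> g)) + A \<psi>) \<and>
         (\<forall>y\<in>carrier Mp. \<forall>\<phi>\<in>ind r. A (translate y \<phi>) = translate y (A \<phi>)) \<and>
         (\<forall>\<phi>. \<phi> \<notin> ind r \<longrightarrow> A \<phi> = 0)}"

definition hecke_one :: "nat list \<Rightarrow> ('f, 'e) operator" where
  "hecke_one r = (\<lambda>\<phi>. if \<phi> \<in> ind r then \<phi> else 0)"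

text \<open>
  The summand for a coset \<open>C\<close> does not depend on the representative; for \<open>\<phi>\<close> in \<open>ind r\<close> all but
  finitely many summands vanish.
\<close>

definition hecke_op :: "nat list \<Rightarrow> nat list \<Rightarrow> nat \<Rightarrow> ('f, 'e) operator" where
  "hecke_op r s n = (\<lambda>\<phi> g.
     if \<phi> \<in> ind r \<and> g \<in> carrier Mp then
       (let summand = (\<lambda>C. let x = (SOME x. x \<in> C) in phi r s n (g \<otimes>\<^bsub>Mp\<^esub> inv\<^bsub>Mp\<^esub> x) (\<phi> x))
        in \<Sum>C\<in>{C \<in> rcosets\<^bsub>Mp\<^esub> (K_tilde R). summand C \<noteq> 0}. summand C)
     else 0)"

end

end

theory Submission
  imports Defs "Jordan_Normal_Form.Char_Poly"
begin

text \<open>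
  By the decomposition of \<open>G\<close> into the double cosets of \<open>K\<close> and \<open>h(w)\<^sup>-\<^sup>n\<close>, an intertwining operator \<open>A\<close>
  is determined by the values at \<open>h(w)\<^sup>-\<^sup>n\<close> of the image of the function supported on \<open>K\<close> with value
  a \<open>U\<close>-invariant vector. Invariance under the unipotent groups leaves one scalar coordinate for
  each \<open>n\<close>, and equivariance under the torus forces the two weights to be equal or exceptional.

  Compositions are computed with the orbital sums \<open>\<phi> \<mapsto> \<Sum>\<^sub>z \<phi>(Lo z g)\<close> over \<open>z\<close> in \<open>F / R\<close>, followed by the
  projection to the coinvariants. The sum defining the value of \<open>T\<^sub>n\<close> splits according to the
  valuation of \<open>z\<close>. The terms with \<open>val z \<le> -2\<close> cancel because \<open>q = 0\<close> in \<open>E\<close>. Those with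
  \<open>val z = -1\<close> vanish individually unless the weight is trivial, and then they cancel in pairs because
  the cocycle contributes a nontrivial quadratic character of the units. So \<open>T\<^sub>n\<close> acts on orbital sums as
  the translation by \<open>h(w)\<^sup>n\<close>, and products of the \<open>T\<^sub>n\<close> add the indices.
\<close>

(* Otherwise names and notation of Jordan_Normal_Form shadow those used in Defs. *)
no_notation vec_index (infixl "$" 100)
hide_const (open) Ring_Hom.ring_hom

section \<open>Integral closure\<close>

text \<open>The orbital sum is the mod p Satake transform. Computing \<open>T_n T_m\<close> directly
  would mean decomposing products of double cosets and following vectors through them; on the Satake
  side only the translations by \<open>h(w)^n\<close> are multiplied. Nothing is lost in passing to
  it: the orbital sum of the image of the top vector at \<open>h(w)^-n\<close> turns out to be the
  \<open>n\<close>-th coordinate itself, not merely a triangular combination of coordinates.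

  The arithmetic has an obstacle of its own. The ring of integers is given as an integral closure
  and the Hilbert symbol by isotropic vectors, so neither completeness nor bilinearity is at hand. A
  power of \<open>w\<close> is divisible by \<open>p\<close>, which carries completeness from the
  base field to \<open>R\<close>; square roots of principal units follow, then the tame formula,
  then bilinearity, and only then associativity of the double cover.

  The operators between the two exceptional weights involve the unknown scalar \<open>c0\<close> by
  which \<open>iota\<close> acts. The resulting factors \<open>kap\<close> are multiplicative along
  composable pairs, and this is why the composition formulas contain no constants.\<close>

locale subring_of_field =
  fixes Z :: "'f::field set"
  assumes Z0: "0 \<in> Z" and Z1: "1 \<in> Z"
    and Zadd: "\<And>x y. x \<in> Z \<Longrightarrow> y \<in> Z \<Longrightarrow> x + y \<in> Z"
    and Zuminus: "\<And>x. x \<in> Z \<Longrightarrow> - x \<in> Z"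
    and Zmult: "\<And>x y. x \<in> Z \<Longrightarrow> y \<in> Z \<Longrightarrow> x * y \<in> Z"
begin

lemma Zsum: "(\<And>i. i \<in> A \<Longrightarrow> g i \<in> Z) \<Longrightarrow> sum g A \<in> Z"
  by (induction A rule: infinite_finite_induct) (auto simp: Z0 Zadd)

lemma Zdiff: "x \<in> Z \<Longrightarrow> y \<in> Z \<Longrightarrow> x - y \<in> Z"
  using Zadd[of x "- y"] Zuminus by auto

definition polyZ :: "'f poly \<Rightarrow> bool" where
  "polyZ P \<longleftrightarrow> (\<forall>i. Polynomial.coeff P i \<in> Z)"

lemma polyZ_add: "polyZ P \<Longrightarrow> polyZ P' \<Longrightarrow> polyZ (P + P')"
  by (auto simp: polyZ_def Zadd)

lemma polyZ_mult: "polyZ P \<Longrightarrow> polyZ P' \<Longrightarrow> polyZ (P * P')"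
  by (auto simp: polyZ_def Polynomial.coeff_mult intro!: Zsum Zmult)

lemma polyZ_1: "polyZ 1"
  by (auto simp: polyZ_def Z0 Z1)

lemma polyZ_const: "c \<in> Z \<Longrightarrow> polyZ [:c:]"
  by (auto simp: polyZ_def Z0 Polynomial.coeff_pCons split: nat.splits)

lemma polyZ_X: "polyZ [:0, 1:]"
  by (auto simp: polyZ_def Z0 Z1 Polynomial.coeff_pCons split: nat.splits)

lemma polyZ_sum: "(\<And>i. i \<in> A \<Longrightarrow> polyZ (g i)) \<Longrightarrow> polyZ (sum g A)"
  by (auto simp: polyZ_def Polynomial.coeff_sum intro!: Zsum)

lemma polyZ_prod: "(\<And>i. i \<in> A \<Longrightarrow> polyZ (g i)) \<Longrightarrow> polyZ (prod g A)"
  by (induction A rule: infinite_finite_induct) (auto simp: polyZ_1 polyZ_mult)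

definition integral_over :: "'f \<Rightarrow> bool" where
  "integral_over x \<longleftrightarrow> (\<exists>P. Polynomial.lead_coeff P = 1 \<and> polyZ P \<and> poly P x = 0)"

lemma polyZ_uminus: "polyZ P \<Longrightarrow> polyZ (- P)"
  by (auto simp: polyZ_def Zuminus)

lemma polyZ_0: "polyZ 0"
  by (auto simp: polyZ_def Z0)

lemma polyZ_char_poly:
  assumes A: "A \<in> carrier_mat n n" and AZ: "\<And>i j. i < n \<Longrightarrow> j < n \<Longrightarrow> A $$ (i, j) \<in> Z"
  shows "polyZ (char_poly A)"
proof -
  have *: "polyZ (char_poly_matrix A $$ (i, j))" if "i < n" "j < n" for i j
  proof -
    have "char_poly_matrix A $$ (i, j) = (if i = j then [:0, 1:] else 0) + [:- (A $$ (i, j)):]"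
      using that A by (simp add: char_poly_matrix_def)
    then show ?thesis
      using polyZ_add[OF _ polyZ_const[OF Zuminus[OF AZ[OF that]]]] polyZ_X polyZ_0
      by (metis (full_types))
  qed
  have "polyZ (signof \<pi>)" for \<pi>
    by (cases \<pi> rule: sign_cases) (auto simp: polyZ_1 polyZ_uminus)
  then have "polyZ (signof \<pi> * (\<Prod>i = 0..<n. char_poly_matrix A $$ (i, \<pi> i)))"
    if "\<pi> permutes {0..<n}" for \<pi>
    using permutes_in_image[OF that] by (intro polyZ_mult polyZ_prod *) auto
  then show ?thesis
    unfolding char_poly_def det_def'[OF char_poly_matrix_closed[OF A]] by (intro polyZ_sum) auto
qed

section \<open>Integrality by the determinant trick\<close>

definition span_of :: "(nat \<Rightarrow> 'f) \<Rightarrow> nat \<Rightarrow> 'f set" where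
  "span_of e n = {\<Sum>k<n. c k * e k | c. \<forall>k. c k \<in> Z}"

lemma span_of_add: "x \<in> span_of e n \<Longrightarrow> y \<in> span_of e n \<Longrightarrow> x + y \<in> span_of e n"
  unfolding span_of_def
  by clarsimp (rule_tac x = "\<lambda>k. c k + ca k" in exI, auto simp: algebra_simps sum.distrib Zadd)

lemma span_of_scale: "a \<in> Z \<Longrightarrow> x \<in> span_of e n \<Longrightarrow> a * x \<in> span_of e n"
  unfolding span_of_def
  by clarsimp (rule_tac x = "\<lambda>k. a * c k" in exI, auto simp: algebra_simps sum_distrib_left Zmult)

lemma span_of_0: "0 \<in> span_of e n"
  unfolding span_of_def by (rule CollectI, rule exI[of _ "\<lambda>_. 0"]) (auto simp: Z0)

lemma span_of_sum: "(\<And>i. i \<in> A \<Longrightarrow> g i \<in> span_of e n) \<Longrightarrow> sum g A \<in> span_of e n"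
  by (induction A rule: infinite_finite_induct) (auto simp: span_of_0 span_of_add)

lemma span_of_base: "k < n \<Longrightarrow> e k \<in> span_of e n"
  unfolding span_of_def
  by (rule CollectI, rule exI[of _ "\<lambda>i. if i = k then 1 else 0"]) 
     (auto simp: Z0 Z1 if_distrib[of "\<lambda>x. x * _"] cong: if_cong)

lemma span_of_stable:
  assumes "\<And>k. k < n \<Longrightarrow> x * e k \<in> span_of e n" "y \<in> span_of e n"
  shows "x * y \<in> span_of e n"
proof -
  from assms(2) obtain c where c: "\<And>k. c k \<in> Z" "y = (\<Sum>k<n. c k * e k)"
    unfolding span_of_def by auto
  have "x * y = (\<Sum>k<n. c k * (x * e k))"
    by (simp add: c sum_distrib_left mult_ac)
  also have "\<dots> \<in> span_of e n"
    using assms(1) c(1) by (intro span_of_sum) (rule span_of_scale, auto)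
  finally show ?thesis .
qed

text \<open>The vector of the generators \<open>e k\<close> is an eigenvector, with eigenvalue
  \<open>z\<close>, of the matrix that expresses each \<open>z * e k\<close> by the generators. Its
  characteristic polynomial is monic with coefficients in \<open>Z\<close> and has the root
  \<open>z\<close>. One nonzero generator makes the eigenvector nonzero.\<close>

lemma integral_if_stable:
  assumes st: "\<And>k. k < n \<Longrightarrow> z * e k \<in> span_of e n" and nz: "k0 < n" "e k0 \<noteq> 0"
  shows "integral_over z"
proof -
  have "\<forall>k<n. \<exists>c. (\<forall>l. c l \<in> Z) \<and> z * e k = (\<Sum>l<n. c l * e l)"
    using st unfolding span_of_def by blast
  then obtain c where cZ: "\<And>k l. k < n \<Longrightarrow> c k l \<in> Z"
    and c: "\<And>k. k < n \<Longrightarrow> z * e k = (\<Sum>l<n. c k l * e l)"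
    by metis
  define A where "A = mat n n (\<lambda>(k, l). c k l)"
  have A: "A \<in> carrier_mat n n" by (simp add: A_def)
  have "eigenvector A (Matrix.vec n e) z"
    unfolding eigenvector_def
  proof (intro conjI)
    show "Matrix.vec n e \<in> carrier_vec (dim_row A)" by (simp add: A_def)
    show "Matrix.vec n e \<noteq> 0\<^sub>v (dim_row A)"
      using nz A by (metis carrier_matD(1) index_vec index_zero_vec(1))
    show "A *\<^sub>v Matrix.vec n e = z \<cdot>\<^sub>v Matrix.vec n e"
      by (rule eq_vecI) (auto simp: A_def scalar_prod_def c atLeast0LessThan)
  qed
  then have "poly (char_poly A) z = 0"
    using eigenvalue_root_char_poly[OF A] unfolding eigenvalue_def by blast
  moreover have "Polynomial.lead_coeff (char_poly A) = 1"
    using degree_monic_char_poly[OF A] by auto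
  moreover have "polyZ (char_poly A)"
    by (rule polyZ_char_poly[OF A]) (auto simp: A_def cZ)
  ultimately show ?thesis unfolding integral_over_def by blast
qed

lemma integral_power_reduce:
  fixes x :: 'f
  assumes "Polynomial.lead_coeff P = 1" "poly P x = 0"
  shows "x ^ Polynomial.degree P = (\<Sum>i<Polynomial.degree P. - Polynomial.coeff P i * x ^ i)"
proof -
  have "0 = (\<Sum>i\<le>Polynomial.degree P. Polynomial.coeff P i * x ^ i)"
    using assms(2) by (simp add: poly_altdef)
  also have "\<dots> = (\<Sum>i<Polynomial.degree P. Polynomial.coeff P i * x ^ i) + x ^ Polynomial.degree P"
    using assms(1) by (simp add: lessThan_Suc_atMost[symmetric])
  finally show ?thesis by (simp add: sum_negf eq_neg_iff_add_eq_0 add.commute)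
qed

text \<open>A single module stable under both \<open>x\<close> and \<open>y\<close> serves for
  \<open>x + y\<close> and \<open>x * y\<close> at once. It is generated by the monomials below the
  degrees of the two monic equations, which reduce the monomials that overshoot.\<close>

lemma integral_stable_pair:
  assumes x: "integral_over x" and y: "integral_over y"
  obtains e n k0 where "k0 < n" "e k0 \<noteq> 0" "\<And>k. k < n \<Longrightarrow> x * e k \<in> span_of e n"
    "\<And>k. k < n \<Longrightarrow> y * e k \<in> span_of e n"
proof -
  from x obtain P where P: "Polynomial.lead_coeff P = 1" "polyZ P" "poly P x = 0"
    unfolding integral_over_def by auto
  from y obtain P' where P': "Polynomial.lead_coeff P' = 1" "polyZ P'" "poly P' y = 0"
    unfolding integral_over_def by auto
  define m where "m = Polynomial.degree P"
  define n where "n = Polynomial.degree P'"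
  have m0: "m > 0" using P unfolding m_def
    by (metis degree_0_id gr0I poly_1 poly_pCons one_neq_zero pCons_one)
  have n0: "n > 0" using P' unfolding n_def
    by (metis degree_0_id gr0I poly_1 poly_pCons one_neq_zero pCons_one)
  \<comment> \<open>The monomials \<open>x ^ i * y ^ j\<close> with \<open>i < m\<close> and
    \<open>j < n\<close> in one sequence; the position of the pair is
    \<open>i * n + j\<close>.\<close>
  define e where "e k = x ^ (k div n) * y ^ (k mod n)" for k
  have eij: "x ^ i * y ^ j \<in> span_of e (m * n)" if "i < m" "j < n" for i j
  proof -
    have "i * n + j < m * n" using that
      by (metis mult.commute mult_Suc_right nat_add_left_cancel_less order_less_le_trans
          Suc_leI mult_le_mono1 add.commute)
    moreover have "e (i * n + j) = x ^ i * y ^ j" using that by (simp add: e_def)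
    ultimately show ?thesis using span_of_base by metis
  qed
  have bnd: "k div n < m" "k mod n < n" if "k < m * n" for k
    using that n0 by (auto simp: less_mult_imp_div_less)
  have "x * e k \<in> span_of e (m * n)" if k: "k < m * n" for k
  proof (cases "Suc (k div n) < m")
    case True
    have "x * e k = x ^ Suc (k div n) * y ^ (k mod n)" by (simp add: e_def)
    then show ?thesis using eij[OF True bnd(2)[OF k]] by (metis)
  next
    case False
    then have "Suc (k div n) = m" using bnd[OF k] by simp
    then have "x * e k = x ^ m * y ^ (k mod n)" by (auto simp: e_def)
    also have "\<dots> = (\<Sum>i<m. - Polynomial.coeff P i * (x ^ i * y ^ (k mod n)))"
      unfolding m_def integral_power_reduce[OF P(1,3)] sum_distrib_right by (simp only: mult.assoc)
    also have "\<dots> \<in> span_of e (m * n)"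
      using P(2) bnd[OF k] unfolding polyZ_def
      by (intro span_of_sum span_of_scale eij) (auto simp: Zuminus)
    finally show ?thesis .
  qed
  moreover have "y * e k \<in> span_of e (m * n)" if k: "k < m * n" for k
  proof (cases "Suc (k mod n) < n")
    case True
    have "y * e k = x ^ (k div n) * y ^ Suc (k mod n)" by (simp add: e_def)
    then show ?thesis using eij[OF bnd(1)[OF k] True] by metis
  next
    case False
    then have "Suc (k mod n) = n" using bnd[OF k] by simp
    then have "y * e k = x ^ (k div n) * y ^ n"
      unfolding e_def by (metis mult.left_commute power_Suc)
    also have "\<dots> = (\<Sum>i<n. - Polynomial.coeff P' i * (x ^ (k div n) * y ^ i))"
      unfolding n_def integral_power_reduce[OF P'(1,3)] sum_distrib_left by (simp only: mult.left_commute)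
    also have "\<dots> \<in> span_of e (m * n)"
      using P'(2) bnd[OF k] unfolding polyZ_def
      by (intro span_of_sum span_of_scale eij) (auto simp: Zuminus)
    finally show ?thesis .
  qed
  moreover have "0 < m * n" "e 0 \<noteq> 0" using m0 n0 by (auto simp: e_def)
  ultimately show ?thesis using that by blast
qed

lemma integral_add: "integral_over x \<Longrightarrow> integral_over y \<Longrightarrow> integral_over (x + y)"
  by (erule (1) integral_stable_pair, rule integral_if_stable) (auto simp: algebra_simps span_of_add)

lemma integral_mult: "integral_over x \<Longrightarrow> integral_over y \<Longrightarrow> integral_over (x * y)"
  by (erule (1) integral_stable_pair, rule integral_if_stable) (auto simp: mult.assoc intro: span_of_stable)

lemma integral_base: "a \<in> Z \<Longrightarrow> integral_over a"
  unfolding integral_over_def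
  by (rule exI[of _ "[:- a, 1:]"])
     (auto simp: polyZ_def Polynomial.coeff_pCons Z0 Z1 Zuminus split: nat.splits)

lemma integral_uminus: "integral_over x \<Longrightarrow> integral_over (- x)"
  using integral_mult[OF integral_base[OF Zuminus[OF Z1]]] by force

end


section \<open>The ring of integers is a complete discrete valuation ring\<close>

lemma ring_of_type_algebra_simps [simp]:
  "carrier ring_of_type_algebra = UNIV"
  "x \<otimes>\<^bsub>ring_of_type_algebra\<^esub> y = x * y" "x \<oplus>\<^bsub>ring_of_type_algebra\<^esub> y = x + y"
  "\<one>\<^bsub>ring_of_type_algebra\<^esub> = 1" "\<zero>\<^bsub>ring_of_type_algebra\<^esub> = 0"
  by (auto simp: ring_of_type_algebra_def)

lemma ring_of_type_algebra_a_inv [simp]: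
  "\<ominus>\<^bsub>ring_of_type_algebra\<^esub> x = - (x :: 'a::comm_ring_1)"
proof -
  interpret ring "ring_of_type_algebra :: 'a ring" by (rule ring_from_type_algebra)
  show ?thesis by (rule minus_equality) auto
qed

lemma ring_of_type_algebra_nat_pow [simp]:
  "x [^]\<^bsub>ring_of_type_algebra\<^esub> (n::nat) = (x :: 'a::comm_ring_1) ^ n"
  by (induction n) (auto simp: nat_pow_def ring_of_type_algebra_def mult.commute)

lemma eval_ring_of_type_algebra:
  "ring.eval ring_of_type_algebra cs x = (\<Sum>i<length cs. rev cs ! i * (x :: 'a::comm_ring_1) ^ i)"
proof -
  interpret ring "ring_of_type_algebra :: 'a ring" by (rule ring_from_type_algebra)
  show ?thesis by (induction cs) (auto simp: nth_append)
qed

locale local_field =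
  fixes p f :: nat
    and Q :: "'f::field_char_0 set"
    and av :: "'f \<Rightarrow> real"
    and R :: "'f set"
    and w :: 'f
  assumes prime_p: "prime p" and odd_p: "p \<noteq> 2"
    and Qp: "is_Qp p Q av"
    and fin_ext: "finite_extension Q"
    and R_eq: "R = ring_of_integers Q av"
    and unif: "is_uniformizer R w"
    and card_res: "card (carrier (residue_field R)) = p ^ f"
begin

section \<open>The absolute value on the base field\<close>

lemma p_gt: "real p > 1"
  using prime_p prime_gt_1_nat by auto

lemma Q_subfield: "subfield Q ring_of_type_algebra"
  using Qp unfolding is_Qp_def by blast

lemma Q_closed:
  "0 \<in> Q" "1 \<in> Q" "x \<in> Q \<Longrightarrow> y \<in> Q \<Longrightarrow> x + y \<in> Q" "x \<in> Q \<Longrightarrow> y \<in> Q \<Longrightarrow> x * y \<in> Q" "x \<in> Q \<Longrightarrow> - x \<in> Q"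
  using subringE[OF subfieldE(1)[OF Q_subfield]] by auto

lemma Q_diff: "x \<in> Q \<Longrightarrow> y \<in> Q \<Longrightarrow> x - y \<in> Q"
  using Q_closed(3)[of x "- y"] Q_closed(5) by auto

lemma Q_inverse: "x \<in> Q \<Longrightarrow> inverse x \<in> Q"
  using ring.subfield_m_inv_simprule[OF ring_from_type_algebra Q_subfield, of x "inverse x"] Q_closed
  by (cases "x = 0") auto

lemma Q_divide: "x \<in> Q \<Longrightarrow> y \<in> Q \<Longrightarrow> x / y \<in> Q"
  by (simp add: divide_inverse Q_closed Q_inverse)

lemma Q_power: "x \<in> Q \<Longrightarrow> x ^ n \<in> Q"
  by (induction n) (auto simp: Q_closed)

lemma Q_of_nat: "of_nat n \<in> Q"
  by (induction n) (auto simp: Q_closed)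

lemma Q_sum: "(\<And>i. i \<in> A \<Longrightarrow> g i \<in> Q) \<Longrightarrow> sum g A \<in> Q"
  by (induction A rule: infinite_finite_induct) (auto simp: Q_closed)

lemma av_nonneg: "x \<in> Q \<Longrightarrow> 0 \<le> av x"
  and av_eq_0: "x \<in> Q \<Longrightarrow> av x = 0 \<longleftrightarrow> x = 0"
  and av_mult: "x \<in> Q \<Longrightarrow> y \<in> Q \<Longrightarrow> av (x * y) = av x * av y"
  and av_add: "x \<in> Q \<Longrightarrow> y \<in> Q \<Longrightarrow> av (x + y) \<le> max (av x) (av y)"
  and av_rat: "av (of_rat t) = padic_norm p t"
  and Q_dense: "Metric_space.mtopology Q (\<lambda>x y. av (x - y)) closure_of \<rat> = Q"
  and Q_complete: "Metric_space.mcomplete Q (\<lambda>x y. av (x - y))"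
  and av_outside: "x \<notin> Q \<Longrightarrow> av x = 0"
  using Qp unfolding is_Qp_def by blast+

lemma av_nonneg': "0 \<le> av x"
  using av_nonneg av_outside by (cases "x \<in> Q") auto

lemma padic_norm_neg1: "padic_norm p (- 1) = 1"
  by (simp add: padic_norm_def quotient_of_int[of "-1", simplified] multiplicity_uminus_right)

lemma av_1: "av 1 = 1"
  using av_rat[of 1] by (simp add: padic_norm_def)

lemma av_uminus: "x \<in> Q \<Longrightarrow> av (- x) = av x"
  using av_mult[of "-1" x] av_rat[of "-1"] padic_norm_neg1 Q_closed by simp

lemma av_diff: "x \<in> Q \<Longrightarrow> y \<in> Q \<Longrightarrow> av (x - y) \<le> max (av x) (av y)"
  using av_add[of x "- y"] av_uminus Q_closed by simp

lemma av_minus_commute: "av (x - y) = av (y - x)"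
proof (cases "x - y \<in> Q")
  case True
  then show ?thesis using av_uminus by fastforce
next
  case False
  moreover have "y - x \<notin> Q" using False Q_closed(5)[of "y - x"] by auto
  ultimately show ?thesis by (simp add: av_outside)
qed

lemma av_p: "av (of_nat p) = 1 / real p"
proof -
  have "multiplicity (int p) (int p) = 1"
    using prime_p by (intro multiplicity_self) (auto simp: prime_gt_1_nat dest: prime_gt_1_nat)
  moreover have "quotient_of (of_nat p) = (int p, 1)"
    using quotient_of_int[of "int p"] by simp
  ultimately have "padic_norm p (of_nat p) = real p powi (- 1)"
    using prime_p by (auto simp: padic_norm_def)
  then show ?thesis using av_rat[of "of_nat p"] by (simp add: power_int_minus field_simps)
qed

lemma av_power: "x \<in> Q \<Longrightarrow> av (x ^ n) = av x ^ n"
  by (induction n) (auto simp: av_1 av_mult Q_power)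

lemma av_inverse: "x \<in> Q \<Longrightarrow> av (inverse x) = inverse (av x)"
proof (cases "x = 0")
  case False
  assume x: "x \<in> Q"
  have "av x * av (inverse x) = 1"
    using av_mult[OF x Q_inverse[OF x]] False av_1 by simp
  then show ?thesis by (metis inverse_unique)
qed (use av_eq_0[OF Q_closed(1)] in simp)

lemma av_divide: "x \<in> Q \<Longrightarrow> y \<in> Q \<Longrightarrow> av (x / y) = av x / av y"
  by (simp add: divide_inverse av_mult Q_inverse av_inverse)

lemma av_sum:
  assumes "\<And>i. i \<in> A \<Longrightarrow> g i \<in> Q \<and> av (g i) \<le> B" "0 \<le> B"
  shows "av (sum g A) \<le> B"
  using assms(1)
proof (induction A rule: infinite_finite_induct)
  case (insert a A)
  then have "av (g a + sum g A) \<le> max (av (g a)) (av (sum g A))"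
    by (intro av_add Q_sum) auto
  moreover have "av (g a) \<le> B" "av (sum g A) \<le> B" using insert by auto
  ultimately have "av (g a + sum g A) \<le> B" by linarith
  then show ?case using insert by simp
qed (use assms(2) av_eq_0[OF Q_closed(1)] in auto)

lemma Q_metric: "Metric_space Q (\<lambda>x y. av (x - y))"
proof
  show "av (x - z) \<le> av (x - y) + av (y - z)" if "x \<in> Q" "y \<in> Q" "z \<in> Q" for x y z
    using av_add[of "x - y" "y - z"] av_nonneg'[of "x - y"] av_nonneg'[of "y - z"] Q_diff that by force
qed (use av_nonneg' av_minus_commute av_eq_0 Q_diff in auto)

text \<open>The value group is that of the rationals: a rational number closer to \<open>a\<close>
  than \<open>av a\<close> has the same absolute value by the ultrametric inequality, so
  \<open>av a\<close> is an integral power of \<open>p\<close>.\<close>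

lemma av_discrete:
  assumes a: "a \<in> Q" "av a < 1"
  shows "av a \<le> 1 / real p"
proof (cases "a = 0")
  case True
  then show ?thesis using av_eq_0[OF Q_closed(1)] by simp
next
  case False
  interpret Metric_space Q "\<lambda>x y. av (x - y)" by (rule Q_metric)
  have pos: "av a > 0" using False av_eq_0 a av_nonneg' by (metis order_le_less)
  then obtain r where r: "r \<in> \<rat>" "r \<in> mball a (av a)"
    using Q_dense metric_closure_of[of \<rat>] a by blast
  then have rQ: "r \<in> Q" and d: "av (a - r) < av a" by auto
  have "av r = av a"
  proof (rule antisym)
    show "av r \<le> av a" using av_diff[of a "a - r"] Q_diff a rQ d by simp
    show "av a \<le> av r" using av_add[of r "a - r"] Q_diff a rQ d by (auto simp: max_def split: if_splits)
  qed
  moreover from r obtain t where t: "r = of_rat t" by (metis Rats_cases)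
  ultimately have n: "padic_norm p t = av a" using av_rat by simp
  then have "t \<noteq> 0" using pos by (auto simp: padic_norm_def)
  then obtain k :: int where k: "av a = real p powi k"
    using n unfolding padic_norm_def by (metis (no_types, lifting))
  have "k < 0" using k a(2) p_gt one_le_power_int[of "real p" k] by (metis less_imp_le linorder_not_less)
  then have "real p powi k \<le> real p powi (- 1)" using p_gt by (intro power_int_increasing) auto
  then show ?thesis using k by (simp add: power_int_minus field_simps)
qed

section \<open>The ring of integers as an integral closure\<close>

definition Zp :: "'f set" where "Zp = {a \<in> Q. av a \<le> 1}"

sublocale Zp: subring_of_field Zp
proof
  show "x + y \<in> Zp" if "x \<in> Zp" "y \<in> Zp" for x y
    using that av_add[of x y] by (auto simp: Zp_def Q_closed)
  show "x * y \<in> Zp" if "x \<in> Zp" "y \<in> Zp" for x y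
    using that by (auto simp: Zp_def Q_closed av_mult mult_le_one av_nonneg')
qed (use av_1 av_eq_0[OF Q_closed(1)] in \<open>auto simp: Zp_def Q_closed av_uminus\<close>)

lemma R_integral: "R = {x. Zp.integral_over x}"
  unfolding R_eq ring_of_integers_def Zp.integral_over_def Zp.polyZ_def by (simp add: Zp_def)

sublocale R: subring_of_field R
  by unfold_locales
    (auto simp: R_integral Zp.integral_add Zp.integral_mult Zp.integral_uminus Zp.integral_base Zp.Z0 Zp.Z1)

lemma Zp_R: "Zp \<subseteq> R"
  by (auto simp: R_integral Zp.integral_base)

lemma R_power: "x \<in> R \<Longrightarrow> x ^ n \<in> R"
  by (induction n) (auto simp: R.Z1 R.Zmult)

lemma Zp_of_nat: "of_nat n \<in> Zp"
  by (induction n) (auto simp: Zp.Z0 Zp.Z1 Zp.Zadd)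

text \<open>The ring \<open>Zp\<close> is integrally closed: if \<open>av x > 1\<close>, then
  \<open>x ^ n\<close> is strictly larger than every lower term of a monic equation, and the
  ultrametric inequality forbids cancellation.\<close>

lemma R_Q:
  assumes "x \<in> R" "x \<in> Q"
  shows "x \<in> Zp"
proof -
  from assms(1) obtain P where P: "Polynomial.lead_coeff P = 1" "Zp.polyZ P" "poly P x = 0"
    unfolding R_integral Zp.integral_over_def by auto
  define n where "n = Polynomial.degree P"
  have n0: "n > 0" using P unfolding n_def
    by (metis degree_0_id gr0I poly_1 poly_pCons one_neq_zero pCons_one)
  have "av x \<le> 1"
  proof (rule ccontr)
    assume c: "\<not> av x \<le> 1"
    have "av (\<Sum>i<n. - Polynomial.coeff P i * x ^ i) \<le> av x ^ (n - 1)"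
    proof (rule av_sum)
      fix i assume i: "i \<in> {..<n}"
      have co: "- Polynomial.coeff P i \<in> Q" "av (- Polynomial.coeff P i) \<le> 1"
        using P(2) unfolding Zp.polyZ_def by (auto simp: Zp_def Q_closed av_uminus)
      have "av (- Polynomial.coeff P i * x ^ i) = av (- Polynomial.coeff P i) * av x ^ i"
        using co assms(2) by (simp only: av_mult av_power Q_power)
      also have "\<dots> \<le> 1 * av x ^ i" using co c by (intro mult_right_mono) auto
      also have "\<dots> \<le> av x ^ (n - 1)" using i c by (auto intro!: power_increasing)
      finally show "- Polynomial.coeff P i * x ^ i \<in> Q \<and>
          av (- Polynomial.coeff P i * x ^ i) \<le> av x ^ (n - 1)"
        using co assms(2) Q_closed(4) Q_power by blast
    qed (use av_nonneg' in auto)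
    then have "av x ^ n \<le> av x ^ (n - 1)"
      using Zp.integral_power_reduce[OF P(1,3)] av_power[OF assms(2), of n] by (simp only: n_def)
    moreover have "av x ^ (n - 1) < av x ^ n" using c n0 by (intro power_strict_increasing) auto
    ultimately show False by simp
  qed
  then show ?thesis using assms by (auto simp: Zp_def)
qed

text \<open>Clearing denominators. If \<open>x\<close> satisfies an equation of degree
  \<open>n\<close> over \<open>Q\<close>, then \<open>p^k x\<close> satisfies the monic one whose
  coefficient at \<open>i\<close> is multiplied by \<open>p^(k (n - i))\<close>. Since
  \<open>n - i\<close> is at least 1, a large \<open>k\<close> makes all coefficients
  integral.\<close>

lemma scale_into_R: "\<exists>k. of_nat p ^ k * x \<in> R"
proof -
  interpret dm: domain "ring_of_type_algebra :: 'f ring"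
    using field_from_type_algebra field.axioms(1) by blast
  have "subring UNIV (ring_of_type_algebra :: 'f ring)"
    using dm.carrier_is_subring by simp
  from dm.finite_dimension_imp_algebraic[OF Q_subfield this]
  have "(dm.algebraic over Q) x"
    using fin_ext unfolding finite_extension_def by auto
  then obtain cs where cs: "cs \<in> carrier (Q [X]\<^bsub>ring_of_type_algebra\<^esub>)" "cs \<noteq> []" "dm.eval cs x = 0"
    using dm.algebraicE[OF subfieldE(1)[OF Q_subfield]] by (metis UNIV_I ring_of_type_algebra_simps(1,5))
  then have cQ: "set cs \<subseteq> Q" and hd: "hd cs \<noteq> 0"
    by (auto simp: univ_poly_def polynomial_def)
  define n where "n = length cs - 1"
  \<comment> \<open>The list of coefficients starts with the leading one, hence the
    reversal.\<close>
  define c where "c i = rev cs ! i" for i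
  have len: "length cs = Suc n" using cs(2) by (simp add: n_def)
  have cn: "c n \<noteq> 0" using hd cs(2) len by (simp add: c_def rev_nth hd_conv_nth)
  have ciQ: "c i \<in> Q" if "i \<le> n" for i
    using cQ len that by (metis c_def in_mono le_imp_less_Suc length_rev nth_mem set_rev)
  have "(\<Sum>i<n. c i * x ^ i) + c n * x ^ n = 0"
    using cs(3) len by (simp add: eval_ring_of_type_algebra c_def)
  then have xn: "x ^ n = (\<Sum>i<n. - (c i / c n) * x ^ i)"
    using cn by (simp add: sum_negf field_simps sum_divide_distrib[symmetric] eq_neg_iff_add_eq_0)
  have n0: "n > 0" using xn by (cases n) auto
  obtain k where k: "real p ^ k > Max ((\<lambda>i. av (c i / c n)) ` {..<n})"
    using real_arch_pow[OF p_gt] by blast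
  have kb: "av (c i / c n) \<le> real p ^ k" if "i < n" for i
  proof -
    have "av (c i / c n) \<le> Max ((\<lambda>i. av (c i / c n)) ` {..<n})" using that by (intro Max_ge) auto
    then show ?thesis using k by linarith
  qed
  define y where "y = of_nat p ^ k * x"
  define d where "d i = - (c i / c n) * of_nat p ^ (k * (n - i))" for i
  have dZ: "d i \<in> Zp" if "i < n" for i
  proof -
    have "av (d i) = av (c i / c n) * (1 / real p) ^ (k * (n - i))"
      unfolding d_def using ciQ that
      by (simp add: av_mult av_uminus av_power Q_power Q_of_nat Q_divide Q_closed av_p av_divide flip: minus_mult_left)
    also have "\<dots> \<le> real p ^ k * (1 / real p) ^ (k * (n - i))"
      using kb[OF that] by (intro mult_right_mono) auto
    also have "\<dots> \<le> real p ^ k * (1 / real p) ^ k"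
      using that p_gt by (intro mult_left_mono power_decreasing) auto
    also have "\<dots> = 1" using p_gt by (simp add: field_simps)
    finally show ?thesis
      unfolding Zp_def d_def using ciQ that
      by (auto intro!: Q_closed Q_divide Q_power Q_of_nat simp flip: minus_mult_left)
  qed
  have yn: "y ^ n = (\<Sum>i<n. d i * y ^ i)"
  proof -
    have "y ^ n = (of_nat p ^ k) ^ n * x ^ n" by (simp add: y_def power_mult_distrib)
    also have "\<dots> = (\<Sum>i<n. d i * y ^ i)"
      unfolding xn sum_distrib_left
    proof (rule sum.cong[OF refl])
      fix i assume i: "i \<in> {..<n}"
      have "(of_nat p ^ k) ^ n = of_nat p ^ (k * (n - i)) * (of_nat p ^ k) ^ i"
        using i by (simp flip: power_mult power_add add: diff_mult_distrib2)
      then show "(of_nat p ^ k) ^ n * (- (c i / c n) * x ^ i) = d i * y ^ i"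
        unfolding d_def y_def power_mult_distrib
        by (metis (no_types, lifting) mult.assoc mult.commute mult.left_commute)
    qed
    finally show ?thesis .
  qed
  have "Zp.integral_over y"
  proof (rule Zp.integral_if_stable[of n y "\<lambda>i. y ^ i" 0])
    fix i assume i: "i < n"
    show "y * y ^ i \<in> Zp.span_of (\<lambda>i. y ^ i) n"
    proof (cases "Suc i < n")
      case True
      then show ?thesis using Zp.span_of_base[OF True, of "\<lambda>i. y ^ i"] by simp
    next
      case False
      then have "Suc i = n" using i by simp
      then have "y * y ^ i = (\<Sum>i<n. d i * y ^ i)" using yn by (metis power_Suc)
      also have "\<dots> \<in> Zp.span_of (\<lambda>i. y ^ i) n"
        using dZ by (intro Zp.span_of_sum Zp.span_of_scale Zp.span_of_base) auto
      finally show ?thesis .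
    qed
  qed (use n0 in auto)
  then show ?thesis unfolding y_def R_integral by blast
qed

section \<open>Divisibility by the uniformizer\<close>

lemma nonunit_iff: "x \<in> R - units_of_integers R \<longleftrightarrow> x \<in> (*) w ` R"
  using unif unfolding is_uniformizer_def max_ideal_def by blast

lemma unit_iff: "x \<in> R \<Longrightarrow> x \<in> units_of_integers R \<longleftrightarrow> x \<notin> (*) w ` R"
  using nonunit_iff[of x] by blast

lemma unit_inverse: "x \<in> units_of_integers R \<longleftrightarrow> x \<in> R \<and> x \<noteq> 0 \<and> inverse x \<in> R"
  unfolding units_of_integers_def by (auto simp: inverse_unique) (metis right_inverse)

lemma wR: "w \<in> R"
  using unif unfolding is_uniformizer_def by simp

lemma mult_dvd: "x \<in> (*) a ` R \<Longrightarrow> y \<in> R \<Longrightarrow> x * y \<in> (*) a ` R"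
  using R.Zmult by (auto simp: mult.assoc)

lemma add_dvd: "x \<in> (*) a ` R \<Longrightarrow> y \<in> (*) a ` R \<Longrightarrow> x + y \<in> (*) a ` R"
  by (auto simp flip: distrib_left intro!: imageI R.Zadd)

lemma uminus_dvd: "x \<in> (*) a ` R \<Longrightarrow> - x \<in> (*) a ` R"
  using R.Zuminus by (metis (no_types, lifting) image_iff mult_minus_right)

lemma diff_dvd: "x \<in> (*) a ` R \<Longrightarrow> y \<in> (*) a ` R \<Longrightarrow> x - y \<in> (*) a ` R"
  using add_dvd[of x a "- y"] uminus_dvd by simp

lemma p_nonunit: "of_nat p \<in> (*) w ` R"
proof (rule ccontr)
  have pR: "of_nat p \<in> R" using Zp_of_nat Zp_R by blast
  assume "of_nat p \<notin> (*) w ` R"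
  then have "inverse (of_nat p) \<in> R" using unit_iff[OF pR] unit_inverse by blast
  then have "inverse (of_nat p) \<in> Zp" using R_Q Q_inverse Q_of_nat by blast
  then show False using p_gt by (simp add: Zp_def av_inverse Q_of_nat av_p)
qed

lemma w_nonzero: "w \<noteq> 0"
proof
  assume "w = 0"
  then have "(of_nat p :: 'f) = 0" using p_nonunit by auto
  then show False using p_gt by simp
qed

lemma one_not_dvd: "1 \<notin> (*) w ` R"
  using unit_iff[OF R.Z1] unit_inverse R.Z1 by auto

text \<open>In a monic equation of \<open>w\<close> over \<open>Zp\<close> let \<open>i\<close> be
  the first index with a unit coefficient. The terms below \<open>i\<close> are divisible by
  \<open>p\<close>, because absolute values below 1 are at most \<open>1/p\<close>. The terms from
  \<open>i\<close> on are \<open>w ^ i * u\<close>, where \<open>u\<close> is a unit coefficient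
  plus a multiple of \<open>w\<close>, hence a unit. So \<open>p\<close> divides
  \<open>w ^ i\<close>, and the two adic topologies on \<open>R\<close> agree.\<close>

lemma w_power_dvd_p: "\<exists>m. w ^ m \<in> (*) (of_nat p) ` R"
proof -
  obtain P where P: "Polynomial.lead_coeff P = 1" "Zp.polyZ P" "poly P w = 0"
    using wR unfolding R_integral Zp.integral_over_def by auto
  define n where "n = Polynomial.degree P"
  define i where "i = (LEAST i. av (Polynomial.coeff P i) = 1)"
  have i: "av (Polynomial.coeff P i) = 1" and below: "\<And>j. j < i \<Longrightarrow> av (Polynomial.coeff P j) \<noteq> 1"
    unfolding i_def using P(1) av_1 not_less_Least by (metis (mono_tags, lifting) LeastI)+
  have "i \<le> n" unfolding n_def
    using i av_eq_0[OF Q_closed(1)] by (metis coeff_eq_0 linorder_not_le zero_neq_one)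
  have cZ: "Polynomial.coeff P j \<in> Zp" for j using P(2) by (simp add: Zp.polyZ_def)
  have low: "Polynomial.coeff P j \<in> (*) (of_nat p) ` R" if "j < i" for j
  proof -
    have "av (Polynomial.coeff P j) \<le> 1 / real p"
      using below[OF that] cZ[of j] by (intro av_discrete) (auto simp: Zp_def)
    then have "Polynomial.coeff P j / of_nat p \<in> Zp"
      using cZ[of j] p_gt by (auto simp: Zp_def av_divide Q_divide Q_of_nat av_p field_simps)
    then show ?thesis using Zp_R p_gt
      by (auto intro!: image_eqI[of _ _ "Polynomial.coeff P j / of_nat p"])
  qed
  define u where "u = (\<Sum>j\<in>{i..n}. Polynomial.coeff P j * w ^ (j - i))"
  have uR: "u \<in> R" unfolding u_def using cZ Zp_R wR by (intro R.Zsum R.Zmult R_power) auto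
  have "0 = (\<Sum>j\<le>n. Polynomial.coeff P j * w ^ j)"
    using P(3) by (simp add: poly_altdef n_def)
  also have "{..n} = {..<i} \<union> {i..n}" using \<open>i \<le> n\<close> by auto
  also have "(\<Sum>j\<in>\<dots>. Polynomial.coeff P j * w ^ j) =
      (\<Sum>j<i. Polynomial.coeff P j * w ^ j) + (\<Sum>j\<in>{i..n}. Polynomial.coeff P j * w ^ j)"
    by (rule sum.union_disjoint) auto
  also have "(\<Sum>j\<in>{i..n}. Polynomial.coeff P j * w ^ j) = w ^ i * u"
    unfolding u_def sum_distrib_left
    by (rule sum.cong) (auto simp: mult_ac simp flip: power_add)
  finally have "w ^ i * u = - (\<Sum>j<i. Polynomial.coeff P j * w ^ j)"
    by (simp add: eq_neg_iff_add_eq_0 add.commute)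
  also have "(\<Sum>j<i. Polynomial.coeff P j * w ^ j) \<in> (*) (of_nat p) ` R"
  proof -
    have "(\<Sum>j\<in>A. Polynomial.coeff P j * w ^ j) \<in> (*) (of_nat p) ` R" if "A \<subseteq> {..<i}" for A
      using finite_subset[OF that finite_lessThan] that
      by (induction A rule: finite_induct) (auto intro!: add_dvd mult_dvd low R_power wR
          simp: image_iff[of 0] R.Z0)
    then show ?thesis by blast
  qed
  then have "- (\<Sum>j<i. Polynomial.coeff P j * w ^ j) \<in> (*) (of_nat p) ` R" by (rule uminus_dvd)
  finally have wu: "w ^ i * u \<in> (*) (of_nat p) ` R" .
  have "u \<notin> (*) w ` R"
  proof
    assume "u \<in> (*) w ` R"
    moreover have "u = Polynomial.coeff P i + (\<Sum>j\<in>{Suc i..n}. Polynomial.coeff P j * w ^ (j - i))"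
      unfolding u_def using \<open>i \<le> n\<close> by (simp add: sum.atLeast_Suc_atMost)
    moreover have "(\<Sum>j\<in>{Suc i..n}. Polynomial.coeff P j * w ^ (j - i)) =
        w * (\<Sum>j\<in>{Suc i..n}. Polynomial.coeff P j * w ^ (j - Suc i))"
      unfolding sum_distrib_left
    proof (rule sum.cong[OF refl])
      fix j assume "j \<in> {Suc i..n}"
      then have "w ^ (j - i) = w * w ^ (j - Suc i)" by (simp flip: power_Suc add: Suc_diff_Suc)
      then show "Polynomial.coeff P j * w ^ (j - i) = w * (Polynomial.coeff P j * w ^ (j - Suc i))"
        by simp
    qed
    moreover have "(\<Sum>j\<in>{Suc i..n}. Polynomial.coeff P j * w ^ (j - Suc i)) \<in> R"
      using cZ Zp_R wR by (intro R.Zsum R.Zmult R_power) auto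
    ultimately have "u \<in> (*) w ` R" "w * (\<Sum>j\<in>{Suc i..n}. Polynomial.coeff P j * w ^ (j - Suc i)) \<in> (*) w ` R"
      "Polynomial.coeff P i = u - w * (\<Sum>j\<in>{Suc i..n}. Polynomial.coeff P j * w ^ (j - Suc i))"
      by auto
    then have "Polynomial.coeff P i \<in> (*) w ` R" using diff_dvd by simp
    moreover have "inverse (Polynomial.coeff P i) \<in> R"
      using i cZ[of i] Zp_R by (auto simp: Zp_def av_inverse Q_inverse)
    moreover have "Polynomial.coeff P i \<noteq> 0" using i av_eq_0[OF Q_closed(1)] by auto
    ultimately show False
      using mult_dvd one_not_dvd by (metis right_inverse)
  qed
  then have "inverse u \<in> R" "u \<noteq> 0" using unit_iff[OF uR] unit_inverse by auto
  then have "w ^ i \<in> (*) (of_nat p) ` R"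
    using mult_dvd[OF wu] by (metis mult.assoc mult.right_neutral right_inverse)
  then show ?thesis by blast
qed

text \<open>After division by a power of \<open>x\<close>, the lowest nonzero coefficient of an
  integral equation of \<open>x\<close> is a multiple of \<open>x\<close>.\<close>

lemma dvd_Zp:
  assumes x: "x \<in> R" "x \<noteq> 0"
  shows "\<exists>a y. a \<in> Zp \<and> a \<noteq> 0 \<and> y \<in> R \<and> a = x * y"
proof -
  obtain P where P: "Polynomial.lead_coeff P = 1" "Zp.polyZ P" "poly P x = 0"
    using x unfolding R_integral Zp.integral_over_def by auto
  have cZ: "Polynomial.coeff P j \<in> Zp" for j using P(2) by (simp add: Zp.polyZ_def)
  define n where "n = Polynomial.degree P"
  define i where "i = (LEAST i. Polynomial.coeff P i \<noteq> 0)"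
  have i: "Polynomial.coeff P i \<noteq> 0" and below: "\<And>j. j < i \<Longrightarrow> Polynomial.coeff P j = 0"
    unfolding i_def using P(1) not_less_Least by (metis (mono_tags, lifting) LeastI one_neq_zero)+
  have "i \<le> n" unfolding n_def using i by (rule le_degree)
  define y where "y = - (\<Sum>j\<in>{Suc i..n}. Polynomial.coeff P j * x ^ (j - Suc i))"
  have "0 = (\<Sum>j\<le>n. Polynomial.coeff P j * x ^ j)"
    using P(3) by (simp add: poly_altdef n_def)
  also have "\<dots> = (\<Sum>j\<in>{i..n}. Polynomial.coeff P j * x ^ j)"
    by (rule sum.mono_neutral_right) (auto simp: below)
  also have "\<dots> = Polynomial.coeff P i * x ^ i + (\<Sum>j\<in>{Suc i..n}. Polynomial.coeff P j * x ^ j)"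
    using \<open>i \<le> n\<close> by (simp add: sum.atLeast_Suc_atMost)
  also have "(\<Sum>j\<in>{Suc i..n}. Polynomial.coeff P j * x ^ j) = - (x ^ i * (x * y))"
    unfolding y_def mult_minus_right minus_minus sum_distrib_left
  proof (rule sum.cong[OF refl])
    fix j assume "j \<in> {Suc i..n}"
    then have "x ^ j = x ^ i * (x * x ^ (j - Suc i))"
      by (simp flip: power_Suc power_add add: Suc_diff_Suc)
    then show "Polynomial.coeff P j * x ^ j = x ^ i * (x * (Polynomial.coeff P j * x ^ (j - Suc i)))"
      by simp
  qed
  finally have "x ^ i * Polynomial.coeff P i = x ^ i * (x * y)" by (simp add: mult.commute)
  then have "Polynomial.coeff P i = x * y" using x(2) by simp
  moreover have "y \<in> R" unfolding y_def using cZ Zp_R x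
    by (intro R.Zuminus R.Zsum R.Zmult R_power) auto
  ultimately show ?thesis using i cZ by blast
qed

text \<open>Divisibility by all powers of \<open>w\<close> gives divisibility by all powers of
  \<open>p\<close>, and this passes to a nonzero multiple of \<open>x\<close> in \<open>Zp\<close>,
  whose absolute value would have to be 0.\<close>

lemma separated:
  assumes x: "x \<in> R" "\<And>n. x \<in> (*) (w ^ n) ` R"
  shows "x = 0"
proof (rule ccontr)
  assume "x \<noteq> 0"
  then obtain a y where a: "a \<in> Zp" "a \<noteq> 0" "y \<in> R" "a = x * y" using dvd_Zp x by blast
  obtain m z where m: "w ^ m = of_nat p * z" "z \<in> R" using w_power_dvd_p by auto
  have "av a * real p ^ k \<le> 1" for k
  proof -
    obtain b where b: "x = w ^ (m * k) * b" "b \<in> R" using x(2)[of "m * k"] by auto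
    have "a = of_nat p ^ k * (z ^ k * b * y)"
      by (simp add: a b power_mult m power_mult_distrib)
    then have "a / of_nat p ^ k = z ^ k * b * y" using p_gt by (simp add: field_simps)
    then have "a / of_nat p ^ k \<in> R" using R.Zmult R_power m a b by metis
    then have "a / of_nat p ^ k \<in> Zp" using R_Q a by (auto simp: Zp_def Q_divide Q_power Q_of_nat)
    then show ?thesis
      using a p_gt by (simp add: Zp_def av_divide Q_power Q_of_nat av_power av_p field_simps)
  qed
  moreover have pos: "av a > 0" using a av_eq_0 av_nonneg' by (metis (no_types, lifting) Zp_def mem_Collect_eq order_le_less)
  obtain k where "real p ^ k > 1 / av a" using real_arch_pow[OF p_gt] by blast
  ultimately show False using pos by (metis linorder_not_less mult.commute pos_divide_less_eq)
qed

lemma decompose_R: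
  assumes x: "x \<in> R" "x \<noteq> 0"
  shows "\<exists>n u. u \<in> units_of_integers R \<and> x = w ^ n * u"
proof -
  obtain n0 where "x \<notin> (*) (w ^ n0) ` R" using separated x by blast
  define n where "n = (LEAST n. x \<notin> (*) (w ^ n) ` R)"
  have n: "x \<notin> (*) (w ^ n) ` R" and below: "\<And>k. k < n \<Longrightarrow> x \<in> (*) (w ^ k) ` R"
    unfolding n_def using \<open>x \<notin> (*) (w ^ n0) ` R\<close> not_less_Least by (metis (mono_tags, lifting) LeastI)+
  have "n \<noteq> 0" using n x by (intro notI) (auto simp: image_iff)
  then obtain k where k: "n = Suc k" by (cases n) auto
  then obtain u where u: "x = w ^ k * u" "u \<in> R" using below[of k] by auto
  have "u \<notin> (*) w ` R" using n k u by (auto simp: mult.assoc mult.left_commute)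
  then show ?thesis using u unit_iff by blast
qed

lemma unit_mult: "u \<in> units_of_integers R \<Longrightarrow> v \<in> units_of_integers R \<Longrightarrow> u * v \<in> units_of_integers R"
  by (auto simp: unit_inverse R.Zmult)

lemma unit_inv: "u \<in> units_of_integers R \<Longrightarrow> inverse u \<in> units_of_integers R"
  by (auto simp: unit_inverse)

lemma decompose:
  assumes "x \<noteq> 0"
  shows "\<exists>i u. u \<in> units_of_integers R \<and> x = w powi i * u"
proof -
  obtain k where k: "of_nat p ^ k * x \<in> R" using scale_into_R by blast
  have p0: "of_nat p ^ k \<noteq> (0::'f)" using p_gt by simp
  obtain n u where u: "u \<in> units_of_integers R" "of_nat p ^ k * x = w ^ n * u"
    using decompose_R[OF k] p0 assms by auto
  obtain m v where v: "v \<in> units_of_integers R" "of_nat p ^ k = w ^ m * v"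
    using decompose_R[OF _ p0] R_power Zp_R Zp_of_nat by (metis subsetD)
  have "v \<noteq> 0" using v unit_inverse by blast
  have "x = (w ^ n * u) / (w ^ m * v)" using u(2) v(2) p0 by (metis nonzero_mult_div_cancel_left)
  also have "\<dots> = w powi (int n - int m) * (u * inverse v)"
    using w_nonzero \<open>v \<noteq> 0\<close> by (simp add: power_int_diff field_simps)
  finally show ?thesis using u(1) v(1) unit_mult unit_inv by blast
qed

section \<open>Completeness and square roots\<close>

lemma Q_series:
  fixes c :: "nat \<Rightarrow> nat"
  shows "\<exists>C\<in>Zp. \<forall>n. \<exists>z\<in>Zp. C - (\<Sum>i<n. of_nat p ^ i * of_nat (c i)) = of_nat p ^ n * z"
proof -
  interpret Metric_space Q "\<lambda>x y. av (x - y)" by (rule Q_metric)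
  define s :: "nat \<Rightarrow> 'f" where "s n = (\<Sum>i<n. of_nat p ^ i * of_nat (c i))" for n
  have sQ: "s n \<in> Q" for n unfolding s_def by (intro Q_sum Q_closed Q_power Q_of_nat)
  have step: "av (s m - s n) \<le> (1 / real p) ^ n" if "n \<le> m" for m n
  proof -
    have "s m - s n = (\<Sum>i\<in>{n..<m}. of_nat p ^ i * of_nat (c i))"
      unfolding s_def lessThan_atLeast0 using that by (intro sum_diff_nat_ivl) auto
    also have "av \<dots> \<le> (1 / real p) ^ n"
    proof (rule av_sum)
      fix i assume i: "i \<in> {n..<m}"
      have "av (of_nat p ^ i * of_nat (c i)) = (1 / real p) ^ i * av (of_nat (c i))"
        by (simp add: av_mult Q_power Q_of_nat av_power av_p)
      also have "\<dots> \<le> (1 / real p) ^ i * 1"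
        using Zp_of_nat[of "c i"] by (intro mult_left_mono) (auto simp: Zp_def)
      also have "\<dots> \<le> (1 / real p) ^ n" using i p_gt by (simp del: power_one_over add: power_decreasing)
      finally show "of_nat p ^ i * of_nat (c i) \<in> Q \<and> av (of_nat p ^ i * of_nat (c i)) \<le> (1 / real p) ^ n"
        using Q_closed(4)[OF Q_power[OF Q_of_nat] Q_of_nat] by simp
    qed (use p_gt in auto)
    finally show ?thesis .
  qed
  have small: "\<exists>N. (1 / real p) ^ N < e" if "e > 0" for e
    using that p_gt by (intro real_arch_pow_inv) auto
  have "MCauchy s"
    unfolding MCauchy_def
  proof (intro conjI allI impI)
    fix e :: real assume "e > 0"
    then obtain N where N: "(1 / real p) ^ N < e" using small by blast
    have "av (s n - s n') < e" if "N \<le> n" "N \<le> n'" for n n'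
    proof -
      have "av (s n - s n') = av ((s n - s N) - (s n' - s N))" by simp
      also have "\<dots> \<le> max (av (s n - s N)) (av (s n' - s N))" by (intro av_diff Q_diff sQ)
      finally show ?thesis using step[OF that(1)] step[OF that(2)] N by auto
    qed
    then show "\<exists>N. \<forall>n n'. N \<le> n \<longrightarrow> N \<le> n' \<longrightarrow> av (s n - s n') < e" by blast
  qed (use sQ in auto)
  then obtain C where "limitin mtopology s C sequentially"
    using Q_complete unfolding mcomplete_def by blast
  then have C: "C \<in> Q" and lim: "\<And>e. e > 0 \<Longrightarrow> \<exists>N. \<forall>n\<ge>N. av (s n - C) < e"
    unfolding limit_metric_sequentially by blast+
  \<comment> \<open>The limit inherits the bound on the differences of partial sums: it is compared
    with a partial sum \<open>s k\<close> far enough out.\<close>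
  have near: "av (C - s n) \<le> (1 / real p) ^ n" for n
  proof -
    obtain N where N: "\<forall>k\<ge>N. av (s k - C) < (1 / real p) ^ n"
      using lim[of "(1 / real p) ^ n"] p_gt by auto
    define k where "k = max N n"
    have "av (C - s n) = av ((s k - s n) - (s k - C))" by simp
    also have "\<dots> \<le> max (av (s k - s n)) (av (s k - C))" using C sQ by (intro av_diff Q_diff)
    finally show ?thesis using step[of n k] N by (auto simp: k_def max_def split: if_splits)
  qed
  have "\<exists>z\<in>Zp. C - s n = of_nat p ^ n * z" for n
  proof
    show "C - s n = of_nat p ^ n * ((C - s n) / of_nat p ^ n)" using p_gt by simp
    have "av ((C - s n) / of_nat p ^ n) = av (C - s n) * real p ^ n"
      by (simp add: av_divide Q_diff C sQ Q_power Q_of_nat av_power av_p field_simps)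
    also have "\<dots> \<le> (1 / real p) ^ n * real p ^ n" using near by (intro mult_right_mono) auto
    also have "\<dots> = 1" using p_gt by (simp flip: power_mult_distrib)
    finally show "(C - s n) / of_nat p ^ n \<in> Zp"
      by (simp add: Zp_def Q_divide Q_diff C sQ Q_power Q_of_nat)
  qed
  moreover have "C \<in> Zp" using near[of 0] C by (simp add: Zp_def s_def)
  ultimately show ?thesis unfolding s_def by blast
qed


lemma finite_residues: "\<exists>D. finite D \<and> D \<subseteq> R \<and> (\<forall>x\<in>R. \<exists>d\<in>D. x - d \<in> (*) w ` R)"
proof -
  define cos where "cos x = max_ideal R +>\<^bsub>integers_ring R\<^esub> x" for x
  have cos: "cos x = (\<lambda>h. h + x) ` ((*) w ` R)" if "x \<in> R" for x
    using unif by (auto simp: cos_def a_r_coset_def r_coset_def is_uniformizer_def ring_of_type_algebra_def)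
  have "carrier (residue_field R) = cos ` R"
    by (auto simp: residue_field_def FactRing_def A_RCOSETS_def RCOSETS_def cos_def a_r_coset_def)
  \<comment> \<open>An infinite set would have cardinality 0, which is not
    \<open>p ^ f\<close>.\<close>
  then have "finite (cos ` R)"
    using card_res p_gt by (metis card.infinite less_numeral_extra(3) of_nat_0 power_not_zero not_one_less_zero)
  then obtain D where D: "D \<subseteq> R" "finite D" "cos ` R = cos ` D"
    by (meson finite_subset_image subset_refl)
  have "\<exists>d\<in>D. x - d \<in> (*) w ` R" if x: "x \<in> R" for x
  proof -
    obtain d where d: "d \<in> D" "cos x = cos d" using D(3) x by (metis imageE imageI)
    have "x \<in> cos x" using cos[OF x] R.Z0 by (auto simp: image_iff intro!: bexI[of _ 0])
    then have "x \<in> (\<lambda>h. h + d) ` ((*) w ` R)" using d cos[of d] D(1) by auto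
    then show ?thesis using d(1) by (intro bexI[of _ d]) auto
  qed
  then show ?thesis using D by blast
qed

lemma finite_residues_power:
  "\<exists>D. finite D \<and> D \<subseteq> R \<and> (\<forall>x\<in>R. \<exists>d\<in>D. x - d \<in> (*) (w ^ n) ` R)"
proof (induction n)
  case 0
  show ?case by (rule exI[of _ "{0}"]) (auto simp: R.Z0)
next
  case (Suc n)
  then obtain D where D: "finite D" "D \<subseteq> R" "\<forall>x\<in>R. \<exists>d\<in>D. x - d \<in> (*) (w ^ n) ` R" by auto
  obtain D1 where D1: "finite D1" "D1 \<subseteq> R" "\<forall>x\<in>R. \<exists>d\<in>D1. x - d \<in> (*) w ` R"
    using finite_residues by auto
  show ?case
  proof (intro exI conjI ballI)
    show "finite ((\<lambda>(a, b). a + w ^ n * b) ` (D \<times> D1))" using D D1 by simp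
    show "(\<lambda>(a, b). a + w ^ n * b) ` (D \<times> D1) \<subseteq> R"
      using D D1 wR by (auto intro!: R.Zadd R.Zmult R_power)
    fix x assume "x \<in> R"
    then obtain d y where d: "d \<in> D" "x - d = w ^ n * y" "y \<in> R" using D by blast
    then obtain d1 z where d1: "d1 \<in> D1" "y - d1 = w * z" "z \<in> R" using D1 by blast
    have "x - (d + w ^ n * d1) = w ^ Suc n * z" using d d1 by (simp add: algebra_simps)
    then show "\<exists>d\<in>(\<lambda>(a, b). a + w ^ n * b) ` (D \<times> D1). x - d \<in> (*) (w ^ Suc n) ` R"
      using d d1 by (intro bexI[of _ "d + w ^ n * d1"]) auto
  qed
qed

text \<open>Completeness of \<open>R\<close>, without a basis over \<open>Zp\<close>. The limit is
  expanded in powers of \<open>p\<close> with digits from a finite set \<open>D\<close> of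
  representatives modulo \<open>p\<close>. Collecting equal digits writes it as a finite combination
  of the elements of \<open>D\<close>, and the coefficients are series in \<open>Zp\<close> that
  converge in \<open>Q\<close>.\<close>

lemma R_limit:
  assumes r: "\<And>n. r n \<in> R" "\<And>n. r (Suc n) - r n \<in> (*) (of_nat p ^ n) ` R"
  shows "\<exists>x\<in>R. \<forall>n. x - r n \<in> (*) (of_nat p ^ n) ` R"
proof -
  obtain m z where m: "w ^ m = of_nat p * z" "z \<in> R" using w_power_dvd_p by auto
  obtain D where D: "finite D" "D \<subseteq> R" "\<forall>x\<in>R. \<exists>d\<in>D. x - d \<in> (*) (w ^ m) ` R"
    using finite_residues_power[of m] by auto
  have Dp: "\<exists>d y. d \<in> D \<and> y \<in> R \<and> x = d + of_nat p * y" if "x \<in> R" for x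
  proof -
    from bspec[OF D(3) that] obtain d where d1: "d \<in> D" "x - d \<in> (*) (w ^ m) ` R" by auto
    then obtain t where d: "d \<in> D" "x - d = w ^ m * t" "t \<in> R" by auto
    have "x = d + (x - d)" by simp
    also have "\<dots> = d + of_nat p * (z * t)" by (simp only: d(2) m(1) mult.assoc)
    finally have "x = d + of_nat p * (z * t)" .
    then show ?thesis using d(1) R.Zmult[OF m(2) d(3)] by (intro exI[of _ d] exI[of _ "z * t"]) simp
  qed
  then obtain dg tl where dg: "\<And>x. x \<in> R \<Longrightarrow> dg x \<in> D" and tl: "\<And>x. x \<in> R \<Longrightarrow> tl x \<in> R"
    and dt: "\<And>x. x \<in> R \<Longrightarrow> x = dg x + of_nat p * tl x" by metis
  define \<delta> where "\<delta> n = (r (Suc n) - r n) / of_nat p ^ n" for n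
  have \<delta>: "\<delta> n \<in> R" "r (Suc n) - r n = of_nat p ^ n * \<delta> n" for n
    using r(2)[of n] p_gt by (auto simp: \<delta>_def)
  \<comment> \<open>The carry of the digit expansion; \<open>l n\<close> below is the digit, and
    \<open>tele\<close> is the resulting expansion of \<open>r n\<close> with remainder
    \<open>p^n y n\<close>.\<close>
  define y where "y = rec_nat 0 (\<lambda>n yn. tl (\<delta> n + yn))"
  define l where "l n = dg (\<delta> n + y n)" for n
  have yR: "y n \<in> R" for n by (induction n) (auto simp: y_def R.Z0 R.Zadd \<delta> tl)
  have lD: "l n \<in> D" for n using dg R.Zadd \<delta> yR by (simp add: l_def)
  have step: "\<delta> n + y n = l n + of_nat p * y (Suc n)" for n
    using dt[of "\<delta> n + y n"] R.Zadd \<delta> yR by (simp add: l_def y_def)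
  have tele: "r n = r 0 + (\<Sum>i<n. of_nat p ^ i * l i) + of_nat p ^ n * y n" for n
  proof (induction n)
    case (Suc n)
    have "r (Suc n) = r n + of_nat p ^ n * \<delta> n" using \<delta>(2)[of n] by (simp add: algebra_simps)
    also have "\<dots> = r 0 + (\<Sum>i<n. of_nat p ^ i * l i) + of_nat p ^ n * (\<delta> n + y n)"
      by (subst Suc.IH) (simp add: algebra_simps)
    finally show ?case unfolding step by (simp add: algebra_simps)
  qed (simp add: y_def)
  \<comment> \<open>Partial sums of the series that marks the positions at which the digit
    \<open>d\<close> occurs.\<close>
  define S :: "'f \<Rightarrow> nat \<Rightarrow> 'f" where "S d n = (\<Sum>i<n. of_nat p ^ i * of_nat (if l i = d then 1 else 0))" for d n
  have "\<exists>C\<in>Zp. \<forall>n. \<exists>z\<in>Zp. C - S d n = of_nat p ^ n * z" for d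
    unfolding S_def by (rule Q_series)
  then obtain C where CZ: "\<And>d. C d \<in> Zp"
    and C: "\<And>d n. \<exists>z\<in>Zp. C d - S d n = of_nat p ^ n * z"
    by metis
  define x where "x = r 0 + (\<Sum>d\<in>D. C d * d)"
  have "x \<in> R" unfolding x_def using r CZ Zp_R D(2) by (intro R.Zadd R.Zsum R.Zmult) auto
  moreover have "x - r n \<in> (*) (of_nat p ^ n) ` R" for n
  proof -
    obtain z where z: "\<And>d. z d \<in> Zp"
      "\<And>d. C d - S d n = of_nat p ^ n * z d"
      using C[of _ n] by metis
    have "(\<Sum>i<n. of_nat p ^ i * l i) = (\<Sum>i<n. \<Sum>d\<in>D. of_nat p ^ i * of_nat (if l i = d then 1 else 0) * d)"
    proof (rule sum.cong[OF refl])
      fix i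
      have "(\<Sum>d\<in>D. of_nat p ^ i * of_nat (if l i = d then 1 else 0) * d) =
          (\<Sum>d\<in>D. if l i = d then of_nat p ^ i * d else 0)"
        by (rule sum.cong) auto
      then show "of_nat p ^ i * l i = (\<Sum>d\<in>D. of_nat p ^ i * of_nat (if l i = d then 1 else 0) * d)"
        using D(1) lD by simp
    qed
    also have "\<dots> = (\<Sum>d\<in>D. S d n * d)"
      unfolding S_def sum_distrib_right by (rule sum.swap)
    finally have "x - r n = (\<Sum>d\<in>D. (C d - S d n) * d)
        - of_nat p ^ n * y n"
      by (subst tele) (simp add: x_def left_diff_distrib sum_subtractf)
    also have "\<dots> = of_nat p ^ n * ((\<Sum>d\<in>D. z d * d) - y n)"
      unfolding z(2) by (simp add: sum_distrib_left right_diff_distrib mult.assoc)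
    also have "\<dots> \<in> (*) (of_nat p ^ n) ` R"
      using z(1) Zp_R D(2) yR by (intro imageI R.Zdiff R.Zsum R.Zmult) auto
    finally show ?thesis .
  qed
  ultimately show ?thesis by blast
qed

lemma two_unit: "2 \<in> units_of_integers R"
proof -
  have two: "2 \<in> R" using Zp_of_nat[of 2] Zp_R by auto
  obtain k where k: "p = 2 * k + 1" using prime_p odd_p by (metis oddE primes_dvd_imp_eq two_is_prime_nat)
  have "of_nat p - 2 * of_nat k \<in> (*) w ` R" if "2 \<in> (*) w ` R"
    using diff_dvd[OF p_nonunit mult_dvd[OF that, of "of_nat k"]] Zp_of_nat Zp_R by auto
  then show ?thesis using one_not_dvd unit_iff[OF two] k by auto
qed

text \<open>Newton iteration for \<open>y^2 = x\<close> starting at 1; division by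
  \<open>2 * s n\<close> is possible because 2 and \<open>s n\<close> are units. Gaining one power
  of \<open>w\<close> per step is all that is used.\<close>

lemma hensel_sqrt:
  assumes x: "x \<in> R" "x - 1 \<in> (*) w ` R"
  shows "\<exists>y\<in>R. y\<^sup>2 = x"
proof -
  define s where "s = rec_nat 1 (\<lambda>_ y. y - (y\<^sup>2 - x) / (2 * y))"
  have s_Suc: "s (Suc n) = s n - ((s n)\<^sup>2 - x) / (2 * s n)" for n by (simp add: s_def)
  have gen: "a - b - a = - b" for a b :: 'f by simp
  have inv: "s n \<in> R \<and> s n - 1 \<in> (*) w ` R \<and> (s n)\<^sup>2 - x \<in> (*) (w ^ Suc n) ` R \<and>
      s (Suc n) - s n \<in> (*) (w ^ Suc n) ` R" for n
  proof (induction n)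
    have A: "s (Suc n) - s n \<in> (*) (w ^ Suc n) ` R \<and> s n \<noteq> 0 \<and> inverse (2 * s n) \<in> R"
      if "s n \<in> R" "s n - 1 \<in> (*) w ` R" "(s n)\<^sup>2 - x \<in> (*) (w ^ Suc n) ` R" for n
    proof -
      have "s n \<notin> (*) w ` R" using that(2) one_not_dvd diff_dvd[of "s n" w "s n - 1"] by auto
      then have u: "2 * s n \<in> units_of_integers R" using two_unit unit_mult unit_iff that(1) by blast
      then have "inverse (2 * s n) \<in> R" "s n \<noteq> 0" by (auto simp: unit_inverse)
      moreover have "s (Suc n) - s n = - (((s n)\<^sup>2 - x) * inverse (2 * s n))"
        unfolding s_Suc divide_inverse by (rule gen)
      ultimately show ?thesis using mult_dvd[OF that(3)] uminus_dvd by metis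
    qed
    {
      case 0
      have "1\<^sup>2 - x \<in> (*) w ` R" using uminus_dvd[OF x(2)] by simp
      then have "s 0 \<in> R \<and> s 0 - 1 \<in> (*) w ` R \<and> (s 0)\<^sup>2 - x \<in> (*) (w ^ Suc 0) ` R"
        using R.Z1 R.Z0 by (auto simp: s_def image_iff[of 0])
      then show ?case using A[of 0] by blast
    next
      case (Suc n)
      then obtain e where e: "s (Suc n) - s n = w ^ Suc n * e" "e \<in> R" by blast
      have nz: "s n \<noteq> 0" using A[of n] Suc by blast
      have "w ^ Suc n * e + s n \<in> R" using Suc e(2) wR by (intro R.Zadd R.Zmult R_power) auto
      then have sR: "s (Suc n) \<in> R" using e(1) by (simp add: diff_eq_eq)
      have "w ^ Suc n * e \<in> (*) w ` R" using e wR R_power R.Zmult by (auto simp: mult.assoc)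
      then have s1: "s (Suc n) - 1 \<in> (*) w ` R"
        using add_dvd[of "s (Suc n) - s n" w "s n - 1"] Suc e(1) by (simp add: algebra_simps)
      \<comment> \<open>For a quadratic polynomial the Newton error is exactly the square of the
        correction.\<close>
      have "(s (Suc n))\<^sup>2 - x = (s (Suc n) - s n)\<^sup>2"
        using nz unfolding s_Suc by (simp add: field_simps power2_eq_square)
      also have "\<dots> = w ^ Suc (Suc n) * (w ^ n * e\<^sup>2)" by (simp add: e power2_eq_square)
      also have "\<dots> \<in> (*) (w ^ Suc (Suc n)) ` R" using e wR by (intro imageI R.Zmult R_power)
      finally show ?case using sR s1 A[of "Suc n"] by blast
    }
  qed
  obtain m z where m: "w ^ m = of_nat p * z" "z \<in> R" using w_power_dvd_p by auto
  obtain z' where z': "of_nat p = w * z'" "z' \<in> R" using p_nonunit by auto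
  have weaken: "t \<in> (*) (w ^ j) ` R" if "t \<in> (*) (w ^ k) ` R" "j \<le> k" for t j k
  proof -
    from that(1) obtain a where "t = w ^ k * a" "a \<in> R" by auto
    moreover have "w ^ k = w ^ j * w ^ (k - j)" using that(2) by (simp flip: power_add)
    ultimately show ?thesis using wR R_power R.Zmult by (auto simp: mult.assoc)
  qed
  have mono: "s (k + j) - s k \<in> (*) (w ^ k) ` R" for k j
  proof (induction j)
    case (Suc j)
    have "s (Suc (k + j)) - s (k + j) \<in> (*) (w ^ k) ` R" using inv[of "k + j"] weaken[of _ "Suc (k + j)" k] by simp
    from add_dvd[OF this Suc] show ?case by simp
  qed (auto simp: image_iff intro!: bexI[of _ 0] R.Z0)
  have wp: "t \<in> (*) (of_nat p ^ n) ` R" if "t \<in> (*) (w ^ (m * n)) ` R" for t n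
    using that m R_power R.Zmult by (auto simp: power_mult power_mult_distrib mult.assoc)
  have pw: "t \<in> (*) (w ^ n) ` R" if "t \<in> (*) (of_nat p ^ n) ` R" for t n
    using that z' R_power R.Zmult by (auto simp: power_mult_distrib mult.assoc)
  \<comment> \<open>Completeness was shown for powers of \<open>p\<close>, so the iteration is
    sampled at the multiples of \<open>m\<close>, where \<open>w ^ m\<close> is divisible by
    \<open>p\<close>.\<close>
  have "\<exists>y\<in>R. \<forall>n. y - s (m * n) \<in> (*) (of_nat p ^ n) ` R"
  proof (rule R_limit)
    show "s (m * Suc n) - s (m * n) \<in> (*) (of_nat p ^ n) ` R" for n
      using wp mono[of "m * n" m] by (simp add: add.commute)
  qed (use inv in auto)
  then obtain y where y: "y \<in> R" "\<And>n. y - s (m * n) \<in> (*) (of_nat p ^ n) ` R" by blast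
  have "y\<^sup>2 - x \<in> (*) (w ^ n) ` R" for n
  proof -
    have mn: "m > 0" using one_not_dvd mult_dvd[OF p_nonunit m(2)] m(1) by (intro gr0I) auto
    have "y\<^sup>2 - x = (y - s (m * n)) * (y + s (m * n)) + ((s (m * n))\<^sup>2 - x)"
      by (simp add: algebra_simps power2_eq_square)
    moreover have "(y - s (m * n)) * (y + s (m * n)) \<in> (*) (w ^ n) ` R"
      using mult_dvd[OF pw[OF y(2)]] R.Zadd y(1) inv by blast
    moreover have "(s (m * n))\<^sup>2 - x \<in> (*) (w ^ n) ` R"
      using inv[of "m * n"] weaken mn by (metis le_SucI mult_le_mono1 nat_mult_1 Suc_leI One_nat_def)
    ultimately show ?thesis using add_dvd by metis
  qed
  moreover have "y\<^sup>2 - x \<in> R" using y x R_power R.Zdiff by blast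
  ultimately have "y\<^sup>2 - x = 0" using separated by blast
  then show ?thesis using y(1) by auto
qed

end


section \<open>Reduction modulo the uniformizer with values in E\<close>

definition (in genuine_data) red :: "'f \<Rightarrow> 'e" where
  "red x = emb (max_ideal R +>\<^bsub>integers_ring R\<^esub> x)"

locale embedded_local_field = local_field p f Q av R w + genuine_data p f R w emb iota
  for p f :: nat and Q :: "'f::field_char_0 set" and av R w
    and emb :: "'f set \<Rightarrow> 'e::field" and iota +
  assumes emb_hom: "emb \<in> ring_hom (residue_field R) ring_of_type_algebra"
begin

lemma max_ideal_eq: "max_ideal R = (*) w ` R"
  using unif unfolding is_uniformizer_def by blast

lemma coset_eq: "max_ideal R +>\<^bsub>integers_ring R\<^esub> x = (\<lambda>h. h + x) ` ((*) w ` R)"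
  by (auto simp: max_ideal_eq a_r_coset_def r_coset_def ring_of_type_algebra_def)

lemma coset_cong:
  assumes "x - y \<in> (*) w ` R"
  shows "max_ideal R +>\<^bsub>integers_ring R\<^esub> x = max_ideal R +>\<^bsub>integers_ring R\<^esub> y"
proof -
  have "(\<lambda>h. h + x) ` ((*) w ` R) \<subseteq> (\<lambda>h. h + y) ` ((*) w ` R)" if "x - y \<in> (*) w ` R" for x y
  proof
    fix t assume "t \<in> (\<lambda>h. h + x) ` ((*) w ` R)"
    then obtain h where "h \<in> (*) w ` R" "t = h + x" by blast
    then have "h + (x - y) \<in> (*) w ` R" "t = (h + (x - y)) + y" using add_dvd that by auto
    then show "t \<in> (\<lambda>h. h + y) ` ((*) w ` R)" by blast
  qed
  from this[OF assms] this[of y x] uminus_dvd[OF assms] show ?thesis by (simp add: coset_eq)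
qed

lemma integers_ring_simps [simp]:
  "carrier (integers_ring R) = R"
  "x \<otimes>\<^bsub>integers_ring R\<^esub> y = x * y" "x \<oplus>\<^bsub>integers_ring R\<^esub> y = x + y"
  "\<one>\<^bsub>integers_ring R\<^esub> = 1" "\<zero>\<^bsub>integers_ring R\<^esub> = 0"
  by (auto simp: ring_of_type_algebra_def)

lemma cring_integers: "cring (integers_ring R)"
  by (intro cringI abelian_groupI comm_monoidI)
    (auto simp: R.Z0 R.Z1 R.Zadd R.Zmult algebra_simps intro: bexI[of _ "- _"] R.Zuminus
      intro!: bexI[OF _ R.Zuminus])

lemma ideal_max: "ideal (max_ideal R) (integers_ring R)"
proof (rule idealI)
  show "ring (integers_ring R)" using cring_integers cring.axioms(1) by blast
  have sub: "max_ideal R \<subseteq> R" using wR R.Zmult by (auto simp: max_ideal_eq)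
  show "subgroup (max_ideal R) (add_monoid (integers_ring R))"
  proof (rule subgroup.intro)
    fix x assume x: "x \<in> max_ideal R"
    interpret cring "integers_ring R" by (rule cring_integers)
    have mx: "- x \<in> max_ideal R" using x uminus_dvd by (simp add: max_ideal_eq)
    then have "x \<in> R" "- x \<in> R" using x sub by auto
    then have "inv\<^bsub>add_monoid (integers_ring R)\<^esub> x = - x"
      using minus_equality[of "- x" x] by (simp add: a_inv_def)
    then show "inv\<^bsub>add_monoid (integers_ring R)\<^esub> x \<in> max_ideal R" using mx by simp
  qed (use sub add_dvd R.Z0 in \<open>auto simp: max_ideal_eq image_iff[of 0]\<close>)
  fix a x assume ax: "a \<in> max_ideal R" "x \<in> carrier (integers_ring R)"
  then have "a * x \<in> max_ideal R" using mult_dvd by (simp add: max_ideal_eq)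
  then show "x \<otimes>\<^bsub>integers_ring R\<^esub> a \<in> max_ideal R" "a \<otimes>\<^bsub>integers_ring R\<^esub> x \<in> max_ideal R"
    by (simp_all add: mult.commute)
qed

lemma red_add: "x \<in> R \<Longrightarrow> y \<in> R \<Longrightarrow> red (x + y) = red x + red y"
  and red_mult: "x \<in> R \<Longrightarrow> y \<in> R \<Longrightarrow> red (x * y) = red x * red y"
  and red_1: "red 1 = 1"
proof -
  interpret I: ideal "max_ideal R" "integers_ring R" by (rule ideal_max)
  have carr: "max_ideal R +>\<^bsub>integers_ring R\<^esub> x \<in> carrier (residue_field R)" if "x \<in> R" for x
    using that by (auto simp: residue_field_def FactRing_def A_RCOSETS_def RCOSETS_def a_r_coset_def)
  show "red (x + y) = red x + red y" if "x \<in> R" "y \<in> R"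
  proof -
    have "max_ideal R +>\<^bsub>integers_ring R\<^esub> (x + y) =
      (max_ideal R +>\<^bsub>integers_ring R\<^esub> x) \<oplus>\<^bsub>residue_field R\<^esub> (max_ideal R +>\<^bsub>integers_ring R\<^esub> y)"
      using I.a_rcos_sum[of x y] that by (simp add: residue_field_def FactRing_def)
    then show ?thesis using ring_hom_add[OF emb_hom carr[OF that(1)] carr[OF that(2)]]
      by (simp add: red_def)
  qed
  show "red (x * y) = red x * red y" if "x \<in> R" "y \<in> R"
  proof -
    have "max_ideal R +>\<^bsub>integers_ring R\<^esub> (x * y) =
      (max_ideal R +>\<^bsub>integers_ring R\<^esub> x) \<otimes>\<^bsub>residue_field R\<^esub> (max_ideal R +>\<^bsub>integers_ring R\<^esub> y)"
      using I.rcoset_mult_add[of x y] that by (simp add: residue_field_def FactRing_def)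
    then show ?thesis using ring_hom_mult[OF emb_hom carr[OF that(1)] carr[OF that(2)]]
      by (simp add: red_def)
  qed
  show "red 1 = 1"
    using ring_hom_one[OF emb_hom] by (simp add: red_def residue_field_def FactRing_def)
qed

lemma red_0: "red 0 = 0"
  using red_add[OF R.Z0 R.Z0] by (metis add.right_neutral add_left_cancel)

lemma red_uminus: "x \<in> R \<Longrightarrow> red (- x) = - red x"
  using red_add[of x "- x"] R.Zuminus red_0 by (simp add: eq_neg_iff_add_eq_0 add.commute)

lemma red_eq_0: "x \<in> R \<Longrightarrow> red x = 0 \<longleftrightarrow> x \<in> (*) w ` R"
proof
  assume x: "x \<in> R"
  {
    assume "x \<in> (*) w ` R"
    then have "max_ideal R +>\<^bsub>integers_ring R\<^esub> x = max_ideal R +>\<^bsub>integers_ring R\<^esub> 0"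
      by (intro coset_cong) simp
    then show "red x = 0" using red_0 by (simp add: red_def)
  next
    assume "red x = 0"
    show "x \<in> (*) w ` R"
    proof (rule ccontr)
      assume "x \<notin> (*) w ` R"
      then have "x \<noteq> 0" "inverse x \<in> R" using unit_iff[OF x] unit_inverse by auto
      then have "red x * red (inverse x) = 1" using red_mult[OF x] red_1 by (metis right_inverse)
      then show False using \<open>red x = 0\<close> by simp
    qed
  }
qed

lemma red_image: "red ` R = emb ` carrier (residue_field R)"
  by (auto simp: red_def residue_field_def FactRing_def A_RCOSETS_def RCOSETS_def a_r_coset_def image_iff)

lemma card_red: "card (red ` R) = p ^ f"
proof -
  have "inj_on emb (carrier (residue_field R))"
  proof (rule inj_onI)
    fix A B assume AB: "A \<in> carrier (residue_field R)" "B \<in> carrier (residue_field R)" "emb A = emb B"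
    then obtain x y where x: "x \<in> R" "A = max_ideal R +>\<^bsub>integers_ring R\<^esub> x"
      and y: "y \<in> R" "B = max_ideal R +>\<^bsub>integers_ring R\<^esub> y"
      by (auto simp: residue_field_def FactRing_def A_RCOSETS_def RCOSETS_def a_r_coset_def)
    have "red (x + - y) = 0"
      using AB(3) x y red_add[of x "- y"] R.Zuminus by (simp add: red_uminus) (simp add: red_def)
    then show "A = B"
      using red_eq_0[OF R.Zadd[OF x(1) R.Zuminus[OF y(1)]]] x(2) y(2) by (simp add: coset_cong)
  qed
  then show ?thesis using card_res by (simp add: red_image card_image)
qed

end

section \<open>The quadratic Hilbert symbol in odd residue characteristic\<close>

locale genuine_setting = embedded_local_field p f Q av R w emb iota
  for p f :: nat and Q :: "'f::field_char_0 set" and av R w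
    and emb :: "'f set \<Rightarrow> 'e::field" and iota +
  assumes char_E: "CHAR('e) = p"
begin

abbreviation units where "units \<equiv> units_of_integers R"

lemma units_R: "u \<in> units \<Longrightarrow> u \<in> R"
  by (simp add: unit_inverse)

lemma units_nonzero: "u \<in> units \<Longrightarrow> u \<noteq> 0"
  by (simp add: unit_inverse)

lemma unit_1: "1 \<in> units"
  by (simp add: unit_inverse R.Z1)

lemma unit_uminus: "u \<in> units \<Longrightarrow> - u \<in> units"
  by (auto simp: unit_inverse R.Zuminus)

lemma unit_power: "u \<in> units \<Longrightarrow> u ^ n \<in> units"
  by (induction n) (auto simp: unit_1 unit_mult)

lemma red_unit_iff: "x \<in> R \<Longrightarrow> x \<in> units \<longleftrightarrow> red x \<noteq> 0"
  using unit_iff red_eq_0 by simp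

lemma red_w: "red w = 0"
  using red_eq_0[OF wR] R.Z1 by (auto simp: image_iff intro!: bexI[of _ 1])

lemma red_power: "x \<in> R \<Longrightarrow> red (x ^ n) = red x ^ n"
  by (induction n) (auto simp: red_1 red_mult R_power)

lemma red_diff: "x \<in> R \<Longrightarrow> y \<in> R \<Longrightarrow> red (x - y) = red x - red y"
  using red_add[of x "- y"] R.Zuminus red_uminus by simp

lemma red_inverse: "u \<in> units \<Longrightarrow> red (inverse u) = inverse (red u)"
  using red_mult[of u "inverse u"] red_1 by (auto simp: unit_inverse inverse_unique)

lemma powi_w_nonzero: "w powi i \<noteq> 0"
  using w_nonzero by simp

lemma powi_unit_R_iff:
  assumes "u \<in> units"
  shows "w powi i * u \<in> R \<longleftrightarrow> i \<ge> 0"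
proof
  assume "i \<ge> 0"
  then show "w powi i * u \<in> R"
    using assms wR R_power R.Zmult units_R by (simp add: power_int_def)
next
  assume x: "w powi i * u \<in> R"
  show "i \<ge> 0"
  proof (rule ccontr)
    assume "\<not> i \<ge> 0"
    then obtain n where n: "i = - int (Suc n)" by (metis int_cases of_nat_0_le_iff)
    have "u = w * (w ^ n * (w powi i * u))"
    proof -
      have "w powi i = inverse (w ^ Suc n)" unfolding n by (simp only: power_int_minus power_int_of_nat)
      then have "w ^ Suc n * w powi i = 1" using w_nonzero by (metis power_not_zero right_inverse)
      moreover have "w * (w ^ n * (w powi i * u)) = (w ^ Suc n * w powi i) * u"
        by (simp only: power_Suc mult.assoc)
      ultimately show ?thesis by simp
    qed
    moreover have "w ^ n * (w powi i * u) \<in> R" using x wR R_power R.Zmult by blast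
    ultimately show False using unit_iff units_R assms by blast
  qed
qed

section \<open>Valuation and angular component\<close>

definition val :: "'f \<Rightarrow> int" where
  "val x = (THE i. \<exists>u\<in>units. x = w powi i * u)"

definition ang :: "'f \<Rightarrow> 'f" where
  "ang x = w powi (- val x) * x"

lemma val_eqI:
  assumes "u \<in> units"
  shows "val (w powi i * u) = i"
  unfolding val_def
proof (rule the_equality)
  fix j assume "\<exists>v\<in>units. w powi i * u = w powi j * v"
  then obtain v where v: "v \<in> units" "w powi i * u = w powi j * v" by blast
  have "i \<le> j" if "u \<in> units" "v \<in> units" "w powi i * u = w powi j * v" for i j u v
  proof -
    have "w powi (j - i) * v = u"
      using that(3) w_nonzero by (simp add: power_int_diff field_simps)
    then show ?thesis using powi_unit_R_iff[OF that(2), of "j - i"] units_R[OF that(1)] by simp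
  qed
  from this[OF assms v] this[OF v(1) assms v(2)[symmetric]] show "j = i" by simp
qed (use assms in blast)

lemma val_ang:
  assumes "x \<noteq> 0"
  shows "ang x \<in> units" "x = w powi (val x) * ang x"
proof -
  obtain i u where u: "u \<in> units" "x = w powi i * u" using decompose[OF assms] by blast
  then have v: "val x = i" using val_eqI by simp
  have "ang x = w powi - i * (w powi i * u)" unfolding ang_def v u(2)[symmetric] ..
  also have "\<dots> = u" using powi_w_nonzero[of i] by (simp add: power_int_minus)
  finally have "ang x = u" .
  then show "ang x \<in> units" "x = w powi (val x) * ang x" using u v by auto
qed

lemma ang_eqI: "u \<in> units \<Longrightarrow> ang (w powi i * u) = u"
  using w_nonzero by (simp add: ang_def val_eqI power_int_minus)

lemma val_mult: "x \<noteq> 0 \<Longrightarrow> y \<noteq> 0 \<Longrightarrow> val (x * y) = val x + val y"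
  and ang_mult: "x \<noteq> 0 \<Longrightarrow> y \<noteq> 0 \<Longrightarrow> ang (x * y) = ang x * ang y"
proof -
  assume xy: "x \<noteq> 0" "y \<noteq> 0"
  have "x * y = (w powi val x * ang x) * (w powi val y * ang y)"
    using val_ang(2)[OF xy(1)] val_ang(2)[OF xy(2)] by simp
  also have "\<dots> = w powi (val x + val y) * (ang x * ang y)"
    using w_nonzero by (simp add: power_int_add)
  finally have *: "x * y = w powi (val x + val y) * (ang x * ang y)" .
  have u: "ang x * ang y \<in> units" using val_ang xy unit_mult by blast
  show "val (x * y) = val x + val y" unfolding * by (rule val_eqI[OF u])
  show "ang (x * y) = ang x * ang y" unfolding * by (rule ang_eqI[OF u])
qed

lemma val_powi: "val (w powi i) = i"
  using val_eqI[OF unit_1, of i] by simp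

lemma val_unit: "u \<in> units \<Longrightarrow> val u = 0"
  using val_eqI[of u 0] by simp

lemma ang_unit: "u \<in> units \<Longrightarrow> ang u = u"
  using ang_eqI[of u 0] by simp

lemma val_1: "val 1 = 0" and val_w: "val w = 1"
  using val_unit[OF unit_1] val_powi[of 1] by auto

lemma val_inverse: "x \<noteq> 0 \<Longrightarrow> val (inverse x) = - val x"
  using val_mult[of x "inverse x"] val_1 by simp

lemma val_divide: "x \<noteq> 0 \<Longrightarrow> y \<noteq> 0 \<Longrightarrow> val (x / y) = val x - val y"
  by (simp add: divide_inverse val_mult val_inverse)

lemma val_power: "x \<noteq> 0 \<Longrightarrow> val (x ^ n) = int n * val x"
  by (induction n) (auto simp: val_1 val_mult algebra_simps)

lemma R_val: "x \<noteq> 0 \<Longrightarrow> x \<in> R \<longleftrightarrow> val x \<ge> 0"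
  using val_ang[of x] powi_unit_R_iff by metis

lemma val_R: "x \<in> R \<Longrightarrow> x \<noteq> 0 \<Longrightarrow> val x \<ge> 0"
  using R_val by blast

lemma unit_val: "x \<in> units \<longleftrightarrow> x \<noteq> 0 \<and> val x = 0"
  using R_val val_inverse by (auto simp: unit_inverse)

lemma red_eq_0_val: "x \<in> R \<Longrightarrow> x \<noteq> 0 \<Longrightarrow> red x = 0 \<longleftrightarrow> val x \<ge> 1"
  using red_unit_iff[of x] unit_val[of x] R_val[of x] by auto

lemma val_uminus: "val (- x) = val x"
proof (cases "x = 0")
  case False
  then show ?thesis
    using val_mult[of "- 1" x] val_unit[OF unit_uminus[OF unit_1]] by simp
qed simp

subsection \<open>Squares in the residue field\<close>

definition kappa :: "'e set" where "kappa = red ` R"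

definition q :: nat where "q = p ^ f"

lemma card_kappa: "card kappa = q"
  by (simp add: kappa_def q_def card_red)

lemma q_pos: "q > 0" using p_gt by (simp add: q_def)

lemma finite_kappa: "finite kappa"
  using card_kappa q_pos by (metis card.infinite less_irrefl)

lemma kappa_closed:
  "0 \<in> kappa" "1 \<in> kappa" "a \<in> kappa \<Longrightarrow> b \<in> kappa \<Longrightarrow> a + b \<in> kappa"
  "a \<in> kappa \<Longrightarrow> b \<in> kappa \<Longrightarrow> a * b \<in> kappa" "a \<in> kappa \<Longrightarrow> b \<in> kappa \<Longrightarrow> a - b \<in> kappa"
  "a \<in> kappa \<Longrightarrow> - a \<in> kappa"
proof -
  show "0 \<in> kappa" unfolding kappa_def using R.Z0 red_0 by (metis imageI)
  show "1 \<in> kappa" unfolding kappa_def using R.Z1 red_1 by (metis imageI)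
  show "a + b \<in> kappa" if "a \<in> kappa" "b \<in> kappa"
    using that unfolding kappa_def by (auto simp flip: red_add intro!: imageI R.Zadd)
  show "a * b \<in> kappa" if "a \<in> kappa" "b \<in> kappa"
    using that unfolding kappa_def by (auto simp flip: red_mult intro!: imageI R.Zmult)
  show "a - b \<in> kappa" if "a \<in> kappa" "b \<in> kappa"
    using that unfolding kappa_def by (auto simp flip: red_diff intro!: imageI R.Zdiff)
  show "- a \<in> kappa" if "a \<in> kappa"
    using that unfolding kappa_def by (auto simp flip: red_uminus intro!: imageI R.Zuminus)
qed

lemma kappa_lift: "c \<in> kappa \<Longrightarrow> \<exists>x\<in>R. red x = c"
  unfolding kappa_def by auto

lemma kappa_lift_unit: "c \<in> kappa \<Longrightarrow> c \<noteq> 0 \<Longrightarrow> \<exists>x\<in>units. red x = c"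
  using kappa_lift red_unit_iff by metis

lemma kappa_inverse: "c \<in> kappa \<Longrightarrow> inverse c \<in> kappa"
proof (cases "c = 0")
  case False
  assume "c \<in> kappa"
  then obtain x where "x \<in> units" "red x = c" using kappa_lift_unit False by blast
  then show ?thesis unfolding kappa_def using red_inverse units_R unit_inv by (metis imageI)
qed simp

lemma kappa_fermat:
  assumes "c \<in> kappa" "c \<noteq> 0"
  shows "c ^ (q - 1) = 1"
proof -
  have bij: "bij_betw ((*) c) (kappa - {0}) (kappa - {0})"
  proof (rule bij_betwI[where g = "(*) (inverse c)"])
    show "(*) c \<in> kappa - {0} \<rightarrow> kappa - {0}" using assms kappa_closed by auto
    show "(*) (inverse c) \<in> kappa - {0} \<rightarrow> kappa - {0}" using assms kappa_closed kappa_inverse by auto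
  qed (use assms in auto)
  have "(\<Prod>x\<in>kappa - {0}. x) = (\<Prod>x\<in>kappa - {0}. c * x)"
    by (rule prod.reindex_bij_betw[OF bij, symmetric])
  also have "\<dots> = c ^ (q - 1) * (\<Prod>x\<in>kappa - {0}. x)"
    using finite_kappa kappa_closed(1) by (simp add: prod.distrib card_kappa)
  finally show ?thesis using finite_kappa by simp
qed

lemma q_odd: "odd q"
  unfolding q_def using prime_p odd_p by (metis even_power primes_dvd_imp_eq two_is_prime_nat)

lemma q_ge: "q \<ge> 3"
proof -
  have "card {0, 1 :: 'e} \<le> q"
    using card_mono[OF finite_kappa, of "{0, 1}"] kappa_closed card_kappa by auto
  then have "q \<ge> 2" by simp
  then show ?thesis using q_odd by (cases "q = 2") auto
qed

lemma f_pos: "f > 0"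
  using q_ge unfolding q_def by (cases f) auto

definition hq :: nat where "hq = (q - 1) div 2"

lemma hq: "q - 1 = 2 * hq" "hq > 0"
  using q_odd q_ge by (auto simp: hq_def)

lemma minus_one_neq_one: "(- 1 :: 'e) \<noteq> 1"
proof
  assume "(- 1 :: 'e) = 1"
  then have "(of_nat 2 :: 'e) = 0" by (metis add.right_inverse one_add_one of_nat_numeral)
  then have "p dvd 2" using char_E by (simp only: of_nat_eq_0_iff_char_dvd)
  then show False using prime_p odd_p by (simp add: primes_dvd_imp_eq)
qed

definition sqs :: "'e set" where "sqs = (\<lambda>c. c\<^sup>2) ` (kappa - {0})"

lemma hq_roots:
  "finite {c :: 'e. c ^ hq = 1}" "card {c :: 'e. c ^ hq = 1} \<le> hq"
proof -
  define P where "P = Polynomial.monom 1 hq - (1 :: 'e poly)"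
  have d: "Polynomial.degree P \<le> hq" unfolding P_def
    by (intro degree_diff_le) (auto simp: degree_monom_le)
  have "Polynomial.coeff P hq = 1" using hq(2) by (simp add: P_def)
  then have "P \<noteq> 0" by auto
  moreover have "{c. c ^ hq = 1} = {c. poly P c = 0}" by (simp add: P_def poly_monom)
  ultimately show "finite {c :: 'e. c ^ hq = 1}" "card {c :: 'e. c ^ hq = 1} \<le> hq"
    using poly_roots_finite[of P] card_poly_roots_bound[of P] d by auto
qed

text \<open>Two counts that meet. Squaring is at most two-to-one on the nonzero elements, so there
  are at least \<open>hq\<close> squares; all of them are roots of \<open>X^hq - 1\<close>, which
  has at most \<open>hq\<close> roots. This is Euler's criterion.\<close>

lemma sqs_roots: "sqs = {c \<in> kappa. c ^ hq = 1}" and card_sqs: "card sqs = hq"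
proof -
  have sub: "sqs \<subseteq> {c. c ^ hq = 1}"
    unfolding sqs_def using kappa_fermat hq(1) by (auto simp flip: power_mult)
  have "card (kappa - {0}) \<le> (\<Sum>s\<in>sqs. card {c \<in> kappa - {0}. c\<^sup>2 = s})"
  proof -
    have "kappa - {0} = (\<Union>s\<in>sqs. {c \<in> kappa - {0}. c\<^sup>2 = s})" by (auto simp: sqs_def)
    then show ?thesis using card_UN_le[of sqs "\<lambda>s. {c \<in> kappa - {0}. c\<^sup>2 = s}"] finite_kappa
      by (simp add: sqs_def)
  qed
  also have "\<dots> \<le> (\<Sum>s\<in>sqs. 2)"
  proof (rule sum_mono)
    fix s assume "s \<in> sqs"
    then obtain d where "s = d\<^sup>2" by (auto simp: sqs_def)
    then have "{c \<in> kappa - {0}. c\<^sup>2 = s} \<subseteq> {d, - d}" by (auto simp: power2_eq_iff)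
    then have "card {c \<in> kappa - {0}. c\<^sup>2 = s} \<le> card {d, - d}" by (intro card_mono) auto
    also have "\<dots> \<le> 2" by (simp add: card_insert_if)
    finally show "card {c \<in> kappa - {0}. c\<^sup>2 = s} \<le> 2" .
  qed
  finally have "hq \<le> card sqs" using kappa_closed(1) finite_kappa card_kappa hq(1) by simp
  moreover have "card sqs \<le> card {c :: 'e. c ^ hq = 1}" by (rule card_mono[OF hq_roots(1) sub])
  ultimately have "card sqs = card {c :: 'e. c ^ hq = 1}" and c: "card sqs = hq" using hq_roots(2) by auto
  then have "sqs = {c. c ^ hq = 1}" using card_subset_eq[OF hq_roots(1) sub] by blast
  moreover have "sqs \<subseteq> kappa" unfolding sqs_def using kappa_closed by (auto simp: power2_eq_square)
  ultimately show "sqs = {c \<in> kappa. c ^ hq = 1}" "card sqs = hq" using c by auto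
qed

text \<open>Squares of the whole field are meant. On units this is the quadratic residue symbol of
  the reduction, by \<open>square_iff\<close>.\<close>

definition leg :: "'f \<Rightarrow> int" where
  "leg u = (if \<exists>y. u = y\<^sup>2 then 1 else - 1)"

lemma one_plus_square:
  assumes "x \<in> R" "red x = 1"
  shows "\<exists>y\<in>units. y\<^sup>2 = x"
proof -
  have "x - 1 \<in> (*) w ` R" using assms red_diff red_1 R.Z1 red_eq_0 R.Zdiff by (metis diff_self)
  then obtain y where y: "y \<in> R" "y\<^sup>2 = x" using hensel_sqrt assms by blast
  have "red y \<noteq> 0" using assms(2) y red_power by auto
  then show ?thesis using y red_unit_iff by blast
qed

text \<open>For the converse, a square root of the residue is lifted to a unit \<open>y\<close>;
  then \<open>u / y^2\<close> is congruent to 1 and is a square by Hensel's lemma.\<close>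

lemma square_iff:
  assumes u: "u \<in> units"
  shows "(\<exists>y. u = y\<^sup>2) \<longleftrightarrow> red u ^ hq = 1"
proof
  assume "\<exists>y. u = y\<^sup>2"
  then obtain y where y: "u = y\<^sup>2" by blast
  have "y \<noteq> 0" using y units_nonzero[OF u] by auto
  then have "y \<in> units" using u y val_power[of y 2] by (auto simp: unit_val)
  then have "red u = (red y)\<^sup>2" "red y \<in> kappa" "red y \<noteq> 0"
    using y red_power units_R red_unit_iff by (auto simp: kappa_def)
  then show "red u ^ hq = 1" using kappa_fermat[of "red y"] hq(1) by (simp flip: power_mult)
next
  assume "red u ^ hq = 1"
  moreover have "red u \<in> kappa" using units_R[OF u] by (auto simp: kappa_def)
  ultimately obtain c where c: "c \<in> kappa" "c \<noteq> 0" "red u = c\<^sup>2"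
    using sqs_roots unfolding sqs_def by auto
  then obtain y where y: "y \<in> units" "red y = c" using kappa_lift_unit by blast
  have "u * inverse y ^ 2 \<in> R" "red (u * inverse y ^ 2) = 1"
    using c y(2) units_R[OF u] units_R[OF unit_inv[OF y(1)]]
    by (simp_all add: R.Zmult R_power red_mult red_power red_inverse[OF y(1)] del: power_inverse)
       (simp add: power_inverse)
  then obtain z where "z\<^sup>2 = u * inverse y ^ 2" using one_plus_square by blast
  then have "u = (z * y)\<^sup>2" using units_nonzero[OF y(1)] by (simp add: field_simps)
  then show "\<exists>y. u = y\<^sup>2" by blast
qed

lemma red_hq: "u \<in> units \<Longrightarrow> red u ^ hq = 1 \<or> red u ^ hq = - 1"
proof -
  assume u: "u \<in> units"
  then have "red u \<in> kappa" "red u \<noteq> 0" using units_R red_unit_iff by (auto simp: kappa_def)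
  then have "(red u ^ hq)\<^sup>2 = 1" using kappa_fermat[of "red u"] hq(1) by (simp flip: power_mult add: mult.commute)
  then show ?thesis by (simp add: power2_eq_1_iff)
qed

lemma leg_mult: "u \<in> units \<Longrightarrow> v \<in> units \<Longrightarrow> leg (u * v) = leg u * leg v"
  using red_hq[of u] red_hq[of v] minus_one_neq_one
  by (auto simp: leg_def square_iff unit_mult red_mult units_R power_mult_distrib)

lemma leg_square: "leg (y\<^sup>2) = 1"
  by (auto simp: leg_def)

lemma leg_cases: "leg u = 1 \<or> leg u = - 1"
  by (auto simp: leg_def)

lemma leg_self: "leg u * leg u = 1"
  by (auto simp: leg_def)

lemma ex_nonsquare: "\<exists>e\<in>units. leg e = - 1"
proof -
  have "card (kappa - {0}) = 2 * hq"
    using kappa_closed(1) finite_kappa card_kappa hq(1) by simp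
  then have "\<not> kappa - {0} \<subseteq> sqs"
    using card_mono[of sqs "kappa - {0}"] card_sqs hq(2) finite_kappa by (auto simp: sqs_def)
  then obtain c where c: "c \<in> kappa" "c \<noteq> 0" "c \<notin> sqs" by blast
  then obtain e where "e \<in> units" "red e = c" using kappa_lift_unit by blast
  then show ?thesis using c by (auto simp: sqs_roots leg_def square_iff)
qed

subsection \<open>The tame formula\<close>

lemma hilbert_sym: "hilbert_symbol a b = hilbert_symbol b a"
  unfolding hilbert_symbol_def by (metis add.commute prod.inject)

lemma hilbert_eq_1I: "(x, y, z) \<noteq> (0, 0, 0) \<Longrightarrow> z\<^sup>2 = a * x\<^sup>2 + b * y\<^sup>2 \<Longrightarrow> hilbert_symbol a b = 1"
  unfolding hilbert_symbol_def by auto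

lemma hilbert_eq_m1I:
  "(\<And>x y z. z\<^sup>2 = a * x\<^sup>2 + b * y\<^sup>2 \<Longrightarrow> x = 0 \<and> y = 0) \<Longrightarrow> hilbert_symbol a b = - 1"
  unfolding hilbert_symbol_def by (fastforce)

lemma hilbert_mult_square:
  assumes "c \<noteq> 0"
  shows "hilbert_symbol (c\<^sup>2 * a) b = hilbert_symbol a b"
proof -
  have "(\<exists>x y z. (x, y, z) \<noteq> (0, 0, 0) \<and> z\<^sup>2 = c\<^sup>2 * a * x\<^sup>2 + b * y\<^sup>2) \<longleftrightarrow>
      (\<exists>x y z. (x, y, z) \<noteq> (0, 0, 0) \<and> z\<^sup>2 = a * x\<^sup>2 + b * y\<^sup>2)" (is "?L \<longleftrightarrow> ?R")
  proof
    assume ?L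
    then obtain x y z where "(x, y, z) \<noteq> (0, 0, 0)" "z\<^sup>2 = c\<^sup>2 * a * x\<^sup>2 + b * y\<^sup>2" by blast
    then show ?R using assms by (intro exI[of _ "c * x"] exI[of _ y] exI[of _ z]) (auto simp: power_mult_distrib)
  next
    assume ?R
    then obtain x y z where "(x, y, z) \<noteq> (0, 0, 0)" "z\<^sup>2 = a * x\<^sup>2 + b * y\<^sup>2" by blast
    then show ?L using assms by (intro exI[of _ "x / c"] exI[of _ y] exI[of _ z]) (auto simp: power_divide)
  qed
  then show ?thesis unfolding hilbert_symbol_def by simp
qed

text \<open>The expression is the norm form of the unramified quadratic extension, whose values have
  even valuation. After division by \<open>y^2\<close> either \<open>z / y\<close> is integral and
  the residue is nonzero because \<open>red v\<close> is not a square, or the term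
  \<open>(z / y)^2\<close> dominates. This parity is the only obstruction used in the tame
  formula.\<close>

lemma nonsquare_norm_val:
  assumes v: "v \<in> units" "leg v = - 1" and nz: "z \<noteq> 0 \<or> y \<noteq> 0"
  shows "z\<^sup>2 - v * y\<^sup>2 \<noteq> 0 \<and> even (val (z\<^sup>2 - v * y\<^sup>2))"
proof (cases "y = 0")
  case True
  then show ?thesis using nz by (simp add: val_power)
next
  case False
  define r where "r = z / y"
  have eq: "z\<^sup>2 - v * y\<^sup>2 = y\<^sup>2 * (r\<^sup>2 - v)" using False by (simp add: r_def field_simps power2_eq_square)
  have "r\<^sup>2 - v \<noteq> 0 \<and> even (val (r\<^sup>2 - v))"
  proof (cases "r \<in> R")
    case True
    have "red (r\<^sup>2 - v) \<noteq> 0"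
    proof
      assume "red (r\<^sup>2 - v) = 0"
      then have e: "red v = (red r)\<^sup>2" using True v units_R by (simp add: red_diff R_power red_power)
      moreover have "red v \<noteq> 0" using v(1) red_unit_iff[OF units_R[OF v(1)]] by blast
      ultimately have "red r \<noteq> 0" "red r \<in> kappa" using True by (auto simp: kappa_def)
      then have "red v ^ hq = 1" using e kappa_fermat[of "red r"] hq(1) by (simp flip: power_mult)
      then show False using v square_iff by (auto simp: leg_def)
    qed
    then have "r\<^sup>2 - v \<in> units" using red_unit_iff True v units_R R.Zdiff R_power by blast
    then show ?thesis by (auto simp: unit_val)
  next
    case rR: False
    then have r0: "r \<noteq> 0" using R.Z0 by auto
    then have vr: "val r < 0" using R_val rR by auto
    have v0: "v \<noteq> 0" using v units_nonzero by auto
    have t: "val (v / r\<^sup>2) \<ge> 1" using vr v0 r0 v(1) by (simp add: val_divide val_power val_unit)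
    then have tR: "v / r\<^sup>2 \<in> R" using R_val v0 r0 by simp
    then have "red (v / r\<^sup>2) = 0" using t red_eq_0_val v0 r0 by simp
    then have "red (1 - v / r\<^sup>2) = 1" using tR R.Z1 by (simp add: red_diff red_1)
    then have u: "1 - v / r\<^sup>2 \<in> units" using red_unit_iff[of "1 - v / r\<^sup>2"] R.Zdiff R.Z1 tR by simp
    have "r\<^sup>2 - v = r\<^sup>2 * (1 - v / r\<^sup>2)" using r0 by (simp add: field_simps)
    then show ?thesis using u r0 val_mult[of "r\<^sup>2" "1 - v / r\<^sup>2"] by (auto simp: unit_val val_power)
  qed
  then show ?thesis unfolding eq using False val_mult[of "y\<^sup>2" "r\<^sup>2 - v"] by (auto simp: val_power)
qed

text \<open>Pigeonhole in the residue field: \<open>red u * a\<close> and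
  \<open>1 - red v * b\<close>, with \<open>a\<close> and \<open>b\<close> running over the squares
  including 0, take \<open>hq + 1\<close> values each, more than \<open>q\<close> together. A common
  value gives \<open>u x^2 + v y^2\<close> congruent to 1, and such an element is a square.\<close>

lemma hilbert_units:
  assumes u: "u \<in> units" and v: "v \<in> units"
  shows "hilbert_symbol u v = 1"
proof -
  define S where "S = (\<lambda>c. c\<^sup>2) ` kappa"
  have S: "S = insert 0 sqs" using kappa_closed(1) by (auto simp: S_def sqs_def)
  have fS: "finite S" using finite_kappa by (simp add: S_def)
  have "0 \<notin> sqs" by (auto simp: sqs_def)
  then have cS: "card S = hq + 1" using fS unfolding S by (simp add: card_sqs)
  have ru: "red u \<in> kappa" "red u \<noteq> 0" and rv: "red v \<in> kappa" "red v \<noteq> 0"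
    using u v units_R red_unit_iff by (auto simp: kappa_def)
  have SK: "S \<subseteq> kappa" unfolding S_def using kappa_closed by (auto simp: power2_eq_square)
  have "card ((\<lambda>c. red u * c) ` S) = hq + 1"
    using ru cS by (subst card_image) (auto simp: inj_on_def)
  moreover have "card ((\<lambda>c. 1 - red v * c) ` S) = hq + 1"
    using rv cS by (subst card_image) (auto simp: inj_on_def)
  moreover have "card ((\<lambda>c. red u * c) ` S \<union> (\<lambda>c. 1 - red v * c) ` S) \<le> q"
    unfolding card_kappa[symmetric]
    using SK ru rv kappa_closed by (intro card_mono finite_kappa) auto
  ultimately have "(\<lambda>c. red u * c) ` S \<inter> (\<lambda>c. 1 - red v * c) ` S \<noteq> {}"
    using hq q_ge card_Un_disjoint[OF finite_imageI[OF fS] finite_imageI[OF fS],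
        of "\<lambda>c. red u * c" "\<lambda>c. 1 - red v * c"] by linarith
  then obtain a b where ab: "a \<in> S" "b \<in> S" "red u * a = 1 - red v * b" by blast
  then obtain x y where xy: "x \<in> R" "a = (red x)\<^sup>2" "y \<in> R" "b = (red y)\<^sup>2"
    by (auto simp: S_def kappa_def)
  have "red (u * x\<^sup>2 + v * y\<^sup>2) = 1"
    using ab xy u v units_R by (simp add: red_add red_mult red_power R.Zmult R_power)
  moreover have "u * x\<^sup>2 + v * y\<^sup>2 \<in> R" using xy u v units_R R.Zadd R.Zmult R_power by auto
  ultimately obtain z where "z \<in> units" "z\<^sup>2 = u * x\<^sup>2 + v * y\<^sup>2" using one_plus_square by blast
  then show ?thesis using units_nonzero by (intro hilbert_eq_1I[of x y z]) auto
qed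

text \<open>If \<open>v\<close> is not a square, then \<open>z^2 - v y^2\<close> has even valuation,
  whereas \<open>w u x^2\<close> with \<open>x\<close> nonzero has odd valuation.\<close>

lemma hilbert_w_unit:
  assumes u: "u \<in> units" and v: "v \<in> units"
  shows "hilbert_symbol (w * u) v = leg v"
proof (cases "leg v = 1")
  case True
  then obtain t where "v = t\<^sup>2" by (auto simp: leg_def split: if_splits)
  then show ?thesis unfolding True by (intro hilbert_eq_1I[of 0 1 t]) auto
next
  case False
  then have l: "leg v = - 1" using leg_cases by blast
  show ?thesis unfolding l
  proof (rule hilbert_eq_m1I)
    fix x y z assume e: "z\<^sup>2 = w * u * x\<^sup>2 + v * y\<^sup>2"
    then have e': "z\<^sup>2 - v * y\<^sup>2 = w * u * x\<^sup>2" by simp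
    have x: "x = 0"
    proof (rule ccontr)
      assume x: "x \<noteq> 0"
      then have "odd (val (w * u * x\<^sup>2))" "w * u * x\<^sup>2 \<noteq> 0"
        using w_nonzero units_nonzero[OF u] by (simp_all add: val_mult val_power val_w val_unit[OF u])
      moreover from this have "z \<noteq> 0 \<or> y \<noteq> 0" using e' by auto
      ultimately show False using nonsquare_norm_val[OF v l, of z y] e' by simp
    qed
    then show "x = 0 \<and> y = 0" using nonsquare_norm_val[OF v l, of z y] e' by auto
  qed
qed

text \<open>If \<open>- (u v) = t^2\<close>, then \<open>(t, u, 0)\<close> is isotropic. Otherwise
  \<open>- (v / u)\<close> is a nonsquare unit, and factoring out \<open>w u\<close> leaves its norm
  form, so the right-hand side has odd valuation while \<open>z^2\<close> has even
  valuation.\<close>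

lemma hilbert_w_w:
  assumes u: "u \<in> units" and v: "v \<in> units"
  shows "hilbert_symbol (w * u) (w * v) = leg (- (u * v))"
proof (cases "leg (- (u * v)) = 1")
  case True
  then obtain t where t: "- (u * v) = t\<^sup>2" by (auto simp: leg_def split: if_splits)
  have "w * u * t\<^sup>2 + w * v * u\<^sup>2 = 0" unfolding t[symmetric] by (simp add: power2_eq_square algebra_simps)
  then show ?thesis unfolding True using units_nonzero[OF u] by (intro hilbert_eq_1I[of t u 0]) auto
next
  case False
  then have l: "leg (- (u * v)) = - 1" using leg_cases by blast
  have u0: "u \<noteq> 0" using units_nonzero u by blast
  have n: "- (v / u) \<in> units" using u v unit_uminus unit_mult unit_inv by (simp add: divide_inverse)
  have "- (u * v) = u\<^sup>2 * - (v / u)" using u0 by (simp add: power2_eq_square)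
  then have l': "leg (- (v / u)) = - 1"
    using l leg_mult[OF unit_power[OF u, of 2] n] leg_square[of u] by simp
  show ?thesis unfolding l
  proof (rule hilbert_eq_m1I)
    fix x y z assume e: "z\<^sup>2 = w * u * x\<^sup>2 + w * v * y\<^sup>2"
    have e': "z\<^sup>2 = w * (u * (x\<^sup>2 - - (v / u) * y\<^sup>2))" using e u0 by (simp add: field_simps)
    show "x = 0 \<and> y = 0"
    proof (rule ccontr)
      assume "\<not> (x = 0 \<and> y = 0)"
      then have N: "x\<^sup>2 - - (v / u) * y\<^sup>2 \<noteq> 0" "even (val (x\<^sup>2 - - (v / u) * y\<^sup>2))"
        using nonsquare_norm_val[OF n l', of x y] by auto
      have "val (w * (u * (x\<^sup>2 - - (v / u) * y\<^sup>2))) = 1 + (0 + val (x\<^sup>2 - - (v / u) * y\<^sup>2))"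
        using val_mult[OF w_nonzero] val_mult[OF u0 N(1)] val_w val_unit[OF u] u0 N(1)
        by (metis mult_eq_0_iff)
      then have "odd (val (w * (u * (x\<^sup>2 - - (v / u) * y\<^sup>2))))" using N(2) by simp
      moreover have "z \<noteq> 0" using e' N u0 w_nonzero by (metis mult_eq_0_iff zero_power2 power_zero_numeral)
      ultimately show False using e' val_power[of z 2] by simp
    qed
  qed
qed

text \<open>The tame symbol: the quadratic residue symbol of
  \<open>(-1)^(val a val b) ang(a)^(val b) ang(b)^(val a)\<close>, in which only the parities of the
  valuations matter.\<close>

definition tame :: "'f \<Rightarrow> 'f \<Rightarrow> int" where
  "tame a b = (if odd (val a) \<and> odd (val b) then leg (- 1) else 1) *
     (if odd (val b) then leg (ang a) else 1) * (if odd (val a) then leg (ang b) else 1)"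

lemma square_class:
  assumes "a \<noteq> 0"
  shows "\<exists>c. c \<noteq> 0 \<and> a = c\<^sup>2 * ((if odd (val a) then w else 1) * ang a)"
proof -
  define k where "k = val a div 2"
  have "val a = 2 * k + (if odd (val a) then 1 else 0)" by (auto simp: k_def)
  then have "w powi (val a) = (w powi k)\<^sup>2 * (if odd (val a) then w else 1)"
    using w_nonzero power_int_add[of w "2 * k" "if odd (val a) then 1 else 0"] power_int_mult[of w k 2]
    by (simp add: mult.commute split: if_splits)
  then show ?thesis using val_ang(2)[OF assms] powi_w_nonzero by (metis mult.assoc)
qed

lemma hilbert_tame:
  assumes "a \<noteq> 0" "b \<noteq> 0"
  shows "hilbert_symbol a b = tame a b"
proof -
  obtain c where c: "c \<noteq> 0" "a = c\<^sup>2 * ((if odd (val a) then w else 1) * ang a)" using square_class assms by blast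
  obtain d where d: "d \<noteq> 0" "b = d\<^sup>2 * ((if odd (val b) then w else 1) * ang b)" using square_class assms by blast
  have u: "ang a \<in> units" "ang b \<in> units" using val_ang assms by auto
  have "hilbert_symbol a b = hilbert_symbol ((if odd (val a) then w else 1) * ang a) ((if odd (val b) then w else 1) * ang b)"
    by (metis c d hilbert_mult_square hilbert_sym)
  also have "\<dots> = tame a b"
  proof -
    have "leg (- (ang a * ang b)) = leg (- 1) * leg (ang a) * leg (ang b)"
      using leg_mult[OF unit_mult[OF unit_uminus[OF unit_1] u(1)] u(2)] leg_mult[OF unit_uminus[OF unit_1] u(1)] by simp
    then show ?thesis
      using u hilbert_units hilbert_w_unit hilbert_w_w hilbert_sym[of "ang a" "w * ang b"]
      by (auto simp: tame_def)
  qed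
  finally show ?thesis .
qed

text \<open>Bilinearity cannot be seen from isotropic vectors. It is read off the tame formula,
  since \<open>val\<close> is additive and \<open>ang\<close> and \<open>leg\<close> are
  multiplicative.\<close>

lemma hilbert_mult_left:
  fixes a b c :: 'f
  assumes "a \<noteq> 0" "b \<noteq> 0" "c \<noteq> 0"
  shows "hilbert_symbol (a * b) c = hilbert_symbol a c * hilbert_symbol b c"
proof -
  have u: "ang a \<in> units" "ang b \<in> units" "ang c \<in> units" using val_ang assms by auto
  show ?thesis
    using assms leg_self[of "- 1"] leg_self[of "ang c"] leg_mult[OF u(1,2)]
    by (simp add: hilbert_tame tame_def val_mult ang_mult) (auto simp: mult_ac)
qed

lemma hilbert_mult_right:
  "(a :: 'f) \<noteq> 0 \<Longrightarrow> b \<noteq> 0 \<Longrightarrow> c \<noteq> 0 \<Longrightarrow> hilbert_symbol c (a * b) = hilbert_symbol c a * hilbert_symbol c b"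
  using hilbert_mult_left[of a b c] hilbert_sym by metis

lemma hilbert_cases: "hilbert_symbol a b = 1 \<or> hilbert_symbol a b = - 1"
  by (auto simp: hilbert_symbol_def)

lemma hilbert_self: "hilbert_symbol a b * hilbert_symbol a b = 1"
  by (auto simp: hilbert_symbol_def)

lemma hilbert_1: "hilbert_symbol a 1 = 1" "hilbert_symbol 1 a = 1"
  by (rule hilbert_eq_1I[of 0 1 1] hilbert_eq_1I[of 1 0 1]; simp)+

lemma hilbert_inverse_left: "(a :: 'f) \<noteq> 0 \<Longrightarrow> b \<noteq> 0 \<Longrightarrow> hilbert_symbol (inverse a) b = hilbert_symbol a b"
  using hilbert_mult_left[of a "inverse a" b] hilbert_1 hilbert_cases by (metis mult_minus1_right mult_1_right
    one_neq_neg_one nonzero_imp_inverse_nonzero right_inverse)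

lemma hilbert_inverse_right: "(a :: 'f) \<noteq> 0 \<Longrightarrow> b \<noteq> 0 \<Longrightarrow> hilbert_symbol b (inverse a) = hilbert_symbol b a"
  using hilbert_inverse_left hilbert_sym by metis

lemma hilbert_divide_left: "(a :: 'f) \<noteq> 0 \<Longrightarrow> b \<noteq> 0 \<Longrightarrow> c \<noteq> 0 \<Longrightarrow>
    hilbert_symbol (a / b) c = hilbert_symbol a c * hilbert_symbol b c"
  by (simp add: divide_inverse hilbert_mult_left hilbert_inverse_left)

lemma hilbert_divide_right: "(a :: 'f) \<noteq> 0 \<Longrightarrow> b \<noteq> 0 \<Longrightarrow> c \<noteq> 0 \<Longrightarrow>
    hilbert_symbol c (a / b) = hilbert_symbol c a * hilbert_symbol c b"
  by (simp add: divide_inverse hilbert_mult_right hilbert_inverse_right)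

lemma hilbert_neg: "hilbert_symbol a (- a) = 1"
  by (rule hilbert_eq_1I[of 1 1 0]) auto

lemma hilbert_steinberg: "a + b = 1 \<Longrightarrow> hilbert_symbol a b = 1"
  by (rule hilbert_eq_1I[of 1 1 1]) auto

lemma hilbert_diag: "(a :: 'f) \<noteq> 0 \<Longrightarrow> hilbert_symbol a a = hilbert_symbol a (- 1)"
  using hilbert_mult_right[of "- 1" "- a" a] hilbert_neg[of a] by simp

lemma hilbert_square_right: "c \<noteq> 0 \<Longrightarrow> hilbert_symbol a (c\<^sup>2) = 1"
  by (rule hilbert_eq_1I[of 0 1 c]) auto

text \<open>Principal units are squares. This is what makes \<open>theta\<close> split the cover
  over the integral matrices.\<close>

lemma hilbert_one_plus:
  assumes "x \<in> R" "red x = 1" "y \<noteq> 0"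
  shows "hilbert_symbol y x = 1"
proof -
  obtain z where "z \<in> units" "z\<^sup>2 = x" using one_plus_square assms by blast
  then show ?thesis using hilbert_square_right[of z y] units_nonzero by auto
qed

end

no_notation fps_nth (infixl "$" 75)
hide_const (open) Determinant.det Matrix.mat Matrix.vec
hide_type (open) Matrix.mat Matrix.vec
hide_fact (open) Matrix.vec_eq_iff

section \<open>The metaplectic group\<close>

lemma mat2_nth [simp]:
  "mat2 a b c d $ 1 $ 1 = a" "mat2 a b c d $ 1 $ 2 = b"
  "mat2 a b c d $ 2 $ 1 = c" "mat2 a b c d $ 2 $ 2 = d"
  by (simp_all add: mat2_def)

lemma mat2_eqI:
  "M $ 1 $ 1 = N $ 1 $ 1 \<Longrightarrow> M $ 1 $ 2 = N $ 1 $ 2 \<Longrightarrow> M $ 2 $ 1 = N $ 2 $ 1 \<Longrightarrow> M $ 2 $ 2 = N $ 2 $ 2 \<Longrightarrow>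
    M = (N :: 'a^2^2)"
  unfolding Finite_Cartesian_Product.vec_eq_iff forall_2 by simp

lemma mat2_eq_iff [simp]: "mat2 a b c d = mat2 a' b' c' d' \<longleftrightarrow> a = a' \<and> b = b' \<and> c = c' \<and> d = d'"
  by (metis mat2_nth)

lemma mat2_eta: "mat2 (M $ 1 $ 1) (M $ 1 $ 2) (M $ 2 $ 1) (M $ 2 $ 2) = M"
  by (rule mat2_eqI) simp_all

lemma mat2_cases: obtains a b c d where "M = mat2 a b c d"
  by (metis mat2_eta)

lemma mat2_mult [simp]:
  "mat2 a b c d ** mat2 a' b' c' d' =
    mat2 (a * a' + b * c') (a * b' + b * d') (c * a' + d * c') (c * b' + d * d' :: 'a::semiring_1)"
  by (rule mat2_eqI) (simp_all add: matrix_matrix_mult_def sum_2)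

lemma mat_1_mat2: "mat 1 = mat2 1 0 0 (1 :: 'a::semiring_1)"
  by (rule mat2_eqI) (simp_all add: Finite_Cartesian_Product.mat_def)

lemma det_mat2 [simp]: "det (mat2 a b c d) = a * d - b * (c :: 'a::comm_ring_1)"
  by (simp add: det_2)

lemma Xfun_mat2 [simp]: "Xfun (mat2 a b c d) = (if c \<noteq> 0 then c else d)"
  by (simp add: Xfun_def)

lemma Xfun_nonzero: "det g = 1 \<Longrightarrow> Xfun g \<noteq> 0"
  by (cases g rule: mat2_cases) auto

section \<open>Kubota's cocycle and the group law of the double cover\<close>

definition cocyc :: "'f::field^2^2 \<Rightarrow> 'f^2^2 \<Rightarrow> int" where
  "cocyc g h = hilbert_symbol (Xfun (g ** h) / Xfun g) (Xfun (g ** h) / Xfun h)"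

lemma carrier_Mp: "(g, e) \<in> carrier Mp \<longleftrightarrow> det g = 1 \<and> (e = 1 \<or> e = - 1)"
  by (auto simp: Mp_def)

lemma mult_Mp [simp]: "(g, e) \<otimes>\<^bsub>Mp\<^esub> (h, e') = (g ** h, e * e' * cocyc g h)"
  by (simp add: Mp_def cocyc_def)

lemma one_Mp: "\<one>\<^bsub>Mp\<^esub> = (mat 1, 1)"
  by (simp add: Mp_def)

definition adj2 :: "'a::comm_ring_1^2^2 \<Rightarrow> 'a^2^2" where
  "adj2 M = mat2 (M $ 2 $ 2) (- (M $ 1 $ 2)) (- (M $ 2 $ 1)) (M $ 1 $ 1)"

lemma adj2_mult: "det M = 1 \<Longrightarrow> adj2 M ** M = mat 1" "det M = 1 \<Longrightarrow> M ** adj2 M = mat 1"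
  by (cases M rule: mat2_cases, simp add: adj2_def mat_1_mat2 mult.commute)+

lemma det_adj2: "det (adj2 M) = det M"
  by (cases M rule: mat2_cases) (simp add: adj2_def)

context genuine_setting
begin

lemma hilbert_self_left: "hilbert_symbol a b * (hilbert_symbol a b * c) = c"
  by (simp flip: mult.assoc add: hilbert_self)

text \<open>When all four symbols are expanded bilinearly, the product of the two sides collapses to
  the single symbol in the hypothesis. Both sides are signs, so product 1 means equality.\<close>

lemma cocycle_algebra:
  fixes x1 x2 x3 x12 x23 x123 :: 'f
  assumes nz: "x1 \<noteq> 0" "x2 \<noteq> 0" "x3 \<noteq> 0" "x12 \<noteq> 0" "x23 \<noteq> 0" "x123 \<noteq> 0"
    and st: "hilbert_symbol (x12 * x23 * x1 * x3) (- (x2 * x123 * x1 * x3)) = 1"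
  shows "hilbert_symbol (x12 / x1) (x12 / x2) * hilbert_symbol (x123 / x12) (x123 / x3) =
    hilbert_symbol (x123 / x1) (x123 / x23) * hilbert_symbol (x23 / x2) (x23 / x3)"
    (is "?L = ?R")
proof -
  have expand: "hilbert_symbol (z / x) (z / y) =
      hilbert_symbol z (- 1) * hilbert_symbol z y * hilbert_symbol x z * hilbert_symbol x y"
    if "x \<noteq> 0" "y \<noteq> 0" "z \<noteq> 0" for x y z :: 'f
    using that by (simp add: hilbert_divide_left hilbert_divide_right hilbert_diag mult_ac)
  have "- (x2 * x123 * x1 * x3) = (- 1) * (x2 * (x123 * (x1 * x3)))" by (simp add: mult.assoc)
  then have st': "hilbert_symbol (x12 * (x23 * (x1 * x3))) ((- 1) * (x2 * (x123 * (x1 * x3)))) = 1"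
    using st by (simp only: mult.assoc)
  have "?L * ?R = hilbert_symbol (x12 * (x23 * (x1 * x3))) ((- 1) * (x2 * (x123 * (x1 * x3))))"
    using nz
    by (simp only: expand hilbert_mult_left hilbert_mult_right mult_eq_0_iff neg_equal_0_iff_equal
        one_neq_zero simp_thms)
      (simp only: hilbert_diag[OF nz(1)] hilbert_diag[OF nz(3)] mult_ac
        hilbert_sym[of "a :: 'f" for a] hilbert_self hilbert_self_left mult_1_right)
  then have "?L * ?R = 1" using st' by simp
  then show ?thesis unfolding zmult_eq_1_iff by auto
qed

lemma Xfun_upper_left:
  assumes "b $ 2 $ 1 = 0"
  shows "Xfun (b ** g) = Xfun b * Xfun g"
  using assms by (cases b rule: mat2_cases, cases g rule: mat2_cases) auto

text \<open>Equality up to a square is the best possible here: the lower left entry is multiplied by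
  \<open>t\<close>, whereas \<open>Xfun b\<close> is \<open>1 / t\<close>. Squares are invisible to
  the symbol.\<close>

lemma Xfun_upper_right:
  assumes "b $ 2 $ 1 = 0" "det b = 1"
  shows "\<exists>s. s \<noteq> 0 \<and> Xfun (g ** b) = s\<^sup>2 * (Xfun g * Xfun b)"
proof -
  obtain t y c d where b: "b = mat2 t y c d" by (rule mat2_cases)
  then have b: "b = mat2 t y 0 d" and td: "t * d = 1" using assms by auto
  obtain a' b' c' d' where g: "g = mat2 a' b' c' d'" by (rule mat2_cases)
  have "t\<^sup>2 * (c' * d) = (t * d) * (c' * t)" by (simp add: power2_eq_square mult_ac)
  then have "c' * t = t\<^sup>2 * (c' * d)" by (simp only: td mult_1)
  note ct = this
  show ?thesis
  proof (cases "c' = 0")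
    case True
    then show ?thesis by (intro exI[of _ 1]) (simp add: b g)
  next
    case False
    have "t \<noteq> 0" using td by auto
    then show ?thesis using False ct by (intro exI[of _ t]) (simp add: b g)
  qed
qed

lemma hilbert_square_left: "c \<noteq> 0 \<Longrightarrow> hilbert_symbol (c\<^sup>2) b = 1"
  using hilbert_square_right hilbert_sym by metis

text \<open>What remains after \<open>cocycle_algebra\<close> is a single symbol. In the generic
  case a relation between lower left entries makes it a Steinberg symbol \<open>(t, 1 - t)\<close>;
  in the degenerate cases it has the form \<open>(x, - x)\<close> or one entry is a square.\<close>

lemma cocycle:
  fixes g1 g2 g3 :: "'f^2^2"
  assumes det: "det g1 = 1" "det g2 = 1" "det g3 = 1"
  shows "cocyc g1 g2 * cocyc (g1 ** g2) g3 = cocyc g1 (g2 ** g3) * cocyc g2 g3"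
proof -
  define x1 x2 x3 x12 x23 x123 where "x1 = Xfun g1" "x2 = Xfun g2" "x3 = Xfun g3"
    "x12 = Xfun (g1 ** g2)" "x23 = Xfun (g2 ** g3)" "x123 = Xfun (g1 ** (g2 ** g3))"
  note x = this
  have nz: "x1 \<noteq> 0" "x2 \<noteq> 0" "x3 \<noteq> 0" "x12 \<noteq> 0" "x23 \<noteq> 0" "x123 \<noteq> 0"
    unfolding x using det by (auto intro!: Xfun_nonzero simp: det_mul)
  have "hilbert_symbol (x12 * x23 * x1 * x3) (- (x2 * x123 * x1 * x3)) = 1"
  proof -
    consider "g1 $ 2 $ 1 = 0" | "g2 $ 2 $ 1 = 0" | "g3 $ 2 $ 1 = 0"
      | "g1 $ 2 $ 1 \<noteq> 0" "g2 $ 2 $ 1 \<noteq> 0" "g3 $ 2 $ 1 \<noteq> 0" by blast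
    then show ?thesis
    proof cases
      case 1
      then have "x12 = x1 * x2" "x123 = x1 * x23" unfolding x by (auto simp: Xfun_upper_left)
      then have "x12 * x23 * x1 * x3 = x1\<^sup>2 * (x2 * x3 * x23)"
        "- (x2 * x123 * x1 * x3) = x1\<^sup>2 * - (x2 * x3 * x23)" by (simp_all add: power2_eq_square)
      then show ?thesis using nz by (metis hilbert_mult_square hilbert_neg hilbert_sym)
    next
      case 2
      then obtain s where "s \<noteq> 0" "x12 = s\<^sup>2 * (x1 * x2)" "x23 = x2 * x3"
        using Xfun_upper_right[of g2 g1] det Xfun_upper_left[of g2 g3] unfolding x by auto
      then have "x12 * x23 * x1 * x3 = (s * x1 * x2 * x3)\<^sup>2" "s * x1 * x2 * x3 \<noteq> 0"
        using nz by (simp_all add: power2_eq_square)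
      then show ?thesis by (simp add: hilbert_square_left)
    next
      case 3
      obtain s where s: "s \<noteq> 0" "x23 = s\<^sup>2 * (x2 * x3)"
        using Xfun_upper_right[of g3 g2] det 3 unfolding x by auto
      obtain s' where s': "s' \<noteq> 0" "x123 = s'\<^sup>2 * (x12 * x3)"
        using Xfun_upper_right[of g3 "g1 ** g2"] det 3 unfolding x by (auto simp: matrix_mul_assoc)
      have "x12 * x23 * x1 * x3 = (s * x3)\<^sup>2 * (x1 * x2 * x12)"
        "- (x2 * x123 * x1 * x3) = (s' * x3)\<^sup>2 * - (x1 * x2 * x12)"
        using s s' by (simp_all add: power2_eq_square)
      then show ?thesis using nz s s' by (metis hilbert_mult_square hilbert_neg hilbert_sym mult_eq_0_iff)
    next
      case 4
      obtain a1 b1 c1 d1 where g1: "g1 = mat2 a1 b1 c1 d1" by (rule mat2_cases)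
      obtain a2 b2 c2 d2 where g2: "g2 = mat2 a2 b2 c2 d2" by (rule mat2_cases)
      obtain a3 b3 c3 d3 where g3: "g3 = mat2 a3 b3 c3 d3" by (rule mat2_cases)
      have c: "c1 \<noteq> 0" "c2 \<noteq> 0" "c3 \<noteq> 0" "x1 = c1" "x2 = c2" "x3 = c3" using 4 by (auto simp: x g1 g2 g3)
      define c12 c23 c123 where "c12 = (g1 ** g2) $ 2 $ 1" "c23 = (g2 ** g3) $ 2 $ 1"
        "c123 = (g1 ** (g2 ** g3)) $ 2 $ 1"
      note cc = this
      have x': "c12 \<noteq> 0 \<Longrightarrow> x12 = c12" "c23 \<noteq> 0 \<Longrightarrow> x23 = c23" "c123 \<noteq> 0 \<Longrightarrow> x123 = c123"
        by (simp_all add: x cc Xfun_def)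
      \<comment> \<open>The quadratic relation behind the cocycle; the determinant of
        \<open>g2\<close> enters exactly here.\<close>
      have "c12 * c23 - c2 * c123 = c1 * c3 * (a2 * d2 - b2 * c2)"
        by (simp add: cc g1 g2 g3 algebra_simps)
      then have rel: "c12 * c23 - c2 * c123 = c1 * c3" using det(2) by (simp add: g2)
      show ?thesis
      proof (cases "c12 = 0 \<or> c23 = 0")
        case True
        then have "- (c2 * c123) = c1 * c3" using rel by auto
        moreover from this have "c123 \<noteq> 0" using c by auto
        moreover have "- (x2 * x123 * x1 * x3) = - (c2 * c123) * (c1 * c3)"
          using x'(3)[OF \<open>c123 \<noteq> 0\<close>] by (simp add: c)
        ultimately have "- (x2 * x123 * x1 * x3) = (c1 * c3)\<^sup>2" by (simp add: power2_eq_square)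
        then show ?thesis using c by (simp add: hilbert_square_right)
      next
        case False
        show ?thesis
        proof (cases "c123 = 0")
          case True
          then have "x12 * x23 * x1 * x3 = (c1 * c3)\<^sup>2"
            using rel False x' by (simp add: c power2_eq_square)
          then show ?thesis using c by (simp add: hilbert_square_left)
        next
          case nz123: False
          have "x12 * x23 * x1 * x3 = (c1 * c3)\<^sup>2 * (c12 * c23 / (c1 * c3))"
            "- (x2 * x123 * x1 * x3) = (c1 * c3)\<^sup>2 * (- (c2 * c123) / (c1 * c3))"
            using False nz123 x' c by (simp_all add: power2_eq_square)
          moreover have "c12 * c23 / (c1 * c3) + - (c2 * c123) / (c1 * c3) = 1"
            using rel c by (simp add: field_simps)
          then have "hilbert_symbol (c12 * c23 / (c1 * c3)) (- (c2 * c123) / (c1 * c3)) = 1"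
            by (rule hilbert_steinberg)
          moreover have "c1 * c3 \<noteq> 0" using c by simp
          ultimately show ?thesis by (metis hilbert_mult_square hilbert_sym)
        qed
      qed
    qed
  qed
  from cocycle_algebra[OF nz this] show ?thesis
    unfolding cocyc_def x by (simp only: matrix_mul_assoc)
qed

lemma cocyc_pm: "cocyc g h = 1 \<or> cocyc g h = - 1"
  unfolding cocyc_def using hilbert_cases by blast

lemma cocyc_1: "det g = 1 \<Longrightarrow> cocyc (mat 1) g = 1" "det g = 1 \<Longrightarrow> cocyc g (mat 1) = 1"
  using Xfun_nonzero[of g] by (simp_all add: cocyc_def hilbert_1)

lemma group_Mp: "group (Mp :: 'f mp monoid)"
proof (rule groupI)
  show "x \<otimes>\<^bsub>Mp\<^esub> y \<in> carrier Mp" if "x \<in> carrier Mp" "y \<in> carrier Mp" for x y :: "'f mp"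
    using that cocyc_pm[of "fst x" "fst y"]
    by (cases x; cases y) (auto simp: carrier_Mp det_mul)
  show "\<one>\<^bsub>Mp\<^esub> \<in> carrier (Mp :: 'f mp monoid)" by (simp add: one_Mp carrier_Mp)
  show "x \<otimes>\<^bsub>Mp\<^esub> y \<otimes>\<^bsub>Mp\<^esub> z = x \<otimes>\<^bsub>Mp\<^esub> (y \<otimes>\<^bsub>Mp\<^esub> z)"
    if "x \<in> carrier Mp" "y \<in> carrier Mp" "z \<in> carrier Mp" for x y z :: "'f mp"
  proof -
    obtain g e g' e' g'' e'' where xyz: "x = (g, e)" "y = (g', e')" "z = (g'', e'')"
      by (cases x, cases y, cases z) auto
    have "cocyc g g' * cocyc (g ** g') g'' = cocyc g (g' ** g'') * cocyc g' g''"
      using that by (intro cocycle) (auto simp: xyz carrier_Mp)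
    then show ?thesis by (simp add: xyz matrix_mul_assoc mult_ac)
  qed
  show "\<one>\<^bsub>Mp\<^esub> \<otimes>\<^bsub>Mp\<^esub> x = x" if "x \<in> carrier Mp" for x :: "'f mp"
    using that by (cases x) (auto simp: one_Mp carrier_Mp cocyc_1)
  show "\<exists>y\<in>carrier Mp. y \<otimes>\<^bsub>Mp\<^esub> x = \<one>\<^bsub>Mp\<^esub>" if "x \<in> carrier Mp" for x :: "'f mp"
  proof -
    obtain g e where x: "x = (g, e)" by (cases x)
    have g: "det g = 1" "e = 1 \<or> e = - 1" using that by (auto simp: x carrier_Mp)
    show ?thesis
      using g cocyc_pm[of "adj2 g" g]
      by (intro bexI[of _ "(adj2 g, e * cocyc (adj2 g) g)"])
        (auto simp: x one_Mp carrier_Mp det_adj2 adj2_mult)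
  qed
qed

sublocale Mp: group "Mp :: 'f mp monoid"
  by (rule group_Mp)

lemma fst_mult: "fst (x \<otimes>\<^bsub>Mp\<^esub> y) = fst x ** fst (y :: 'f mp)"
  by (cases x; cases y) simp

lemma det_fst: "x \<in> carrier Mp \<Longrightarrow> det (fst (x :: 'f mp)) = 1"
  by (cases x) (simp add: carrier_Mp)

lemma fst_inv: "x \<in> carrier Mp \<Longrightarrow> fst (inv\<^bsub>Mp\<^esub> x) = adj2 (fst (x :: 'f mp))"
proof -
  assume x: "x \<in> carrier Mp"
  have "fst (inv\<^bsub>Mp\<^esub> x) ** fst x = mat 1"
    using Mp.l_inv[OF x] fst_mult by (metis fst_conv one_Mp)
  then have "fst (inv\<^bsub>Mp\<^esub> x) ** (fst x ** adj2 (fst x)) = adj2 (fst x)"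
    by (simp add: matrix_mul_assoc)
  then show ?thesis using adj2_mult(2)[OF det_fst[OF x]] by simp
qed

text \<open>A factorization of matrices lifts to the cover up to the sign of one factor, so matrix
  decompositions can be carried over without computing cocycles.\<close>

lemma lift_exists:
  assumes "A \<in> carrier Mp" "g \<in> carrier Mp" "fst g = fst A ** k" "det k = 1"
  shows "\<exists>e\<in>{1, - 1}. (k, e) \<in> carrier Mp \<and> g = A \<otimes>\<^bsub>Mp\<^esub> (k, e :: int)"
proof -
  obtain a e1 where A: "A = (a, e1)" by (cases A)
  obtain m e2 where g: "g = (m, e2)" by (cases g)
  show ?thesis
    using assms cocyc_pm[of a k]
    by (intro bexI[of _ "e1 * e2 * cocyc a k"]) (auto simp: A g carrier_Mp)
qed

subsection \<open>Lifts of unipotent and diagonal elements\<close>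

definition Up :: "'f \<Rightarrow> 'f mp" where "Up x = (mat2 1 x 0 1, 1)"
definition Lo :: "'f \<Rightarrow> 'f mp" where "Lo z = (mat2 1 0 z 1, 1)"
definition Di :: "'f \<Rightarrow> int \<Rightarrow> 'f mp" where "Di t e = (mat2 t 0 0 (inverse t), e)"
definition We :: "'f mp" where "We = (mat2 0 (- 1) 1 0, 1)"

lemma lifts_carrier [simp]:
  "Up x \<in> carrier Mp" "Lo z \<in> carrier Mp" "We \<in> carrier Mp"
  "t \<noteq> 0 \<Longrightarrow> Di t e \<in> carrier Mp \<longleftrightarrow> e = 1 \<or> e = - 1"
  by (simp_all add: Up_def Lo_def Di_def We_def carrier_Mp)

text \<open>The function \<open>Xfun\<close> is unchanged by upper unipotents on either side, so the
  cocycle with them is trivial.\<close>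

lemma Up_mult: "det M = 1 \<Longrightarrow> Up x \<otimes>\<^bsub>Mp\<^esub> (M, e) = (mat2 1 x 0 1 ** M, e)"
  using Xfun_nonzero[of M] by (simp add: Up_def cocyc_def Xfun_upper_left hilbert_1)

lemma mult_Up: "det M = 1 \<Longrightarrow> (M, e) \<otimes>\<^bsub>Mp\<^esub> Up x = (M ** mat2 1 x 0 1, e)"
  using Xfun_nonzero[of M] by (cases M rule: mat2_cases) (auto simp: Up_def cocyc_def hilbert_1)

lemma Di_mult:
  assumes "det M = 1" "t \<noteq> 0"
  shows "Di t e \<otimes>\<^bsub>Mp\<^esub> (M, e') = (mat2 t 0 0 (inverse t) ** M, e * e' * hilbert_symbol (Xfun M) t)"
  using Xfun_nonzero[OF assms(1)] assms
  by (simp add: Di_def cocyc_def Xfun_upper_left hilbert_inverse_right)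

lemma mult_Di:
  assumes "det M = 1" "t \<noteq> 0"
  shows "(M, e') \<otimes>\<^bsub>Mp\<^esub> Di t e = (M ** mat2 t 0 0 (inverse t), e * e' * hilbert_symbol (Xfun M) t)"
proof -
  obtain a b c d where M: "M = mat2 a b c d" by (rule mat2_cases)
  have "cocyc M (mat2 t 0 0 (inverse t)) = hilbert_symbol (Xfun M) t"
  proof (cases "c = 0")
    case True
    then show ?thesis using assms
      by (auto simp: M cocyc_def hilbert_inverse_left hilbert_sym[of t])
  next
    case False
    then have "hilbert_symbol t (t\<^sup>2 * c) = hilbert_symbol c t"
      using hilbert_mult_square[of t c t] assms hilbert_sym by metis
    moreover have "c * t / c = t" "c * t / inverse t = t\<^sup>2 * c"
      using False by (simp_all add: divide_inverse power2_eq_square)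
    ultimately show ?thesis using assms False by (simp add: M cocyc_def)
  qed
  then show ?thesis by (simp add: Di_def)
qed

text \<open>No sign appears because \<open>z\<close> and \<open>z / t^2\<close> lie in the same
  square class.\<close>

lemma Di_Lo: "t \<noteq> 0 \<Longrightarrow> Di t e \<otimes>\<^bsub>Mp\<^esub> Lo z = Lo (z / t\<^sup>2) \<otimes>\<^bsub>Mp\<^esub> Di t e"
proof -
  assume t: "t \<noteq> 0"
  have "hilbert_symbol (z / t\<^sup>2) t = hilbert_symbol z t"
    using hilbert_mult_square[of "inverse t" z t] t by (simp add: field_simps)
  then show ?thesis
    using t by (simp add: Lo_def Di_mult mult_Di power2_eq_square) (auto simp: field_simps)
qed

lemma Di_Up: "t \<noteq> 0 \<Longrightarrow> Di t e \<otimes>\<^bsub>Mp\<^esub> Up x = Up (t\<^sup>2 * x) \<otimes>\<^bsub>Mp\<^esub> Di t e"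
  by (simp add: Up_def Di_mult mult_Di power2_eq_square field_simps)

lemma Di_Di: "t \<noteq> 0 \<Longrightarrow> s \<noteq> 0 \<Longrightarrow> Di t e \<otimes>\<^bsub>Mp\<^esub> Di s e' = Di (t * s) (e * e' * hilbert_symbol s t)"
  using hilbert_inverse_left[of s t] Di_mult[of "mat2 s 0 0 (inverse s)" t e e']
  by (simp add: Di_def)

text \<open>The quadratic symbol is symmetric, so the cover of the diagonal torus is
  commutative.\<close>

lemma Di_commute: "t \<noteq> 0 \<Longrightarrow> s \<noteq> 0 \<Longrightarrow> Di t e \<otimes>\<^bsub>Mp\<^esub> Di s e' = Di s e' \<otimes>\<^bsub>Mp\<^esub> Di t e"
  by (simp add: Di_Di hilbert_sym mult.commute)

text \<open>Generically the cocycle is the symbol of \<open>(x + y) / x\<close> and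
  \<open>(x + y) / y\<close>. The inverses of these add up to 1, so it is trivial by the Steinberg
  relation; if \<open>x + y = 0\<close> it is of the form \<open>(a, - a)\<close>. Hence
  \<open>Lo\<close> is a homomorphic section.\<close>

lemma Lo_Lo: "Lo x \<otimes>\<^bsub>Mp\<^esub> Lo y = Lo (x + y)"
proof -
  have "cocyc (mat2 1 0 x 1) (mat2 1 0 y 1) = 1"
  proof (cases "x = 0 \<or> y = 0 \<or> x + y = 0")
    case True
    then show ?thesis
      using cocyc_1[of "mat2 1 0 x 1"] cocyc_1[of "mat2 1 0 y 1"]
      by (auto simp: cocyc_def hilbert_1 mat_1_mat2) 
         (metis (no_types, lifting) add.commute add_eq_0_iff hilbert_neg divide_minus_right divide_minus_left minus_minus)
  next
    case False
    have "hilbert_symbol (x / (x + y)) (y / (x + y)) = 1"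
      using False by (intro hilbert_steinberg) (simp flip: add_divide_distrib)
    then have "hilbert_symbol (inverse ((x + y) / x)) (inverse ((x + y) / y)) = 1" using False by simp
    then have "hilbert_symbol ((x + y) / x) ((x + y) / y) = 1"
      using False by (subst (asm) hilbert_inverse_left) (auto simp: hilbert_inverse_right simp del: inverse_divide)
    then show ?thesis using False by (simp add: cocyc_def)
  qed
  then show ?thesis by (simp add: Lo_def)
qed

lemma Lo_0: "Lo 0 = \<one>\<^bsub>Mp\<^esub>"
  by (simp_all add: Up_def Lo_def one_Mp mat_1_mat2)

section \<open>Powers of the lift of diag(w, 1/w)\<close>

definition Hw :: "int \<Rightarrow> 'f mp" where "Hw i = h_tilde w [^]\<^bsub>Mp\<^esub> i"

lemma h_tilde_Di: "h_tilde x = Di x (hilbert_symbol (- 1) x)"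
  by (simp add: h_tilde_def Di_def)

lemma h_tilde_carrier: "h_tilde w \<in> carrier Mp"
  using w_nonzero hilbert_cases[of "- 1" w] by (simp add: h_tilde_Di)

lemma Hw_carrier [simp]: "Hw i \<in> carrier Mp"
  unfolding Hw_def using h_tilde_carrier by (rule Mp.int_pow_closed)

lemma Hw_add: "Hw i \<otimes>\<^bsub>Mp\<^esub> Hw j = Hw (i + j)"
  unfolding Hw_def using h_tilde_carrier by (simp add: Mp.int_pow_mult)

lemma Hw_0: "Hw 0 = \<one>\<^bsub>Mp\<^esub>"
  by (simp add: Hw_def)

text \<open>The sign is left undetermined: conjugation by a torus element does not see it, and
  integral powers add up by definition.\<close>

lemma Hw_Di: "\<exists>e\<in>{1, - 1}. Hw i = Di (w powi i) e"
proof -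
  have nat: "\<exists>e\<in>{1, - 1}. Hw (int n) = Di (w powi (int n)) e" for n
  proof (induction n)
    case 0
    show ?case by (simp add: Hw_0 one_Mp Di_def mat_1_mat2)
  next
    case (Suc n)
    then obtain e where e: "e \<in> {1, - 1}" "Hw (int n) = Di (w powi (int n)) e" by blast
    have "Hw (int (Suc n)) = Hw (int n) \<otimes>\<^bsub>Mp\<^esub> Hw 1" by (simp add: Hw_add add.commute)
    also have "Hw 1 = Di w (hilbert_symbol (- 1) w)"
      using h_tilde_carrier by (simp add: Hw_def h_tilde_Di)
    also have "Hw (int n) \<otimes>\<^bsub>Mp\<^esub> \<dots> =
        Di (w powi (int n) * w) (e * hilbert_symbol (- 1) w * hilbert_symbol w (w powi int n))"
      unfolding e(2) using powi_w_nonzero w_nonzero by (rule Di_Di)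
    also have "w powi (int n) * w = w powi (int (Suc n))" by (simp only: power_int_of_nat power_Suc2)
    finally have "Hw (int (Suc n)) = Di (w powi int (Suc n))
        (e * hilbert_symbol (- 1) w * hilbert_symbol w (w powi int n))" .
    moreover have "e * hilbert_symbol (- 1) w * hilbert_symbol w (w powi int n) \<in> {1, - 1}"
      using e(1) hilbert_cases[of "- 1" w] hilbert_cases[of w "w powi int n"] by auto
    ultimately show ?case by blast
  qed
  show ?thesis
  proof (cases "i \<ge> 0")
    case True
    then show ?thesis using nat[of "nat i"] by simp
  next
    case False
    then obtain n where n: "i = - int n" by (metis int_cases of_nat_0_le_iff)
    obtain e where e: "e \<in> {1, - 1}" "Hw (int n) = Di (w powi (int n)) e" using nat by blast
    define e' where "e' = e * hilbert_symbol (w powi i) (w powi int n)"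
    have "Hw (int n) \<otimes>\<^bsub>Mp\<^esub> Di (w powi i) e' = \<one>\<^bsub>Mp\<^esub>"
      using w_nonzero e(1) hilbert_self[of "w powi i" "w powi int n"]
      by (auto simp: e(2) Di_Di e'_def n power_int_minus) (auto simp: Di_def one_Mp mat_1_mat2)
    moreover have e': "e' \<in> {1, - 1}" using e(1) hilbert_cases[of "w powi i" "w powi int n"] by (auto simp: e'_def)
    then have D: "Di (w powi i) e' \<in> carrier Mp" using powi_w_nonzero by simp
    moreover have "Hw (int n) \<otimes>\<^bsub>Mp\<^esub> Hw i = \<one>\<^bsub>Mp\<^esub>" by (simp add: Hw_add n Hw_0)
    ultimately have "Hw i = Di (w powi i) e'" by (metis Hw_carrier Mp.inv_equality Mp.inv_inv Mp.inv_comm)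
    then show ?thesis using e' by blast
  qed
qed

lemma fst_Hw: "fst (Hw i) = mat2 (w powi i) 0 0 (w powi (- i))"
  using Hw_Di[of i] by (auto simp: Di_def power_int_minus)

lemma Hw_Lo: "Hw i \<otimes>\<^bsub>Mp\<^esub> Lo z = Lo (w powi (- 2 * i) * z) \<otimes>\<^bsub>Mp\<^esub> Hw i"
proof -
  have "w powi (- 2 * i) = inverse ((w powi i)\<^sup>2)"
    using power_int_mult[of w i 2] power_int_minus[of w "i * 2"] by (simp add: mult.commute)
  then have "z / (w powi i)\<^sup>2 = w powi (- 2 * i) * z" by (simp add: divide_inverse)
  then show ?thesis using Hw_Di[of i] Di_Lo[OF powi_w_nonzero, of i _ z] by auto
qed

lemma Hw_Up: "Hw i \<otimes>\<^bsub>Mp\<^esub> Up x = Up (w powi (2 * i) * x) \<otimes>\<^bsub>Mp\<^esub> Hw i"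
proof -
  have "(w powi i)\<^sup>2 * x = w powi (2 * i) * x"
    using power_int_mult[of w i 2] by (simp add: mult.commute)
  then show ?thesis using Hw_Di[of i] Di_Up[OF powi_w_nonzero, of i _ x] by auto
qed

lemma Hw_Di_commute: "t \<noteq> 0 \<Longrightarrow> Hw i \<otimes>\<^bsub>Mp\<^esub> Di t e = Di t e \<otimes>\<^bsub>Mp\<^esub> Hw i"
  using Hw_Di[of i] Di_commute[OF powi_w_nonzero] by auto

text \<open>Upper unipotents carry no sign, so the whole cost of replacing \<open>z\<close> by
  \<open>e z\<close> is the symbol contributed by the torus factor \<open>Di (1 / e) 1\<close>. This
  sign is the source of the cancellation at \<open>val z = -1\<close>.\<close>

lemma Lo_scale_unit:
  assumes "z \<noteq> 0" "e \<noteq> 0"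
  shows "Up (1 / (e * z)) \<otimes>\<^bsub>Mp\<^esub> (Di (1 / e) 1 \<otimes>\<^bsub>Mp\<^esub> (Up (- 1 / z) \<otimes>\<^bsub>Mp\<^esub> Lo z \<otimes>\<^bsub>Mp\<^esub> Up (- 1 / z + 1 / (e * z)))) =
    (mat2 1 0 (e * z) 1, hilbert_symbol z e)"
proof -
  have 1: "Up (- 1 / z) \<otimes>\<^bsub>Mp\<^esub> Lo z = (mat2 0 (- 1 / z) z 1, 1)"
    unfolding Lo_def using assms by (subst Up_mult) auto
  have 2: "\<dots> \<otimes>\<^bsub>Mp\<^esub> Up (- 1 / z + 1 / (e * z)) = (mat2 0 (- 1 / z) z (1 / e), 1)"
    using assms by (subst mult_Up) (auto simp: field_simps)
  have 3: "Di (1 / e) 1 \<otimes>\<^bsub>Mp\<^esub> (mat2 0 (- 1 / z) z (1 / e), 1) =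
      (mat2 0 (- 1 / (e * z)) (e * z) 1, hilbert_symbol z e)"
    using assms hilbert_inverse_right[of e z] by (subst Di_mult) (auto simp: inverse_eq_divide)
  have 4: "Up (1 / (e * z)) \<otimes>\<^bsub>Mp\<^esub> (mat2 0 (- 1 / (e * z)) (e * z) 1, hilbert_symbol z e) =
      (mat2 1 0 (e * z) 1, hilbert_symbol z e)"
    using assms by (subst Up_mult) auto
  show ?thesis unfolding 1 2 3 4 ..
qed

subsection \<open>The maximal compact subgroup\<close>

lemma SL2_int_mat2: "mat2 a b c d \<in> SL2_int R \<longleftrightarrow> a * d - b * c = 1 \<and> a \<in> R \<and> b \<in> R \<and> c \<in> R \<and> d \<in> R"
  by (auto simp: SL2_int_def forall_2)

lemma SL2_int_mult: "k \<in> SL2_int R \<Longrightarrow> k' \<in> SL2_int R \<Longrightarrow> k ** k' \<in> SL2_int R"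
  unfolding SL2_int_def by (simp add: det_mul) (simp add: matrix_matrix_mult_def sum_2 R.Zadd R.Zmult)

lemma SL2_int_adj2: "k \<in> SL2_int R \<Longrightarrow> adj2 k \<in> SL2_int R"
  by (cases k rule: mat2_cases) (auto simp: adj2_def SL2_int_mat2 R.Zuminus algebra_simps)

lemma SL2_int_1: "mat 1 \<in> SL2_int R"
  by (simp add: mat_1_mat2 SL2_int_mat2 R.Z0 R.Z1)

lemma theta_pm: "theta R k = 1 \<or> theta R k = - 1"
  using hilbert_cases by (auto simp: theta_def)

text \<open>Multiplicativity of \<open>theta\<close> with a fixed left factor. By the cocycle
  identity such factors are closed under products, so it suffices to treat generators of the
  integral group.\<close>

definition good :: "'f^2^2 \<Rightarrow> bool" where
  "good k \<longleftrightarrow> (\<forall>k'\<in>SL2_int R. theta R (k ** k') = theta R k * theta R k' * cocyc k k')"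

lemma good_mult:
  assumes k: "k \<in> SL2_int R" "good k" and l: "l \<in> SL2_int R" "good l"
  shows "good (k ** l)"
  unfolding good_def
proof
  fix m assume m: "m \<in> SL2_int R"
  have "theta R (k ** l ** m) = theta R k * theta R (l ** m) * cocyc k (l ** m)"
    using k SL2_int_mult[OF l(1) m] by (simp add: good_def matrix_mul_assoc[symmetric])
  also have "theta R (l ** m) = theta R l * theta R m * cocyc l m" using l m by (simp add: good_def)
  also have "theta R k * (theta R l * theta R m * cocyc l m) * cocyc k (l ** m) =
      theta R k * theta R l * theta R m * (cocyc k (l ** m) * cocyc l m)" by simp
  also have "cocyc k (l ** m) * cocyc l m = cocyc k l * cocyc (k ** l) m"
    using k l m by (intro cocycle[symmetric]) (auto simp: SL2_int_def)
  also have "theta R k * theta R l * theta R m * (cocyc k l * cocyc (k ** l) m) =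
      theta R (k ** l) * theta R m * cocyc (k ** l) m"
    using k l by (simp add: good_def)
  finally show "theta R (k ** l ** m) = theta R (k ** l) * theta R m * cocyc (k ** l) m" .
qed

lemma unit_mult_iff: "u \<in> units \<Longrightarrow> x \<in> R \<Longrightarrow> x * u \<in> units \<longleftrightarrow> x \<in> units"
  using red_unit_iff[of x] red_unit_iff[of "x * u"] red_mult[of x u] R.Zmult[of x u] red_unit_iff[of u] units_R[of u]
  by auto

lemma det_unit:
  assumes "a * d - b * c = 1" "a \<in> R" "b \<in> R" "c \<in> R" "d \<in> R" "c \<notin> units"
  shows "a \<in> units" "d \<in> units" "red (a * d) = 1"
proof -
  have "red c = 0" using red_unit_iff assms by blast
  have "a * d = 1 + b * c" using assms by (simp add: algebra_simps)
  then show *: "red (a * d) = 1"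
    using assms \<open>red c = 0\<close> by (simp add: red_add R.Z1 R.Zmult red_mult red_1)
  then show "a \<in> units" "d \<in> units"
    using red_unit_iff[of a] red_unit_iff[of d] assms by (auto simp: red_mult)
qed

text \<open>The cocycle is \<open>(Xfun k', t)\<close>. It is trivial when \<open>Xfun k'\<close> is
  a unit. Otherwise the lower left entry \<open>c\<close> is a nonzero nonunit, \<open>d\<close> is
  a unit, and dividing both by \<open>t\<close> changes \<open>(c, d)\<close> by exactly
  \<open>(c, t)\<close>.\<close>

lemma good_upper:
  assumes t: "t \<in> units" "y \<in> R"
  shows "good (mat2 t y 0 (inverse t))"
  unfolding good_def
proof
  fix k' assume k': "k' \<in> SL2_int R"
  obtain a b c d where k: "k' = mat2 a b c d" by (rule mat2_cases)
  have abcd: "a * d - b * c = 1" "a \<in> R" "b \<in> R" "c \<in> R" "d \<in> R"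
    using k' by (auto simp: k SL2_int_mat2)
  have t0: "t \<noteq> 0" using t units_nonzero by blast
  have it: "inverse t \<in> units" using unit_inv t by blast
  have "Xfun k' \<noteq> 0" using k' Xfun_nonzero by (auto simp: SL2_int_def)
  then have co: "cocyc (mat2 t y 0 (inverse t)) k' = hilbert_symbol (Xfun k') t"
    using t0 by (simp add: cocyc_def Xfun_upper_left hilbert_inverse_right)
  have prod: "mat2 t y 0 (inverse t) ** k' = mat2 (t * a + y * c) (t * b + y * d) (c * inverse t) (d * inverse t)"
    by (simp add: k mult.commute)
  have "theta R (mat2 t y 0 (inverse t) ** k') = theta R k' * hilbert_symbol (Xfun k') t"
  proof (cases "c = 0")
    case True
    then have "c \<notin> units" using units_nonzero by blast
    then have "d \<in> units" using det_unit(2)[OF abcd] by blast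
    then show ?thesis unfolding prod using True hilbert_units[OF _ t(1)] by (simp add: k theta_def)
  next
    case c0: False
    have cu: "c * inverse t \<in> units \<longleftrightarrow> c \<in> units" using unit_mult_iff[OF it abcd(4)] .
    show ?thesis
    proof (cases "c \<in> units")
      case True
      then show ?thesis unfolding prod using c0 cu hilbert_units[OF True t(1)] by (simp add: theta_def k)
    next
      case False
      then have d: "d \<in> units" using det_unit abcd by blast
      then have "hilbert_symbol (c * inverse t) (d * inverse t) = hilbert_symbol c d * hilbert_symbol c t"
        using hilbert_units[OF it d] hilbert_units[OF it it] units_nonzero[OF d] t0 c0
        by (simp add: hilbert_mult_left hilbert_mult_right hilbert_inverse_right)
      then show ?thesis unfolding prod using c0 cu False t0 by (simp add: theta_def k)
    qed
  qed
  then show "theta R (mat2 t y 0 (inverse t) ** k') =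
      theta R (mat2 t y 0 (inverse t)) * theta R k' * cocyc (mat2 t y 0 (inverse t)) k'"
    by (simp add: co) (simp add: theta_def)
qed

text \<open>The cocycle is \<open>(y, - x)\<close> with \<open>x\<close> and \<open>y\<close> the
  values of \<open>Xfun\<close> before and after. If \<open>c\<close> is a nonunit then
  \<open>a d\<close> is congruent to 1, and if \<open>a\<close> is a nonunit then
  \<open>- b c\<close> is; symbols with such elements are trivial, which matches
  \<open>theta\<close> of \<open>(c, d)\<close> with that of \<open>(a, b)\<close>.\<close>

lemma good_weyl: "good (mat2 0 (- 1) 1 0)"
  unfolding good_def
proof
  fix k' assume k': "k' \<in> SL2_int R"
  obtain a b c d where k: "k' = mat2 a b c d" by (rule mat2_cases)
  have abcd: "a * d - b * c = 1" "a \<in> R" "b \<in> R" "c \<in> R" "d \<in> R"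
    using k' by (auto simp: k SL2_int_mat2)
  have m1: "- 1 \<in> units" using unit_uminus unit_1 by blast
  let ?y = "if a \<noteq> 0 then a else b" and ?x = "if c \<noteq> 0 then c else d"
  have y0: "?y \<noteq> 0" and x0: "?x \<noteq> 0" using abcd(1) by auto
  have prod: "mat2 0 (- 1) 1 0 ** k' = mat2 (- c) (- d) a b" by (simp add: k)
  have "cocyc (mat2 0 (- 1) 1 0) k' = hilbert_symbol ?y (?y / ?x)"
    unfolding cocyc_def prod by (simp add: k)
  also have "\<dots> = hilbert_symbol ?y (- 1) * hilbert_symbol ?y ?x"
    using y0 x0 hilbert_diag[OF y0] hilbert_divide_right[OF y0 x0 y0] by presburger
  also have "\<dots> = hilbert_symbol ?y (- ?x)"
    using y0 x0 hilbert_mult_right[of "- 1" ?x ?y] by simp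
  finally have co: "cocyc (mat2 0 (- 1) 1 0) k' = hilbert_symbol ?y (- ?x)" .
  have "theta R (mat2 (- c) (- d) a b) = theta R k' * hilbert_symbol ?y (- ?x)"
  proof (cases "a \<in> units")
    case True
    then have a0: "a \<noteq> 0" using units_nonzero by blast
    have "theta R k' * hilbert_symbol a (- ?x) = 1"
    proof (cases "c = 0 \<or> c \<in> units")
      case c: True
      have "?x \<in> units"
      proof (cases "c = 0")
        case True
        then have "c \<notin> units" using units_nonzero by blast
        then show ?thesis using True det_unit(2)[OF abcd] by simp
      qed (use c in auto)
      then show ?thesis using c hilbert_units[OF True unit_uminus] by (auto simp: theta_def k)
    next
      case False
      have "hilbert_symbol c (a * d) = 1"
        using det_unit(3)[OF abcd] False abcd by (intro hilbert_one_plus R.Zmult) auto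
      moreover have "d \<noteq> 0" using det_unit(2)[OF abcd] False units_nonzero by blast
      moreover have "hilbert_symbol a (- c) = hilbert_symbol c a"
        using hilbert_mult_right[of "- 1" c a] hilbert_units[OF True m1] a0 False hilbert_sym[of a c] by simp
      ultimately show ?thesis using False a0 by (simp add: theta_def k hilbert_mult_right mult.commute)
    qed
    then show ?thesis using True a0 by (simp add: theta_def)
  next
    case False
    have "red (b * (- c)) = 1"
    proof -
      have "red a = 0" using red_unit_iff False abcd by blast
      have "b * (- c) = 1 - a * d" using abcd(1) by (simp add: algebra_simps)
      then show ?thesis using abcd \<open>red a = 0\<close> by (simp add: red_diff R.Z1 R.Zmult red_mult red_1)
    qed
    then have bc: "b \<in> units" "c \<in> units"
    proof -
      have "red b * - red c = 1"
        using \<open>red (b * (- c)) = 1\<close> red_mult[OF abcd(3) R.Zuminus[OF abcd(4)]] red_uminus[OF abcd(4)] by simp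
      then have "red b \<noteq> 0" "red c \<noteq> 0" by auto
      then show "b \<in> units" "c \<in> units" using red_unit_iff abcd by blast+
    qed
    then have c0: "c \<noteq> 0" "b \<noteq> 0" using units_nonzero by auto
    show ?thesis
    proof (cases "a = 0")
      case True
      then show ?thesis using bc c0 hilbert_units[OF bc(1) unit_uminus[OF bc(2)]] by (simp add: theta_def k)
    next
      case a0: False
      have "hilbert_symbol a (b * (- c)) = 1"
        using \<open>red (b * (- c)) = 1\<close> a0 abcd by (intro hilbert_one_plus R.Zmult R.Zuminus) auto
      then have "hilbert_symbol a b * hilbert_symbol a (- c) = 1"
        using hilbert_mult_right[of b "- c" a] c0 a0 by simp
      then show ?thesis
        using bc c0 a0 False hilbert_cases[of a b] hilbert_cases[of a "- c"] by (auto simp: theta_def k)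
    qed
  qed
  then show "theta R (mat2 0 (- 1) 1 0 ** k') =
      theta R (mat2 0 (- 1) 1 0) * theta R k' * cocyc (mat2 0 (- 1) 1 0) k'"
    unfolding prod co by (simp add: theta_def unit_1)
qed

text \<open>If the lower left entry is a unit, the matrix is a product of upper triangular matrices
  and one Weyl element. Otherwise its upper left entry is a unit, and multiplication by the Weyl
  element reduces to the first case.\<close>

lemma theta_mult:
  assumes k: "k \<in> SL2_int R" and l: "l \<in> SL2_int R"
  shows "theta R (k ** l) = theta R k * theta R l * cocyc k l"
proof -
  have weyl: "mat2 0 (- 1) 1 0 \<in> SL2_int R" by (simp add: SL2_int_mat2 R.Z0 R.Z1 R.Zuminus)
  have upper: "mat2 t y 0 (inverse t) \<in> SL2_int R" if "t \<in> units" "y \<in> R" for t y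
    using that by (auto simp: SL2_int_mat2 R.Z0 unit_inverse)
  have big: "good m" if m: "m \<in> SL2_int R" "m $ 2 $ 1 \<in> units" for m
  proof -
    obtain a b c d where M: "m = mat2 a b c d" by (rule mat2_cases)
    then have c: "c \<in> units" "c \<noteq> 0" "inverse c \<in> units" "inverse c \<in> R" using m units_nonzero unit_inv units_R by auto
    have abcd: "a * d - b * c = 1" "a \<in> R" "b \<in> R" "c \<in> R" "d \<in> R"
      using m by (auto simp: M SL2_int_mat2)
    have "m = mat2 (inverse c) a 0 (inverse (inverse c)) ** mat2 0 (- 1) 1 0 ** mat2 1 (inverse c * d) 0 (inverse 1)"
      using c abcd(1) by (simp add: M field_simps)
    moreover have "good \<dots>"
      using c abcd unit_1 R.Zmult
      by (intro good_mult good_upper good_weyl SL2_int_mult weyl upper) auto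
    ultimately show ?thesis by simp
  qed
  have "good k"
  proof (cases "k $ 2 $ 1 \<in> units")
    case True
    then show ?thesis using big k by blast
  next
    case False
    obtain a b c d where M: "k = mat2 a b c d" by (rule mat2_cases)
    have abcd: "a * d - b * c = 1" "a \<in> R" "b \<in> R" "c \<in> R" "d \<in> R" "c \<notin> units"
      using k False by (auto simp: M SL2_int_mat2)
    have s: "mat2 (- c) (- d) a b \<in> SL2_int R" using abcd by (simp add: SL2_int_mat2 R.Zuminus algebra_simps)
    then have "good (mat2 (- c) (- d) a b)" using det_unit(1)[OF abcd] by (intro big) auto
    then have "good (mat2 (- 1) 0 0 (inverse (- 1)) ** mat2 0 (- 1) 1 0 ** mat2 (- c) (- d) a b)"
      using s unit_uminus[OF unit_1] R.Z0
      by (intro good_mult good_upper good_weyl SL2_int_mult weyl upper) auto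
    then show ?thesis by (simp add: M)
  qed
  then show ?thesis using l by (simp add: good_def)
qed

abbreviation KK :: "'f mp set" where "KK \<equiv> K_tilde R"

text \<open>Both signs occur above every integral matrix, so \<open>theta\<close> drops out of the
  description of the group; it survives only in the genuine representation.\<close>

lemma K_tilde_iff: "(k, e) \<in> KK \<longleftrightarrow> k \<in> SL2_int R \<and> (e = 1 \<or> e = - 1)"
proof -
  have "x \<in> KK \<longleftrightarrow> (\<exists>k\<in>SL2_int R. \<exists>e\<in>{1, - 1}. x = (k, theta R k * e))" for x
  proof -
    have "(k, theta R k) \<otimes>\<^bsub>Mp\<^esub> (mat 1, e) = (k, theta R k * e)" if "k \<in> SL2_int R" for k e
      using that by (simp add: cocyc_1 SL2_int_def)
    note m = this
    show ?thesis
    proof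
      assume "x \<in> KK"
      then obtain k where k: "k \<in> SL2_int R"
        "x = (k, theta R k) \<otimes>\<^bsub>Mp\<^esub> (mat 1, 1) \<or> x = (k, theta R k) \<otimes>\<^bsub>Mp\<^esub> (mat 1, - 1)"
        unfolding K_tilde_def K_star_def set_mult_def by blast
      then show "\<exists>k\<in>SL2_int R. \<exists>e\<in>{1, - 1}. x = (k, theta R k * e)"
        unfolding m[OF k(1)] by blast
    next
      assume "\<exists>k\<in>SL2_int R. \<exists>e\<in>{1, - 1}. x = (k, theta R k * e)"
      then obtain k e where k: "k \<in> SL2_int R" "e \<in> {1, - 1}" "x = (k, theta R k) \<otimes>\<^bsub>Mp\<^esub> (mat 1, e)"
        using m by metis
      then show "x \<in> KK" unfolding K_tilde_def K_star_def set_mult_def by blast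
    qed
  qed
  then show ?thesis using theta_pm[of k] by auto
qed

lemma KK_iff: "x \<in> KK \<longleftrightarrow> x \<in> carrier Mp \<and> fst x \<in> SL2_int R"
  by (cases x) (auto simp: K_tilde_iff carrier_Mp SL2_int_def)

lemma KK_subgroup: "subgroup KK Mp"
proof (rule Mp.subgroupI)
  have "(mat 1, 1) \<in> KK" using SL2_int_1 by (simp add: K_tilde_iff)
  then show "KK \<noteq> {}" by blast
qed (auto simp: KK_iff fst_inv fst_mult SL2_int_adj2 SL2_int_mult)

lemma lifts_KK [simp]:
  "Up x \<in> KK \<longleftrightarrow> x \<in> R" "Lo x \<in> KK \<longleftrightarrow> x \<in> R" "We \<in> KK"
  "t \<in> units \<Longrightarrow> Di t e \<in> KK \<longleftrightarrow> e = 1 \<or> e = - 1"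
  by (auto simp: Up_def Lo_def We_def Di_def K_tilde_iff SL2_int_mat2 R.Z0 R.Z1 R.Zuminus unit_inverse)

lemma theta_lifts:
  "theta R (mat2 1 x 0 1) = 1" "theta R (mat2 1 0 x 1) = 1" "theta R (mat2 0 (- 1) 1 0) = 1"
  "theta R (mat2 t 0 0 (inverse t)) = 1"
  by (auto simp: theta_def hilbert_1 unit_1)

subsection \<open>Iwasawa and Cartan decompositions\<close>

text \<open>Dividing by the entry of least valuation makes one entry a unit, and a row with a unit
  entry is the first row of an integral matrix of determinant 1.\<close>

lemma primitive_row:
  assumes "a \<noteq> 0 \<or> b \<noteq> (0 :: 'f)"
  obtains j c d where "mat2 (w powi (- j) * a) (w powi (- j) * b) c d \<in> SL2_int R"
proof -
  have *: "\<exists>j c d. mat2 (w powi (- j) * a) (w powi (- j) * b) c d \<in> SL2_int R"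
    if a: "a \<noteq> 0" and ab: "b = 0 \<or> val a \<le> val b" for a b
  proof -
    define j where "j = val a"
    have "ang a \<in> units" using val_ang a by blast
    then have u: "w powi (- j) * a \<in> units" by (simp add: ang_def j_def)
    have "w powi (- j) * b \<in> R"
    proof (cases "b = 0")
      case False
      then show ?thesis using ab R_val[of "w powi (- j) * b"] powi_w_nonzero val_powi[of "- j"]
        val_mult[OF powi_w_nonzero False, of "- j"] by (simp add: j_def)
    qed (simp add: R.Z0)
    then have "mat2 (w powi (- j) * a) (w powi (- j) * b) 0 (inverse (w powi (- j) * a)) \<in> SL2_int R"
      using u R.Z0 by (auto simp: SL2_int_mat2 unit_inverse simp del: inverse_mult_distrib)
    then show ?thesis by blast
  qed
  show ?thesis
  proof (cases "a \<noteq> 0 \<and> (b = 0 \<or> val a \<le> val b)")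
    case True
    then show ?thesis using * that by blast
  next
    case False
    then have "b \<noteq> 0" "a = 0 \<or> val b \<le> val a" using assms by auto
    from *[OF this] obtain j c d where jcd: "mat2 (w powi (- j) * b) (w powi (- j) * a) c d \<in> SL2_int R" by blast
    then have "mat2 (w powi (- j) * a) (w powi (- j) * b) (- d) (- c) \<in> SL2_int R"
      by (auto simp: SL2_int_mat2 R.Zuminus algebra_simps)
    then show ?thesis using that by blast
  qed
qed

lemma iwasawa:
  assumes g: "g \<in> carrier Mp"
  obtains x j k where "k \<in> KK" "g = Lo x \<otimes>\<^bsub>Mp\<^esub> Hw j \<otimes>\<^bsub>Mp\<^esub> k"
proof -
  obtain a b c d where M: "fst g = mat2 a b c d" by (rule mat2_cases)
  have det: "a * d - b * c = 1" using det_fst[OF g] by (simp add: M)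
  then have "a \<noteq> 0 \<or> b \<noteq> 0" by auto
  then obtain j c' d' where k: "mat2 (w powi (- j) * a) (w powi (- j) * b) c' d' \<in> SL2_int R"
    using primitive_row by blast
  define k0 where "k0 = mat2 (w powi (- j) * a) (w powi (- j) * b) c' d'"
  have k0: "k0 \<in> SL2_int R" "det k0 = 1" using k by (auto simp: k0_def SL2_int_def)
  define W where "W = w powi j"
  have W: "W \<noteq> 0" "w powi (- j) = inverse W" using w_nonzero by (auto simp: W_def power_int_minus)
  have det': "a * d' - b * c' = W" using k0(2) W by (simp add: k0_def field_simps)
  \<comment> \<open>The lower left entry of \<open>fst g\<close> times the inverse of
    \<open>k0\<close> is \<open>c d' - d c'\<close>, and in the wanted product it is
    \<open>x W\<close>.\<close>
  define x where "x = inverse W * (c * d' - d * c')"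
  have "mat2 1 0 x 1 ** mat2 W 0 0 (inverse W) ** k0 = mat2 a b (x * a + inverse W * c') (x * b + inverse W * d')"
    using W by (simp add: k0_def field_simps)
  also have "\<dots> = mat2 a b c d"
  proof -
    have Wx: "W * x = c * d' - d * c'" "W * inverse W = 1" using W by (simp_all add: x_def)
    have "W * (x * a + inverse W * c') = (W * x) * a + (W * inverse W) * c'"
      by (simp only: distrib_left mult.assoc)
    also have "\<dots> = a * c * d' - (a * d - 1) * c'" unfolding Wx by (simp add: algebra_simps)
    also have "a * d - 1 = b * c" using det by (simp add: algebra_simps)
    also have "a * c * d' - b * c * c' = c * (a * d' - b * c')" by (simp add: algebra_simps)
    finally have 1: "x * a + inverse W * c' = c" using W det' by (simp add: mult.commute)
    have "W * (x * b + inverse W * d') = (W * x) * b + (W * inverse W) * d'"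
      by (simp only: distrib_left mult.assoc)
    also have "\<dots> = (b * c + 1) * d' - b * d * c'" unfolding Wx by (simp add: algebra_simps)
    also have "b * c + 1 = a * d" using det by (simp add: algebra_simps)
    also have "a * d * d' - b * d * c' = d * (a * d' - b * c')" by (simp add: algebra_simps)
    finally have 2: "x * b + inverse W * d' = d" using W det' by (simp add: mult.commute)
    show ?thesis using 1 2 by simp
  qed
  finally have "fst g = fst (Lo x \<otimes>\<^bsub>Mp\<^esub> Hw j) ** k0"
    by (simp add: M fst_mult fst_Hw Lo_def W W_def)
  then obtain e where e: "e \<in> {1, - 1}" "g = Lo x \<otimes>\<^bsub>Mp\<^esub> Hw j \<otimes>\<^bsub>Mp\<^esub> (k0, e)"
    using lift_exists[OF _ g _ k0(2), of "Lo x \<otimes>\<^bsub>Mp\<^esub> Hw j"] by auto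
  then show ?thesis using that[of "(k0, e)" x j] k0 by (auto simp: K_tilde_iff)
qed

definition dcoset :: "nat \<Rightarrow> 'f mp set" where
  "dcoset n = {k \<otimes>\<^bsub>Mp\<^esub> Hw (- int n) \<otimes>\<^bsub>Mp\<^esub> k' | k k'. k \<in> KK \<and> k' \<in> KK}"

lemma KK_carrier: "k \<in> KK \<Longrightarrow> k \<in> carrier Mp"
  by (simp add: KK_iff)

lemma KK_mult: "k \<in> KK \<Longrightarrow> k' \<in> KK \<Longrightarrow> k \<otimes>\<^bsub>Mp\<^esub> k' \<in> KK"
  using KK_subgroup by (rule subgroup.m_closed)

lemma KK_inv: "k \<in> KK \<Longrightarrow> inv\<^bsub>Mp\<^esub> k \<in> KK"
  using KK_subgroup by (rule subgroup.m_inv_closed)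

lemma KK_one: "\<one>\<^bsub>Mp\<^esub> \<in> KK"
  using KK_subgroup by (rule subgroup.one_closed)

text \<open>Membership depends on the matrix alone, because the sign of a lift can be absorbed in
  the right factor from \<open>KK\<close>.\<close>

lemma dcoset_iff: "g \<in> dcoset n \<longleftrightarrow> g \<in> carrier Mp \<and>
    (\<exists>k\<in>SL2_int R. \<exists>k'\<in>SL2_int R. fst g = k ** mat2 (w powi (- int n)) 0 0 (w powi (int n)) ** k')"
proof
  assume "g \<in> dcoset n"
  then obtain k k' where k: "k \<in> KK" "k' \<in> KK" "g = k \<otimes>\<^bsub>Mp\<^esub> Hw (- int n) \<otimes>\<^bsub>Mp\<^esub> k'"
    unfolding dcoset_def by blast
  then show "g \<in> carrier Mp \<and>
    (\<exists>k\<in>SL2_int R. \<exists>k'\<in>SL2_int R. fst g = k ** mat2 (w powi (- int n)) 0 0 (w powi (int n)) ** k')"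
    by (auto simp: fst_mult fst_Hw KK_iff)
next
  assume "g \<in> carrier Mp \<and>
    (\<exists>k\<in>SL2_int R. \<exists>k'\<in>SL2_int R. fst g = k ** mat2 (w powi (- int n)) 0 0 (w powi (int n)) ** k')"
  then obtain k k' where k: "g \<in> carrier Mp" "k \<in> SL2_int R" "k' \<in> SL2_int R"
    "fst g = k ** mat2 (w powi (- int n)) 0 0 (w powi (int n)) ** k'" by blast
  have kK: "(k, 1) \<in> KK" using k by (simp add: K_tilde_iff)
  obtain e where "e \<in> {1, - 1}" "g = (k, 1) \<otimes>\<^bsub>Mp\<^esub> Hw (- int n) \<otimes>\<^bsub>Mp\<^esub> (k', e)"
    using lift_exists[OF _ k(1), of "(k, 1) \<otimes>\<^bsub>Mp\<^esub> Hw (- int n)" k'] k kK KK_carrier[OF kK]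
    by (auto simp: fst_mult fst_Hw SL2_int_def)
  moreover from this have "(k', e) \<in> KK" using k by (auto simp: K_tilde_iff)
  ultimately show "g \<in> dcoset n" using kK unfolding dcoset_def by blast
qed

lemma dcoset_KK: "k \<in> KK \<Longrightarrow> g \<in> dcoset n \<Longrightarrow> k \<otimes>\<^bsub>Mp\<^esub> g \<in> dcoset n"
  "k \<in> KK \<Longrightarrow> g \<in> dcoset n \<Longrightarrow> g \<otimes>\<^bsub>Mp\<^esub> k \<in> dcoset n"
proof -
  assume k: "k \<in> KK" and "g \<in> dcoset n"
  then obtain k1 k2 where g: "k1 \<in> KK" "k2 \<in> KK" "g = k1 \<otimes>\<^bsub>Mp\<^esub> Hw (- int n) \<otimes>\<^bsub>Mp\<^esub> k2"
    unfolding dcoset_def by blast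
  have "k \<otimes>\<^bsub>Mp\<^esub> g = k \<otimes>\<^bsub>Mp\<^esub> k1 \<otimes>\<^bsub>Mp\<^esub> Hw (- int n) \<otimes>\<^bsub>Mp\<^esub> k2"
    "g \<otimes>\<^bsub>Mp\<^esub> k = k1 \<otimes>\<^bsub>Mp\<^esub> Hw (- int n) \<otimes>\<^bsub>Mp\<^esub> (k2 \<otimes>\<^bsub>Mp\<^esub> k)"
    using g k by (simp_all add: Mp.m_assoc KK_carrier)
  then show "k \<otimes>\<^bsub>Mp\<^esub> g \<in> dcoset n" "g \<otimes>\<^bsub>Mp\<^esub> k \<in> dcoset n"
    unfolding dcoset_def using g k KK_mult by blast+
qed

lemma fst_dcoset_diag:
  assumes "g \<in> carrier Mp" "fst g = k ** mat2 (w powi j) 0 0 (w powi (- j)) ** k'" "k \<in> SL2_int R" "k' \<in> SL2_int R"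
  shows "g \<in> dcoset (nat \<bar>j\<bar>)"
proof (cases "j \<le> 0")
  case True
  then show ?thesis using assms by (auto simp: dcoset_iff)
next
  case False
  have s: "mat2 0 (- 1) 1 0 \<in> SL2_int R" "mat2 0 1 (- 1) 0 \<in> SL2_int R"
    by (auto simp: SL2_int_mat2 R.Z0 R.Z1 R.Zuminus)
  have E: "mat2 (w powi j) 0 0 (w powi (- j)) =
      mat2 0 (- 1) 1 0 ** mat2 (w powi (- j)) 0 0 (w powi j) ** mat2 0 1 (- 1) 0" by simp
  then have "fst g = (k ** mat2 0 (- 1) 1 0) ** mat2 (w powi (- int (nat \<bar>j\<bar>))) 0 0 (w powi (int (nat \<bar>j\<bar>))) **
      (mat2 0 1 (- 1) 0 ** k')"
    using assms(2) False unfolding E by (simp only: matrix_mul_assoc) simp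
  then show ?thesis unfolding dcoset_iff using assms s SL2_int_mult by blast
qed

text \<open>Starting from the Iwasawa form, the lower unipotent is absorbed on the left if
  \<open>x\<close> is integral, or on the right of the torus if \<open>W^2 x\<close> is. In the
  remaining case both have negative valuation, so their inverses are integral and
  \<open>Lo x\<close> can be replaced by upper unipotents and a Weyl element.\<close>

lemma cartan:
  assumes g: "g \<in> carrier Mp"
  shows "\<exists>n. g \<in> dcoset n"
proof -
  obtain x j k where k: "k \<in> KK" "g = Lo x \<otimes>\<^bsub>Mp\<^esub> Hw j \<otimes>\<^bsub>Mp\<^esub> k" using iwasawa[OF g] by blast
  define W where "W = w powi j"
  have W: "W \<noteq> 0" "w powi (- j) = inverse W" using w_nonzero by (auto simp: W_def power_int_minus)
  have kS: "fst k \<in> SL2_int R" using k by (simp add: KK_iff)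
  have fg: "fst g = mat2 1 0 x 1 ** mat2 W 0 0 (inverse W) ** fst k"
    unfolding k(2) by (simp add: fst_mult fst_Hw Lo_def W W_def)
  show ?thesis
  proof (cases "x \<in> R")
    case True
    then have "mat2 1 0 x 1 \<in> SL2_int R" by (simp add: SL2_int_mat2 R.Z0 R.Z1)
    then show ?thesis using fst_dcoset_diag[OF g, of "mat2 1 0 x 1" j "fst k"] fg kS W by (auto simp: W_def)
  next
    case False
    then have x0: "x \<noteq> 0" using R.Z0 by auto
    then have vx: "val x < 0" using R_val False by auto
    show ?thesis
    proof (cases "W\<^sup>2 * x \<in> R")
      case True
      have "mat2 1 0 x 1 ** mat2 W 0 0 (inverse W) = mat2 W 0 0 (inverse W) ** mat2 1 0 (W\<^sup>2 * x) 1"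
        using W by (simp add: power2_eq_square)
      then have "fst g = mat 1 ** mat2 W 0 0 (inverse W) ** (mat2 1 0 (W\<^sup>2 * x) 1 ** fst k)"
        using fg by (simp only: matrix_mul_lid matrix_mul_assoc)
      then have "fst g = mat 1 ** mat2 (w powi j) 0 0 (w powi (- j)) ** (mat2 1 0 (W\<^sup>2 * x) 1 ** fst k)"
        by (simp only: W W_def)
      moreover have "mat2 1 0 (W\<^sup>2 * x) 1 \<in> SL2_int R" using True by (simp add: SL2_int_mat2 R.Z0 R.Z1)
      ultimately show ?thesis using fst_dcoset_diag[OF g] SL2_int_1 SL2_int_mult kS by blast
    next
      case F2: False
      have "W\<^sup>2 * x \<noteq> 0" using W x0 by simp
      then have v2: "val (W\<^sup>2 * x) < 0" using F2 R_val by auto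
      define y where "y = inverse x"
      define z where "z = inverse (W\<^sup>2 * x)"
      have yz: "y \<in> R" "z \<in> R" "y \<noteq> 0"
        using R_val[of y] R_val[of z] x0 W vx v2 val_inverse[OF x0] val_inverse[OF \<open>W\<^sup>2 * x \<noteq> 0\<close>]
        by (auto simp: y_def z_def simp del: inverse_mult_distrib)
      \<comment> \<open>From the identity that writes a lower unipotent as \<open>Up (1/x)\<close>,
        \<open>diag (1/x, x)\<close>, the Weyl element and \<open>Up (1/x)\<close>; moving
        \<open>diag (W, 1/W)\<close> across changes the torus part to
        \<open>1 / (x W)\<close>.\<close>
      define D where "D = y / W"
      have D0: "D \<noteq> 0" using yz W by (simp add: D_def)
      define i where "i = val D"
      define u where "u = ang D"
      have u: "u \<in> units" "D = w powi i * u" using val_ang[OF D0] by (auto simp: u_def i_def)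
      have u0: "u \<noteq> 0" using units_nonzero u by blast
      have "mat2 1 0 x 1 ** mat2 W 0 0 (inverse W) =
          mat2 1 y 0 1 ** mat2 D 0 0 (inverse D) ** (mat2 0 (- 1) 1 0 ** mat2 1 z 0 1)"
        using W x0 by (simp add: y_def z_def D_def field_simps power2_eq_square)
      also have "mat2 D 0 0 (inverse D) = mat2 (w powi i) 0 0 (w powi (- i)) ** mat2 u 0 0 (inverse u)"
        by (simp add: u(2) power_int_minus)
      finally have "fst g = mat2 1 y 0 1 ** mat2 (w powi i) 0 0 (w powi (- i)) **
          (mat2 u 0 0 (inverse u) ** (mat2 0 (- 1) 1 0 ** mat2 1 z 0 1) ** fst k)"
        using fg by (simp only: matrix_mul_assoc)
      moreover have "mat2 1 y 0 1 \<in> SL2_int R" "mat2 u 0 0 (inverse u) \<in> SL2_int R"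
        "mat2 0 (- 1) 1 0 \<in> SL2_int R" "mat2 1 z 0 1 \<in> SL2_int R"
        using yz u u0 by (auto simp: SL2_int_mat2 R.Z0 R.Z1 R.Zuminus unit_inverse)
      moreover from this have "mat2 u 0 0 (inverse u) ** (mat2 0 (- 1) 1 0 ** mat2 1 z 0 1) ** fst k \<in> SL2_int R"
        by (intro SL2_int_mult kS)
      ultimately have "g \<in> dcoset (nat \<bar>i\<bar>)" by (intro fst_dcoset_diag[OF g])
      then show ?thesis by blast
    qed
  qed
qed

text \<open>All entries of a matrix in \<open>dcoset n\<close> lie in \<open>w^-n R\<close>, so both
  \<open>j\<close> and \<open>- j\<close> are at least \<open>- n\<close>. This separates the double
  cosets.\<close>

lemma dcoset_le:
  assumes "Hw j \<in> dcoset n"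
  shows "\<bar>j\<bar> \<le> int n"
proof -
  obtain k k' where k: "k \<in> SL2_int R" "k' \<in> SL2_int R"
    "mat2 (w powi j) 0 0 (w powi (- j)) = k ** mat2 (w powi (- int n)) 0 0 (w powi (int n)) ** k'"
    using assms by (auto simp: dcoset_iff fst_Hw)
  obtain a b c d where K: "k = mat2 a b c d" by (rule mat2_cases)
  obtain a' b' c' d' where K': "k' = mat2 a' b' c' d'" by (rule mat2_cases)
  define A B where "A = w powi (- int n)" and "B = w powi (int n)"
  have AB: "B = A * w ^ (2 * n)"
  proof -
    have "w ^ (2 * n) = B * B" by (simp add: B_def mult_2 power_add)
    moreover have "A * B = 1" using w_nonzero by (simp add: A_def B_def power_int_minus)
    ultimately show ?thesis by (simp flip: mult.assoc)
  qed
  have "w powi j = a * A * a' + b * B * c'" "w powi (- j) = c * A * b' + d * B * d'"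
    using k(3) unfolding A_def[symmetric] B_def[symmetric] by (simp_all add: K K')
  then have "w powi j = w powi (- int n) * (a * a' + w ^ (2 * n) * (b * c'))"
    "w powi (- j) = w powi (- int n) * (c * b' + w ^ (2 * n) * (d * d'))"
    unfolding AB A_def[symmetric] by (simp_all add: algebra_simps)
  moreover have "a * a' + w ^ (2 * n) * (b * c') \<in> R" "c * b' + w ^ (2 * n) * (d * d') \<in> R"
    using k(1,2) wR by (auto simp: K K' SL2_int_mat2 intro!: R.Zadd R.Zmult R_power)
  ultimately obtain x y where xy: "x \<in> R" "y \<in> R" "w powi j = w powi (- int n) * x" "w powi (- j) = w powi (- int n) * y"
    by blast
  then have "x \<noteq> 0" "y \<noteq> 0" using powi_w_nonzero by (metis mult_eq_0_iff)+
  then have "j = - int n + val x" "- j = - int n + val y"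
    using xy val_powi val_mult powi_w_nonzero by metis+
  then show ?thesis using val_R[OF xy(1) \<open>x \<noteq> 0\<close>] val_R[OF xy(2) \<open>y \<noteq> 0\<close>] by linarith
qed

lemma dcoset_disjoint:
  assumes "g \<in> dcoset n" "g \<in> dcoset m"
  shows "n = m"
proof -
  have "n \<le> m" if "g \<in> dcoset n" "g \<in> dcoset m" for n m
  proof -
    from that(1) obtain k k' where k: "k \<in> KK" "k' \<in> KK" "g = k \<otimes>\<^bsub>Mp\<^esub> Hw (- int n) \<otimes>\<^bsub>Mp\<^esub> k'"
      unfolding dcoset_def by blast
    have "inv\<^bsub>Mp\<^esub> k \<otimes>\<^bsub>Mp\<^esub> g \<otimes>\<^bsub>Mp\<^esub> inv\<^bsub>Mp\<^esub> k' = Hw (- int n)"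
      using k by (simp add: KK_carrier Mp.m_assoc Mp.inv_solve_left')
    then have "Hw (- int n) \<in> dcoset m" using dcoset_KK KK_inv k(1,2) that(2) by metis
    then show ?thesis using dcoset_le by fastforce
  qed
  then show ?thesis using assms by (meson antisym)
qed

lemma Hw_dcoset_iff: "Hw j \<in> dcoset n \<longleftrightarrow> n = nat \<bar>j\<bar>"
proof -
  have "Hw j \<in> dcoset (nat \<bar>j\<bar>)"
    using fst_dcoset_diag[of "Hw j" "mat 1" j "mat 1"] SL2_int_1 by (simp add: fst_Hw)
  then show ?thesis using dcoset_disjoint by blast
qed

end

section \<open>Twisted tensor products of symmetric powers\<close>

lemma index_set_Nil: "index_set [] = {[]}"
  by (auto simp: index_set_def)

lemma index_set_Cons: "index_set (n # r) = (\<lambda>(k, K). k # K) ` ({..n} \<times> index_set r)"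
  by (auto simp: index_set_def list_all2_Cons2 image_iff)

lemma finite_index_set: "finite (index_set r)"
  by (induction r) (auto simp: index_set_Nil index_set_Cons)

lemma index_set_length: "J \<in> index_set r \<Longrightarrow> length J = length r"
  by (auto simp: index_set_def list_all2_lengthD)

lemma index_set_nth: "J \<in> index_set r \<Longrightarrow> i < length r \<Longrightarrow> J ! i \<le> r ! i"
  by (auto simp: index_set_def list_all2_conv_all_nth)

lemma index_set_self: "r \<in> index_set r"
  by (auto simp: index_set_def list_all2_conv_all_nth)

lemma index_set_eqI: "J \<in> index_set r \<Longrightarrow> K \<in> index_set r \<Longrightarrow> (\<And>i. i < length r \<Longrightarrow> J ! i = K ! i) \<Longrightarrow> J = K"
  by (intro nth_equalityI) (simp_all add: index_set_length)

lemma sum_index_set_prod: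
  "(\<Sum>K\<in>index_set r. \<Prod>i<length r. g i (K ! i)) = (\<Prod>i<length r. \<Sum>k\<le>r ! i. g i k :: 'a::comm_semiring_1)"
proof (induction r arbitrary: g)
  case Nil
  then show ?case by (simp add: index_set_Nil)
next
  case (Cons n r)
  have inj: "inj_on (\<lambda>(k, K). k # K) ({..n} \<times> index_set r)" by (auto simp: inj_on_def)
  have "(\<Sum>K\<in>index_set (n # r). \<Prod>i<length (n # r). g i (K ! i)) =
      (\<Sum>(k, K)\<in>{..n} \<times> index_set r. g 0 k * (\<Prod>i<length r. g (Suc i) (K ! i)))"
    unfolding index_set_Cons
    by (subst sum.reindex[OF inj]) (auto intro!: sum.cong simp: prod.lessThan_Suc_shift simp del: prod.lessThan_Suc)
  also have "\<dots> = (\<Sum>k\<le>n. g 0 k) * (\<Sum>K\<in>index_set r. \<Prod>i<length r. g (Suc i) (K ! i))"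
    by (simp add: sum_product sum.cartesian_product)
  also have "\<dots> = (\<Prod>i<length (n # r). \<Sum>k\<le>(n # r) ! i. g i k)"
    using Cons.IH[of "\<lambda>i. g (Suc i)"] by (simp add: prod.lessThan_Suc_shift del: prod.lessThan_Suc)
  finally show ?case .
qed

text \<open>This is \<open>B^n P(A/B)\<close> without division: substitution of two linear forms
  into a binary form of degree \<open>n\<close>, where \<open>P\<close> is the form with
  \<open>e_2\<close> set to 1.\<close>

definition homog :: "nat \<Rightarrow> 'e::field poly \<Rightarrow> 'e poly \<Rightarrow> 'e poly \<Rightarrow> 'e poly" where
  "homog n P A B = (\<Sum>k\<le>n. Polynomial.smult (Polynomial.coeff P k) (A ^ k * B ^ (n - k)))"

lemma homog_linear:
  assumes "Polynomial.degree P \<le> n"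
  shows "homog (Suc n) ([:c, a:] * P) A B = (Polynomial.smult c B + Polynomial.smult a A) * homog n P A B"
proof -
  let ?t = "\<lambda>k. Polynomial.smult (Polynomial.coeff P k)"
  have co: "Polynomial.coeff ([:c, a:] * P) k = c * Polynomial.coeff P k + (if k = 0 then 0 else a * Polynomial.coeff P (k - 1))" for k
    by (cases k) (simp_all add: mult_pCons_left Polynomial.coeff_pCons)
  have z: "Polynomial.coeff P (Suc n) = 0" using assms by (simp add: coeff_eq_0)
  have "homog (Suc n) ([:c, a:] * P) A B =
      (\<Sum>k\<le>Suc n. Polynomial.smult (c * Polynomial.coeff P k) (A ^ k * B ^ (Suc n - k))) +
      (\<Sum>k\<le>Suc n. Polynomial.smult (if k = 0 then 0 else a * Polynomial.coeff P (k - 1)) (A ^ k * B ^ (Suc n - k)))"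
    unfolding homog_def co by (simp only: smult_add_left sum.distrib)
  also have "(\<Sum>k\<le>Suc n. Polynomial.smult (c * Polynomial.coeff P k) (A ^ k * B ^ (Suc n - k))) =
      Polynomial.smult c B * homog n P A B"
    by (simp add: z homog_def sum_distrib_left Suc_diff_le mult_ac)
  also have "(\<Sum>k\<le>Suc n. Polynomial.smult (if k = 0 then 0 else a * Polynomial.coeff P (k - 1)) (A ^ k * B ^ (Suc n - k))) =
      Polynomial.smult a A * homog n P A B"
    by (subst sum.atMost_Suc_shift) (simp add: homog_def sum_distrib_left mult_ac)
  finally show ?thesis by (simp add: distrib_right)
qed

lemma homog_powers:
  "homog (i + j) ([:c, a:] ^ i * [:c', a':] ^ j) A B =
    (Polynomial.smult c B + Polynomial.smult a A) ^ i * (Polynomial.smult c' B + Polynomial.smult a' A) ^ j"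
proof -
  have d1: "Polynomial.degree ([:c', a':] ^ j) \<le> j" for j
    using degree_power_le[of "[:c', a':]" j] by (simp split: if_splits)
  have d2: "Polynomial.degree ([:c, a:] ^ i * [:c', a':] ^ j) \<le> i + j" for i j
  proof -
    have "Polynomial.degree ([:c, a:] ^ i) \<le> i"
      using degree_power_le[of "[:c, a:]" i] by (simp split: if_splits)
    then show ?thesis using degree_mult_le[of "[:c, a:] ^ i" "[:c', a':] ^ j"] d1[of j] by linarith
  qed
  have j: "homog j ([:c', a':] ^ j) A B = (Polynomial.smult c' B + Polynomial.smult a' A) ^ j"
  proof (induction j)
    case (Suc j)
    then show ?case using homog_linear[OF d1[of j], of c' a' A B] by simp
  qed (simp add: homog_def)
  show ?thesis
  proof (induction i)
    case (Suc i)
    then show ?case using homog_linear[OF d2[of i j], of c a A B]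
      by (simp only: add_Suc power_Suc mult.assoc)
  qed (simp add: j)
qed

text \<open>The columns of the matrix of \<open>N\<close> are products of linear forms, and applying
  \<open>M\<close> substitutes linear forms into them. Substitution is compatible with products,
  which is \<open>homog_powers\<close>.\<close>

lemma sym_entry_mult:
  assumes "i \<le> n"
  shows "(\<Sum>k\<le>n. sym_entry n M j k * sym_entry n N k i) = sym_entry n (M ** N) j i"
proof -
  define A where "A = [:M $ 2 $ 1, M $ 1 $ 1:]"
  define B where "B = [:M $ 2 $ 2, M $ 1 $ 2:]"
  define P where "P = [:N $ 2 $ 1, N $ 1 $ 1:] ^ i * [:N $ 2 $ 2, N $ 1 $ 2:] ^ (n - i)"
  have "(\<Sum>k\<le>n. sym_entry n M j k * sym_entry n N k i) = Polynomial.coeff (homog n P A B) j"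
    by (simp add: homog_def Polynomial.coeff_sum sym_entry_def A_def B_def P_def mult.commute)
  also have "homog n P A B =
    (Polynomial.smult (N $ 2 $ 1) B + Polynomial.smult (N $ 1 $ 1) A) ^ i *
    (Polynomial.smult (N $ 2 $ 2) B + Polynomial.smult (N $ 1 $ 2) A) ^ (n - i)"
    using homog_powers[of i "n - i"] assms by (simp add: P_def)
  also have "Polynomial.smult (N $ 2 $ 1) B + Polynomial.smult (N $ 1 $ 1) A = [:(M ** N) $ 2 $ 1, (M ** N) $ 1 $ 1:]"
    by (simp add: A_def B_def matrix_matrix_mult_def sum_2 algebra_simps)
  also have "Polynomial.smult (N $ 2 $ 2) B + Polynomial.smult (N $ 1 $ 2) A = [:(M ** N) $ 2 $ 2, (M ** N) $ 1 $ 2:]"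
    by (simp add: A_def B_def matrix_matrix_mult_def sum_2 algebra_simps)
  finally show ?thesis by (simp add: sym_entry_def)
qed

lemma sym_entry_upper_top: "i \<le> n \<Longrightarrow> sym_entry n (mat2 1 c 0 1) n i = c ^ (n - i)"
proof -
  assume i: "i \<le> n"
  have "sym_entry n (mat2 1 c 0 1) n i = Polynomial.coeff (Polynomial.monom 1 i * [:1, c:] ^ (n - i)) (i + (n - i))"
    using i by (simp add: sym_entry_def flip: monom_altdef) (simp add: monom_altdef)
  also have "\<dots> = Polynomial.coeff ([:1, c:] ^ (n - i)) (n - i)"
    by (simp add: coeff_monom_mult)
  also have "\<dots> = c ^ (n - i)" by (simp add: coeff_linear_poly_power)
  finally show ?thesis .
qed

lemma sym_entry_monomial_top: "sym_entry n (mat2 a b 0 d) j n = (if j = n then a ^ n else 0)"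
proof -
  have "[:0, a:] = Polynomial.monom a 1" by (simp add: monom_altdef)
  then have "[:0, a:] ^ n = Polynomial.monom (a ^ n) n" by (simp add: monom_power)
  then show ?thesis by (simp add: sym_entry_def)
qed

lemma sym_entry_lower_top: "sym_entry n (mat2 1 0 c 1) j n = of_nat (n choose j) * c ^ (n - j)"
  by (cases "j \<le> n") (simp_all add: sym_entry_def coeff_linear_poly_power coeff_eq_0 degree_linear_power binomial_eq_0)

lemma sym_entry_lower_row:
  "i \<le> n \<Longrightarrow> sym_entry n (mat2 a 0 c d) n i = (if i = n then a ^ n else 0)"
proof -
  assume i: "i \<le> n"
  have "[:d, 0:] ^ (n - i) = [:d ^ (n - i):]" by (simp add: poly_const_pow)
  then have e: "sym_entry n (mat2 a 0 c d) n i = Polynomial.coeff ([:c, a:] ^ i) n * d ^ (n - i)"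
    by (simp add: sym_entry_def mult.commute)
  show ?thesis
  proof (cases "i = n")
    case True
    then show ?thesis using e by (simp add: coeff_linear_poly_power)
  next
    case False
    have "Polynomial.degree ([:c, a:] ^ i) \<le> i"
      using degree_power_le[of "[:c, a:]" i] by (simp split: if_splits)
    then show ?thesis using False i by (simp add: e coeff_eq_0)
  qed
qed

lemma sym_entry_weyl_top: "sym_entry n (mat2 0 b 1 0) j n = (if j = 0 then 1 else 0)"
  by (simp add: sym_entry_def one_pCons[symmetric])

lemma sym_entry_one: "i \<le> n \<Longrightarrow> sym_entry n (mat 1) j i = (if j = i then 1 else 0)"
proof -
  have "[:0, 1:] ^ i = Polynomial.monom (1 :: 'a) i" by (simp add: monom_altdef)
  then show ?thesis by (simp add: sym_entry_def mat_1_mat2 one_pCons[symmetric])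
qed

lemma sum_delta_mult: "finite A \<Longrightarrow> J \<in> A \<Longrightarrow> (\<Sum>I\<in>A. (if I = J then c else 0) * g I) = c * (g J :: 'a::semiring_0)"
proof -
  assume A: "finite A" "J \<in> A"
  have "(\<Sum>I\<in>A. (if I = J then c else 0) * g I) = (\<Sum>I\<in>A. if I = J then c * g I else 0)"
    by (rule sum.cong) auto
  then show ?thesis using A by simp
qed

text \<open>The pure tensor of the vectors \<open>e_1^(r_i)\<close>. It will span the invariants of
  the upper unipotents, and the coordinate at the same index \<open>r\<close> will describe the
  coinvariants of the lower ones. This makes \<open>j_r\<close> the identity in coordinates.\<close>

definition vtop :: "nat list \<Rightarrow> 'e::field tvec" where
  "vtop r = (\<lambda>J. if J = r then 1 else 0)"

lemma vtop_top [simp]: "vtop r r = 1"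
  by (simp add: vtop_def)

lemma vtop_other: "J \<noteq> r \<Longrightarrow> vtop r J = 0"
  by (simp add: vtop_def)

definition vbase :: "nat list \<Rightarrow> 'e::field tvec" where
  "vbase K = (\<lambda>J. if J = K then 1 else 0)"

lemma V_closed: "v \<in> V r \<Longrightarrow> v' \<in> V r \<Longrightarrow> v + v' \<in> V r" "v \<in> V r \<Longrightarrow> vscale c v \<in> V r" "0 \<in> V r"
  "v \<in> V r \<Longrightarrow> v' \<in> V r \<Longrightarrow> v - v' \<in> V r"
  by (auto simp: V_def vscale_def)

lemma V_sum: "(\<And>i. i \<in> A \<Longrightarrow> g i \<in> V r) \<Longrightarrow> sum g A \<in> V r"
  by (induction A rule: infinite_finite_induct) (auto simp: V_closed)

lemma vbase_V: "K \<in> index_set r \<Longrightarrow> vbase K \<in> V r"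
  by (auto simp: V_def vbase_def)

lemma vtop_V: "vtop r \<in> V r"
  using index_set_self by (auto simp: V_def vtop_def)

lemma vtop_vbase: "vtop = vbase"
  by (simp add: vtop_def vbase_def fun_eq_iff)

lemma sum_fun_apply: "(sum g A) x = (\<Sum>i\<in>A. g i x)"
  by (induction A rule: infinite_finite_induct) auto

lemma V_expand: "v \<in> V r \<Longrightarrow> v = (\<Sum>K\<in>index_set r. vscale (v K) (vbase K))"
proof
  fix J assume v: "v \<in> V r"
  show "v J = (\<Sum>K\<in>index_set r. vscale (v K) (vbase K)) J"
  proof (cases "J \<in> index_set r")
    case True
    then show ?thesis
      using finite_index_set by (simp add: sum_fun_apply vscale_def vbase_def if_distrib[of "(*) _"] cong: if_cong)
  next
    case False
    have "(\<Sum>K\<in>index_set r. vscale (v K) (vbase K)) J = 0"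
      unfolding sum_fun_apply using False by (intro sum.neutral) (auto simp: vscale_def vbase_def)
    then show ?thesis using v False by (simp add: V_def)
  qed
qed

lemma vscale_simps [simp]:
  "vscale 1 v = v" "vscale 0 v = 0" "vscale c 0 = 0" "vscale a (vscale b v) = vscale (a * b) v"
  by (auto simp: vscale_def fun_eq_iff)

lemma vscale_add: "vscale c (v + v') = vscale c v + vscale c v'" "vscale (a + b) v = vscale a v + vscale b v"
  by (auto simp: vscale_def fun_eq_iff algebra_simps)

lemma vscale_sum: "vscale c (sum g A) = (\<Sum>i\<in>A. vscale c (g i))"
  by (induction A rule: infinite_finite_induct)
    (simp_all only: sum.infinite sum.empty sum.insert vscale_simps vscale_add simp_thms if_True if_False)

lemma vscale_apply: "vscale c v J = c * v J"
  by (simp add: vscale_def)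

text \<open>The torus element \<open>diag (a, 1/a)\<close> acts on the top vector by the power
  \<open>a ^ wt p r\<close>. For restricted weights this is a base \<open>p\<close> expansion, so
  \<open>wt\<close> is injective with values below \<open>q\<close>.\<close>

definition wt :: "nat \<Rightarrow> nat list \<Rightarrow> nat" where
  "wt p r = (\<Sum>i<length r. r ! i * p ^ i)"

lemma wt_Cons: "wt p (x # r) = x + p * wt p r"
  by (simp add: wt_def sum.lessThan_Suc_shift sum_distrib_left mult_ac del: sum.lessThan_Suc)

lemma wt_Nil: "wt p [] = 0"
  by (simp add: wt_def)

lemma wt_bound: "set r \<subseteq> {..<p} \<Longrightarrow> wt p r < p ^ length r"
proof (induction r)
  case (Cons x r)
  then have "wt p r + 1 \<le> p ^ length r" "x < p" by auto
  then have "x + p * wt p r < p * (wt p r + 1)" by simp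
  also have "\<dots> \<le> p * p ^ length r" using \<open>wt p r + 1 \<le> _\<close> by (intro mult_left_mono) auto
  finally show ?case by (simp add: wt_Cons)
qed (simp add: wt_Nil)

lemma wt_inj:
  assumes "length r = length s" "set r \<subseteq> {..<p}" "set s \<subseteq> {..<p}" "wt p r = wt p s"
  shows "r = s"
  using assms
proof (induction r s rule: list_induct2)
  case (Cons x r y s)
  then have xy: "x < p" "y < p" and e: "x + p * wt p r = y + p * wt p s" by (auto simp: wt_Cons)
  then have "(x + p * wt p r) mod p = (y + p * wt p s) mod p" "(x + p * wt p r) div p = (y + p * wt p s) div p" by simp_all
  then have "x = y" "wt p r = wt p s" using xy by simp_all
  then show ?case using Cons by auto
qed simp

lemma wt_replicate_0: "wt p (replicate n 0) = 0"
  by (induction n) (auto simp: wt_Nil wt_Cons)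

lemma wt_replicate: "p > 0 \<Longrightarrow> wt p (replicate n (p - 1)) = p ^ n - 1"
proof (induction n)
  case (Suc n)
  have "p ^ n > 0" using Suc by simp
  then obtain m where "p ^ n = Suc m" using gr0_implies_Suc by blast
  then have "p - 1 + p * (p ^ n - 1) = p * p ^ n - 1" using Suc(2) by simp
  then show ?case using Suc by (simp add: wt_Cons)
qed (simp add: wt_Nil)

lemma wt_eq_0_iff: "p > 0 \<Longrightarrow> wt p r = 0 \<longleftrightarrow> r = replicate (length r) 0"
  by (induction r) (auto simp: wt_Nil wt_Cons)

lemma wt_diff:
  assumes "J \<in> index_set r"
  shows "(\<Sum>i<length r. (r ! i - J ! i) * p ^ i) = wt p r - wt p J" "wt p J \<le> wt p r"
proof -
  have le: "J ! i * p ^ i \<le> r ! i * p ^ i" if "i < length r" for i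
    using index_set_nth[OF assms that] by simp
  then show "wt p J \<le> wt p r" unfolding wt_def index_set_length[OF assms] by (intro sum_mono) auto
  show "(\<Sum>i<length r. (r ! i - J ! i) * p ^ i) = wt p r - wt p J"
    unfolding wt_def index_set_length[OF assms] diff_mult_distrib
    using le by (intro sum_subtractf_nat) auto
qed

section \<open>The tensor product as a representation in coordinates\<close>

context genuine_setting
begin

definition frob :: "nat \<Rightarrow> 'e^2^2 \<Rightarrow> 'e^2^2" where
  "frob i M = (\<chi> a b. (M $ a $ b) ^ (p ^ i))"

lemma frob_mat2: "frob i (mat2 a b c d) = mat2 (a ^ p ^ i) (b ^ p ^ i) (c ^ p ^ i) (d ^ p ^ i)"
  by (rule mat2_eqI) (simp_all add: frob_def)

lemma p_pos: "p > 0" using prime_p prime_gt_0_nat by blast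

lemma zero_frob [simp]: "(0 :: 'e) ^ p ^ i = 0"
  using p_pos by (simp add: zero_power)

lemma frob_mult: "frob i (M ** N) = frob i M ** frob i N"
proof -
  have add: "(x + y) ^ p ^ i = x ^ p ^ i + y ^ p ^ i" for x y :: 'e
    using freshmans_dream'[of "p ^ i" i x y] prime_p char_E by simp
  obtain a b c d where M: "M = mat2 a b c d" by (rule mat2_cases)
  obtain a' b' c' d' where N: "N = mat2 a' b' c' d'" by (rule mat2_cases)
  show ?thesis by (simp add: M N frob_mat2 add power_mult_distrib)
qed

definition tens :: "nat list \<Rightarrow> 'e^2^2 \<Rightarrow> nat list \<Rightarrow> nat list \<Rightarrow> 'e" where
  "tens r M J I = (\<Prod>i<length r. sym_entry (r ! i) (frob i M) (J ! i) (I ! i))"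

definition act :: "nat list \<Rightarrow> 'e^2^2 \<Rightarrow> 'e tvec \<Rightarrow> 'e tvec" where
  "act r M v = tensor_act p r M v"

lemma act_eq: "act r M v = (\<lambda>J. if J \<in> index_set r then \<Sum>I\<in>index_set r. tens r M J I * v I else 0)"
  unfolding act_def tensor_act_def tens_def frob_def ..

lemma tens_zero: "i < length r \<Longrightarrow> sym_entry (r ! i) (frob i M) (J ! i) (I ! i) = 0 \<Longrightarrow> tens r M J I = 0"
  by (auto simp: tens_def)

lemma index_set_neq: "I \<in> index_set r \<Longrightarrow> J \<in> index_set r \<Longrightarrow> I \<noteq> J \<Longrightarrow> \<exists>i<length r. I ! i \<noteq> J ! i"
  using index_set_eqI by blast

lemma tens_mult:
  assumes "I \<in> index_set r"
  shows "(\<Sum>K\<in>index_set r. tens r M J K * tens r N K I) = tens r (M ** N) J I"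
proof -
  have "(\<Sum>K\<in>index_set r. tens r M J K * tens r N K I) = (\<Sum>K\<in>index_set r. \<Prod>i<length r.
      (\<lambda>i k. sym_entry (r ! i) (frob i M) (J ! i) k * sym_entry (r ! i) (frob i N) k (I ! i)) i (K ! i))"
    by (simp add: tens_def prod.distrib)
  also have "\<dots> = (\<Prod>i<length r. \<Sum>k\<le>r ! i. sym_entry (r ! i) (frob i M) (J ! i) k * sym_entry (r ! i) (frob i N) k (I ! i))"
    by (rule sum_index_set_prod)
  also have "\<dots> = tens r (M ** N) J I"
    unfolding tens_def frob_mult using index_set_nth[OF assms]
    by (intro prod.cong refl sym_entry_mult) auto
  finally show ?thesis .
qed

lemma act_mult: "act r (M ** N) v = act r M (act r N v)"
proof
  fix J
  show "act r (M ** N) v J = act r M (act r N v) J"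
  proof (cases "J \<in> index_set r")
    case True
    have "act r M (act r N v) J = (\<Sum>K\<in>index_set r. \<Sum>I\<in>index_set r. tens r M J K * tens r N K I * v I)"
      using True by (simp add: act_eq sum_distrib_left mult.assoc)
    also have "\<dots> = (\<Sum>I\<in>index_set r. (\<Sum>K\<in>index_set r. tens r M J K * tens r N K I) * v I)"
      by (subst sum.swap) (simp add: sum_distrib_right)
    also have "\<dots> = act r (M ** N) v J" using True by (simp add: act_eq tens_mult)
    finally show ?thesis ..
  qed (simp add: act_eq)
qed

lemma act_V: "act r M v \<in> V r"
  by (simp add: act_eq V_def)

lemma act_add: "act r M (v + v') = act r M v + act r M v'"
  by (auto simp: act_eq fun_eq_iff distrib_left sum.distrib)

lemma act_scale: "act r M (vscale c v) = vscale c (act r M v)"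
  by (auto simp: act_eq fun_eq_iff vscale_def sum_distrib_left mult_ac)

lemma act_0: "act r M 0 = 0"
  by (auto simp: act_eq fun_eq_iff)

lemma act_one:
  assumes "v \<in> V r"
  shows "act r (mat 1) v = v"
proof
  fix J
  have f1: "frob i (mat 1) = mat 1" for i using p_pos by (simp add: mat_1_mat2 frob_mat2)
  show "act r (mat 1) v J = v J"
  proof (cases "J \<in> index_set r")
    case True
    have "tens r (mat 1) J I = (if I = J then 1 else 0)" if "I \<in> index_set r" for I
    proof (cases "I = J")
      case True
      then show ?thesis using index_set_nth[OF that] by (simp add: tens_def f1 sym_entry_one)
    next
      case False
      from index_set_neq[OF that True False] obtain i where i: "i < length r" "I ! i \<noteq> J ! i" by blast
      then show ?thesis using False index_set_nth[OF that i(1)]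
        by (simp add: tens_zero[OF i(1)] f1 sym_entry_one)
    qed
    then have "act r (mat 1) v J = (\<Sum>I\<in>index_set r. (if I = J then 1 else 0) * v I)"
      using True by (simp add: act_eq)
    also have "\<dots> = v J" using sum_delta_mult[OF finite_index_set True, of 1 v] by simp
    finally show ?thesis .
  next
    case False
    then show ?thesis using assms by (simp add: act_eq V_def)
  qed
qed

definition uu :: "'e \<Rightarrow> 'e^2^2" where "uu c = mat2 1 c 0 1"
definition ll :: "'e \<Rightarrow> 'e^2^2" where "ll c = mat2 1 0 c 1"
definition dd :: "'e \<Rightarrow> 'e^2^2" where "dd a = mat2 a 0 0 (inverse a)"
definition ww :: "'e^2^2" where "ww = mat2 0 (- 1) 1 0"

lemma power_wt: "(\<Prod>i<n. (c ^ p ^ i) ^ (g i)) = c ^ (\<Sum>i<n. g i * p ^ i)" for c :: 'e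
  by (simp add: power_sum mult.commute flip: power_mult)

text \<open>The orbit under the upper unipotents is encoded in a polynomial in \<open>c\<close>
  whose coefficients are the coordinates of \<open>v\<close> themselves, without binomial
  factors.\<close>

lemma top_upper:
  "act r (uu c) v r = (\<Sum>I\<in>index_set r. v I * c ^ (wt p r - wt p I))"
proof -
  have "tens r (uu c) r I = c ^ (wt p r - wt p I)" if "I \<in> index_set r" for I
  proof -
    have "tens r (uu c) r I = (\<Prod>i<length r. (c ^ p ^ i) ^ (r ! i - I ! i))"
      unfolding tens_def uu_def frob_mat2 using index_set_nth[OF that] p_pos
      by (intro prod.cong) (auto simp: sym_entry_upper_top)
    then show ?thesis using wt_diff[OF that] power_wt by simp
  qed
  then show ?thesis using index_set_self by (simp add: act_eq mult.commute)
qed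

lemma act_vtop: "act r M (vtop r) J = (if J \<in> index_set r then tens r M J r else 0)"
  using finite_index_set index_set_self
  by (simp add: act_eq vtop_def if_distrib[of "(*) _"] cong: if_cong)

lemma act_borel_vtop: "act r (mat2 a b 0 d) (vtop r) = vscale (a ^ wt p r) (vtop r)"
proof
  fix J
  show "act r (mat2 a b 0 d) (vtop r) J = vscale (a ^ wt p r) (vtop r) J"
  proof (cases "J = r")
    case True
    have "tens r (mat2 a b 0 d) r r = (\<Prod>i<length r. (a ^ p ^ i) ^ (r ! i))"
      unfolding tens_def frob_mat2 using p_pos by (intro prod.cong) (auto simp: sym_entry_monomial_top)
    then show ?thesis using True index_set_self[of r] power_wt[where g = "\<lambda>i. r ! i"]
      by (simp add: act_vtop vscale_apply wt_def)
  next
    case False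
    have "tens r (mat2 a b 0 d) J r = 0" if "J \<in> index_set r"
    proof -
      from index_set_neq[OF that index_set_self False] obtain i where i: "i < length r" "J ! i \<noteq> r ! i" by blast
      then show ?thesis by (intro tens_zero[OF i(1)]) (simp add: frob_mat2 sym_entry_monomial_top)
    qed
    then show ?thesis using False by (simp add: act_vtop vscale_apply vtop_other)
  qed
qed

lemma top_lower: "act r (mat2 a 0 c d) v r = a ^ wt p r * v r"
proof -
  have "tens r (mat2 a 0 c d) r I = (if I = r then a ^ wt p r else 0)" if "I \<in> index_set r" for I
  proof (cases "I = r")
    case True
    have "tens r (mat2 a 0 c d) r r = (\<Prod>i<length r. (a ^ p ^ i) ^ (r ! i))"
      unfolding tens_def frob_mat2 using p_pos by (intro prod.cong) (auto simp: sym_entry_lower_row)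
    then show ?thesis using True power_wt[where g = "\<lambda>i. r ! i"] by (simp add: wt_def)
  next
    case False
    from index_set_neq[OF that index_set_self False] obtain i where i: "i < length r" "I ! i \<noteq> r ! i" by blast
    then have "tens r (mat2 a 0 c d) r I = 0" using index_set_nth[OF that i(1)]
      by (intro tens_zero[OF i(1)]) (simp add: frob_mat2 sym_entry_lower_row)
    then show ?thesis using False by simp
  qed
  then have "act r (mat2 a 0 c d) v r = (\<Sum>I\<in>index_set r. (if I = r then a ^ wt p r else 0) * v I)"
    using index_set_self by (simp add: act_eq)
  then show ?thesis by (simp only: sum_delta_mult[OF finite_index_set index_set_self])
qed

lemma act_lower_vtop:
  "J \<in> index_set r \<Longrightarrow> act r (ll c) (vtop r) J = (\<Prod>i<length r. of_nat (r ! i choose J ! i)) * c ^ (wt p r - wt p J)"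
proof -
  assume J: "J \<in> index_set r"
  have "tens r (ll c) J r = (\<Prod>i<length r. of_nat (r ! i choose J ! i) * (c ^ p ^ i) ^ (r ! i - J ! i))"
    unfolding tens_def ll_def frob_mat2 using p_pos
    by (intro prod.cong) (auto simp: sym_entry_lower_top)
  then show ?thesis using J wt_diff[OF J] power_wt by (simp add: act_vtop prod.distrib)
qed

lemma act_weyl_vtop: "act r ww (vtop r) = vbase (replicate (length r) 0)"
proof
  fix J
  have z: "replicate (length r) 0 \<in> index_set r"
    by (auto simp: index_set_def list_all2_conv_all_nth)
  have f: "frob i ww = mat2 0 ((- 1) ^ p ^ i) 1 0" for i using p_pos by (simp add: ww_def frob_mat2)
  show "act r ww (vtop r) J = vbase (replicate (length r) 0) J"
  proof (cases "J = replicate (length r) 0")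
    case True
    then show ?thesis using z by (simp add: act_vtop vbase_def tens_def f sym_entry_weyl_top)
  next
    case False
    have "tens r ww J r = 0" if "J \<in> index_set r"
    proof -
      from index_set_neq[OF that z False] obtain i where i: "i < length r" "J ! i \<noteq> 0" by auto
      then show ?thesis by (intro tens_zero[OF i(1)]) (simp add: f sym_entry_weyl_top)
    qed
    then show ?thesis using False by (simp add: act_vtop vbase_def)
  qed
qed

section \<open>Invariants and coinvariants through polynomials on the residue field\<close>

lemma weights_index:
  assumes "r \<in> weights p f" "J \<in> index_set r"
  shows "J \<in> weights p f" "length J = f" "set J \<subseteq> {..<p}"
proof -
  have len: "length J = f" "length r = f" using assms index_set_length by (auto simp: weights_def)
  have "x \<le> p - 1" if "x \<in> set J" for x
  proof -
    from that obtain i where i: "i < length J" "x = J ! i" by (metis in_set_conv_nth)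
    have "r ! i \<in> set r" using i len by simp
    then have "r ! i \<le> p - 1" using assms(1) unfolding weights_def by fastforce
    moreover have "J ! i \<le> r ! i" using index_set_nth[OF assms(2)] i len by simp
    ultimately show ?thesis using i(2) by linarith
  qed
  then have *: "set J \<subseteq> {0..p - 1}" by auto
  then show "J \<in> weights p f" "length J = f" using len by (simp_all add: weights_def)
  show "set J \<subseteq> {..<p}"
  proof
    fix x assume "x \<in> set J"
    then have "x \<le> p - 1" using * by auto
    then show "x \<in> {..<p}" using p_pos by simp
  qed
qed

lemma weights_bound: "r \<in> weights p f \<Longrightarrow> wt p r < q" "r \<in> weights p f \<Longrightarrow> set r \<subseteq> {..<p}"
  "r \<in> weights p f \<Longrightarrow> length r = f"
  using weights_index[OF _ index_set_self] wt_bound[of r p] by (auto simp: q_def)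

lemma wt_index_inj:
  assumes "r \<in> weights p f"
  shows "inj_on (wt p) (index_set r)"
  by (intro inj_onI wt_inj) (simp_all add: weights_index[OF assms])

lemma poly_on_kappa:
  fixes P :: "'e poly"
  assumes "Polynomial.degree P < q" "\<And>c. c \<in> kappa \<Longrightarrow> poly P c = 0"
  shows "P = 0"
proof (rule ccontr)
  assume "P \<noteq> 0"
  then have "card kappa \<le> card {c. poly P c = 0}"
    using assms(2) poly_roots_finite by (intro card_mono) auto
  also have "\<dots> \<le> Polynomial.degree P" using \<open>P \<noteq> 0\<close> by (rule card_poly_roots_bound)
  finally show False using assms(1) card_kappa by simp
qed

text \<open>The exponents are pairwise distinct and below \<open>q\<close>, so no two terms can be
  mixed up on a field with \<open>q\<close> elements: a polynomial of degree below \<open>q\<close>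
  that is constant there is constant as a polynomial. Invariants, coinvariants and cyclicity all
  reduce to this.\<close>

lemma constant_on_kappa:
  assumes r: "r \<in> weights p f"
    and const: "\<And>c. c \<in> kappa \<Longrightarrow> (\<Sum>I\<in>index_set r. a I * c ^ (wt p r - wt p I)) = C"
    and J: "J \<in> index_set r" "J \<noteq> r"
  shows "a J = 0"
proof -
  define P where "P = (\<Sum>I\<in>index_set r. Polynomial.monom (a I) (wt p r - wt p I)) - [:C:]"
  have "Polynomial.degree P < q"
    unfolding P_def
  proof (intro degree_diff_less degree_sum_less)
    show "Polynomial.degree (Polynomial.monom (a I) (wt p r - wt p I)) < q" for I
      using weights_bound(1)[OF r] by (intro le_less_trans[OF degree_monom_le]) auto
  qed (use q_pos in auto)
  moreover have "poly P c = 0" if "c \<in> kappa" for c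
    using const[OF that] by (simp add: P_def poly_sum poly_monom)
  ultimately have P: "P = 0" by (rule poly_on_kappa)
  have lt: "wt p J < wt p r"
    using wt_diff(2)[OF J(1), of p] wt_index_inj[OF r] J index_set_self[of r]
    by (metis inj_onD le_neq_implies_less)
  have "wt p r - wt p I = wt p r - wt p J \<longleftrightarrow> I = J" if "I \<in> index_set r" for I
  proof
    assume "wt p r - wt p I = wt p r - wt p J"
    then have "wt p I = wt p J" using wt_diff(2)[OF that, of p] wt_diff(2)[OF J(1), of p] by linarith
    then show "I = J" using inj_onD[OF wt_index_inj[OF r] _ that J(1)] by blast
  qed simp
  then have "Polynomial.coeff P (wt p r - wt p J) = (\<Sum>I\<in>index_set r. if I = J then a I else 0)"
    using lt by (simp add: P_def Polynomial.coeff_sum Polynomial.coeff_pCons split: nat.split)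
  then show ?thesis using P J(1) finite_index_set by simp
qed

lemma U_invariant:
  assumes r: "r \<in> weights p f" and v: "v \<in> V r" "\<And>c. c \<in> kappa \<Longrightarrow> act r (uu c) v = v"
  shows "v = vscale (v r) (vtop r)"
proof
  fix J
  have "(\<Sum>I\<in>index_set r. v I * c ^ (wt p r - wt p I)) = v r" if "c \<in> kappa" for c
    using v(2)[OF that] top_upper[of r c v] by simp
  from constant_on_kappa[OF r this] have "v J = 0" if "J \<in> index_set r" "J \<noteq> r" using that by blast
  then show "v J = vscale (v r) (vtop r) J" using v(1) by (auto simp: vscale_def vtop_def V_def)
qed

text \<open>The translates of the top coordinate by the upper unipotents span the dual space. Hence
  a vector, and with it an equivariant map, is determined by top coordinates alone.\<close>

lemma cyclic_functional:
  assumes r: "r \<in> weights p f" and v: "v \<in> V r" "\<And>c. c \<in> kappa \<Longrightarrow> act r (uu c) v r = 0"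
  shows "v = 0"
proof
  fix J
  have s: "(\<Sum>I\<in>index_set r. v I * c ^ (wt p r - wt p I)) = 0" if "c \<in> kappa" for c
    using v(2)[OF that] top_upper[of r c v] by simp
  have J: "v J = 0" if "J \<in> index_set r" "J \<noteq> r" for J using constant_on_kappa[OF r s] that by blast
  have "(\<Sum>I\<in>index_set r. v I * 1 ^ (wt p r - wt p I)) = v r"
    using J finite_index_set index_set_self[of r] by (simp add: sum.remove[of _ r])
  then have "v r = 0" using s[OF kappa_closed(2)] by simp
  then show "v J = 0 J" using J v(1) by (cases "J \<in> index_set r"; cases "J = r") (auto simp: V_def)
qed

lemma functional_sum:
  fixes L :: "'e tvec \<Rightarrow> 'e"
  assumes lin: "\<And>c v v'. v \<in> V r \<Longrightarrow> v' \<in> V r \<Longrightarrow> L (vscale c v + v') = c * L v + L v'"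
    and g: "\<And>i. i \<in> A \<Longrightarrow> g i \<in> V r"
  shows "L (\<Sum>i\<in>A. vscale (c i) (g i)) = (\<Sum>i\<in>A. c i * L (g i))"
  using g
proof (induction A rule: infinite_finite_induct)
  have "L (vscale 1 0 + 0) = 1 * L 0 + L 0" using V_closed(3) by (intro lin)
  then have "L 0 = L 0 + L 0" by simp
  then have "L 0 = 0" by (metis add_cancel_right_right)
  {
    case (infinite A)
    then show ?case by (simp only: sum.infinite \<open>L 0 = 0\<close> not_False_eq_True)
  next
    case empty
    show ?case by (simp only: sum.empty \<open>L 0 = 0\<close>)
  next
    case (insert x A)
    have "L (vscale (c x) (g x) + (\<Sum>i\<in>A. vscale (c i) (g i))) = c x * L (g x) + L (\<Sum>i\<in>A. vscale (c i) (g i))"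
      using insert.prems by (intro lin V_sum V_closed(2)) auto
    then show ?case using insert by (simp only: sum.insert not_False_eq_True) simp
  }
qed

text \<open>Invariance is applied to the orbit of the top vector only. It yields a polynomial in
  \<open>c\<close> whose coefficients are \<open>L\<close> of the basis vectors times products of
  binomial coefficients; these products are nonzero because the entries of the weight are below
  \<open>p\<close>.\<close>

lemma Ubar_functional:
  fixes L :: "'e tvec \<Rightarrow> 'e"
  assumes r: "r \<in> weights p f"
    and lin: "\<And>c v v'. v \<in> V r \<Longrightarrow> v' \<in> V r \<Longrightarrow> L (vscale c v + v') = c * L v + L v'"
    and inv: "\<And>c v. c \<in> kappa \<Longrightarrow> v \<in> V r \<Longrightarrow> L (act r (ll c) v) = L v"
    and v: "v \<in> V r"
  shows "L v = L (vtop r) * (v r :: 'e)"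
proof -
  define b where "b J = (\<Prod>i<length r. (of_nat (r ! i choose J ! i) :: 'e))" for J
  have ex: "L u = (\<Sum>K\<in>index_set r. u K * L (vbase K))" if "u \<in> V r" for u
    using functional_sum[of r L "index_set r" vbase u, OF lin] vbase_V V_expand[OF that] by metis
  have "(\<Sum>K\<in>index_set r. (b K * L (vbase K)) * c ^ (wt p r - wt p K)) = L (vtop r)" if "c \<in> kappa" for c
  proof -
    have "L (vtop r) = L (act r (ll c) (vtop r))" using inv[OF that vtop_V] by simp
    also have "\<dots> = (\<Sum>K\<in>index_set r. act r (ll c) (vtop r) K * L (vbase K))" by (rule ex[OF act_V])
    also have "\<dots> = (\<Sum>K\<in>index_set r. (b K * L (vbase K)) * c ^ (wt p r - wt p K))"
      by (rule sum.cong) (simp_all add: act_lower_vtop b_def mult_ac)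
    finally show ?thesis ..
  qed
  from constant_on_kappa[OF r this]
  have bJ: "b J * L (vbase J) = 0" if "J \<in> index_set r" "J \<noteq> r" for J using that by blast
  \<comment> \<open>Each binomial coefficient divides the factorial of a number below
    \<open>p\<close>.\<close>
  have "b J \<noteq> 0" if "J \<in> index_set r" for J
  proof -
    have "(of_nat (r ! i choose J ! i) :: 'e) \<noteq> 0" if i: "i < length r" for i
    proof
      assume "(of_nat (r ! i choose J ! i) :: 'e) = 0"
      then have "p dvd (r ! i choose J ! i)" by (simp add: of_nat_eq_0_iff_char_dvd char_E)
      moreover have "(r ! i choose J ! i) dvd fact (r ! i)"
        using index_set_nth[OF \<open>J \<in> _\<close> i] binomial_fact_lemma by (metis dvd_triv_right)
      ultimately have "p dvd fact (r ! i)" by (rule dvd_trans)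
      then have "p \<le> r ! i" using prime_p by (simp add: prime_dvd_fact_iff)
      moreover have "r ! i \<in> set r" using i by simp
      ultimately show False using weights_bound(2)[OF r] by auto
    qed
    then show ?thesis by (simp add: b_def)
  qed
  then have z: "L (vbase J) = 0" if "J \<in> index_set r" "J \<noteq> r" for J using bJ that by force
  have "L v = (\<Sum>K\<in>index_set r. v K * L (vbase K))" by (rule ex[OF v])
  also have "\<dots> = v r * L (vbase r)"
    using z finite_index_set index_set_self[of r] by (simp add: sum.remove[of _ r])
  finally show ?thesis by (simp add: vtop_vbase mult.commute)
qed

subsection \<open>The genuine representations\<close>

definition redm :: "'f^2^2 \<Rightarrow> 'e^2^2" where "redm k = (\<chi> i j. red (k $ i $ j))"

lemma redm_mat2: "redm (mat2 a b c d) = mat2 (red a) (red b) (red c) (red d)"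
  by (rule mat2_eqI) (simp_all add: redm_def)

lemma sigma_reduction: "sigma r (reduction k) = act r (redm k)"
  by (simp add: sigma_def reduction_def act_def redm_def red_def fun_eq_iff)

lemma redm_mult: "k \<in> SL2_int R \<Longrightarrow> k' \<in> SL2_int R \<Longrightarrow> redm (k ** k') = redm k ** redm k'"
  by (cases k rule: mat2_cases, cases k' rule: mat2_cases)
    (simp add: SL2_int_mat2 redm_mat2 red_add red_mult R.Zmult)

abbreviation sg where "sg \<equiv> sigma_tilde"

lemma sg_eq: "sg r (k, e) v = vscale (of_int (e * theta R k)) (act r (redm k) v)"
  by (simp add: sigma_tilde_def sigma_reduction)

lemma sg_V: "sg r k v \<in> V r"
  by (cases k) (simp add: sg_eq V_closed act_V)

lemma sg_add: "sg r k (v + v') = sg r k v + sg r k v'"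
  by (cases k) (simp add: sg_eq act_add vscale_add)

lemma sg_scale: "sg r k (vscale c v) = vscale c (sg r k v)"
  by (cases k) (simp add: sg_eq act_scale mult.commute)

lemma sg_0: "sg r k 0 = 0"
  by (cases k) (simp add: sg_eq act_0)

lemma sg_sum: "sg r k (sum g A) = (\<Sum>i\<in>A. sg r k (g i))"
  by (induction A rule: infinite_finite_induct)
    (simp_all only: sum.infinite sum.empty sum.insert sg_0 sg_add simp_thms)

text \<open>The cocycle of the cover and the defect of \<open>theta\<close> are the same sign, by
  \<open>theta_mult\<close>; this is why the twist by \<open>theta\<close> gives a
  representation.\<close>

lemma sg_mult:
  assumes "k \<in> KK" "k' \<in> KK"
  shows "sg r (k \<otimes>\<^bsub>Mp\<^esub> k') v = sg r k (sg r k' v)"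
proof -
  obtain a e where k: "k = (a, e)" by (cases k)
  obtain b e' where k': "k' = (b, e')" by (cases k')
  have ab: "a \<in> SL2_int R" "b \<in> SL2_int R" using assms by (auto simp: k k' K_tilde_iff)
  have "cocyc a b * theta R (a ** b) = theta R a * theta R b"
    using theta_mult[OF ab] cocyc_pm[of a b] by auto
  then have "e * e' * cocyc a b * theta R (a ** b) = e * theta R a * (e' * theta R b)"
    by (simp add: mult.assoc mult.left_commute)
  then show ?thesis
    by (simp only: k k' mult_Mp sg_eq redm_mult[OF ab] act_mult act_scale vscale_simps of_int_mult)
qed

lemma redm_one: "redm (mat 1) = mat 1"
  by (simp add: mat_1_mat2 redm_mat2 red_1 red_0)

lemma sg_one: "v \<in> V r \<Longrightarrow> sg r \<one>\<^bsub>Mp\<^esub> v = v"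
  using theta_lifts(1)[of 0] by (simp add: one_Mp sg_eq redm_one act_one) (simp add: mat_1_mat2)

lemma sg_Up: "sg r (Up x) v = act r (uu (red x)) v"
  by (simp add: Up_def sg_eq theta_lifts redm_mat2 red_1 red_0 uu_def)

lemma sg_Lo: "sg r (Lo x) v = act r (ll (red x)) v"
  by (simp add: Lo_def sg_eq theta_lifts redm_mat2 red_1 red_0 ll_def)

lemma sg_Di: "t \<in> units \<Longrightarrow> sg r (Di t e) v = vscale (of_int e) (act r (dd (red t)) v)"
  by (simp add: Di_def sg_eq theta_lifts redm_mat2 red_0 red_inverse dd_def)

lemma sg_We: "sg r We v = act r ww v"
  by (simp add: We_def sg_eq theta_lifts redm_mat2 red_1 red_0 red_uminus R.Z1 ww_def)

lemma sg_Up_vtop: "sg r (Up x) (vtop r) = vtop r"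
  by (simp add: sg_Up uu_def act_borel_vtop)

lemma sg_Di_vtop: "t \<in> units \<Longrightarrow> sg r (Di t e) (vtop r) = vscale (of_int e * red t ^ wt p r) (vtop r)"
  by (simp add: sg_Di dd_def act_borel_vtop)

lemma top_Lo: "sg r (Lo x) v r = v r"
  by (simp add: sg_Lo ll_def top_lower)

lemma top_Di: "t \<in> units \<Longrightarrow> sg r (Di t e) v r = of_int e * red t ^ wt p r * v r"
  by (simp add: sg_Di dd_def top_lower vscale_apply)

lemma uu_0: "v \<in> V r \<Longrightarrow> act r (uu 0) v = v" and ll_0: "v \<in> V r \<Longrightarrow> act r (ll 0) v = v"
  using act_one by (simp_all add: uu_def ll_def mat_1_mat2)

lemma sg_Up_small: "v \<in> V r \<Longrightarrow> red x = 0 \<Longrightarrow> sg r (Up x) v = v"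
  and sg_Lo_small: "v \<in> V r \<Longrightarrow> red x = 0 \<Longrightarrow> sg r (Lo x) v = v"
  by (simp_all add: sg_Up sg_Lo uu_0 ll_0)

subsection \<open>Coinvariants and the operator \<open>rho\<close>\<close>

lemma emb_carrier: "emb ` carrier (residue_field R) = kappa"
  by (simp add: kappa_def red_image)

lemma emb_zero: "emb \<zero>\<^bsub>residue_field R\<^esub> = 0"
proof -
  have "\<zero>\<^bsub>residue_field R\<^esub> = max_ideal R" by (simp add: residue_field_def FactRing_def)
  moreover have "max_ideal R = max_ideal R +>\<^bsub>integers_ring R\<^esub> 0" by (subst coset_eq) (simp add: max_ideal_eq)
  ultimately show ?thesis using red_0 by (simp add: red_def)
qed

lemma emb_one: "emb \<one>\<^bsub>residue_field R\<^esub> = 1"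
  using ring_hom_one[OF emb_hom] by simp

lemma emb_mat2: "(\<chi> i j. emb (mat2 a b c d $ i $ j)) = mat2 (emb a) (emb b) (emb c) (emb d)"
  by (rule mat2_eqI) simp_all

lemma sigma_U: "sigma r (mat2 \<one>\<^bsub>residue_field R\<^esub> x \<zero>\<^bsub>residue_field R\<^esub> \<one>\<^bsub>residue_field R\<^esub>) = act r (uu (emb x))"
  by (simp add: sigma_def emb_mat2 emb_zero emb_one uu_def act_def fun_eq_iff)

lemma sigma_Ubar: "sigma r (mat2 \<one>\<^bsub>residue_field R\<^esub> \<zero>\<^bsub>residue_field R\<^esub> x \<one>\<^bsub>residue_field R\<^esub>) = act r (ll (emb x))"
  by (simp add: sigma_def emb_mat2 emb_zero emb_one ll_def act_def fun_eq_iff)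

lemma invariants_eq: "r \<in> weights p f \<Longrightarrow> invariants r = {vscale c (vtop r) | c. True}"
proof -
  assume r: "r \<in> weights p f"
  have "invariants r = {v \<in> V r. \<forall>c\<in>kappa. act r (uu c) v = v}"
    unfolding invariants_def U_k_def emb_carrier[symmetric] by (auto simp: sigma_U)
  also have "\<dots> = {vscale c (vtop r) | c. True}"
  proof (intro equalityI subsetI)
    fix v assume "v \<in> {v \<in> V r. \<forall>c\<in>kappa. act r (uu c) v = v}"
    then have "v = vscale (v r) (vtop r)" using U_invariant[OF r] by blast
    then show "v \<in> {vscale c (vtop r) | c. True}" by blast
  next
    fix v :: "'e tvec" assume "v \<in> {vscale c (vtop r) | c. True}"
    then obtain c where v: "v = vscale c (vtop r)" by blast
    show "v \<in> {v \<in> V r. \<forall>c\<in>kappa. act r (uu c) v = v}"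
      unfolding v by (simp add: V_closed(2)[OF vtop_V] act_scale uu_def act_borel_vtop)
  qed
  finally show ?thesis .
qed

text \<open>The span of the differences is the kernel of the top coordinate. It is contained in the
  kernel because lower unipotents preserve that coordinate. Conversely, a vector outside the span is
  detected by a linear functional that vanishes on the span; such a functional is invariant, hence a
  multiple of the top coordinate.\<close>

lemma coinv_rel_iff:
  assumes r: "r \<in> weights p f"
  shows "(v, v') \<in> coinv_rel r \<longleftrightarrow> v \<in> V r \<and> v' \<in> V r \<and> v r = v' r"
proof -
  interpret vs: vector_space "vscale :: 'e \<Rightarrow> 'e tvec \<Rightarrow> 'e tvec" by (rule vector_space_vscale)
  define S where "S = {act r (ll c) x - x | c x. c \<in> kappa \<and> x \<in> V r}"
  have S: "{sigma r u x - x | u x. u \<in> Ubar_k \<and> x \<in> V r} = S"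
  proof (intro equalityI subsetI)
    fix t assume "t \<in> {sigma r u x - x | u x. u \<in> Ubar_k \<and> x \<in> V r}"
    then obtain y x where "y \<in> carrier (residue_field R)" "x \<in> V r" "t = act r (ll (emb y)) x - x"
      unfolding Ubar_k_def sigma_Ubar[symmetric] by blast
    then show "t \<in> S" unfolding S_def emb_carrier[symmetric] by blast
  next
    fix t assume "t \<in> S"
    then obtain y x where "y \<in> carrier (residue_field R)" "x \<in> V r" "t = act r (ll (emb y)) x - x"
      unfolding S_def emb_carrier[symmetric] by blast
    then show "t \<in> {sigma r u x - x | u x. u \<in> Ubar_k \<and> x \<in> V r}"
      unfolding Ubar_k_def sigma_Ubar[symmetric] by blast
  qed
  have sub: "u \<in> V r \<and> u r = 0" if "u \<in> vs.span S" for u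
    using that
  proof (induction rule: vs.span_induct_alt)
    case (step c x y)
    then have x: "x \<in> V r" "x r = 0" by (auto simp: S_def V_closed act_V ll_def top_lower)
    have y: "y \<in> V r" "y r = 0" using step by auto
    have "vscale c x + y \<in> V r" by (rule V_closed(1)[OF V_closed(2)[OF x(1)] y(1)])
    moreover have "(vscale c x + y) r = 0" using x y by (simp add: vscale_apply)
    ultimately show ?case by blast
  qed (simp add: V_def)
  have sup: "u \<in> vs.span S" if u: "u \<in> V r" "u r = 0" for u
  proof (rule ccontr)
    assume u': "u \<notin> vs.span S"
    obtain B where B: "vs.independent B" "vs.span B = vs.span S"
      using vs.basis_exists[of "vs.span S"] by (metis vs.span_subspace vs.subspace_span)
    have "vs.independent (insert u B)" using B u' by (simp add: vs.independent_insert)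
    interpret vp: vector_space_pair "vscale :: 'e \<Rightarrow> 'e tvec \<Rightarrow> 'e tvec" "(*) :: 'e \<Rightarrow> 'e \<Rightarrow> 'e"
      by unfold_locales (auto simp: algebra_simps)
    obtain L where L: "Vector_Spaces.linear vscale (*) L"
      "\<forall>x\<in>insert u B. L x = (if x = u then 1 else 0)"
      using vp.linear_independent_extend[OF \<open>vs.independent (insert u B)\<close>, of "\<lambda>x. if x = u then 1 else 0"]
      by blast
    have uB: "u \<notin> B" using u' B vs.span_base by metis
    have L0: "L x = 0" if "x \<in> vs.span S" for x
    proof -
      have "L x = (0 :: 'e)" if "x \<in> vs.span B" for x
        using L(2) uB by (intro vp.linear_eq_0_on_span[OF L(1) _ that]) auto
      then show ?thesis using that B by simp
    qed
    have add: "L (x + y) = L x + L y" and scale: "L (vscale c x) = c * L x" for x y c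
      using L(1) by (simp_all add: vp.linear_add vp.linear_scale)
    have "L (act r (ll c) x) = L x" if "c \<in> kappa" "x \<in> V r" for c x
    proof -
      have "L (act r (ll c) x - x) = 0" using that by (intro L0 vs.span_base) (auto simp: S_def)
      then show ?thesis using add[of "act r (ll c) x - x" x] by simp
    qed
    then have "L u = L (vtop r) * u r"
      by (intro Ubar_functional[OF r _ _ u(1)]) (simp_all only: add scale)
    then show False using u(2) L(2) by simp
  qed
  have "(v, v') \<in> coinv_rel r \<longleftrightarrow> v \<in> V r \<and> v' \<in> V r \<and> v - v' \<in> vs.span S"
    unfolding coinv_rel_def S by simp
  then show ?thesis using sub[of "v - v'"] sup[of "v - v'"] V_closed(4) by auto
qed

lemma proj_eq_iff:
  assumes r: "r \<in> weights p f" and "v \<in> V r" "v' \<in> V r"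
  shows "proj r v = proj r v' \<longleftrightarrow> v r = v' r"
  using assms by (auto simp: proj_def coinv_rel_iff[OF r])

lemma coinvariants_proj: "coinvariants r = proj r ` V r"
  by (auto simp: coinvariants_def quotient_def proj_def)

text \<open>The inverse of \<open>j_r\<close>, followed by the inclusion of the invariants: it
  replaces a vector by its top coordinate times the top vector.\<close>

lemma section_invariants:
  assumes r: "r \<in> weights p f" and v: "v \<in> V r"
  shows "inv_into (invariants r) (proj r) (proj r v) = vscale (v r) (vtop r)"
proof -
  have "inj_on (proj r) (invariants r)"
    by (auto simp: inj_on_def invariants_eq[OF r] proj_eq_iff[OF r] V_closed(2)[OF vtop_V] vscale_apply)
  moreover have "proj r v = proj r (vscale (v r) (vtop r))"
    using v by (simp add: proj_eq_iff[OF r] V_closed(2)[OF vtop_V] vscale_apply)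
  moreover have "vscale (v r) (vtop r) \<in> invariants r" by (auto simp: invariants_eq[OF r])
  ultimately show ?thesis by (simp add: inv_into_f_f)
qed

end

section \<open>The scalar of iota and the compatible pairs of weights\<close>

locale hecke_setting = genuine_setting p f Q av R w emb iota
  for p f :: nat and Q :: "'f::field_char_0 set" and av R w
    and emb :: "'f set \<Rightarrow> 'e::field" and iota +
  assumes coinv: coinv_isomorphism
begin

abbreviation rz where "rz \<equiv> replicate f 0"
abbreviation rm where "rm \<equiv> replicate f (p - 1)"

lemma rz_weights: "rz \<in> weights p f" and rm_weights: "rm \<in> weights p f"
  by (auto simp: weights_def)

lemma rz_neq_rm: "rz \<noteq> rm"
  using f_pos prime_gt_1_nat[OF prime_p] by (auto simp: replicate_eq_replicate)

text \<open>Both spaces of coinvariants are lines with the top coordinate as coordinate, so a linear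
  bijection between them is multiplication by a nonzero scalar.\<close>

lemma iota_scalar: "\<exists>c0. c0 \<noteq> 0 \<and> (\<forall>v\<in>V rz. iota (proj rz v) = proj rm (vscale (c0 * v rz) (vtop rm)))"
proof -
  have bij: "bij_betw iota (coinvariants rz) (coinvariants rm)"
    and lin: "\<And>v v' x x' c. v \<in> V rz \<Longrightarrow> v' \<in> V rz \<Longrightarrow> x \<in> V rm \<Longrightarrow> x' \<in> V rm \<Longrightarrow>
      iota (proj rz v) = proj rm x \<Longrightarrow> iota (proj rz v') = proj rm x' \<Longrightarrow>
      iota (proj rz (vscale c v + v')) = proj rm (vscale c x + x')"
    using coinv unfolding coinv_isomorphism_def Let_def by blast+
  have ex: "\<exists>x\<in>V rm. iota (proj rz v) = proj rm x" if "v \<in> V rz" for v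
    using bij that unfolding bij_betw_def coinvariants_proj by blast
  obtain x where x: "x \<in> V rm" "iota (proj rz (vtop rz)) = proj rm x" using ex vtop_V by blast
  \<comment> \<open>Linearity is given for expressions \<open>c v + v'\<close> with chosen
    representatives, so that \<open>iota\<close> maps zero to zero has to be derived from the case
    \<open>v = v' = 0\<close>.\<close>
  obtain x' where x': "x' \<in> V rm" "iota (proj rz 0) = proj rm x'" using ex V_closed(3) by blast
  have "iota (proj rz (vscale 1 0 + 0)) = proj rm (vscale 1 x' + x')"
    using V_closed(3) x' by (intro lin)
  then have "proj rm x' = proj rm (x' + x')" using x'(2) by simp
  then have "x' rm = x' rm + x' rm"
    using proj_eq_iff[OF rm_weights x'(1) V_closed(1)[OF x'(1) x'(1)]] by simp
  then have x'0: "x' rm = 0" by (metis add_cancel_right_right)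
  have val: "iota (proj rz v) = proj rm (vscale (x rm * v rz) (vtop rm))" if v: "v \<in> V rz" for v
  proof -
    have "proj rz v = proj rz (vscale (v rz) (vtop rz) + 0)"
      using v V_closed(2)[OF vtop_V[of rz], of "v rz"] by (subst proj_eq_iff[OF rz_weights]) (auto simp: vscale_apply)
    then have "iota (proj rz v) = proj rm (vscale (v rz) x + x')"
      using lin[OF vtop_V V_closed(3) x(1) x'(1) x(2) x'(2)] by simp
    also have "\<dots> = proj rm (vscale (x rm * v rz) (vtop rm))"
      using V_closed(1)[OF V_closed(2)[OF x(1)] x'(1)] V_closed(2)[OF vtop_V[of rm]] x'0
      by (subst proj_eq_iff[OF rm_weights]) (auto simp: vscale_apply)
    finally show ?thesis .
  qed
  have "x rm \<noteq> 0"
  proof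
    assume "x rm = 0"
    then have "iota (proj rz (vtop rz)) = iota (proj rz 0)"
      using val[OF vtop_V] val[OF V_closed(3)] by simp
    then have "proj rz (vtop rz) = proj rz 0"
      using bij vtop_V V_closed(3) unfolding bij_betw_def coinvariants_proj by (metis imageI inj_onD)
    then show False using proj_eq_iff[OF rz_weights vtop_V V_closed(3)] by simp
  qed
  then show ?thesis using val by blast
qed

definition c0 :: 'e where
  "c0 = (SOME c0. c0 \<noteq> 0 \<and> (\<forall>v\<in>V rz. iota (proj rz v) = proj rm (vscale (c0 * v rz) (vtop rm))))"

lemma c0: "c0 \<noteq> 0" "v \<in> V rz \<Longrightarrow> iota (proj rz v) = proj rm (vscale (c0 * v rz) (vtop rm))"
  using someI_ex[OF iota_scalar] unfolding c0_def[symmetric] by blast+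

text \<open>The pairs on which the units of \<open>R\<close> act by the same character of the torus:
  see \<open>compatible_power\<close> and \<open>incompatible_power\<close>.\<close>

definition compatible :: "nat list \<Rightarrow> nat list \<Rightarrow> bool" where
  "compatible r s \<longleftrightarrow> r \<in> weights p f \<and> s \<in> weights p f \<and> (r = s \<or> {r, s} = {rz, rm})"

text \<open>The factor by which \<open>rho r s\<close> maps the top vector of \<open>r\<close> to
  that of \<open>s\<close>; meaningful for compatible pairs.\<close>

definition kap :: "nat list \<Rightarrow> nat list \<Rightarrow> 'e" where
  "kap r s = (if r = s then 1 else if r = rz then c0 else inverse c0)"

lemma kap_nonzero: "kap r s \<noteq> 0"
  using c0 by (simp add: kap_def)

lemma kap_mult:
  assumes "compatible r s" "compatible s t"
  shows "kap r s * kap s t = kap r t" "compatible r t"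
  using assms c0 rz_neq_rm by (auto simp: compatible_def kap_def doubleton_eq_iff)

lemma rho_eq:
  assumes c: "compatible r s" and v: "v \<in> V r"
  shows "rho r s v = vscale (kap r s * v r) (vtop s)"
proof -
  have rs: "r \<in> weights p f" "s \<in> weights p f" using c by (auto simp: compatible_def)
  have "iota_map r s (proj r v) = proj s (vscale (kap r s * v r) (vtop s))"
  proof (cases "r = s")
    case True
    then show ?thesis using v
      by (simp add: iota_map_def kap_def proj_eq_iff[OF rs(2)] V_closed(2)[OF vtop_V] vscale_apply)
  next
    case False
    then consider "r = rz" "s = rm" | "r = rm" "s = rz" using c by (auto simp: compatible_def doubleton_eq_iff)
    then show ?thesis
    proof cases
      case 1
      then show ?thesis using v c0(2)[of v] rz_neq_rm by (simp add: iota_map_def kap_def)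
    next
      case 2
      have bij: "bij_betw iota (coinvariants rz) (coinvariants rm)"
        using coinv unfolding coinv_isomorphism_def Let_def by blast
      define u where "u = vscale (inverse c0 * v rm) (vtop rz :: 'e tvec)"
      have u: "u \<in> V rz" unfolding u_def by (rule V_closed(2)[OF vtop_V])
      have "iota (proj rz u) = proj rm v"
      proof -
        have "c0 * u rz = v rm" using c0(1) by (simp add: u_def vscale_apply)
        moreover have "proj rm (vscale (v rm) (vtop rm)) = proj rm v"
          using 2 v by (subst proj_eq_iff[OF rm_weights V_closed(2)[OF vtop_V]]) (auto simp: vscale_apply)
        ultimately show ?thesis using c0(2)[OF u] by metis
      qed
      then have "inv_into (coinvariants rz) iota (proj rm v) = proj rz u"
        using bij u unfolding bij_betw_def coinvariants_proj by (metis imageI inv_into_f_f)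
      then show ?thesis using 2 rz_neq_rm by (simp add: iota_map_def kap_def u_def)
    qed
  qed
  then show ?thesis
    using section_invariants[OF rs(2) V_closed(2)[OF vtop_V]] by (simp add: rho_def vscale_apply)
qed

lemma compatible_power:
  assumes "compatible r s" "c \<in> kappa" "c \<noteq> 0"
  shows "c ^ wt p r = c ^ wt p s"
  using assms kappa_fermat wt_replicate_0[of p f] wt_replicate[OF p_pos, of f]
  by (auto simp: compatible_def doubleton_eq_iff q_def)

text \<open>Equal characters mean that the difference \<open>n\<close> of the exponents satisfies
  \<open>c ^ n = 1\<close> on all nonzero residues. Both exponents are below \<open>q\<close>, so
  \<open>n\<close> is 0, or \<open>n = q - 1\<close> and the exponents are \<open>0\<close> and
  \<open>q - 1\<close>, which is the exceptional pair.\<close>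

lemma incompatible_power:
  assumes r: "r \<in> weights p f" and s: "s \<in> weights p f"
    and eq: "\<And>c. c \<in> kappa \<Longrightarrow> c \<noteq> 0 \<Longrightarrow> c ^ wt p r = c ^ wt p s"
  shows "compatible r s"
proof -
  have *: "compatible r s \<and> compatible s r"
    if r: "r \<in> weights p f" and s: "s \<in> weights p f" and le: "wt p r \<le> wt p s"
      and eq: "\<And>c. c \<in> kappa \<Longrightarrow> c \<noteq> 0 \<Longrightarrow> c ^ wt p r = c ^ wt p s" for r s
  proof -
    define n where "n = wt p s - wt p r"
    have one: "c ^ n = 1" if "c \<in> kappa" "c \<noteq> 0" for c
      using eq[OF that] le that by (simp add: n_def power_diff)
    have "n < q" using weights_bound(1)[OF s] by (simp add: n_def)
    show ?thesis
    proof (cases "n = 0 \<or> n = q - 1")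
      case True
      have "r = s" if "n = 0"
        using that le weights_bound[OF r] weights_bound[OF s] by (intro wt_inj[of r s p]) (auto simp: n_def)
      moreover have "r = rz \<and> s = rm" if "n = q - 1"
      proof -
        have "wt p r = 0" "wt p s = q - 1" using that le weights_bound(1)[OF s] q_ge by (auto simp: n_def)
        then have "r = rz" "wt p s = wt p rm"
          using wt_eq_0_iff[OF p_pos, of r] weights_bound(3)[OF r] wt_replicate[OF p_pos, of f] by (auto simp: q_def)
        moreover from this have "s = rm"
          using weights_bound[OF s] weights_bound[OF rm_weights] by (intro wt_inj[of s rm p]) auto
        ultimately show ?thesis by simp
      qed
      ultimately show ?thesis using True r s by (auto simp: compatible_def)
    next
      case False
      \<comment> \<open>The factor \<open>X\<close> in \<open>X^(n+1) - X\<close> adds the root 0,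
        and \<open>n < q - 1\<close> keeps the degree below \<open>q\<close>.\<close>
      define P where "P = Polynomial.monom 1 (Suc n) - Polynomial.monom (1 :: 'e) 1"
      have "Polynomial.degree P < q"
        using False \<open>n < q\<close> q_ge unfolding P_def
        by (intro degree_diff_less le_less_trans[OF degree_monom_le]) auto
      moreover have "poly P c = 0" if "c \<in> kappa" for c
        using one[OF that] by (cases "c = 0") (auto simp: P_def poly_monom)
      ultimately have "P = 0" by (rule poly_on_kappa)
      moreover have "Polynomial.coeff P 1 \<noteq> 0" using False by (simp add: P_def)
      ultimately show ?thesis by simp
    qed
  qed
  show ?thesis
    using *[OF r s _ eq] *[OF s r _ eq[symmetric]] by (cases "wt p r \<le> wt p s") auto
qed

end

section \<open>Compact induction and intertwining operators\<close>

context hecke_setting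
begin

lemma coset_eq_iff: "x \<in> carrier Mp \<Longrightarrow> y \<in> carrier Mp \<Longrightarrow>
    KK #>\<^bsub>Mp\<^esub> x = KK #>\<^bsub>Mp\<^esub> y \<longleftrightarrow> x \<otimes>\<^bsub>Mp\<^esub> inv\<^bsub>Mp\<^esub> y \<in> KK"
proof -
  assume xy: "x \<in> carrier Mp" "y \<in> carrier Mp"
  have "x \<in> KK #>\<^bsub>Mp\<^esub> y \<longleftrightarrow> x \<otimes>\<^bsub>Mp\<^esub> inv\<^bsub>Mp\<^esub> y \<in> KK"
  proof
    assume "x \<in> KK #>\<^bsub>Mp\<^esub> y"
    then obtain k where "k \<in> KK" "x = k \<otimes>\<^bsub>Mp\<^esub> y" by (auto simp: r_coset_def)
    then show "x \<otimes>\<^bsub>Mp\<^esub> inv\<^bsub>Mp\<^esub> y \<in> KK" using xy by (simp add: KK_carrier Mp.m_assoc)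
  next
    assume "x \<otimes>\<^bsub>Mp\<^esub> inv\<^bsub>Mp\<^esub> y \<in> KK"
    moreover have "x = x \<otimes>\<^bsub>Mp\<^esub> inv\<^bsub>Mp\<^esub> y \<otimes>\<^bsub>Mp\<^esub> y" using xy by (simp add: Mp.m_assoc)
    ultimately show "x \<in> KK #>\<^bsub>Mp\<^esub> y" unfolding r_coset_def by blast
  qed
  moreover have "x \<in> KK #>\<^bsub>Mp\<^esub> y \<longleftrightarrow> KK #>\<^bsub>Mp\<^esub> x = KK #>\<^bsub>Mp\<^esub> y"
    using Mp.repr_independence[OF _ xy(2) KK_subgroup, of x] Mp.rcos_self[OF xy(1) KK_subgroup] by auto
  ultimately show ?thesis by simp
qed

abbreviation cosets where "cosets \<equiv> rcosets\<^bsub>Mp\<^esub> KK"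

definition rep :: "'f mp set \<Rightarrow> 'f mp" where "rep C = (SOME x. x \<in> C)"

lemma coset_in: "x \<in> carrier Mp \<Longrightarrow> KK #>\<^bsub>Mp\<^esub> x \<in> cosets"
  by (auto simp: RCOSETS_def)

lemma coset_self: "x \<in> carrier Mp \<Longrightarrow> x \<in> KK #>\<^bsub>Mp\<^esub> x"
  using Mp.rcos_self[OF _ KK_subgroup] by blast

lemma coset_of:
  assumes "C \<in> cosets" "x \<in> C"
  shows "x \<in> carrier Mp" "C = KK #>\<^bsub>Mp\<^esub> x"
proof -
  obtain y where y: "y \<in> carrier Mp" "C = KK #>\<^bsub>Mp\<^esub> y" using assms(1) by (auto simp: RCOSETS_def)
  then show "x \<in> carrier Mp" using assms(2) by (auto simp: r_coset_def KK_carrier)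
  show "C = KK #>\<^bsub>Mp\<^esub> x" using Mp.repr_independence[OF _ y(1) KK_subgroup] assms(2) y(2) by simp
qed

lemma rep_coset:
  assumes "C \<in> cosets"
  shows "rep C \<in> C" "rep C \<in> carrier Mp" "C = KK #>\<^bsub>Mp\<^esub> rep C"
proof -
  obtain y where "y \<in> carrier Mp" "C = KK #>\<^bsub>Mp\<^esub> y" using assms by (auto simp: RCOSETS_def)
  then have "\<exists>x. x \<in> C" using coset_self by blast
  then show "rep C \<in> C" unfolding rep_def by (rule someI_ex)
  then show "rep C \<in> carrier Mp" "C = KK #>\<^bsub>Mp\<^esub> rep C" using coset_of[OF assms] by auto
qed

text \<open>The support as a set of cosets. The target is polymorphic because both functions in
  \<open>ind r\<close> and kernels with values in linear maps are measured by it.\<close>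

definition supp :: "('f mp \<Rightarrow> 'b::zero) \<Rightarrow> 'f mp set set" where
  "supp \<phi> = (\<lambda>x. KK #>\<^bsub>Mp\<^esub> x) ` {x \<in> carrier Mp. \<phi> x \<noteq> 0}"

lemma supp_cosets: "supp \<phi> \<subseteq> cosets"
  by (auto simp: supp_def coset_in)

lemma finite_supp_iff:
  assumes "\<And>g. g \<notin> carrier Mp \<Longrightarrow> \<phi> g = 0"
  shows "finite (supp \<phi>) \<longleftrightarrow> (\<exists>S. finite S \<and> S \<subseteq> carrier Mp \<and> {g. \<phi> g \<noteq> 0} \<subseteq> (\<Union>x\<in>S. KK #>\<^bsub>Mp\<^esub> x))"
proof
  assume "finite (supp \<phi>)"
  moreover have "{g. \<phi> g \<noteq> 0} \<subseteq> (\<Union>x\<in>rep ` supp \<phi>. KK #>\<^bsub>Mp\<^esub> x)"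
  proof
    fix g assume "g \<in> {g. \<phi> g \<noteq> 0}"
    then have g: "g \<in> carrier Mp" "\<phi> g \<noteq> 0" using assms by blast+
    then have C: "KK #>\<^bsub>Mp\<^esub> g \<in> supp \<phi>" by (auto simp: supp_def)
    then have "KK #>\<^bsub>Mp\<^esub> g = KK #>\<^bsub>Mp\<^esub> rep (KK #>\<^bsub>Mp\<^esub> g)" using rep_coset(3) supp_cosets by blast
    then show "g \<in> (\<Union>x\<in>rep ` supp \<phi>. KK #>\<^bsub>Mp\<^esub> x)" using C coset_self[OF g(1)] by blast
  qed
  moreover have "rep ` supp \<phi> \<subseteq> carrier Mp" using supp_cosets rep_coset(2) by blast
  ultimately show "\<exists>S. finite S \<and> S \<subseteq> carrier Mp \<and> {g. \<phi> g \<noteq> 0} \<subseteq> (\<Union>x\<in>S. KK #>\<^bsub>Mp\<^esub> x)"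
    by (intro exI[of _ "rep ` supp \<phi>"]) auto
next
  assume "\<exists>S. finite S \<and> S \<subseteq> carrier Mp \<and> {g. \<phi> g \<noteq> 0} \<subseteq> (\<Union>x\<in>S. KK #>\<^bsub>Mp\<^esub> x)"
  then obtain S where S: "finite S" "S \<subseteq> carrier Mp" "{g. \<phi> g \<noteq> 0} \<subseteq> (\<Union>x\<in>S. KK #>\<^bsub>Mp\<^esub> x)" by blast
  have "supp \<phi> \<subseteq> (\<lambda>x. KK #>\<^bsub>Mp\<^esub> x) ` S"
  proof
    fix C assume "C \<in> supp \<phi>"
    then obtain g where g: "\<phi> g \<noteq> 0" "C = KK #>\<^bsub>Mp\<^esub> g" by (auto simp: supp_def)
    then obtain x where x: "x \<in> S" "g \<in> KK #>\<^bsub>Mp\<^esub> x" using S(3) by blast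
    then have "KK #>\<^bsub>Mp\<^esub> x = KK #>\<^bsub>Mp\<^esub> g" using coset_of(2)[OF coset_in x(2)] S(2) by blast
    then show "C \<in> (\<lambda>x. KK #>\<^bsub>Mp\<^esub> x) ` S" using g x by blast
  qed
  then show "finite (supp \<phi>)" using S(1) finite_subset by blast
qed

lemma ind_iff: "\<phi> \<in> ind r \<longleftrightarrow> (\<forall>g\<in>carrier Mp. \<phi> g \<in> V r) \<and> (\<forall>g. g \<notin> carrier Mp \<longrightarrow> \<phi> g = 0) \<and>
    (\<forall>k\<in>KK. \<forall>g\<in>carrier Mp. \<phi> (k \<otimes>\<^bsub>Mp\<^esub> g) = sg r k (\<phi> g)) \<and> finite (supp \<phi>)"
  using finite_supp_iff[of \<phi>] unfolding ind_def by blast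

lemma ind_V: "\<phi> \<in> ind r \<Longrightarrow> g \<in> carrier Mp \<Longrightarrow> \<phi> g \<in> V r"
  and ind_outside: "\<phi> \<in> ind r \<Longrightarrow> g \<notin> carrier Mp \<Longrightarrow> \<phi> g = 0"
  and ind_left: "\<phi> \<in> ind r \<Longrightarrow> k \<in> KK \<Longrightarrow> g \<in> carrier Mp \<Longrightarrow> \<phi> (k \<otimes>\<^bsub>Mp\<^esub> g) = sg r k (\<phi> g)"
  and ind_finite: "\<phi> \<in> ind r \<Longrightarrow> finite (supp \<phi>)"
  unfolding ind_iff by blast+

lemma supp_zero_iff:
  assumes "\<phi> \<in> ind r" "g \<in> carrier Mp"
  shows "KK #>\<^bsub>Mp\<^esub> g \<in> supp \<phi> \<longleftrightarrow> \<phi> g \<noteq> 0"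
proof
  assume "KK #>\<^bsub>Mp\<^esub> g \<in> supp \<phi>"
  then obtain x where x: "x \<in> carrier Mp" "\<phi> x \<noteq> 0" "KK #>\<^bsub>Mp\<^esub> x = KK #>\<^bsub>Mp\<^esub> g" by (auto simp: supp_def)
  then have "x \<otimes>\<^bsub>Mp\<^esub> inv\<^bsub>Mp\<^esub> g \<in> KK" using coset_eq_iff assms by blast
  moreover have "x = x \<otimes>\<^bsub>Mp\<^esub> inv\<^bsub>Mp\<^esub> g \<otimes>\<^bsub>Mp\<^esub> g" using x assms by (simp add: Mp.m_assoc)
  ultimately have "\<phi> x = sg r (x \<otimes>\<^bsub>Mp\<^esub> inv\<^bsub>Mp\<^esub> g) (\<phi> g)" using ind_left assms by metis
  then show "\<phi> g \<noteq> 0" using x(2) sg_0 by metis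
qed (use assms in \<open>auto simp: supp_def\<close>)

lemma fun_plus: "(\<phi> + \<psi>) g = \<phi> g + (\<psi> g :: 'e tvec)"
  by simp

lemma supp_subset: "(\<And>g. \<phi> g = 0 \<Longrightarrow> \<psi> g = 0 \<Longrightarrow> \<xi> g = 0) \<Longrightarrow> supp \<xi> \<subseteq> supp \<phi> \<union> supp \<psi>"
  unfolding supp_def by blast

lemma ind_lin:
  assumes "\<phi> \<in> ind r" "\<psi> \<in> ind r"
  shows "(\<lambda>g. vscale c (\<phi> g)) + \<psi> \<in> ind r"
  unfolding ind_iff
proof (intro conjI ballI allI impI)
  have "supp ((\<lambda>g. vscale c (\<phi> g)) + \<psi>) \<subseteq> supp \<phi> \<union> supp \<psi>"
    by (rule supp_subset) (simp only: fun_plus vscale_simps add_0_left)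
  then show "finite (supp ((\<lambda>g. vscale c (\<phi> g)) + \<psi>))"
    using ind_finite assms by (meson finite_UnI finite_subset)
next
  fix g :: "'f mp" assume "g \<in> carrier Mp"
  then show "((\<lambda>g. vscale c (\<phi> g)) + \<psi>) g \<in> V r"
    unfolding fun_plus using assms ind_V by (intro V_closed) auto
next
  fix g :: "'f mp" assume "g \<notin> carrier Mp"
  then show "((\<lambda>g. vscale c (\<phi> g)) + \<psi>) g = 0"
    unfolding fun_plus using assms ind_outside by (metis vscale_simps(3) add_0_left)
next
  fix k g :: "'f mp" assume "k \<in> KK" "g \<in> carrier Mp"
  then show "((\<lambda>g. vscale c (\<phi> g)) + \<psi>) (k \<otimes>\<^bsub>Mp\<^esub> g) = sg r k (((\<lambda>g. vscale c (\<phi> g)) + \<psi>) g)"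
    unfolding fun_plus using assms by (simp only: ind_left sg_add sg_scale)
qed

lemma ind_0: "0 \<in> ind r"
  unfolding ind_iff by (simp add: supp_def V_def sg_0[unfolded zero_fun_def] zero_fun_def)

lemma ind_add: "\<phi> \<in> ind r \<Longrightarrow> \<psi> \<in> ind r \<Longrightarrow> \<phi> + \<psi> \<in> ind r"
  using ind_lin[of \<phi> r \<psi> 1] by (simp only: vscale_simps)

lemma translate_apply: "g \<in> carrier Mp \<Longrightarrow> translate y \<phi> g = \<phi> (g \<otimes>\<^bsub>Mp\<^esub> y)"
  by (simp add: translate_def)

lemma ind_translate:
  assumes "\<phi> \<in> ind r" "y \<in> carrier Mp"
  shows "translate y \<phi> \<in> ind r"
  unfolding ind_iff
proof (intro conjI ballI allI impI)
  have "supp (translate y \<phi>) \<subseteq> (\<lambda>C. C #>\<^bsub>Mp\<^esub> inv\<^bsub>Mp\<^esub> y) ` supp \<phi>"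
  proof
    fix C assume "C \<in> supp (translate y \<phi>)"
    then obtain x where x: "x \<in> carrier Mp" "\<phi> (x \<otimes>\<^bsub>Mp\<^esub> y) \<noteq> 0" "C = KK #>\<^bsub>Mp\<^esub> x"
      by (auto simp: supp_def translate_def)
    then have "C = (KK #>\<^bsub>Mp\<^esub> (x \<otimes>\<^bsub>Mp\<^esub> y)) #>\<^bsub>Mp\<^esub> inv\<^bsub>Mp\<^esub> y"
      using assms(2) subgroup.subset[OF KK_subgroup] by (simp add: Mp.coset_mult_assoc Mp.m_assoc)
    then show "C \<in> (\<lambda>C. C #>\<^bsub>Mp\<^esub> inv\<^bsub>Mp\<^esub> y) ` supp \<phi>"
      using x assms(2) unfolding supp_def by blast
  qed
  then show "finite (supp (translate y \<phi>))" using ind_finite[OF assms(1)] finite_subset by blast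
next
  fix k g :: "'f mp" assume "k \<in> KK" "g \<in> carrier Mp"
  then show "translate y \<phi> (k \<otimes>\<^bsub>Mp\<^esub> g) = sg r k (translate y \<phi> g)"
    using assms by (simp add: translate_apply KK_carrier Mp.m_assoc ind_left)
qed (use assms in \<open>auto simp: translate_def ind_V\<close>)

text \<open>The image of \<open>v\<close> under the canonical embedding of the weight into the
  compact induction. By Frobenius reciprocity an intertwining operator is determined by its values
  on these functions.\<close>

definition delta :: "nat list \<Rightarrow> 'e tvec \<Rightarrow> 'f mp \<Rightarrow> 'e tvec" where
  "delta r v g = (if g \<in> KK then sg r g v else 0)"

lemma delta_ind: "delta r v \<in> ind r"
  unfolding ind_iff
proof (intro conjI ballI allI impI)
  have "supp (delta r v) \<subseteq> {KK}"
    using Mp.coset_join2[OF _ KK_subgroup] by (auto simp: supp_def delta_def)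
  then show "finite (supp (delta r v))" using finite_subset by blast
next
  fix k g :: "'f mp" assume kg: "k \<in> KK" "g \<in> carrier Mp"
  have "k \<otimes>\<^bsub>Mp\<^esub> g \<in> KK \<longleftrightarrow> g \<in> KK"
  proof
    assume "k \<otimes>\<^bsub>Mp\<^esub> g \<in> KK"
    then have "inv\<^bsub>Mp\<^esub> k \<otimes>\<^bsub>Mp\<^esub> (k \<otimes>\<^bsub>Mp\<^esub> g) \<in> KK" using kg KK_mult KK_inv by blast
    then show "g \<in> KK" using kg by (simp add: KK_carrier flip: Mp.m_assoc)
  qed (use kg KK_mult in auto)
  then show "delta r v (k \<otimes>\<^bsub>Mp\<^esub> g) = sg r k (delta r v g)"
    by (cases "g \<in> KK") (simp_all only: delta_def sg_mult[OF kg(1)] sg_0 if_True if_False simp_thms)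
qed (simp_all only: delta_def sg_V V_closed(3) KK_carrier split: if_split, auto simp: KK_carrier)

lemma translate_delta:
  assumes "k \<in> KK"
  shows "translate k (delta r v) = delta r (sg r k v)"
proof
  fix g
  have "g \<otimes>\<^bsub>Mp\<^esub> k \<in> KK \<longleftrightarrow> g \<in> KK" if g: "g \<in> carrier Mp"
  proof
    assume "g \<otimes>\<^bsub>Mp\<^esub> k \<in> KK"
    then have "g \<otimes>\<^bsub>Mp\<^esub> k \<otimes>\<^bsub>Mp\<^esub> inv\<^bsub>Mp\<^esub> k \<in> KK" using assms KK_mult KK_inv by blast
    then show "g \<in> KK" using assms g by (simp add: KK_carrier Mp.m_assoc)
  qed (use assms KK_mult in auto)
  then show "translate k (delta r v) g = delta r (sg r k v) g"
    using assms KK_carrier by (auto simp: translate_def delta_def sg_mult)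
qed

lemma delta_lin: "delta r (vscale c v + v') = (\<lambda>g. vscale c (delta r v g)) + delta r v'"
proof
  fix g
  show "delta r (vscale c v + v') g = ((\<lambda>g. vscale c (delta r v g)) + delta r v') g"
    unfolding fun_plus delta_def by (cases "g \<in> KK") (simp_all only: if_True if_False sg_add sg_scale vscale_simps add_0_left)
qed

lemma ind_expand:
  assumes f: "\<phi> \<in> ind r"
  shows "\<phi> = (\<Sum>C\<in>supp \<phi>. translate (inv\<^bsub>Mp\<^esub> rep C) (delta r (\<phi> (rep C))))"
proof
  fix g
  let ?t = "\<lambda>C. translate (inv\<^bsub>Mp\<^esub> rep C) (delta r (\<phi> (rep C)))"
  show "\<phi> g = (\<Sum>C\<in>supp \<phi>. ?t C) g"
  proof (cases "g \<in> carrier Mp")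
    case False
    have "(\<Sum>C\<in>supp \<phi>. ?t C) g = 0"
      unfolding sum_fun_apply[of _ _ g] using False by (intro sum.neutral) (simp add: translate_def)
    then show ?thesis using ind_outside[OF f False] by simp
  next
    case g: True
    let ?C = "KK #>\<^bsub>Mp\<^esub> g"
    have zero: "?t C g = 0" if "C \<in> supp \<phi>" "C \<noteq> ?C" for C
    proof -
      have C: "C \<in> cosets" using that supp_cosets by blast
      have "g \<otimes>\<^bsub>Mp\<^esub> inv\<^bsub>Mp\<^esub> rep C \<notin> KK"
        using coset_eq_iff[OF g rep_coset(2)[OF C]] rep_coset(3)[OF C] that(2) by auto
      then show ?thesis using g by (simp add: translate_apply delta_def zero_fun_def)
    qed
    have self: "?t ?C g = \<phi> g"
    proof -
      have C: "?C \<in> cosets" using g coset_in by blast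
      have k: "g \<otimes>\<^bsub>Mp\<^esub> inv\<^bsub>Mp\<^esub> rep ?C \<in> KK"
        using coset_eq_iff[OF g rep_coset(2)[OF C]] rep_coset(3)[OF C] by simp
      have "?t ?C g = sg r (g \<otimes>\<^bsub>Mp\<^esub> inv\<^bsub>Mp\<^esub> rep ?C) (\<phi> (rep ?C))"
        using g k by (simp add: translate_apply delta_def)
      also have "\<dots> = \<phi> (g \<otimes>\<^bsub>Mp\<^esub> inv\<^bsub>Mp\<^esub> rep ?C \<otimes>\<^bsub>Mp\<^esub> rep ?C)"
        by (rule ind_left[OF f k rep_coset(2)[OF C], symmetric])
      also have "\<dots> = \<phi> g" using g rep_coset(2)[OF C] by (simp add: Mp.m_assoc)
      finally show ?thesis .
    qed
    show ?thesis
    proof (cases "?C \<in> supp \<phi>")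
      case True
      have "(\<Sum>C\<in>supp \<phi>. ?t C g) = ?t ?C g + (\<Sum>C\<in>supp \<phi> - {?C}. ?t C g)"
        by (rule sum.remove[OF ind_finite[OF f] True])
      also have "(\<Sum>C\<in>supp \<phi> - {?C}. ?t C g) = 0" using zero by (intro sum.neutral) blast
      finally show ?thesis unfolding sum_fun_apply[of _ _ g] self by simp
    next
      case False
      then have "\<phi> g = 0" using supp_zero_iff[OF f g] by blast
      moreover have "(\<Sum>C\<in>supp \<phi>. ?t C g) = 0" using zero False by (intro sum.neutral) blast
      ultimately show ?thesis unfolding sum_fun_apply[of _ _ g] by simp
    qed
  qed
qed

text \<open>Every function in \<open>ind r\<close> is a finite sum of translates of functions
  \<open>delta r v\<close>, one for each coset in its support. A statement compatible with sums
  needs to be checked on these translates only.\<close>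

lemma ind_induct [consumes 1, case_names zero add translate]:
  assumes f: "\<phi> \<in> ind r" and z: "P 0"
    and a: "\<And>\<phi> \<psi>. \<phi> \<in> ind r \<Longrightarrow> \<psi> \<in> ind r \<Longrightarrow> P \<phi> \<Longrightarrow> P \<psi> \<Longrightarrow> P (\<phi> + \<psi>)"
    and t: "\<And>y v. y \<in> carrier Mp \<Longrightarrow> v \<in> V r \<Longrightarrow> P (translate y (delta r v))"
  shows "P \<phi>"
proof -
  have "(\<Sum>C\<in>S. translate (inv\<^bsub>Mp\<^esub> rep C) (delta r (\<phi> (rep C)))) \<in> ind r \<and>
      P (\<Sum>C\<in>S. translate (inv\<^bsub>Mp\<^esub> rep C) (delta r (\<phi> (rep C))))" if "finite S" "S \<subseteq> cosets" for S
    using that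
  proof (induction S)
    case empty
    then show ?case by (simp only: sum.empty z ind_0 simp_thms)
  next
    case (insert C S)
    then have C: "rep C \<in> carrier Mp" using rep_coset by blast
    have "translate (inv\<^bsub>Mp\<^esub> rep C) (delta r (\<phi> (rep C))) \<in> ind r \<and> P (translate (inv\<^bsub>Mp\<^esub> rep C) (delta r (\<phi> (rep C))))"
      using C t ind_translate[OF delta_ind] ind_V[OF f] by blast
    then show ?case using insert a ind_add by (simp only: sum.insert insert_subset simp_thms)
  qed
  from this[OF ind_finite[OF f] supp_cosets] show ?thesis using ind_expand[OF f] by simp
qed

lemma heckeD:
  assumes "A \<in> hecke r s"
  shows "\<phi> \<in> ind r \<Longrightarrow> A \<phi> \<in> ind s"
    "\<phi> \<in> ind r \<Longrightarrow> \<psi> \<in> ind r \<Longrightarrow> A ((\<lambda>g. vscale c (\<phi> g)) + \<psi>) = (\<lambda>g. vscale c (A \<phi> g)) + A \<psi>"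
    "y \<in> carrier Mp \<Longrightarrow> \<phi> \<in> ind r \<Longrightarrow> A (translate y \<phi>) = translate y (A \<phi>)"
    "\<phi> \<notin> ind r \<Longrightarrow> A \<phi> = 0"
  using assms unfolding hecke_def by blast+

lemma hecke_add:
  assumes "A \<in> hecke r s" "\<phi> \<in> ind r" "\<psi> \<in> ind r"
  shows "A (\<phi> + \<psi>) = A \<phi> + A \<psi>"
  using heckeD(2)[OF assms, of 1] by (simp only: vscale_simps)

lemma hecke_0:
  assumes "A \<in> hecke r s"
  shows "A 0 = 0"
proof -
  have "A 0 = A 0 + A 0" using hecke_add[OF assms ind_0 ind_0] by (simp only: add_0_right)
  then show ?thesis by (metis add_cancel_right_right)
qed

lemma hecke_eqI:
  assumes A: "A \<in> hecke r s" and B: "B \<in> hecke r s"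
    and eq: "\<And>v. v \<in> V r \<Longrightarrow> A (delta r v) = B (delta r v)"
  shows "A = B"
proof
  fix \<phi>
  show "A \<phi> = B \<phi>"
  proof (cases "\<phi> \<in> ind r")
    case True
    then show ?thesis
    proof (induction rule: ind_induct)
      case zero
      show ?case unfolding hecke_0[OF A] hecke_0[OF B] ..
    next
      case (add \<phi> \<psi>)
      then show ?case by (simp only: hecke_add[OF A] hecke_add[OF B])
    next
      case (translate y v)
      then show ?case using heckeD(3)[OF A _ delta_ind] heckeD(3)[OF B _ delta_ind] eq by simp
    qed
  next
    case False
    then show ?thesis using heckeD(4)[OF A] heckeD(4)[OF B] by simp
  qed
qed

subsection \<open>Operators attached to bi-equivariant kernels\<close>

definition hkernel :: "nat list \<Rightarrow> nat list \<Rightarrow> ('f mp \<Rightarrow> 'e tvec \<Rightarrow> 'e tvec) \<Rightarrow> bool" where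
  "hkernel r s \<Phi> \<longleftrightarrow> (\<forall>g. \<Phi> g \<in> Hom_V r s) \<and> (\<forall>g. g \<notin> carrier Mp \<longrightarrow> \<Phi> g = 0) \<and>
    (\<forall>k\<in>KK. \<forall>k'\<in>KK. \<forall>g\<in>carrier Mp. \<forall>v\<in>V r. \<Phi> (k \<otimes>\<^bsub>Mp\<^esub> g \<otimes>\<^bsub>Mp\<^esub> k') v = sg s k (\<Phi> g (sg r k' v))) \<and>
    finite (supp \<Phi>)"

definition op_of :: "nat list \<Rightarrow> ('f mp \<Rightarrow> 'e tvec \<Rightarrow> 'e tvec) \<Rightarrow> ('f, 'e) operator" where
  "op_of r \<Phi> = (\<lambda>\<phi> g. if \<phi> \<in> ind r \<and> g \<in> carrier Mp then
     (\<Sum>C\<in>{C \<in> cosets. \<Phi> (g \<otimes>\<^bsub>Mp\<^esub> inv\<^bsub>Mp\<^esub> rep C) (\<phi> (rep C)) \<noteq> 0}. \<Phi> (g \<otimes>\<^bsub>Mp\<^esub> inv\<^bsub>Mp\<^esub> rep C) (\<phi> (rep C))) else 0)"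

lemma hecke_op_eq: "hecke_op r s n = op_of r (phi r s n)"
  unfolding hecke_op_def op_of_def rep_def Let_def ..

lemma Hom_VD:
  assumes "A \<in> Hom_V r s"
  shows "v \<in> V r \<Longrightarrow> A v \<in> V s" "v \<in> V r \<Longrightarrow> v' \<in> V r \<Longrightarrow> A (vscale c v + v') = vscale c (A v) + A v'"
    "v \<notin> V r \<Longrightarrow> A v = 0" "A 0 = 0"
proof -
  show "v \<in> V r \<Longrightarrow> A v \<in> V s" "v \<in> V r \<Longrightarrow> v' \<in> V r \<Longrightarrow> A (vscale c v + v') = vscale c (A v) + A v'"
    "v \<notin> V r \<Longrightarrow> A v = 0" for v v' c using assms unfolding Hom_V_def by blast+
  then have "A (vscale 1 0 + 0) = vscale 1 (A 0) + A 0" using V_closed(3) by blast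
  then have "A 0 = A 0 + A 0" by (simp only: vscale_simps add_0_right)
  then show "A 0 = 0" by (metis add_cancel_right_right)
qed

context
  fixes r s \<Phi>
  assumes ker: "hkernel r s \<Phi>"
begin

lemma ker_Hom: "\<Phi> g \<in> Hom_V r s" and ker_outside: "g \<notin> carrier Mp \<Longrightarrow> \<Phi> g = 0"
  and ker_equiv: "k \<in> KK \<Longrightarrow> k' \<in> KK \<Longrightarrow> g \<in> carrier Mp \<Longrightarrow> v \<in> V r \<Longrightarrow>
    \<Phi> (k \<otimes>\<^bsub>Mp\<^esub> g \<otimes>\<^bsub>Mp\<^esub> k') v = sg s k (\<Phi> g (sg r k' v))"
  and ker_finite: "finite (supp \<Phi>)"
  using ker unfolding hkernel_def by blast+

lemma ker_left: "k \<in> KK \<Longrightarrow> g \<in> carrier Mp \<Longrightarrow> v \<in> V r \<Longrightarrow> \<Phi> (k \<otimes>\<^bsub>Mp\<^esub> g) v = sg s k (\<Phi> g v)"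
  using ker_equiv[of k "\<one>\<^bsub>Mp\<^esub>" g v] KK_one by (simp add: KK_carrier sg_one)

lemma ker_right: "k \<in> KK \<Longrightarrow> g \<in> carrier Mp \<Longrightarrow> v \<in> V r \<Longrightarrow> \<Phi> (g \<otimes>\<^bsub>Mp\<^esub> k) v = \<Phi> g (sg r k v)"
  using ker_equiv[of "\<one>\<^bsub>Mp\<^esub>" k g v] KK_one sg_one[OF Hom_VD(1)[OF ker_Hom sg_V]] by simp

lemma summand_indep:
  assumes f: "\<phi> \<in> ind r" and g: "g \<in> carrier Mp" and x: "x \<in> carrier Mp" "y \<in> carrier Mp"
    "KK #>\<^bsub>Mp\<^esub> x = KK #>\<^bsub>Mp\<^esub> y"
  shows "\<Phi> (g \<otimes>\<^bsub>Mp\<^esub> inv\<^bsub>Mp\<^esub> x) (\<phi> x) = \<Phi> (g \<otimes>\<^bsub>Mp\<^esub> inv\<^bsub>Mp\<^esub> y) (\<phi> y)"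
proof -
  define k where "k = x \<otimes>\<^bsub>Mp\<^esub> inv\<^bsub>Mp\<^esub> y"
  have k: "k \<in> KK" using coset_eq_iff x by (simp add: k_def)
  have "g \<otimes>\<^bsub>Mp\<^esub> inv\<^bsub>Mp\<^esub> y = g \<otimes>\<^bsub>Mp\<^esub> inv\<^bsub>Mp\<^esub> x \<otimes>\<^bsub>Mp\<^esub> k"
    using g x by (simp add: k_def Mp.m_assoc Mp.inv_solve_left)
  moreover have xk: "x = k \<otimes>\<^bsub>Mp\<^esub> y" using x by (simp add: k_def Mp.m_assoc)
  ultimately show ?thesis
    using ker_right[OF k, of "g \<otimes>\<^bsub>Mp\<^esub> inv\<^bsub>Mp\<^esub> x" "\<phi> y"] g x ind_V[OF f x(2)] ind_left[OF f k x(2)]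
    by simp
qed

text \<open>The definition sums over the nonzero summands, a set that depends on \<open>g\<close>
  and on the function. Any finite set of cosets containing the support may replace it, so that sums
  for different arguments become comparable.\<close>

lemma op_of_sum:
  assumes f: "\<phi> \<in> ind r" and g: "g \<in> carrier Mp" and F: "finite F" "supp \<phi> \<subseteq> F" "F \<subseteq> cosets"
  shows "op_of r \<Phi> \<phi> g = (\<Sum>C\<in>F. \<Phi> (g \<otimes>\<^bsub>Mp\<^esub> inv\<^bsub>Mp\<^esub> rep C) (\<phi> (rep C)))"
proof -
  have "C \<in> F" if "C \<in> cosets" "\<Phi> (g \<otimes>\<^bsub>Mp\<^esub> inv\<^bsub>Mp\<^esub> rep C) (\<phi> (rep C)) \<noteq> 0" for C
  proof -
    have "\<phi> (rep C) \<noteq> 0" using that(2) Hom_VD(4)[OF ker_Hom] by metis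
    then have "KK #>\<^bsub>Mp\<^esub> rep C \<in> supp \<phi>" using supp_zero_iff[OF f] rep_coset[OF that(1)] by blast
    then show ?thesis using F(2) rep_coset(3)[OF that(1)] by auto
  qed
  then show ?thesis
    unfolding op_of_def using f g F by (simp only: simp_thms if_True) (rule sum.mono_neutral_left, auto)
qed

lemma op_of_V: "\<phi> \<in> ind r \<Longrightarrow> g \<in> carrier Mp \<Longrightarrow> op_of r \<Phi> \<phi> g \<in> V s"
  unfolding op_of_sum[OF _ _ ind_finite subset_refl supp_cosets]
  using supp_cosets rep_coset(2) ind_V by (intro V_sum Hom_VD(1)[OF ker_Hom]) blast

lemma op_of_ind:
  assumes f: "\<phi> \<in> ind r"
  shows "op_of r \<Phi> \<phi> \<in> ind s"
proof -
  note sm = op_of_sum[OF f _ ind_finite[OF f] subset_refl supp_cosets]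
  have out: "op_of r \<Phi> \<phi> g = 0" if "g \<notin> carrier Mp" for g using that by (simp add: op_of_def)
  have eqv: "op_of r \<Phi> \<phi> (k \<otimes>\<^bsub>Mp\<^esub> g) = sg s k (op_of r \<Phi> \<phi> g)" if "k \<in> KK" "g \<in> carrier Mp" for k g
  proof -
    have "\<Phi> (k \<otimes>\<^bsub>Mp\<^esub> g \<otimes>\<^bsub>Mp\<^esub> inv\<^bsub>Mp\<^esub> rep C) (\<phi> (rep C)) = sg s k (\<Phi> (g \<otimes>\<^bsub>Mp\<^esub> inv\<^bsub>Mp\<^esub> rep C) (\<phi> (rep C)))"
      if C: "C \<in> supp \<phi>" for C
    proof -
      have "rep C \<in> carrier Mp" using C supp_cosets rep_coset(2) by blast
      then show ?thesis
        using ker_left[OF \<open>k \<in> KK\<close>, of "g \<otimes>\<^bsub>Mp\<^esub> inv\<^bsub>Mp\<^esub> rep C" "\<phi> (rep C)"] \<open>k \<in> KK\<close> \<open>g \<in> carrier Mp\<close>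
          ind_V[OF f] by (simp add: Mp.m_assoc KK_carrier)
    qed
    then show ?thesis
      using that KK_carrier by (simp add: sm sg_sum)
  qed
  \<comment> \<open>If \<open>g\<close> carries a nonzero value, then \<open>g\<close> divided by a
    point \<open>D\<close> of the support of the function lies in the support of the kernel; so the
    support is covered by products of representatives.\<close>
  define S where "S = (\<lambda>(C, D). rep C \<otimes>\<^bsub>Mp\<^esub> rep D) ` (supp \<Phi> \<times> supp \<phi>)"
  have "{g. op_of r \<Phi> \<phi> g \<noteq> 0} \<subseteq> (\<Union>x\<in>S. KK #>\<^bsub>Mp\<^esub> x)"
  proof
    fix g assume "g \<in> {g. op_of r \<Phi> \<phi> g \<noteq> 0}"
    then have g: "g \<in> carrier Mp" "op_of r \<Phi> \<phi> g \<noteq> 0" using out by blast+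
    then obtain D where D: "D \<in> supp \<phi>" "\<Phi> (g \<otimes>\<^bsub>Mp\<^esub> inv\<^bsub>Mp\<^esub> rep D) (\<phi> (rep D)) \<noteq> 0"
      unfolding sm[OF g(1)] by (meson sum.not_neutral_contains_not_neutral)
    let ?x = "g \<otimes>\<^bsub>Mp\<^esub> inv\<^bsub>Mp\<^esub> rep D"
    have rD: "rep D \<in> carrier Mp" using D(1) supp_cosets rep_coset(2) by blast
    then have x: "?x \<in> carrier Mp" using g by simp
    have "\<Phi> ?x \<noteq> 0" using D(2) by (auto simp: zero_fun_def)
    then have C: "KK #>\<^bsub>Mp\<^esub> ?x \<in> supp \<Phi>" using x by (auto simp: supp_def)
    define c where "c = rep (KK #>\<^bsub>Mp\<^esub> ?x)"
    have c: "c \<in> carrier Mp" "KK #>\<^bsub>Mp\<^esub> ?x = KK #>\<^bsub>Mp\<^esub> c" unfolding c_def using rep_coset[OF coset_in[OF x]] by auto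
    then have "?x \<otimes>\<^bsub>Mp\<^esub> inv\<^bsub>Mp\<^esub> c \<in> KK" using coset_eq_iff x by blast
    moreover have "?x \<otimes>\<^bsub>Mp\<^esub> inv\<^bsub>Mp\<^esub> c = g \<otimes>\<^bsub>Mp\<^esub> inv\<^bsub>Mp\<^esub> (c \<otimes>\<^bsub>Mp\<^esub> rep D)"
      using g rD c by (simp add: Mp.inv_mult_group Mp.m_assoc)
    ultimately have "KK #>\<^bsub>Mp\<^esub> g = KK #>\<^bsub>Mp\<^esub> (c \<otimes>\<^bsub>Mp\<^esub> rep D)" using coset_eq_iff g c rD by simp
    moreover have "c \<otimes>\<^bsub>Mp\<^esub> rep D \<in> S" using C D(1) by (auto simp: S_def c_def)
    ultimately show "g \<in> (\<Union>x\<in>S. KK #>\<^bsub>Mp\<^esub> x)" using coset_self[OF g(1)] by blast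
  qed
  moreover have "finite S" unfolding S_def using ker_finite ind_finite[OF f] by simp
  moreover have "S \<subseteq> carrier Mp"
  proof -
    have "rep C \<otimes>\<^bsub>Mp\<^esub> rep D \<in> carrier Mp" if "C \<in> supp \<Phi>" "D \<in> supp \<phi>" for C D
      using rep_coset(2)[OF subsetD[OF supp_cosets that(1)]] rep_coset(2)[OF subsetD[OF supp_cosets that(2)]] by simp
    then show ?thesis unfolding S_def image_subset_iff by (simp add: case_prod_beta mem_Times_iff)
  qed
  ultimately have "finite (supp (op_of r \<Phi> \<phi>))" using finite_supp_iff[of "op_of r \<Phi> \<phi>"] out by blast
  then show ?thesis unfolding ind_iff using op_of_V[OF f] out eqv by blast
qed

lemma op_of_hecke: "op_of r \<Phi> \<in> hecke r s"
  unfolding hecke_def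
proof (intro CollectI conjI ballI allI impI)
  fix \<phi> assume "\<phi> \<in> ind r"
  then show "op_of r \<Phi> \<phi> \<in> ind s" by (rule op_of_ind)
next
  fix c \<phi> \<psi> assume f: "\<phi> \<in> ind r" "\<psi> \<in> ind r"
  show "op_of r \<Phi> ((\<lambda>g. vscale c (\<phi> g)) + \<psi>) = (\<lambda>g. vscale c (op_of r \<Phi> \<phi> g)) + op_of r \<Phi> \<psi>"
  proof
    fix g
    show "op_of r \<Phi> ((\<lambda>g. vscale c (\<phi> g)) + \<psi>) g = ((\<lambda>g. vscale c (op_of r \<Phi> \<phi> g)) + op_of r \<Phi> \<psi>) g"
    proof (cases "g \<in> carrier Mp")
      case True
      define F where "F = supp \<phi> \<union> supp \<psi>"
      have F: "finite F" "supp \<phi> \<subseteq> F" "supp \<psi> \<subseteq> F" "F \<subseteq> cosets"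
        using f ind_finite supp_cosets by (auto simp: F_def)
      have F': "supp ((\<lambda>g. vscale c (\<phi> g)) + \<psi>) \<subseteq> F"
        unfolding F_def by (rule supp_subset) (simp only: fun_plus vscale_simps add_0_left)
      have "op_of r \<Phi> ((\<lambda>g. vscale c (\<phi> g)) + \<psi>) g = (\<Sum>C\<in>F. \<Phi> (g \<otimes>\<^bsub>Mp\<^esub> inv\<^bsub>Mp\<^esub> rep C) (vscale c (\<phi> (rep C)) + \<psi> (rep C)))"
        unfolding op_of_sum[OF ind_lin[OF f] True F(1) F' F(4)] fun_plus ..
      also have "\<dots> = (\<Sum>C\<in>F. vscale c (\<Phi> (g \<otimes>\<^bsub>Mp\<^esub> inv\<^bsub>Mp\<^esub> rep C) (\<phi> (rep C))) + \<Phi> (g \<otimes>\<^bsub>Mp\<^esub> inv\<^bsub>Mp\<^esub> rep C) (\<psi> (rep C)))"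
        using F(4) rep_coset(2) ind_V f by (intro sum.cong refl Hom_VD(2)[OF ker_Hom]) blast+
      also have "\<dots> = vscale c (op_of r \<Phi> \<phi> g) + op_of r \<Phi> \<psi> g"
        unfolding op_of_sum[OF f(1) True F(1,2,4)] op_of_sum[OF f(2) True F(1,3,4)] sum.distrib vscale_sum ..
      finally show ?thesis unfolding fun_plus .
    next
      case False
      then show ?thesis by (simp add: op_of_def vscale_def fun_eq_iff)
    qed
  qed
next
  fix y :: "'f mp" and \<phi> assume y: "y \<in> carrier Mp" and f: "\<phi> \<in> ind r"
  show "op_of r \<Phi> (translate y \<phi>) = translate y (op_of r \<Phi> \<phi>)"
  proof
    fix g
    show "op_of r \<Phi> (translate y \<phi>) g = translate y (op_of r \<Phi> \<phi>) g"
    proof (cases "g \<in> carrier Mp")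
      case g: True
      have sh: "(KK #>\<^bsub>Mp\<^esub> x) #>\<^bsub>Mp\<^esub> z = KK #>\<^bsub>Mp\<^esub> (x \<otimes>\<^bsub>Mp\<^esub> z)" if "x \<in> carrier Mp" "z \<in> carrier Mp" for x z
        using that subgroup.subset[OF KK_subgroup] by (simp add: Mp.coset_mult_assoc)
      have tf: "translate y \<phi> \<in> ind r" by (rule ind_translate[OF f y])
      have "(\<Sum>C\<in>supp (translate y \<phi>). \<Phi> (g \<otimes>\<^bsub>Mp\<^esub> inv\<^bsub>Mp\<^esub> rep C) (translate y \<phi> (rep C))) =
          (\<Sum>D\<in>supp \<phi>. \<Phi> (g \<otimes>\<^bsub>Mp\<^esub> y \<otimes>\<^bsub>Mp\<^esub> inv\<^bsub>Mp\<^esub> rep D) (\<phi> (rep D)))"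
      \<comment> \<open>Right translation by \<open>y\<close> permutes the cosets. The chosen
        representatives do not correspond, but \<open>summand_indep\<close> makes the choice
        irrelevant.\<close>
      proof (rule sum.reindex_bij_witness[where i = "\<lambda>D. D #>\<^bsub>Mp\<^esub> inv\<^bsub>Mp\<^esub> y" and j = "\<lambda>C. C #>\<^bsub>Mp\<^esub> y"])
        fix C assume C: "C \<in> supp (translate y \<phi>)"
        then have Cc: "C \<in> cosets" using supp_cosets by blast
        note rc = rep_coset[OF Cc]
        have Cy: "C #>\<^bsub>Mp\<^esub> y = KK #>\<^bsub>Mp\<^esub> (rep C \<otimes>\<^bsub>Mp\<^esub> y)" using sh[OF rc(2) y] rc(3) by simp
        have x: "rep C \<otimes>\<^bsub>Mp\<^esub> y \<in> carrier Mp" using rc y by simp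
        show "C #>\<^bsub>Mp\<^esub> y #>\<^bsub>Mp\<^esub> inv\<^bsub>Mp\<^esub> y = C"
          unfolding Cy using sh[OF x, of "inv\<^bsub>Mp\<^esub> y"] y rc by (simp add: Mp.m_assoc)
        have "translate y \<phi> (rep C) \<noteq> 0" using supp_zero_iff[OF tf rc(2)] C rc(3) by simp
        then have "\<phi> (rep C \<otimes>\<^bsub>Mp\<^esub> y) \<noteq> 0" using rc(2) by (simp add: translate_apply)
        then show D: "C #>\<^bsub>Mp\<^esub> y \<in> supp \<phi>" unfolding Cy using supp_zero_iff[OF f x] by blast
        let ?D = "C #>\<^bsub>Mp\<^esub> y"
        have Dc: "?D \<in> cosets" using D supp_cosets by blast
        have "\<Phi> (g \<otimes>\<^bsub>Mp\<^esub> y \<otimes>\<^bsub>Mp\<^esub> inv\<^bsub>Mp\<^esub> rep ?D) (\<phi> (rep ?D)) =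
            \<Phi> (g \<otimes>\<^bsub>Mp\<^esub> y \<otimes>\<^bsub>Mp\<^esub> inv\<^bsub>Mp\<^esub> (rep C \<otimes>\<^bsub>Mp\<^esub> y)) (\<phi> (rep C \<otimes>\<^bsub>Mp\<^esub> y))"
          using rep_coset[OF Dc] Cy x g y by (intro summand_indep[OF f]) auto
        also have "g \<otimes>\<^bsub>Mp\<^esub> y \<otimes>\<^bsub>Mp\<^esub> inv\<^bsub>Mp\<^esub> (rep C \<otimes>\<^bsub>Mp\<^esub> y) = g \<otimes>\<^bsub>Mp\<^esub> inv\<^bsub>Mp\<^esub> rep C"
        proof -
          have "y \<otimes>\<^bsub>Mp\<^esub> (inv\<^bsub>Mp\<^esub> y \<otimes>\<^bsub>Mp\<^esub> inv\<^bsub>Mp\<^esub> rep C) = inv\<^bsub>Mp\<^esub> rep C"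
            using y rc by (simp flip: Mp.m_assoc)
          then show ?thesis using g y rc by (simp add: Mp.inv_mult_group Mp.m_assoc)
        qed
        finally show "\<Phi> (g \<otimes>\<^bsub>Mp\<^esub> y \<otimes>\<^bsub>Mp\<^esub> inv\<^bsub>Mp\<^esub> rep ?D) (\<phi> (rep ?D)) = \<Phi> (g \<otimes>\<^bsub>Mp\<^esub> inv\<^bsub>Mp\<^esub> rep C) (translate y \<phi> (rep C))"
          using rc(2) by (simp add: translate_apply)
      next
        fix D assume D: "D \<in> supp \<phi>"
        then have Dc: "D \<in> cosets" using supp_cosets by blast
        note rd = rep_coset[OF Dc]
        have Dy: "D #>\<^bsub>Mp\<^esub> inv\<^bsub>Mp\<^esub> y = KK #>\<^bsub>Mp\<^esub> (rep D \<otimes>\<^bsub>Mp\<^esub> inv\<^bsub>Mp\<^esub> y)" using sh[OF rd(2), of "inv\<^bsub>Mp\<^esub> y"] rd(3) y by simp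
        have x: "rep D \<otimes>\<^bsub>Mp\<^esub> inv\<^bsub>Mp\<^esub> y \<in> carrier Mp" using rd y by simp
        show "D #>\<^bsub>Mp\<^esub> inv\<^bsub>Mp\<^esub> y #>\<^bsub>Mp\<^esub> y = D"
          unfolding Dy using sh[OF x y] y rd by (simp add: Mp.m_assoc)
        have "\<phi> (rep D) \<noteq> 0" using supp_zero_iff[OF f rd(2)] D rd(3) by simp
        then have "translate y \<phi> (rep D \<otimes>\<^bsub>Mp\<^esub> inv\<^bsub>Mp\<^esub> y) \<noteq> 0"
          using x y rd(2) by (simp add: translate_apply Mp.m_assoc)
        then show "D #>\<^bsub>Mp\<^esub> inv\<^bsub>Mp\<^esub> y \<in> supp (translate y \<phi>)" unfolding Dy using supp_zero_iff[OF tf x] by blast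
      qed
      then show ?thesis
        using op_of_sum[OF tf g ind_finite[OF tf] subset_refl supp_cosets]
          op_of_sum[OF f _ ind_finite[OF f] subset_refl supp_cosets, of "g \<otimes>\<^bsub>Mp\<^esub> y"] g y
        by (simp add: translate_apply)
    next
      case False
      then show ?thesis by (simp add: op_of_def translate_def)
    qed
  qed
qed (simp add: op_of_def fun_eq_iff)

text \<open>Only the trivial coset contributes, so the operator returns its kernel.\<close>

lemma op_of_delta:
  assumes v: "v \<in> V r" and g: "g \<in> carrier Mp"
  shows "op_of r \<Phi> (delta r v) g = \<Phi> g v"
proof -
  have KKc: "KK \<in> cosets" using coset_in[OF Mp.one_closed] Mp.coset_join2[OF _ KK_subgroup KK_one] by simp
  have "supp (delta r v) \<subseteq> {KK}"
    using Mp.coset_join2[OF _ KK_subgroup] by (auto simp: supp_def delta_def)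
  then have "op_of r \<Phi> (delta r v) g = \<Phi> (g \<otimes>\<^bsub>Mp\<^esub> inv\<^bsub>Mp\<^esub> rep KK) (delta r v (rep KK))"
    using op_of_sum[OF delta_ind g, of "{KK}"] KKc by simp
  also have "\<dots> = \<Phi> (g \<otimes>\<^bsub>Mp\<^esub> inv\<^bsub>Mp\<^esub> \<one>\<^bsub>Mp\<^esub>) (delta r v \<one>\<^bsub>Mp\<^esub>)"
    using rep_coset[OF KKc] Mp.coset_join2[OF _ KK_subgroup KK_one] g
    by (intro summand_indep[OF delta_ind]) auto
  also have "\<dots> = \<Phi> g v" using g v KK_one by (simp add: delta_def sg_one)
  finally show ?thesis .
qed

end

end

section \<open>The operators \<open>T_n\<close> span the intertwining operators\<close>

context hecke_setting
begin

definition rk1 :: "nat list \<Rightarrow> nat list \<Rightarrow> 'e tvec \<Rightarrow> 'e tvec" where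
  "rk1 r s v = (if v \<in> V r then vscale (kap r s * v r) (vtop s) else 0)"

lemma rk1_V: "rk1 r s v \<in> V s"
  by (simp only: rk1_def V_closed(2)[OF vtop_V] V_closed(3) split: if_split) simp

lemma Hw_conj: "inv\<^bsub>Mp\<^esub> (Hw i) = Hw (- i)"
  using Mp.inv_equality[of "Hw (- i)" "Hw i"] by (simp add: Hw_add Hw_0)

lemma red_w_mult: "x \<in> R \<Longrightarrow> n > 0 \<Longrightarrow> red (w ^ n * x) = 0"
  using wR red_w by (simp add: red_mult R_power red_power)

text \<open>This makes \<open>phi\<close> well defined: \<open>a\<close> and \<open>b\<close> range
  over the ambiguity in writing an element as \<open>k h k'\<close>. Write \<open>b\<close> as a
  product \<open>Lo z\<close>, torus, \<open>Up x\<close> with \<open>x\<close> divisible by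
  \<open>w\<close>; conjugation by \<open>h\<close> turns it into \<open>a\<close> as
  \<open>Lo (w^(2n) z)\<close>, the same torus element, \<open>Up y\<close>. On the source
  \<open>Up x\<close> acts trivially and the top coordinate ignores \<open>Lo z\<close>; on the
  target \<open>Up y\<close> fixes the top vector and the lower unipotent acts trivially. The torus
  characters agree by compatibility.\<close>

lemma stabilizer:
  assumes c: "compatible r s" and n: "n > 0" and a: "a \<in> KK" and b: "b \<in> KK"
    and ab: "a \<otimes>\<^bsub>Mp\<^esub> Hw (- int n) = Hw (- int n) \<otimes>\<^bsub>Mp\<^esub> b" and v: "v \<in> V r"
  shows "sg s a (rk1 r s v) = rk1 r s (sg r b v)"
proof -
  obtain M e where bM: "b = (M, e)" by (cases b)
  obtain \<alpha> \<beta> \<gamma> \<delta> where M: "M = mat2 \<alpha> \<beta> \<gamma> \<delta>" by (rule mat2_cases)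
  have e: "e = 1 \<or> e = - 1" and MR: "\<alpha> * \<delta> - \<beta> * \<gamma> = 1" "\<alpha> \<in> R" "\<beta> \<in> R" "\<gamma> \<in> R" "\<delta> \<in> R"
    using b by (auto simp: bM K_tilde_iff M SL2_int_mat2)
  define W where "W = w ^ n"
  have W: "W \<noteq> 0" "w powi (- int n) = inverse W" "w powi int n = W" "W \<in> R"
    using w_nonzero wR R_power by (auto simp: W_def power_int_minus)
  obtain a1 b1 c1 d1 where aM: "fst a = mat2 a1 b1 c1 d1" by (rule mat2_cases)
  have aR: "b1 \<in> R" using a by (auto simp: KK_iff aM SL2_int_mat2)
  have "fst (a \<otimes>\<^bsub>Mp\<^esub> Hw (- int n)) = fst (Hw (- int n) \<otimes>\<^bsub>Mp\<^esub> b)" by (simp only: ab)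
  \<comment> \<open>Comparison of the upper right entries shows that the one of \<open>b\<close> is
    divisible by \<open>w^(2n)\<close>.\<close>
  then have "b1 * W = inverse W * \<beta>" by (simp add: fst_mult fst_Hw aM bM M W W_def[symmetric])
  then have "inverse W * \<beta> = b1 * W" ..
  moreover have "\<beta> = W * (inverse W * \<beta>)" using W(1) by (simp flip: mult.assoc)
  ultimately have "\<beta> = W * (b1 * W)" by metis
  then have \<beta>: "\<beta> = w ^ (2 * n) * b1" by (simp add: W_def mult_2 power_add)
  then have r\<beta>: "red \<beta> = 0" using red_w_mult[OF aR] n by simp
  then have "\<beta> \<notin> units" using red_unit_iff MR by blast
  then have \<alpha>: "\<alpha> \<in> units" using det_unit(1)[of \<alpha> \<delta> \<gamma> \<beta>] MR by (simp add: mult.commute)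
  then have \<alpha>0: "\<alpha> \<noteq> 0" "inverse \<alpha> \<in> R" using units_nonzero unit_inv units_R by auto
  define z where "z = \<gamma> * inverse \<alpha>"
  define x where "x = inverse \<alpha> * \<beta>"
  have zR: "z \<in> R" and xR: "x \<in> R" using MR \<alpha>0 R.Zmult by (auto simp: z_def x_def)
  have x': "x = w ^ (2 * n) * (inverse \<alpha> * b1)" by (simp add: x_def \<beta>)
  define y where "y = inverse \<alpha> * b1"
  have yR: "y \<in> R" using \<alpha>0 aR R.Zmult by (simp add: y_def)
  define A where "A = Lo z \<otimes>\<^bsub>Mp\<^esub> Di \<alpha> 1"
  have "\<delta> = z * \<beta> + inverse \<alpha>"
    using MR(1) \<alpha>0 by (simp add: z_def field_simps)
  then have Mfac: "M = fst (Lo z \<otimes>\<^bsub>Mp\<^esub> Di \<alpha> 1) ** mat2 1 x 0 1"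
    using \<alpha>0 by (simp add: fst_mult Lo_def Di_def M z_def x_def mult.assoc)
  have bc: "b \<in> carrier Mp" using b KK_carrier by blast
  obtain e' where e': "e' \<in> {1, - 1}" "b = Lo z \<otimes>\<^bsub>Mp\<^esub> Di \<alpha> e' \<otimes>\<^bsub>Mp\<^esub> Up x"
  proof -
    \<comment> \<open>The sign that absorbs the cocycle between \<open>Lo z\<close> and the torus
      element.\<close>
    define e' where "e' = e * hilbert_symbol (Xfun (mat2 1 0 z 1)) \<alpha>"
    have "Lo z \<otimes>\<^bsub>Mp\<^esub> Di \<alpha> e' = (mat2 1 0 z 1 ** mat2 \<alpha> 0 0 (inverse \<alpha>), e' * hilbert_symbol (Xfun (mat2 1 0 z 1)) \<alpha>)"
      unfolding Lo_def using \<alpha>0 by (subst mult_Di) auto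
    also have "e' * hilbert_symbol (Xfun (mat2 1 0 z 1)) \<alpha> = e"
      by (simp only: e'_def mult.assoc hilbert_self mult_1_right)
    finally have "Lo z \<otimes>\<^bsub>Mp\<^esub> Di \<alpha> e' \<otimes>\<^bsub>Mp\<^esub> Up x = (mat2 1 0 z 1 ** mat2 \<alpha> 0 0 (inverse \<alpha>) ** mat2 1 x 0 1, e)"
      using \<alpha>0 by (simp only: mult_Up det_mul) (subst mult_Up, simp_all add: det_mul)
    also have "\<dots> = b" using Mfac by (simp add: bM Lo_def Di_def fst_mult)
    finally have "b = Lo z \<otimes>\<^bsub>Mp\<^esub> Di \<alpha> e' \<otimes>\<^bsub>Mp\<^esub> Up x" ..
    moreover have "e' \<in> {1, - 1}" using e hilbert_cases[of "Xfun (mat2 1 0 z 1)" \<alpha>] by (auto simp: e'_def)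
    ultimately show ?thesis using that by blast
  qed
  have ac: "a \<in> carrier Mp" using a KK_carrier by blast
  have Dc: "Di \<alpha> e' \<in> carrier Mp" "Di \<alpha> e' \<in> KK" using e' \<alpha> \<alpha>0 by auto
  have "Hw (- int n) \<otimes>\<^bsub>Mp\<^esub> b = Hw (- int n) \<otimes>\<^bsub>Mp\<^esub> Lo z \<otimes>\<^bsub>Mp\<^esub> Di \<alpha> e' \<otimes>\<^bsub>Mp\<^esub> Up x"
    using Dc by (simp add: e' Mp.m_assoc)
  also have "Hw (- int n) \<otimes>\<^bsub>Mp\<^esub> Lo z = Lo (w ^ (2 * n) * z) \<otimes>\<^bsub>Mp\<^esub> Hw (- int n)"
    using Hw_Lo[of "- int n" z] power_int_of_nat[of w "2 * n"] by simp
  also have "Lo (w ^ (2 * n) * z) \<otimes>\<^bsub>Mp\<^esub> Hw (- int n) \<otimes>\<^bsub>Mp\<^esub> Di \<alpha> e' \<otimes>\<^bsub>Mp\<^esub> Up x =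
      Lo (w ^ (2 * n) * z) \<otimes>\<^bsub>Mp\<^esub> Di \<alpha> e' \<otimes>\<^bsub>Mp\<^esub> (Hw (- int n) \<otimes>\<^bsub>Mp\<^esub> Up x)"
    using Dc Hw_Di_commute[OF \<alpha>0(1)] by (simp add: Mp.m_assoc)
  also have "Hw (- int n) \<otimes>\<^bsub>Mp\<^esub> Up x = Up y \<otimes>\<^bsub>Mp\<^esub> Hw (- int n)"
  proof -
    have "w powi (- (2 * int n)) * w ^ (2 * n) = 1"
      using w_nonzero power_int_of_nat[of w "2 * n"] power_int_minus[of w "2 * int n"] by simp
    then have "w powi (2 * - int n) * x = y" by (simp add: x' y_def flip: mult.assoc)
    then show ?thesis using Hw_Up[of "- int n" x] by simp
  qed
  also have "Lo (w ^ (2 * n) * z) \<otimes>\<^bsub>Mp\<^esub> Di \<alpha> e' \<otimes>\<^bsub>Mp\<^esub> (Up y \<otimes>\<^bsub>Mp\<^esub> Hw (- int n)) =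
      Lo (w ^ (2 * n) * z) \<otimes>\<^bsub>Mp\<^esub> Di \<alpha> e' \<otimes>\<^bsub>Mp\<^esub> Up y \<otimes>\<^bsub>Mp\<^esub> Hw (- int n)"
    using Dc by (simp add: Mp.m_assoc)
  finally have "a \<otimes>\<^bsub>Mp\<^esub> Hw (- int n) = Lo (w ^ (2 * n) * z) \<otimes>\<^bsub>Mp\<^esub> Di \<alpha> e' \<otimes>\<^bsub>Mp\<^esub> Up y \<otimes>\<^bsub>Mp\<^esub> Hw (- int n)"
    using ab by simp
  then have a': "a = Lo (w ^ (2 * n) * z) \<otimes>\<^bsub>Mp\<^esub> Di \<alpha> e' \<otimes>\<^bsub>Mp\<^esub> Up y"
    by (rule Mp.right_cancel[THEN iffD1, rotated 3]) (use ac Dc in simp_all)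
  have w2R: "w ^ (2 * n) * z \<in> R" using wR R_power zR R.Zmult by blast
  have rw2: "red (w ^ (2 * n) * z) = 0" and rx: "red x = 0"
    using red_w_mult zR n x' yR by (auto simp: y_def)
  have kR: "red \<alpha> \<in> kappa" "red \<alpha> \<noteq> 0" using \<alpha> units_R red_unit_iff by (auto simp: kappa_def)
  define ch where "ch = of_int e' * red \<alpha> ^ wt p s"
  have chr: "ch = of_int e' * red \<alpha> ^ wt p r" using compatible_power[OF c kR] by (simp add: ch_def)
  have L1: "Lo (w ^ (2 * n) * z) \<in> KK" "Lo z \<in> KK" "Up y \<in> KK" "Up x \<in> KK" using w2R zR yR xR by auto
  have "sg s a (vtop s) = sg s (Lo (w ^ (2 * n) * z)) (sg s (Di \<alpha> e') (sg s (Up y) (vtop s)))"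
    unfolding a' using L1 Dc KK_mult by (simp only: sg_mult)
  also have "\<dots> = vscale ch (vtop s)"
    by (simp only: sg_Up_vtop sg_Di_vtop[OF \<alpha>] sg_scale sg_Lo_small[OF vtop_V rw2] ch_def)
  finally have 1: "sg s a (rk1 r s v) = vscale (kap r s * v r * ch) (vtop s)"
    using v by (simp only: rk1_def if_True sg_scale vscale_simps)
  have "sg r b v = sg r (Lo z) (sg r (Di \<alpha> e') (sg r (Up x) v))"
    unfolding e'(2) using L1 Dc KK_mult by (simp only: sg_mult)
  also have "sg r (Up x) v = v" by (rule sg_Up_small[OF v rx])
  finally have "sg r b v r = ch * v r" by (simp only: top_Lo top_Di[OF \<alpha>] chr)
  then have 2: "rk1 r s (sg r b v) = vscale (kap r s * (ch * v r)) (vtop s)"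
    by (simp only: rk1_def sg_V if_True)
  show ?thesis unfolding 1 2 by (simp add: mult_ac)
qed

text \<open>An explicit candidate for \<open>phi\<close>, built from an arbitrary choice of
  factorization; \<open>Phi_eq\<close> shows that the choice is immaterial.\<close>

definition Phi :: "nat list \<Rightarrow> nat list \<Rightarrow> nat \<Rightarrow> 'f mp \<Rightarrow> 'e tvec \<Rightarrow> 'e tvec" where
  "Phi r s n g v = (if g \<in> dcoset n \<and> v \<in> V r then
     (let (k, k') = SOME (k, k'). k \<in> KK \<and> k' \<in> KK \<and> g = k \<otimes>\<^bsub>Mp\<^esub> Hw (- int n) \<otimes>\<^bsub>Mp\<^esub> k'
      in sg s k (rk1 r s (sg r k' v))) else 0)"

lemma Phi_eq:
  assumes c: "compatible r s" and n: "n > 0" and k: "k \<in> KK" "k' \<in> KK" and v: "v \<in> V r"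
  shows "Phi r s n (k \<otimes>\<^bsub>Mp\<^esub> Hw (- int n) \<otimes>\<^bsub>Mp\<^esub> k') v = sg s k (rk1 r s (sg r k' v))"
proof -
  let ?H = "Hw (- int n)"
  let ?g = "k \<otimes>\<^bsub>Mp\<^esub> ?H \<otimes>\<^bsub>Mp\<^esub> k'"
  define P where "P = (\<lambda>(l, l'). l \<in> KK \<and> l' \<in> KK \<and> ?g = l \<otimes>\<^bsub>Mp\<^esub> ?H \<otimes>\<^bsub>Mp\<^esub> l')"
  have "P (k, k')" using k by (simp add: P_def)
  then have "P (Eps P)" by (rule someI)
  then obtain l l' where l: "Eps P = (l, l')" "l \<in> KK" "l' \<in> KK" "?g = l \<otimes>\<^bsub>Mp\<^esub> ?H \<otimes>\<^bsub>Mp\<^esub> l'"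
    by (cases "Eps P") (auto simp: P_def)
  have g: "?g \<in> dcoset n" using k unfolding dcoset_def by blast
  define a where "a = inv\<^bsub>Mp\<^esub> l \<otimes>\<^bsub>Mp\<^esub> k"
  define b where "b = l' \<otimes>\<^bsub>Mp\<^esub> inv\<^bsub>Mp\<^esub> k'"
  have ab: "a \<in> KK" "b \<in> KK" using k l KK_mult KK_inv by (auto simp: a_def b_def)
  have cr: "k \<in> carrier Mp" "k' \<in> carrier Mp" "l \<in> carrier Mp" "l' \<in> carrier Mp" using k l KK_carrier by auto
  have "a \<otimes>\<^bsub>Mp\<^esub> ?H = inv\<^bsub>Mp\<^esub> l \<otimes>\<^bsub>Mp\<^esub> ?g \<otimes>\<^bsub>Mp\<^esub> inv\<^bsub>Mp\<^esub> k'"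
    using cr by (simp add: a_def Mp.m_assoc)
  also have "\<dots> = ?H \<otimes>\<^bsub>Mp\<^esub> b"
    unfolding l(4) using cr by (simp add: b_def Mp.m_assoc Mp.inv_solve_left')
  finally have eq: "a \<otimes>\<^bsub>Mp\<^esub> ?H = ?H \<otimes>\<^bsub>Mp\<^esub> b" .
  have "Phi r s n ?g v = sg s l (rk1 r s (sg r l' v))"
    using g v l(1) unfolding Phi_def P_def by simp
  also have "l' = b \<otimes>\<^bsub>Mp\<^esub> k'" using cr by (simp add: b_def Mp.m_assoc)
  also have "sg r (b \<otimes>\<^bsub>Mp\<^esub> k') v = sg r b (sg r k' v)" by (rule sg_mult[OF ab(2) k(2)])
  also have "rk1 r s (sg r b (sg r k' v)) = sg s a (rk1 r s (sg r k' v))"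
    by (rule stabilizer[OF c n ab eq sg_V, symmetric])
  also have "sg s l (sg s a (rk1 r s (sg r k' v))) = sg s (l \<otimes>\<^bsub>Mp\<^esub> a) (rk1 r s (sg r k' v))"
    by (rule sg_mult[OF l(2) ab(1), symmetric])
  also have "l \<otimes>\<^bsub>Mp\<^esub> a = k" using cr by (simp add: a_def flip: Mp.m_assoc)
  finally show ?thesis .
qed

lemma finite_factor:
  assumes "finite (g ` A)" "\<And>x y. x \<in> A \<Longrightarrow> y \<in> A \<Longrightarrow> g x = g y \<Longrightarrow> h x = h y"
  shows "finite (h ` A)"
proof -
  have "h ` A \<subseteq> (\<lambda>z. h (SOME x. x \<in> A \<and> g x = z)) ` (g ` A)"
  proof
    fix t assume "t \<in> h ` A"
    then obtain x where x: "x \<in> A" "t = h x" by blast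
    then have "\<exists>y. y \<in> A \<and> g y = g x" by blast
    then have "(SOME y. y \<in> A \<and> g y = g x) \<in> A \<and> g (SOME y. y \<in> A \<and> g y = g x) = g x" by (rule someI_ex)
    then have "t = h (SOME y. y \<in> A \<and> g y = g x)" using assms(2) x by metis
    then show "t \<in> (\<lambda>z. h (SOME x. x \<in> A \<and> g x = z)) ` (g ` A)" using x(1) by blast
  qed
  then show ?thesis using assms(1) finite_subset by blast
qed

text \<open>The right coset of \<open>h(w)^-n k\<close> depends only on the first row of
  \<open>k\<close> modulo \<open>w^(2n)\<close>, and there are finitely many such rows.\<close>

lemma finite_dcoset_cosets: "finite ((\<lambda>x. KK #>\<^bsub>Mp\<^esub> x) ` dcoset n)"
proof -
  let ?H = "Hw (- int n)"
  obtain D where D: "finite D" "D \<subseteq> R" "\<forall>x\<in>R. \<exists>d\<in>D. x - d \<in> (*) (w ^ (2 * n)) ` R"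
    using finite_residues_power[of "2 * n"] by auto
  then obtain cl where cl: "\<And>x. x \<in> R \<Longrightarrow> cl x \<in> D" "\<And>x. x \<in> R \<Longrightarrow> x - cl x \<in> (*) (w ^ (2 * n)) ` R" by metis
  define G where "G k = (cl (fst k $ 1 $ 1), cl (fst k $ 1 $ 2))" for k :: "'f mp"
  have "G ` KK \<subseteq> D \<times> D" using cl(1) by (auto simp: G_def KK_iff SL2_int_def)
  then have fG: "finite (G ` KK)" using D(1) finite_subset by blast
  have key: "KK #>\<^bsub>Mp\<^esub> (?H \<otimes>\<^bsub>Mp\<^esub> k) = KK #>\<^bsub>Mp\<^esub> (?H \<otimes>\<^bsub>Mp\<^esub> l)"
    if k: "k \<in> KK" and l: "l \<in> KK" and G: "G k = G l" for k l
  proof -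
    have cr: "k \<in> carrier Mp" "l \<in> carrier Mp" using k l KK_carrier by auto
    obtain a b c d where kM: "fst k = mat2 a b c d" by (rule mat2_cases)
    obtain a' b' c' d' where lM: "fst l = mat2 a' b' c' d'" by (rule mat2_cases)
    have R: "a * d - b * c = 1" "a \<in> R" "b \<in> R" "c \<in> R" "d \<in> R"
      "a' * d' - b' * c' = 1" "a' \<in> R" "b' \<in> R" "c' \<in> R" "d' \<in> R"
      using k l by (auto simp: KK_iff kM lM SL2_int_mat2)
    have "x - y \<in> (*) (w ^ (2 * n)) ` R" if "x \<in> R" "y \<in> R" "cl x = cl y" for x y
      using diff_dvd[OF cl(2)[OF that(1)] cl(2)[OF that(2)]] that(3) by simp
    then have "a - a' \<in> (*) (w ^ (2 * n)) ` R" "b - b' \<in> (*) (w ^ (2 * n)) ` R"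
      using G R by (auto simp: G_def kM lM)
    then obtain x y where xy: "a - a' = w ^ (2 * n) * x" "x \<in> R" "b - b' = w ^ (2 * n) * y" "y \<in> R" by auto
    define W where "W = w ^ n"
    have W: "W \<noteq> 0" "w powi (- int n) = inverse W" "w powi int n = W" "W \<in> R" "w ^ (2 * n) = W * W"
      using w_nonzero wR R_power by (auto simp: W_def power_int_minus mult_2 power_add)
    have aa: "a = a' + W * W * x" "b = b' + W * W * y" using xy W by (auto simp: algebra_simps)
    \<comment> \<open>Up to the factor \<open>W^-2\<close> this is the upper right entry of the
      quotient of the two elements, the only one in which a denominator occurs. It is the
      determinant of the two first rows, so their congruence makes it divisible by
      \<open>W^2\<close>.\<close>
    have up: "b * a' - a * b' = W * W * (y * a' - x * b')" unfolding aa by (simp add: algebra_simps)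
    have canc2: "inverse W * (inverse W * (W * (W * t))) = t" for t using W(1) by (simp flip: mult.assoc)
    have canc: "W * (s * (t * inverse W)) = s * t" for s t using W(1) by simp
    have "fst (?H \<otimes>\<^bsub>Mp\<^esub> k \<otimes>\<^bsub>Mp\<^esub> inv\<^bsub>Mp\<^esub> (?H \<otimes>\<^bsub>Mp\<^esub> l)) =
        mat2 (a * d' - b * c') (inverse W * inverse W * (b * a' - a * b')) (W * W * (c * d' - d * c')) (d * a' - c * b')"
      using cr W(1) by (simp add: fst_mult fst_inv fst_Hw kM lM adj2_def W(2,3) W_def[symmetric]) (simp add: algebra_simps canc)
    also have "inverse W * inverse W * (b * a' - a * b') = y * a' - x * b'" unfolding up using W(1) by (simp add: mult.assoc canc2)
    finally have m: "fst (?H \<otimes>\<^bsub>Mp\<^esub> k \<otimes>\<^bsub>Mp\<^esub> inv\<^bsub>Mp\<^esub> (?H \<otimes>\<^bsub>Mp\<^esub> l)) =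
        mat2 (a * d' - b * c') (y * a' - x * b') (W * W * (c * d' - d * c')) (d * a' - c * b')" .
    have "det (fst (?H \<otimes>\<^bsub>Mp\<^esub> k \<otimes>\<^bsub>Mp\<^esub> inv\<^bsub>Mp\<^esub> (?H \<otimes>\<^bsub>Mp\<^esub> l))) = 1"
      using cr by (intro det_fst) auto
    then have "?H \<otimes>\<^bsub>Mp\<^esub> k \<otimes>\<^bsub>Mp\<^esub> inv\<^bsub>Mp\<^esub> (?H \<otimes>\<^bsub>Mp\<^esub> l) \<in> KK"
      unfolding KK_iff m using cr R xy W by (auto simp: SL2_int_mat2 intro!: R.Zdiff R.Zmult)
    then show ?thesis using cr by (subst coset_eq_iff) auto
  qed
  have "finite ((\<lambda>k. KK #>\<^bsub>Mp\<^esub> (?H \<otimes>\<^bsub>Mp\<^esub> k)) ` KK)"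
    by (rule finite_factor[OF fG]) (rule key)
  moreover have "(\<lambda>x. KK #>\<^bsub>Mp\<^esub> x) ` dcoset n \<subseteq> (\<lambda>k. KK #>\<^bsub>Mp\<^esub> (?H \<otimes>\<^bsub>Mp\<^esub> k)) ` KK"
  proof
    fix C assume "C \<in> (\<lambda>x. KK #>\<^bsub>Mp\<^esub> x) ` dcoset n"
    then obtain k k' where k: "k \<in> KK" "k' \<in> KK" "C = KK #>\<^bsub>Mp\<^esub> (k \<otimes>\<^bsub>Mp\<^esub> ?H \<otimes>\<^bsub>Mp\<^esub> k')"
      unfolding dcoset_def by blast
    have "C = KK #>\<^bsub>Mp\<^esub> (?H \<otimes>\<^bsub>Mp\<^esub> k')"
      unfolding k(3) using k KK_carrier by (subst coset_eq_iff) (auto simp: Mp.m_assoc)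
    then show "C \<in> (\<lambda>k. KK #>\<^bsub>Mp\<^esub> (?H \<otimes>\<^bsub>Mp\<^esub> k)) ` KK" using k(2) by blast
  qed
  ultimately show ?thesis using finite_subset by blast
qed

lemma dcoset_carrier: "g \<in> dcoset n \<Longrightarrow> g \<in> carrier Mp"
  by (simp add: dcoset_iff)

lemma KK_cancel:
  assumes "k \<in> KK" "k' \<in> KK" "g \<in> carrier Mp"
  shows "inv\<^bsub>Mp\<^esub> k \<otimes>\<^bsub>Mp\<^esub> (k \<otimes>\<^bsub>Mp\<^esub> g \<otimes>\<^bsub>Mp\<^esub> k') \<otimes>\<^bsub>Mp\<^esub> inv\<^bsub>Mp\<^esub> k' = g"
proof -
  have "inv\<^bsub>Mp\<^esub> k \<otimes>\<^bsub>Mp\<^esub> (k \<otimes>\<^bsub>Mp\<^esub> (g \<otimes>\<^bsub>Mp\<^esub> k')) = g \<otimes>\<^bsub>Mp\<^esub> k'"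
    using assms KK_carrier by (simp flip: Mp.m_assoc)
  then show ?thesis using assms KK_carrier by (simp add: Mp.m_assoc)
qed

lemma dcoset_mult_iff:
  assumes "k \<in> KK" "k' \<in> KK" "g \<in> carrier Mp"
  shows "k \<otimes>\<^bsub>Mp\<^esub> g \<otimes>\<^bsub>Mp\<^esub> k' \<in> dcoset n \<longleftrightarrow> g \<in> dcoset n"
proof
  assume "k \<otimes>\<^bsub>Mp\<^esub> g \<otimes>\<^bsub>Mp\<^esub> k' \<in> dcoset n"
  from dcoset_KK(2)[OF KK_inv[OF assms(2)] dcoset_KK(1)[OF KK_inv[OF assms(1)] this]] show "g \<in> dcoset n"
    unfolding KK_cancel[OF assms] .
qed (use assms dcoset_KK in blast)

lemma rk1_lin: "v \<in> V r \<Longrightarrow> v' \<in> V r \<Longrightarrow> rk1 r s (vscale c v + v') = vscale c (rk1 r s v) + rk1 r s v'"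
  using V_closed(1)[OF V_closed(2), of v r v' c]
  by (simp add: rk1_def vscale_apply distrib_left vscale_add(2) mult_ac fun_eq_iff) (simp add: vscale_def algebra_simps)

lemma Phi_outside: "g \<notin> dcoset n \<Longrightarrow> Phi r s n g = 0"
  by (auto simp: Phi_def fun_eq_iff)

lemma Phi_kernel:
  assumes c: "compatible r s" and n: "n > 0"
  shows "hkernel r s (Phi r s n)"
  unfolding hkernel_def
proof (intro conjI allI ballI impI)
  fix g :: "'f mp"
  show "Phi r s n g \<in> Hom_V r s"
  proof (cases "g \<in> dcoset n")
    case True
    then obtain k k' where k: "k \<in> KK" "k' \<in> KK" "g = k \<otimes>\<^bsub>Mp\<^esub> Hw (- int n) \<otimes>\<^bsub>Mp\<^esub> k'"
      unfolding dcoset_def by blast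
    have e: "Phi r s n g v = sg s k (rk1 r s (sg r k' v))" if "v \<in> V r" for v
      unfolding k(3) by (rule Phi_eq[OF c n k(1,2) that])
    show ?thesis
      unfolding Hom_V_def
    proof (intro CollectI conjI allI ballI impI)
      fix a and v v' :: "'e tvec" assume v: "v \<in> V r" "v' \<in> V r"
      have "vscale a v + v' \<in> V r" by (rule V_closed(1)[OF V_closed(2)[OF v(1)] v(2)])
      then show "Phi r s n g (vscale a v + v') = vscale a (Phi r s n g v) + Phi r s n g v'"
        using v by (simp only: e sg_add sg_scale rk1_lin[OF sg_V sg_V])
    qed (use e sg_V in \<open>auto simp: Phi_def\<close>)
  next
    case False
    then have "Phi r s n g v = 0" for v by (simp only: Phi_def simp_thms if_False)
    then show ?thesis unfolding Hom_V_def using V_closed(3)[of s]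
      by (auto simp only: vscale_simps add_0_left mem_Collect_eq)
  qed
next
  fix g :: "'f mp" assume "g \<notin> carrier Mp"
  then show "Phi r s n g = 0" using dcoset_carrier by (intro Phi_outside) blast
next
  fix k k' g :: "'f mp" and v :: "'e tvec"
  assume k: "k \<in> KK" "k' \<in> KK" and g: "g \<in> carrier Mp" and v: "v \<in> V r"
  show "Phi r s n (k \<otimes>\<^bsub>Mp\<^esub> g \<otimes>\<^bsub>Mp\<^esub> k') v = sg s k (Phi r s n g (sg r k' v))"
  proof (cases "g \<in> dcoset n")
    case True
    then obtain l l' where l: "l \<in> KK" "l' \<in> KK" "g = l \<otimes>\<^bsub>Mp\<^esub> Hw (- int n) \<otimes>\<^bsub>Mp\<^esub> l'"
      unfolding dcoset_def by blast
    have "k \<otimes>\<^bsub>Mp\<^esub> g \<otimes>\<^bsub>Mp\<^esub> k' = (k \<otimes>\<^bsub>Mp\<^esub> l) \<otimes>\<^bsub>Mp\<^esub> Hw (- int n) \<otimes>\<^bsub>Mp\<^esub> (l' \<otimes>\<^bsub>Mp\<^esub> k')"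
      using k l KK_carrier by (simp add: Mp.m_assoc)
    then have "Phi r s n (k \<otimes>\<^bsub>Mp\<^esub> g \<otimes>\<^bsub>Mp\<^esub> k') v = sg s (k \<otimes>\<^bsub>Mp\<^esub> l) (rk1 r s (sg r (l' \<otimes>\<^bsub>Mp\<^esub> k') v))"
      using Phi_eq[OF c n KK_mult[OF k(1) l(1)] KK_mult[OF l(2) k(2)] v] by simp
    also have "\<dots> = sg s k (sg s l (rk1 r s (sg r l' (sg r k' v))))"
      using k l by (simp only: sg_mult)
    also have "sg s l (rk1 r s (sg r l' (sg r k' v))) = Phi r s n g (sg r k' v)"
      unfolding l(3) by (rule Phi_eq[OF c n l(1,2) sg_V, symmetric])
    finally show ?thesis .
  next
    case False
    then show ?thesis using dcoset_mult_iff[OF k g] sg_0[of s k] by (simp only: Phi_def simp_thms if_False)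
  qed
next
  have "{x \<in> carrier Mp. Phi r s n x \<noteq> 0} \<subseteq> dcoset n" by (auto simp: Phi_def fun_eq_iff)
  then show "finite (supp (Phi r s n))"
    unfolding supp_def using finite_dcoset_cosets[of n] by (meson finite_subset image_mono)
qed

lemma Phi_Hw:
  assumes "compatible r s" "n > 0" "v \<in> V r"
  shows "Phi r s n (Hw (- int n)) v = rk1 r s v"
  using Phi_eq[OF assms(1,2) KK_one KK_one assms(3)] sg_one[OF assms(3)] sg_one[OF rk1_V] by simp

text \<open>Existence for the definite description is \<open>Phi_kernel\<close>; uniqueness holds
  because equivariance fixes the values on the double coset once the value at \<open>h(w)^-n\<close>
  is prescribed.\<close>

lemma phi_eq_Phi:
  assumes c: "compatible r s" and n: "n > 0"
  shows "phi r s n = Phi r s n"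
proof -
  have dc: "KK <#>\<^bsub>Mp\<^esub> {Hw (- int n)} <#>\<^bsub>Mp\<^esub> KK = dcoset n"
    unfolding set_mult_def dcoset_def by blast
  have isp: "is_phi r s n \<psi> \<longleftrightarrow> (\<forall>g. \<psi> g \<in> Hom_V r s) \<and> (\<forall>g. g \<notin> dcoset n \<longrightarrow> \<psi> g = 0) \<and>
      (\<forall>k\<in>KK. \<forall>k'\<in>KK. \<forall>g\<in>carrier Mp. \<forall>v\<in>V r. \<psi> (k \<otimes>\<^bsub>Mp\<^esub> g \<otimes>\<^bsub>Mp\<^esub> k') v = sg s k (\<psi> g (sg r k' v))) \<and>
      (\<forall>v\<in>V r. \<psi> (Hw (- int n)) v = rk1 r s v)" for \<psi>
    unfolding is_phi_def Let_def Hw_def[symmetric] dc using rho_eq[OF c] by (simp add: rk1_def)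
  have "(THE \<psi>. is_phi r s n \<psi>) = Phi r s n"
  proof (rule the_equality)
    show "is_phi r s n (Phi r s n)"
      unfolding isp using Phi_kernel[OF c n] Phi_outside Phi_Hw[OF c n] unfolding hkernel_def by blast
  next
    fix \<psi> assume "is_phi r s n \<psi>"
    then have h: "\<And>g. \<psi> g \<in> Hom_V r s" and o: "\<And>g. g \<notin> dcoset n \<Longrightarrow> \<psi> g = 0"
      and e: "\<And>k k' g v. k \<in> KK \<Longrightarrow> k' \<in> KK \<Longrightarrow> g \<in> carrier Mp \<Longrightarrow> v \<in> V r \<Longrightarrow>
        \<psi> (k \<otimes>\<^bsub>Mp\<^esub> g \<otimes>\<^bsub>Mp\<^esub> k') v = sg s k (\<psi> g (sg r k' v))"
      and H: "\<And>v. v \<in> V r \<Longrightarrow> \<psi> (Hw (- int n)) v = rk1 r s v"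
      unfolding isp by blast+
    show "\<psi> = Phi r s n"
    proof (rule ext, rule ext)
      fix g v
      show "\<psi> g v = Phi r s n g v"
      proof (cases "g \<in> dcoset n \<and> v \<in> V r")
        case True
        then obtain k k' where k: "k \<in> KK" "k' \<in> KK" "g = k \<otimes>\<^bsub>Mp\<^esub> Hw (- int n) \<otimes>\<^bsub>Mp\<^esub> k'"
          unfolding dcoset_def by blast
        show ?thesis
          unfolding k(3) using True by (simp only: Phi_eq[OF c n k(1,2)] e[OF k(1,2) Hw_carrier] H[OF sg_V])
      next
        case False
        then show ?thesis using o[of g] Hom_VD(3)[OF h, of v g] by (auto simp: Phi_def)
      qed
    qed
  qed
  then show ?thesis using n by (simp add: phi_def)
qed

lemma phi_0_kernel: "hkernel r r (phi r r 0)"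
proof -
  have ph: "phi r r 0 g v = (if g \<in> KK \<and> v \<in> V r then sg r g v else 0)" for g v
    by (simp add: phi_def)
  have KKiff: "k \<otimes>\<^bsub>Mp\<^esub> g \<otimes>\<^bsub>Mp\<^esub> k' \<in> KK \<longleftrightarrow> g \<in> KK" if "k \<in> KK" "k' \<in> KK" "g \<in> carrier Mp" for k k' g
  proof
    assume "k \<otimes>\<^bsub>Mp\<^esub> g \<otimes>\<^bsub>Mp\<^esub> k' \<in> KK"
    from KK_mult[OF KK_mult[OF KK_inv[OF that(1)] this] KK_inv[OF that(2)]] show "g \<in> KK"
      unfolding KK_cancel[OF that] .
  qed (use that KK_mult in blast)
  show ?thesis
    unfolding hkernel_def
  proof (intro conjI allI ballI impI)
    fix g :: "'f mp"
    show "phi r r 0 g \<in> Hom_V r r"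
      unfolding Hom_V_def
    proof (intro CollectI conjI allI ballI impI)
      fix a and v v' :: "'e tvec" assume v: "v \<in> V r" "v' \<in> V r"
      have "vscale a v + v' \<in> V r" by (rule V_closed(1)[OF V_closed(2)[OF v(1)] v(2)])
      then show "phi r r 0 g (vscale a v + v') = vscale a (phi r r 0 g v) + phi r r 0 g v'"
        using v unfolding ph by (cases "g \<in> KK") (simp_all only: simp_thms if_True if_False sg_add sg_scale vscale_simps add_0_left)
    qed (unfold ph, use sg_V V_closed(3) in \<open>auto\<close>)
  next
    fix k k' g :: "'f mp" and v :: "'e tvec"
    assume "k \<in> KK" "k' \<in> KK" "g \<in> carrier Mp" "v \<in> V r"
    then show "phi r r 0 (k \<otimes>\<^bsub>Mp\<^esub> g \<otimes>\<^bsub>Mp\<^esub> k') v = sg r k (phi r r 0 g (sg r k' v))"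
      unfolding ph using KKiff sg_V[of r k' v] sg_0[of r k] KK_mult[of k g] by (auto simp: sg_mult)
  next
    have "supp (phi r r 0) \<subseteq> {KK}"
      using Mp.coset_join2[OF _ KK_subgroup] by (auto simp: supp_def phi_def fun_eq_iff split: if_splits)
    then show "finite (supp (phi r r 0))" using finite_subset by blast
  qed (auto simp: phi_def fun_eq_iff KK_carrier)
qed

text \<open>The cases in which the operator with index \<open>n\<close> is one of the theorem; for
  \<open>n = 0\<close> this requires equal weights.\<close>

definition admissible :: "nat list \<Rightarrow> nat list \<Rightarrow> nat \<Rightarrow> bool" where
  "admissible r s n \<longleftrightarrow> compatible r s \<and> (n > 0 \<or> r = s)"

abbreviation TT where "TT \<equiv> hecke_op"

lemma phi_kernel: "admissible r s n \<Longrightarrow> hkernel r s (phi r s n)"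
  using phi_eq_Phi Phi_kernel phi_0_kernel unfolding admissible_def by (cases "n > 0") auto

lemma TT_hecke: "admissible r s n \<Longrightarrow> TT r s n \<in> hecke r s"
  using op_of_hecke[OF phi_kernel] by (simp add: hecke_op_eq)

lemma TT_delta: "admissible r s n \<Longrightarrow> v \<in> V r \<Longrightarrow> g \<in> carrier Mp \<Longrightarrow> TT r s n (delta r v) g = phi r s n g v"
  using op_of_delta[OF phi_kernel] by (simp add: hecke_op_eq)

lemma TT_0: "r \<in> weights p f \<Longrightarrow> TT r r 0 = hecke_one r"
proof -
  assume r: "r \<in> weights p f"
  then have ad: "admissible r r 0" by (simp add: admissible_def compatible_def)
  have one: "hecke_one r \<in> hecke r r"
    unfolding hecke_def hecke_one_def using ind_lin ind_translate by (auto simp del: plus_fun_apply)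
  show ?thesis
  proof (rule hecke_eqI[OF TT_hecke[OF ad] one])
    fix v :: "'e tvec" assume v: "v \<in> V r"
    show "TT r r 0 (delta r v) = hecke_one r (delta r v)"
    proof
      fix g
      show "TT r r 0 (delta r v) g = hecke_one r (delta r v) g"
      proof (cases "g \<in> carrier Mp")
        case True
        then show ?thesis using TT_delta[OF ad v True] v delta_ind[of r v] by (simp add: hecke_one_def phi_def delta_def)
      next
        case False
        then show ?thesis
          using ind_outside[OF heckeD(1)[OF TT_hecke[OF ad] delta_ind] False] ind_outside[OF delta_ind False, of r v]
            delta_ind[of r v] by (simp only: hecke_one_def if_True)
      qed
    qed
  qed
qed

lemma Hw_neg_KK: "Hw (- int n) \<in> KK \<longleftrightarrow> n = 0"
proof
  assume "Hw (- int n) \<in> KK"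
  then have "Hw (- int n) \<otimes>\<^bsub>Mp\<^esub> Hw (- int 0) \<otimes>\<^bsub>Mp\<^esub> \<one>\<^bsub>Mp\<^esub> \<in> dcoset 0"
    unfolding dcoset_def using KK_one by blast
  then have "Hw (- int n) \<in> dcoset 0" by (simp add: Hw_0)
  then show "n = 0" using Hw_dcoset_iff by simp
qed (simp add: Hw_0 KK_one)

lemma phi_Hw:
  assumes "admissible r s n" "v \<in> V r"
  shows "phi r s n (Hw (- int m)) v r' = (if m = n then (if n = 0 then v r' else rk1 r s v r') else 0)"
proof (cases "n = 0")
  case True
  then show ?thesis using assms sg_one[OF assms(2)] Hw_neg_KK[of m] by (auto simp: phi_def Hw_0)
next
  case False
  then show ?thesis
    using assms phi_eq_Phi[of r s n] Phi_Hw[of r s n v] Phi_outside[of "Hw (- int m)" n r s] Hw_dcoset_iff[of "- int m" n]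
    by (auto simp: admissible_def)
qed

subsection \<open>Coordinates of an intertwining operator\<close>

text \<open>A single scalar is read off at each power of \<open>h(w)\<close>. That these scalars
  determine the operator is the content of \<open>value_Hw\<close>, \<open>value_one\<close> and the
  Cartan decomposition.\<close>

definition coord :: "('f, 'e) operator \<Rightarrow> nat list \<Rightarrow> nat list \<Rightarrow> nat \<Rightarrow> 'e" where
  "coord A r s n = A (delta r (vtop r)) (Hw (- int n)) s"

context
  fixes A r s
  assumes A: "A \<in> hecke r s" and r: "r \<in> weights p f" and s: "s \<in> weights p f"
begin

lemma A_right: "k \<in> KK \<Longrightarrow> g \<in> carrier Mp \<Longrightarrow> A (delta r v) (g \<otimes>\<^bsub>Mp\<^esub> k) = A (delta r (sg r k v)) g"
  using heckeD(3)[OF A KK_carrier delta_ind, of k v] translate_delta[of k r v] by (metis translate_apply)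

lemma A_left: "k \<in> KK \<Longrightarrow> g \<in> carrier Mp \<Longrightarrow> A (delta r v) (k \<otimes>\<^bsub>Mp\<^esub> g) = sg s k (A (delta r v) g)"
  using ind_left[OF heckeD(1)[OF A delta_ind]] by blast

lemma A_lin: "A (delta r (vscale c v + v')) g = vscale c (A (delta r v) g) + A (delta r v') g"
  using heckeD(2)[OF A delta_ind delta_ind] by (simp only: delta_lin fun_plus)

lemma A_V: "g \<in> carrier Mp \<Longrightarrow> A (delta r v) g \<in> V s"
  using ind_V[OF heckeD(1)[OF A delta_ind]] by blast

text \<open>Moving \<open>Lo x\<close> across \<open>h(w)^-n\<close> gives
  \<open>Lo (w^(2n) x)\<close>, which is again integral and is not seen by the top coordinate of the
  target. So the left-hand side is an invariant functional of \<open>v\<close>.\<close>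

lemma top_functional:
  assumes v: "v \<in> V r"
  shows "A (delta r v) (Hw (- int n)) s = coord A r s n * v r"
  unfolding coord_def
proof (rule Ubar_functional[OF r _ _ v])
  fix c and v v' :: "'e tvec"
  show "A (delta r (vscale c v + v')) (Hw (- int n)) s =
      c * A (delta r v) (Hw (- int n)) s + A (delta r v') (Hw (- int n)) s"
    unfolding A_lin by (simp only: plus_fun_apply vscale_apply)
next
  fix c and v :: "'e tvec" assume "c \<in> kappa"
  then obtain x where x: "x \<in> R" "c = red x" unfolding kappa_def by blast
  have xw: "w powi (2 * int n) * x \<in> R"
    using x wR R_power R.Zmult power_int_of_nat[of w "2 * n"] by simp
  have "A (delta r (act r (ll c) v)) (Hw (- int n)) = A (delta r v) (Hw (- int n) \<otimes>\<^bsub>Mp\<^esub> Lo x)"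
    using A_right[of "Lo x" "Hw (- int n)" v] x by (simp add: sg_Lo)
  also have "Hw (- int n) \<otimes>\<^bsub>Mp\<^esub> Lo x = Lo (w powi (2 * int n) * x) \<otimes>\<^bsub>Mp\<^esub> Hw (- int n)"
    using Hw_Lo[of "- int n" x] by simp
  also have "A (delta r v) \<dots> = sg s (Lo (w powi (2 * int n) * x)) (A (delta r v) (Hw (- int n)))"
    using xw by (intro A_left) auto
  finally show "A (delta r (act r (ll c) v)) (Hw (- int n)) s = A (delta r v) (Hw (- int n)) s"
    by (simp only: top_Lo)
qed

text \<open>A torus element commutes with \<open>h(w)^-n\<close>. Evaluated on the right it acts by
  the character of \<open>r\<close>, and on the left by that of \<open>s\<close>; a nonzero
  coordinate forces them to agree.\<close>

lemma coord_compatible: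
  assumes "coord A r s n \<noteq> 0"
  shows "compatible r s"
proof (rule incompatible_power[OF r s])
  fix c assume "c \<in> kappa" "c \<noteq> 0"
  then obtain t where t: "t \<in> units" "red t = c" using kappa_lift_unit by blast
  let ?H = "Hw (- int n)"
  have "A (delta r (vtop r)) (?H \<otimes>\<^bsub>Mp\<^esub> Di t 1) = A (delta r (sg r (Di t 1) (vtop r))) ?H"
    using t by (intro A_right) auto
  then have 1: "A (delta r (vtop r)) (?H \<otimes>\<^bsub>Mp\<^esub> Di t 1) s = coord A r s n * c ^ wt p r"
    using top_functional[OF sg_V, of "Di t 1" "vtop r" n] t by (simp add: sg_Di_vtop vscale_apply)
  have "A (delta r (vtop r)) (Di t 1 \<otimes>\<^bsub>Mp\<^esub> ?H) = sg s (Di t 1) (A (delta r (vtop r)) ?H)"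
    using t by (intro A_left) auto
  then have 2: "A (delta r (vtop r)) (Di t 1 \<otimes>\<^bsub>Mp\<^esub> ?H) s = c ^ wt p s * coord A r s n"
    using t by (simp add: top_Di coord_def)
  have "coord A r s n * c ^ wt p r = coord A r s n * c ^ wt p s"
    unfolding 1[symmetric] Hw_Di_commute[OF units_nonzero[OF t(1)]] 2 by (rule mult.commute)
  then show "c ^ wt p r = c ^ wt p s" using assms by simp
qed

text \<open>For \<open>n > 0\<close> an arbitrary integral \<open>Up x\<close> on the left of
  \<open>h(w)^-n\<close> comes from \<open>Up (w^(2n) x)\<close> on the right, which acts trivially
  on the source. Hence the value is invariant under the upper unipotents and lies on the line of the
  top vector.\<close>

lemma value_Hw:
  assumes v: "v \<in> V r" and n: "n > 0"
  shows "A (delta r v) (Hw (- int n)) = vscale (coord A r s n * v r) (vtop s)"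
proof -
  let ?u = "A (delta r v) (Hw (- int n))"
  have "act s (uu c) ?u = ?u" if "c \<in> kappa" for c
  proof -
    obtain x where x: "x \<in> R" "c = red x" using \<open>c \<in> kappa\<close> unfolding kappa_def by blast
    define y where "y = w ^ (2 * n) * x"
    have y: "y \<in> R" "red y = 0" using x wR R_power R.Zmult red_w_mult n by (auto simp: y_def)
    have "w powi (- (2 * int n)) * w ^ (2 * n) = 1"
      using w_nonzero power_int_of_nat[of w "2 * n"] power_int_minus[of w "2 * int n"] by simp
    then have "w powi (2 * - int n) * y = x" by (simp add: y_def flip: mult.assoc)
    then have "Hw (- int n) \<otimes>\<^bsub>Mp\<^esub> Up y = Up x \<otimes>\<^bsub>Mp\<^esub> Hw (- int n)" using Hw_Up[of "- int n" y] by simp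
    moreover have "A (delta r v) (Hw (- int n) \<otimes>\<^bsub>Mp\<^esub> Up y) = ?u"
      using A_right[of "Up y" "Hw (- int n)" v] y sg_Up_small[OF v y(2)] by simp
    moreover have "A (delta r v) (Up x \<otimes>\<^bsub>Mp\<^esub> Hw (- int n)) = sg s (Up x) ?u"
      using x by (intro A_left) auto
    ultimately show ?thesis using x by (simp add: sg_Up)
  qed
  from U_invariant[OF s A_V this] show ?thesis using top_functional[OF v] by simp
qed

lemma act_trivial: "v \<in> V rz \<Longrightarrow> act rz M v = v"
proof -
  assume v: "v \<in> V rz"
  have ix: "index_set rz = {rz}"
    using index_set_nth[of _ rz] index_set_length[of _ rz] index_set_self[of rz]
    by (auto intro!: nth_equalityI)
  have "tens rz M rz rz = 1" by (simp add: tens_def sym_entry_def)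
  then show ?thesis using v by (auto simp: act_eq ix fun_eq_iff V_def)
qed

text \<open>At the identity the operator gives a map of representations of \<open>K\<close>, and
  such a map is determined by its top coordinate through \<open>cyclic_functional\<close>. For equal
  weights it is therefore a scalar. Unequal compatible weights are the exceptional pair, where the
  Weyl element decides: it fixes the trivial weight but moves the top vector of the other one. This
  is why index 0 is absent from the mixed modules.\<close>

lemma value_one:
  assumes v: "v \<in> V r"
  shows "A (delta r v) \<one>\<^bsub>Mp\<^esub> = (if r = s then vscale (coord A r s 0) v else 0)"
    and "r \<noteq> s \<Longrightarrow> coord A r s 0 = 0"
proof -
  let ?F = "\<lambda>v. A (delta r v) \<one>\<^bsub>Mp\<^esub>"
  define a where "a = coord A r s 0"
  have top: "?F v s = a * v r" if "v \<in> V r" for v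
    using top_functional[OF that, of 0] by (simp add: Hw_0 a_def)
  have eqv: "?F (sg r k v) = sg s k (?F v)" if "k \<in> KK" for k v
    using A_right[OF that Mp.one_closed, of v] A_left[OF that Mp.one_closed, of v] KK_carrier[OF that] by simp
  have FV: "?F v \<in> V s" for v by (intro A_V) simp
  have zero: "?F v = 0" if a0: "a = 0" and v: "v \<in> V r" for v
  proof (rule cyclic_functional[OF s FV])
    fix c assume "c \<in> kappa"
    then obtain x where x: "x \<in> R" "c = red x" unfolding kappa_def by blast
    then have "act s (uu c) (?F v) = ?F (sg r (Up x) v)" using eqv[of "Up x" v] by (simp add: sg_Up)
    then show "act s (uu c) (?F v) s = 0" using top[OF sg_V] a0 by simp
  qed
  have neq: "a = 0" if rs: "r \<noteq> s"
  proof (rule ccontr)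
    assume "a \<noteq> 0"
    then have "compatible r s" using coord_compatible unfolding a_def by blast
    then consider "r = rz" "s = rm" | "r = rm" "s = rz" using rs by (auto simp: compatible_def doubleton_eq_iff)
    then show False
    proof cases
      case 1
      let ?u = "?F (vtop r)"
      have "act s (uu c) ?u = ?u" if "c \<in> kappa" for c
      proof -
        obtain x where x: "x \<in> R" "c = red x" using \<open>c \<in> kappa\<close> unfolding kappa_def by blast
        then show ?thesis using eqv[of "Up x" "vtop r"] sg_Up_vtop[of r x] by (simp add: sg_Up)
      qed
      from U_invariant[OF s FV this] have u: "?u = vscale a (vtop s)" using top[OF vtop_V] by simp
      \<comment> \<open>The Weyl element acts trivially on the source, so it would have to fix the
        top vector of the target, which it sends to the basis vector at the opposite end.\<close>
      have "sg r We (vtop r) = vtop r" using 1 act_trivial[OF vtop_V] by (simp add: sg_We)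
      then have "sg s We ?u = ?u" using eqv[of We "vtop r"] by simp
      then have "vscale a (vbase rz) = vscale a (vtop s)"
        unfolding u using 1 by (simp add: sg_We act_scale act_weyl_vtop)
      then have "vscale a (vbase rz) rm = vscale a (vtop s) rm" by simp
      then show False using \<open>a \<noteq> 0\<close> 1 rz_neq_rm by (simp add: vscale_apply vbase_def)
    next
      case 2
      have "?F (sg r We (vtop r)) s = a * sg r We (vtop r) r" by (rule top[OF sg_V])
      also have "sg r We (vtop r) r = 0" using 2 rz_neq_rm by (simp add: sg_We act_weyl_vtop vbase_def)
      finally have "sg s We (?F (vtop r)) s = 0" using eqv[of We "vtop r"] by simp
      moreover have "sg s We (?F (vtop r)) = ?F (vtop r)" using 2 act_trivial[of "?F (vtop r)"] FV by (simp add: sg_We)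
      ultimately show False using top[OF vtop_V] \<open>a \<noteq> 0\<close> by simp
    qed
  qed
  then show "r \<noteq> s \<Longrightarrow> coord A r s 0 = 0" by (simp add: a_def)
  show "?F v = (if r = s then vscale (coord A r s 0) v else 0)"
  proof (cases "r = s")
    case True
    have "?F v - vscale a v = 0"
    proof (rule cyclic_functional[OF s])
      show "?F v - vscale a v \<in> V s" using FV[of v] v True V_closed(2)[of v r a] by (intro V_closed(4)) auto
    next
      fix c assume "c \<in> kappa"
      then obtain x where x: "x \<in> R" "c = red x" unfolding kappa_def by blast
      have "act s (uu c) (?F v - vscale a v) + act s (uu c) (vscale a v) = act s (uu c) (?F v)"
        by (simp only: act_add[symmetric] diff_add_cancel)
      from fun_cong[OF this, of s] have "act s (uu c) (?F v - vscale a v) s + a * act s (uu c) v s = act s (uu c) (?F v) s"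
        by (simp only: act_scale plus_fun_apply vscale_apply)
      then have "act s (uu c) (?F v - vscale a v) s = act s (uu c) (?F v) s - a * act s (uu c) v s"
        by (simp only: eq_diff_eq)
      moreover have "act s (uu c) (?F v) = ?F (sg r (Up x) v)" using x eqv[of "Up x" v] by (simp add: sg_Up)
      moreover have "?F (sg r (Up x) v) s = a * act s (uu c) v s" using top[OF sg_V[of r "Up x" v]] x True by (simp add: sg_Up)
      ultimately show "act s (uu c) (?F v - vscale a v) s = 0" by simp
    qed
    then have "?F v = vscale a v" by (metis eq_iff_diff_eq_0)
    then show ?thesis using True by (simp add: a_def)
  next
    case False
    then show ?thesis using zero[OF neq v] by simp
  qed
qed

text \<open>The powers \<open>h(w)^-n\<close> lie in pairwise different right cosets, and only
  finitely many of these meet the support.\<close>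

lemma coord_finite: "finite {n. coord A r s n \<noteq> 0}"
proof -
  have fs: "finite (supp (A (delta r (vtop r))))" by (rule ind_finite[OF heckeD(1)[OF A delta_ind]])
  define N where "N = {n. coord A r s n \<noteq> 0}"
  have "(\<lambda>n. KK #>\<^bsub>Mp\<^esub> Hw (- int n)) ` N \<subseteq> supp (A (delta r (vtop r)))"
    by (auto simp: N_def coord_def supp_def)
  moreover have "inj_on (\<lambda>n. KK #>\<^bsub>Mp\<^esub> Hw (- int n)) N"
  proof (rule inj_onI)
    fix m n assume "KK #>\<^bsub>Mp\<^esub> Hw (- int m) = KK #>\<^bsub>Mp\<^esub> Hw (- int n)"
    then have K: "Hw (int n - int m) \<in> KK" by (subst (asm) coset_eq_iff) (auto simp: Hw_conj Hw_add)
    show "m = n"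
    proof (cases "n \<le> m")
      case True
      then have "Hw (- int (m - n)) \<in> KK" using K by simp
      then have "m - n = 0" unfolding Hw_neg_KK .
      then show ?thesis using True by simp
    next
      case False
      have "Hw (- int (n - m)) \<in> KK" using KK_inv[OF K] False by (simp add: Hw_conj)
      then have "n - m = 0" unfolding Hw_neg_KK .
      then show ?thesis using False by simp
    qed
  qed
  ultimately have "finite N" using fs finite_subset finite_imageD by metis
  then show ?thesis by (simp add: N_def)
qed

end

lemma coord_eqI:
  assumes A: "A \<in> hecke r s" and B: "B \<in> hecke r s" and r: "r \<in> weights p f" and s: "s \<in> weights p f"
    and eq: "\<And>n. coord A r s n = coord B r s n"
  shows "A = B"
proof (rule hecke_eqI[OF A B])
  fix v0 :: "'e tvec" assume v0: "v0 \<in> V r"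
  have H: "A (delta r v) (Hw (- int n)) = B (delta r v) (Hw (- int n))" if v: "v \<in> V r" for v n
  proof (cases "n > 0")
    case True
    then show ?thesis using value_Hw[OF A r s v True] value_Hw[OF B r s v True] eq by simp
  next
    case False
    then have "- int n = 0" by simp
    then show ?thesis by (simp only: Hw_0 value_one(1)[OF A r s v] value_one(1)[OF B r s v] eq)
  qed
  show "A (delta r v0) = B (delta r v0)"
  proof
    fix g
    show "A (delta r v0) g = B (delta r v0) g"
    proof (cases "g \<in> carrier Mp")
      case True
      then obtain n k k' where k: "k \<in> KK" "k' \<in> KK" "g = k \<otimes>\<^bsub>Mp\<^esub> Hw (- int n) \<otimes>\<^bsub>Mp\<^esub> k'"
        using cartan[OF True] unfolding dcoset_def by blast
      have "A (delta r v0) g = sg s k (A (delta r (sg r k' v0)) (Hw (- int n)))"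
        unfolding k(3) using A_right[OF A r s k(2)] A_left[OF A r s k(1)] k KK_carrier by simp
      also have "\<dots> = sg s k (B (delta r (sg r k' v0)) (Hw (- int n)))" using H[OF sg_V] by simp
      also have "\<dots> = B (delta r v0) g"
        unfolding k(3) using A_right[OF B r s k(2)] A_left[OF B r s k(1)] k KK_carrier by simp
      finally show ?thesis .
    next
      case False
      then show ?thesis
        using ind_outside[OF heckeD(1)[OF A delta_ind] False] ind_outside[OF heckeD(1)[OF B delta_ind] False] by simp
    qed
  qed
qed

lemma coord_TT:
  assumes "admissible r s n"
  shows "coord (TT r s n) r s m = (if m = n then kap r s else 0)"
  using assms TT_delta[OF assms vtop_V Hw_carrier] phi_Hw[OF assms vtop_V]
  by (auto simp: coord_def rk1_def vtop_V vscale_apply admissible_def kap_def)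

end

section \<open>Orbital sums along the lower unipotent subgroup\<close>

context hecke_setting
begin

section \<open>Finitely supported functions on F / R\<close>

definition zcl :: "'f \<Rightarrow> 'f set" where "zcl z = {a. a - z \<in> R}"

lemma zcl_eq_iff: "zcl x = zcl y \<longleftrightarrow> x - y \<in> R"
proof
  assume "zcl x = zcl y"
  moreover have "x \<in> zcl x" using R.Z0 by (simp add: zcl_def)
  ultimately show "x - y \<in> R" by (simp add: zcl_def)
next
  assume "x - y \<in> R"
  then have "a - x \<in> R \<longleftrightarrow> a - y \<in> R" for a
    using R.Zadd[of "a - x" "x - y"] R.Zdiff[of "a - y" "x - y"] by auto
  then show "zcl x = zcl y" by (simp add: zcl_def)
qed

definition zrep :: "'f set \<Rightarrow> 'f" where "zrep Z = (SOME z. zcl z = Z)"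

lemma zcl_zrep: "Z \<in> range zcl \<Longrightarrow> zcl (zrep Z) = Z"
  unfolding zrep_def by (rule someI_ex) auto

text \<open>Functions on the quotient \<open>F / R\<close> with finite support, kept as periodic
  functions on the field so that explicit formulas in \<open>z\<close> can be used.\<close>

definition sch :: "('f \<Rightarrow> 'e) \<Rightarrow> bool" where
  "sch F \<longleftrightarrow> (\<forall>z. \<forall>x\<in>R. F (z + x) = F z) \<and> finite (zcl ` {z. F z \<noteq> 0})"

definition psum :: "('f \<Rightarrow> 'e) \<Rightarrow> 'e" where
  "psum F = (\<Sum>Z\<in>zcl ` {z. F z \<noteq> 0}. F (zrep Z))"

lemma sch_cong: "sch F \<Longrightarrow> zcl z = zcl z' \<Longrightarrow> F z = F z'"
  unfolding sch_def zcl_eq_iff by (metis add.commute diff_add_cancel)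

lemma sch_rep: "sch F \<Longrightarrow> F (zrep (zcl z)) = F z"
  by (erule sch_cong) (simp add: zcl_zrep)

lemma psum_superset:
  assumes F: "sch F" and A: "finite A" "A \<subseteq> range zcl" "zcl ` {z. F z \<noteq> 0} \<subseteq> A"
  shows "psum F = (\<Sum>Z\<in>A. F (zrep Z))"
  unfolding psum_def
proof (rule sum.mono_neutral_left[OF A(1,3)], rule ballI)
  fix Z assume Z: "Z \<in> A - zcl ` {z. F z \<noteq> 0}"
  then have "zcl (zrep Z) = Z" using A(2) zcl_zrep by blast
  moreover have "zcl (zrep Z) \<in> zcl ` {z. F z \<noteq> 0}" if "F (zrep Z) \<noteq> 0" using that by blast
  ultimately show "F (zrep Z) = 0" using Z by auto
qed

lemma sch_lin:
  assumes F: "sch F" and G: "sch G"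
  shows "sch (\<lambda>z. c * F z + G z)" "psum (\<lambda>z. c * F z + G z) = c * psum F + psum G"
proof -
  let ?A = "zcl ` {z. F z \<noteq> 0} \<union> zcl ` {z. G z \<noteq> 0}"
  have A: "finite ?A" "?A \<subseteq> range zcl" using F G by (auto simp: sch_def)
  have sub: "zcl ` {z. c * F z + G z \<noteq> 0} \<subseteq> ?A" by auto
  show L: "sch (\<lambda>z. c * F z + G z)"
    using F G finite_subset[OF sub A(1)] by (simp add: sch_def)
  show "psum (\<lambda>z. c * F z + G z) = c * psum F + psum G"
    using psum_superset[OF L A sub] psum_superset[OF F A] psum_superset[OF G A]
    by (simp add: sum.distrib sum_distrib_left)
qed

text \<open>The condition on differences says that the bijection \<open>h\<close> and its inverse
  descend to \<open>F / R\<close>; translations and multiplications by units are the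
  instances.\<close>

lemma psum_reindex:
  assumes F: "sch F" and h: "\<And>z. h' (h z) = z" "\<And>z. h (h' z) = z"
    and hR: "\<And>z z'. h z - h z' \<in> R \<longleftrightarrow> z - z' \<in> R"
  shows "psum (\<lambda>z. F (h z)) = psum F"
proof -
  have h'R: "zcl (h' z) = zcl (h' z') \<longleftrightarrow> zcl z = zcl z'" for z z'
    using hR[of "h' z" "h' z'"] by (simp add: h(2) zcl_eq_iff)
  have hR': "zcl (h z) = zcl (h z') \<longleftrightarrow> zcl z = zcl z'" for z z'
    using hR by (simp add: zcl_eq_iff)
  show ?thesis
    unfolding psum_def
  proof (rule sum.reindex_bij_witness[where i = "\<lambda>Z. zcl (h' (zrep Z))" and j = "\<lambda>Z. zcl (h (zrep Z))"])
    fix Z assume "Z \<in> zcl ` {z. F (h z) \<noteq> 0}"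
    then obtain z where z: "F (h z) \<noteq> 0" "Z = zcl z" by blast
    have r: "zcl (zrep Z) = zcl z" unfolding z(2) by (rule zcl_zrep) simp
    have e: "zcl (h (zrep Z)) = zcl (h z)" using r hR' by blast
    have r2: "zcl (zrep (zcl (h z))) = zcl (h z)" by (rule zcl_zrep) simp
    show "zcl (h' (zrep (zcl (h (zrep Z))))) = Z" unfolding e unfolding z(2) using r2 h'R[of "zrep (zcl (h z))" "h z"] h(1) by simp
    show "zcl (h (zrep Z)) \<in> zcl ` {z. F z \<noteq> 0}" unfolding e using z(1) by blast
    show "F (zrep (zcl (h (zrep Z)))) = F (h (zrep Z))" by (rule sch_rep[OF F])
  next
    fix Z assume "Z \<in> zcl ` {z. F z \<noteq> 0}"
    then obtain z where z: "F z \<noteq> 0" "Z = zcl z" by blast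
    have r: "zcl (zrep Z) = zcl z" unfolding z(2) by (rule zcl_zrep) simp
    have e: "zcl (h' (zrep Z)) = zcl (h' z)" using r h'R by blast
    have r2: "zcl (zrep (zcl (h' z))) = zcl (h' z)" by (rule zcl_zrep) simp
    show "zcl (h (zrep (zcl (h' (zrep Z))))) = Z" unfolding e unfolding z(2) using r2 hR'[of "zrep (zcl (h' z))" "h' z"] h(2) by simp
    show "zcl (h' (zrep Z)) \<in> zcl ` {z. F (h z) \<noteq> 0}" unfolding e using z(1) h(2) by force
  qed
qed

lemma psum_R: "sch (\<lambda>z. if z \<in> R then c else 0)" "psum (\<lambda>z. if z \<in> R then c else 0) = c"
proof -
  have R: "z + x \<in> R \<longleftrightarrow> z \<in> R" if "x \<in> R" for z x
    using that R.Zadd[of z x] R.Zdiff[of "z + x" x] by auto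
  have sub: "zcl ` {z. (if z \<in> R then c else 0) \<noteq> 0} \<subseteq> {zcl 0}"
    by (rule image_subsetI) (simp add: zcl_eq_iff split: if_splits)
  show s: "sch (\<lambda>z. if z \<in> R then c else 0)"
    using R finite_subset[OF sub] by (simp add: sch_def)
  have "zrep (zcl 0) \<in> R" using zcl_zrep[of "zcl 0"] zcl_eq_iff by fastforce
  then show "psum (\<lambda>z. if z \<in> R then c else 0) = c"
    using psum_superset[OF s _ _ sub] by simp
qed

lemma card_image_cong:
  assumes "\<And>x y. x \<in> A \<Longrightarrow> y \<in> A \<Longrightarrow> g x = g y \<longleftrightarrow> h x = h y"
  shows "card (g ` A) = card (h ` A)"
proof (rule bij_betw_same_card, rule bij_betwI')
  let ?k = "\<lambda>z. h (inv_into A g z)"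
  have k: "?k (g x) = h x" if "x \<in> A" for x
    using assms inv_into_into[of "g x" g A] f_inv_into_f[of "g x" g A] that by blast
  fix z z' assume "z \<in> g ` A" "z' \<in> g ` A"
  then show "?k z = ?k z' \<longleftrightarrow> z = z'" using k assms by auto
next
  fix z assume "z \<in> g ` A"
  then show "h (inv_into A g z) \<in> h ` A" by (intro imageI inv_into_into)
next
  fix z assume "z \<in> h ` A"
  then obtain x where x: "x \<in> A" "z = h x" by blast
  then have "h (inv_into A g (g x)) = h x"
    using assms inv_into_into[of "g x" g A] f_inv_into_f[of "g x" g A] by blast
  then show "\<exists>y\<in>g ` A. z = h (inv_into A g y)" using x by (intro bexI[of _ "g x"]) auto
qed

text \<open>A function that is invariant under the larger lattice \<open>w\<^sup>-\<^sup>1 R\<close> takes each value on a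
  multiple of \<open>q\<close> cosets of \<open>R\<close>, and \<open>q = 0\<close> in \<open>E\<close>.\<close>

lemma psum_vanish:
  assumes F: "sch F" and per: "\<And>z a. a \<in> R \<Longrightarrow> F (z + a / w) = F z"
  shows "psum F = 0"
proof -
  let ?S = "zcl ` {z. F z \<noteq> 0}"
  \<comment> \<open>Classes modulo the lattice \<open>w^-1 R\<close>, by which the sum is
    grouped.\<close>
  define wcl where "wcl z = {a. w * (a - z) \<in> R}" for z
  have wcl: "wcl x = wcl y \<longleftrightarrow> w * (x - y) \<in> R" for x y
  proof
    assume "wcl x = wcl y"
    moreover have "x \<in> wcl x" using R.Z0 by (simp add: wcl_def)
    ultimately show "w * (x - y) \<in> R" by (simp add: wcl_def)
  next
    assume "w * (x - y) \<in> R"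
    then have "w * (a - x) \<in> R \<longleftrightarrow> w * (a - y) \<in> R" for a
      using R.Zadd[of "w * (a - x)" "w * (x - y)"] R.Zdiff[of "w * (a - y)" "w * (x - y)"]
      by (auto simp: algebra_simps)
    then show "wcl x = wcl y" by (simp add: wcl_def)
  qed
  have inner: "(\<Sum>Z\<in>{Z \<in> ?S. wcl (zrep Z) = W}. F (zrep Z)) = 0" if W: "W \<in> (\<lambda>Z. wcl (zrep Z)) ` ?S" for W
  proof -
    obtain z where z: "F z \<noteq> 0" "W = wcl (zrep (zcl z))" using W by blast
    define y where "y = zrep (zcl z)"
    have y: "F y \<noteq> 0" "W = wcl y" using z sch_rep[OF F] by (auto simp: y_def)
    have const: "F x = F y" if "wcl x = wcl y" for x
    proof -
      have "w * (x - y) \<in> R" using that wcl by blast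
      from per[OF this, of y] show ?thesis using w_nonzero by simp
    qed
    have "{Z \<in> ?S. wcl (zrep Z) = W} = (\<lambda>a. zcl (y + a / w)) ` R"
    proof (intro equalityI subsetI)
      fix Z assume "Z \<in> {Z \<in> ?S. wcl (zrep Z) = W}"
      then have Z: "zcl (zrep Z) = Z" "w * (zrep Z - y) \<in> R" using y wcl zcl_zrep[of Z] by auto
      have "Z = zcl (y + w * (zrep Z - y) / w)" using w_nonzero Z(1) by simp
      then show "Z \<in> (\<lambda>a. zcl (y + a / w)) ` R" using Z(2) by blast
    next
      fix Z assume "Z \<in> (\<lambda>a. zcl (y + a / w)) ` R"
      then obtain a where a: "a \<in> R" "Z = zcl (y + a / w)" by blast
      have r: "zrep Z - (y + a / w) \<in> R" unfolding a(2) using zcl_zrep[of "zcl (y + a / w)"] zcl_eq_iff by blast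
      have "w * (zrep Z - y) = w * (zrep Z - (y + a / w)) + a" using w_nonzero by (simp add: field_simps)
      then have "wcl (zrep Z) = W" unfolding y(2) wcl using r a(1) wR R.Zadd R.Zmult by simp
      moreover have "F (y + a / w) \<noteq> 0" using per[OF a(1)] y(1) by simp
      ultimately show "Z \<in> {Z \<in> ?S. wcl (zrep Z) = W}" using a(2) by blast
    qed
    moreover have "card ((\<lambda>a. zcl (y + a / w)) ` R) = card (red ` R)"
    proof (rule card_image_cong)
      fix a b assume ab: "a \<in> R" "b \<in> R"
      have "zcl (y + a / w) = zcl (y + b / w) \<longleftrightarrow> (a - b) / w \<in> R"
        unfolding zcl_eq_iff by (simp add: diff_divide_distrib)
      also have "\<dots> \<longleftrightarrow> a - b \<in> (*) w ` R"
      proof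
        assume "(a - b) / w \<in> R"
        moreover have "a - b = w * ((a - b) / w)" using w_nonzero by simp
        ultimately show "a - b \<in> (*) w ` R" by blast
      qed (use w_nonzero in auto)
      also have "\<dots> \<longleftrightarrow> red a = red b" using red_eq_0[of "a - b"] red_diff ab R.Zdiff by simp
      finally show "zcl (y + a / w) = zcl (y + b / w) \<longleftrightarrow> red a = red b" .
    qed
    ultimately have "card {Z \<in> ?S. wcl (zrep Z) = W} = q" using card_kappa by (simp add: kappa_def)
    moreover have "(\<Sum>Z\<in>{Z \<in> ?S. wcl (zrep Z) = W}. F (zrep Z)) = (\<Sum>Z\<in>{Z \<in> ?S. wcl (zrep Z) = W}. F y)"
      by (rule sum.cong[OF refl], rule const) (simp add: y(2))
    moreover have "of_nat q = (0 :: 'e)"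
      unfolding of_nat_eq_0_iff_char_dvd char_E q_def using f_pos by simp
    ultimately show ?thesis by simp
  qed
  have "psum F = (\<Sum>W\<in>(\<lambda>Z. wcl (zrep Z)) ` ?S. \<Sum>Z\<in>{Z \<in> ?S. wcl (zrep Z) = W}. F (zrep Z))"
    unfolding psum_def using F by (intro sum.image_gen) (simp add: sch_def)
  then show ?thesis using inner by simp
qed

text \<open>The orbital sum in coordinates: the top coordinate is the projection to the
  coinvariants. It is insensitive to integral lower unipotents on the left, so the summand depends
  only on \<open>z\<close> modulo \<open>R\<close>.\<close>

definition Lam :: "nat list \<Rightarrow> ('f mp \<Rightarrow> 'e tvec) \<Rightarrow> 'f mp \<Rightarrow> 'e" where
  "Lam r \<phi> g = psum (\<lambda>z. \<phi> (Lo z \<otimes>\<^bsub>Mp\<^esub> g) r)"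

text \<open>Distinct classes of \<open>z\<close> give distinct right cosets of
  \<open>Lo z g\<close>, so finiteness of the support passes to \<open>F / R\<close>.\<close>

lemma sch_Lam:
  assumes f: "\<phi> \<in> ind r" and g: "g \<in> carrier Mp"
  shows "sch (\<lambda>z. \<phi> (Lo z \<otimes>\<^bsub>Mp\<^esub> g) r)"
  unfolding sch_def
proof (intro conjI allI ballI)
  fix z x assume x: "x \<in> R"
  have "Lo (z + x) \<otimes>\<^bsub>Mp\<^esub> g = Lo x \<otimes>\<^bsub>Mp\<^esub> (Lo z \<otimes>\<^bsub>Mp\<^esub> g)"
    using g Lo_Lo[of x z] by (simp add: add.commute flip: Mp.m_assoc)
  then show "\<phi> (Lo (z + x) \<otimes>\<^bsub>Mp\<^esub> g) r = \<phi> (Lo z \<otimes>\<^bsub>Mp\<^esub> g) r"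
    using ind_left[OF f, of "Lo x" "Lo z \<otimes>\<^bsub>Mp\<^esub> g"] x g top_Lo by simp
next
  let ?A = "{z. \<phi> (Lo z \<otimes>\<^bsub>Mp\<^esub> g) r \<noteq> 0}"
  have "(\<lambda>z. KK #>\<^bsub>Mp\<^esub> (Lo z \<otimes>\<^bsub>Mp\<^esub> g)) ` ?A \<subseteq> supp \<phi>"
    using g by (auto simp: supp_def)
  then have "finite ((\<lambda>z. KK #>\<^bsub>Mp\<^esub> (Lo z \<otimes>\<^bsub>Mp\<^esub> g)) ` ?A)" using ind_finite[OF f] finite_subset by blast
  then show "finite (zcl ` ?A)"
  proof (rule finite_factor)
    fix x y assume "KK #>\<^bsub>Mp\<^esub> (Lo x \<otimes>\<^bsub>Mp\<^esub> g) = KK #>\<^bsub>Mp\<^esub> (Lo y \<otimes>\<^bsub>Mp\<^esub> g)"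
    then have "Lo x \<otimes>\<^bsub>Mp\<^esub> g \<otimes>\<^bsub>Mp\<^esub> inv\<^bsub>Mp\<^esub> (Lo y \<otimes>\<^bsub>Mp\<^esub> g) \<in> KK"
      using g by (subst (asm) coset_eq_iff) auto
    moreover have "Lo x \<otimes>\<^bsub>Mp\<^esub> g \<otimes>\<^bsub>Mp\<^esub> inv\<^bsub>Mp\<^esub> (Lo y \<otimes>\<^bsub>Mp\<^esub> g) = Lo x \<otimes>\<^bsub>Mp\<^esub> inv\<^bsub>Mp\<^esub> Lo y"
    proof -
      have "g \<otimes>\<^bsub>Mp\<^esub> (inv\<^bsub>Mp\<^esub> g \<otimes>\<^bsub>Mp\<^esub> inv\<^bsub>Mp\<^esub> Lo y) = inv\<^bsub>Mp\<^esub> Lo y" using g by (simp flip: Mp.m_assoc)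
      then show ?thesis using g by (simp add: Mp.inv_mult_group Mp.m_assoc)
    qed
    moreover have "inv\<^bsub>Mp\<^esub> Lo y = Lo (- y)"
      using Mp.inv_equality[of "Lo (- y)" "Lo y"] by (simp add: Lo_Lo Lo_0)
    ultimately have "Lo (x - y) \<in> KK" by (simp add: Lo_Lo)
    then show "zcl x = zcl y" using zcl_eq_iff by simp
  qed
qed

lemma Lam_lin:
  assumes "\<phi> \<in> ind r" "\<psi> \<in> ind r" "g \<in> carrier Mp"
  shows "Lam r ((\<lambda>g. vscale c (\<phi> g)) + \<psi>) g = c * Lam r \<phi> g + Lam r \<psi> g"
  unfolding Lam_def fun_plus plus_fun_apply vscale_apply
  by (rule sch_lin(2)[OF sch_Lam[OF assms(1,3)] sch_Lam[OF assms(2,3)]])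

lemma Lam_0: "Lam r 0 g = 0"
  by (simp add: Lam_def psum_def)

lemma Lam_add: "\<phi> \<in> ind r \<Longrightarrow> \<psi> \<in> ind r \<Longrightarrow> g \<in> carrier Mp \<Longrightarrow> Lam r (\<phi> + \<psi>) g = Lam r \<phi> g + Lam r \<psi> g"
  using Lam_lin[of \<phi> r \<psi> g 1] by (simp only: vscale_simps mult_1_left)

lemma Lam_translate:
  "g \<in> carrier Mp \<Longrightarrow> y \<in> carrier Mp \<Longrightarrow> Lam r (translate y \<phi>) g = Lam r \<phi> (g \<otimes>\<^bsub>Mp\<^esub> y)"
  by (simp add: Lam_def translate_apply Mp.m_assoc)

lemma Lam_Lo:
  assumes f: "\<phi> \<in> ind r" and g: "g \<in> carrier Mp"
  shows "Lam r \<phi> (Lo x \<otimes>\<^bsub>Mp\<^esub> g) = Lam r \<phi> g"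
proof -
  have "Lo z \<otimes>\<^bsub>Mp\<^esub> (Lo x \<otimes>\<^bsub>Mp\<^esub> g) = Lo (z + x) \<otimes>\<^bsub>Mp\<^esub> g" for z
    using g Lo_Lo[of z x] by (simp flip: Mp.m_assoc)
  then show ?thesis
    unfolding Lam_def using psum_reindex[OF sch_Lam[OF f g], of "\<lambda>z. z - x" "\<lambda>z. z + x"] by simp
qed

lemma Lam_delta:
  assumes v: "v \<in> V r"
  shows "Lam r (delta r v) (Hw j) = (if j = 0 then v r else 0)"
proof (cases "j = 0")
  case True
  have "delta r v (Lo z) r = (if z \<in> R then v r else 0)" for z
    using top_Lo[of r z v] by (simp add: delta_def)
  then show ?thesis using True psum_R by (simp add: Lam_def Hw_0)
next
  case False
  have "Lo z \<otimes>\<^bsub>Mp\<^esub> Hw j \<notin> KK" for z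
  proof
    assume "Lo z \<otimes>\<^bsub>Mp\<^esub> Hw j \<in> KK"
    then have "mat2 (w powi j) 0 (z * w powi j) (w powi (- j)) \<in> SL2_int R"
      by (simp add: KK_iff fst_mult fst_Hw Lo_def)
    then have "w powi j \<in> R" "w powi (- j) \<in> R" by (auto simp: SL2_int_mat2)
    then show False using False R_val[of "w powi j"] R_val[of "w powi (- j)"] powi_w_nonzero val_powi by fastforce
  qed
  then show ?thesis using False by (simp add: Lam_def delta_def psum_def)
qed

section \<open>Orbital sums of the operators T_n\<close>

lemma add_small:
  assumes "z \<noteq> 0" "x = z * (w * a)" "a \<in> R"
  shows "\<exists>t\<in>units. z + x = z * t\<^sup>2"
proof -
  have "1 + w * a \<in> R" "red (1 + w * a) = 1"
    using assms wR R.Z1 R.Zadd R.Zmult by (auto simp: red_add red_mult red_1 red_w)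
  then obtain t where t: "t \<in> units" "t\<^sup>2 = 1 + w * a" using one_plus_square by blast
  have "z + x = z * t\<^sup>2" unfolding t(2) assms(2) by (simp add: algebra_simps)
  then show ?thesis using t(1) by blast
qed

lemma powi_R: "i \<ge> 0 \<Longrightarrow> w powi i \<in> R"
  using R_val[OF powi_w_nonzero, of i] by (simp only: val_powi)

lemma val_square_mult: "z \<noteq> 0 \<Longrightarrow> t \<in> units \<Longrightarrow> z * t\<^sup>2 \<noteq> 0 \<and> val (z * t\<^sup>2) = val z"
  using units_nonzero by (simp add: val_mult val_power val_unit)

lemma Di_1: "det M = 1 \<Longrightarrow> (M, e') \<otimes>\<^bsub>Mp\<^esub> Di 1 e = (M, e * e')"
proof -
  assume "det M = 1"
  then show ?thesis by (simp add: mult_Di hilbert_1 flip: mat_1_mat2)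
qed

lemma same_fst:
  assumes "x \<in> carrier Mp" "y \<in> carrier Mp" "fst x = fst y"
  obtains e where "e = 1 \<or> e = - 1" "x = y \<otimes>\<^bsub>Mp\<^esub> Di 1 e"
proof -
  obtain M a b where M: "x = (M, a)" "y = (M, b)" using assms(3) by (cases x, cases y) auto
  have "det M = 1" "a = 1 \<or> a = - 1" "b = 1 \<or> b = - 1" using assms M carrier_Mp by auto
  then show ?thesis using that[of "a * b"] M by (auto simp: Di_1)
qed

context
  fixes r s :: "nat list" and n :: nat
  assumes c: "compatible r s" and n: "n > 0"
begin

abbreviation D where "D \<equiv> TT r s n (delta r (vtop r))"

lemma ad: "admissible r s n"
  using c n by (simp add: admissible_def)

lemma s_weights: "r \<in> weights p f" "s \<in> weights p f"
  using c by (auto simp: compatible_def)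

lemma D_ind: "D \<in> ind s"
  by (rule heckeD(1)[OF TT_hecke[OF ad] delta_ind])

lemma D_left: "k \<in> KK \<Longrightarrow> g \<in> carrier Mp \<Longrightarrow> D (k \<otimes>\<^bsub>Mp\<^esub> g) = sg s k (D g)"
  by (rule ind_left[OF D_ind])

lemma D_right: "k \<in> KK \<Longrightarrow> g \<in> carrier Mp \<Longrightarrow> D (g \<otimes>\<^bsub>Mp\<^esub> k) = TT r s n (delta r (sg r k (vtop r))) g"
  by (rule A_right[OF TT_hecke[OF ad] s_weights])

lemma D_Up: "x \<in> R \<Longrightarrow> g \<in> carrier Mp \<Longrightarrow> D (g \<otimes>\<^bsub>Mp\<^esub> Up x) = D g"
  by (simp add: D_right sg_Up_vtop)

lemma D_Lo: "x \<in> R \<Longrightarrow> red x = 0 \<Longrightarrow> g \<in> carrier Mp \<Longrightarrow> D (g \<otimes>\<^bsub>Mp\<^esub> Lo x) = D g"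
  by (simp add: D_right sg_Lo_small[OF vtop_V])

lemma D_Di: 
  assumes "t \<in> units" "e = 1 \<or> e = - 1" "g \<in> carrier Mp"
  shows "D (g \<otimes>\<^bsub>Mp\<^esub> Di t e) = vscale (of_int e * red t ^ wt p r) (D g)"
proof -
  have "TT r s n (delta r (vscale (of_int e * red t ^ wt p r) (vtop r) + 0)) g =
      vscale (of_int e * red t ^ wt p r) (D g) + TT r s n (delta r 0) g"
    by (rule A_lin[OF TT_hecke[OF ad] s_weights])
  moreover have "delta r 0 = 0" by (rule ext) (simp only: delta_def sg_0 zero_fun_apply if_cancel)
  ultimately show ?thesis
    using assms by (simp only: D_right lifts_KK sg_Di_vtop hecke_0[OF TT_hecke[OF ad]] add_0_right zero_fun_apply)
qed

lemma D_Hw: "D (Hw (- int m)) s' = (if m = n then kap r s * vtop s s' else 0)"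
  using TT_delta[OF ad vtop_V Hw_carrier] phi_Hw[OF ad vtop_V] n by (simp add: rk1_def vtop_V vscale_apply)

abbreviation FD where "FD j z \<equiv> D (Lo z \<otimes>\<^bsub>Mp\<^esub> Hw (- j)) s"

lemma FD_sch: "sch (FD j)"
  by (rule sch_Lam[OF D_ind Hw_carrier])

text \<open>Conjugation by the torus element of \<open>t\<close> rescales \<open>z\<close> by a
  square without a sign. The factors picked up on the two sides are the characters of
  \<open>s\<close> and \<open>r\<close> at \<open>t\<close>, which agree.\<close>

lemma FD_square:
  assumes t: "t \<in> units"
  shows "FD j (z * t\<^sup>2) = FD j z"
proof -
  have t0: "t \<noteq> 0" "red t \<noteq> 0" "red t \<in> kappa" using t units_nonzero red_unit_iff units_R by (auto simp: kappa_def)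
  have "Di t 1 \<otimes>\<^bsub>Mp\<^esub> (Lo (z * t\<^sup>2) \<otimes>\<^bsub>Mp\<^esub> Hw (- j)) = Lo z \<otimes>\<^bsub>Mp\<^esub> Hw (- j) \<otimes>\<^bsub>Mp\<^esub> Di t 1"
    using t0 Di_Lo[of t 1 "z * t\<^sup>2"] Hw_Di_commute[of t "- j" 1] by (simp add: Mp.m_assoc) (simp flip: Mp.m_assoc)
  then have "sg s (Di t 1) (D (Lo (z * t\<^sup>2) \<otimes>\<^bsub>Mp\<^esub> Hw (- j))) = vscale (of_int 1 * red t ^ wt p r) (D (Lo z \<otimes>\<^bsub>Mp\<^esub> Hw (- j)))"
    using D_left[of "Di t 1" "Lo (z * t\<^sup>2) \<otimes>\<^bsub>Mp\<^esub> Hw (- j)"] D_Di[OF t, of 1 "Lo z \<otimes>\<^bsub>Mp\<^esub> Hw (- j)"] t by simp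
  from fun_cong[OF this, of s] have "red t ^ wt p s * FD j (z * t\<^sup>2) = red t ^ wt p r * FD j z"
    by (simp add: top_Di[OF t] vscale_apply)
  then show ?thesis using compatible_power[OF c t0(3,2)] t0(2) by simp
qed

text \<open>If \<open>val z \<le> -2\<close>, then translating \<open>z\<close> by \<open>w\<^sup>-\<^sup>1 R\<close> multiplies it by the square of a unit, and
  conjugating by the torus element of that unit shows that the integrand does not change.\<close>

lemma FD_far: "sch (\<lambda>z. if z \<noteq> 0 \<and> val z \<le> - 2 then FD j z else 0)" (is "sch ?F")
  "psum (\<lambda>z. if z \<noteq> 0 \<and> val z \<le> - 2 then FD j z else 0) = 0"
proof -
  have cond: "z + x \<noteq> 0 \<and> val (z + x) \<le> - 2 \<and> FD j (z + x) = FD j z"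
    if z: "z \<noteq> 0" "val z \<le> - 2" and x: "w * x \<in> R" for z x
  proof -
    have "inverse (w * w * z) \<in> R"
      using z w_nonzero by (subst R_val) (simp_all add: val_inverse val_mult val_w)
    then have "w * x * inverse (w * w * z) \<in> R" using x R.Zmult by blast
    moreover have "x = z * (w * (w * x * inverse (w * w * z)))" using z w_nonzero by (simp add: field_simps)
    ultimately obtain t where t: "t \<in> units" "z + x = z * t\<^sup>2" using add_small[OF z(1)] by blast
    show ?thesis unfolding t(2) using val_square_mult[OF z(1) t(1)] z(2) FD_square[OF t(1)] by simp
  qed
  have per: "?F (z + x) = ?F z" if x: "w * x \<in> R" for z x
  proof (cases "z \<noteq> 0 \<and> val z \<le> - 2")
    case True
    then show ?thesis using cond[of z x] x by simp
  next
    case False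
    then have "\<not> (z + x \<noteq> 0 \<and> val (z + x) \<le> - 2)" using cond[of "z + x" "- x"] x R.Zuminus[of "w * x"] by auto
    then show ?thesis using False by (simp only: if_False)
  qed
  have "zcl ` {z. ?F z \<noteq> 0} \<subseteq> zcl ` {z. FD j z \<noteq> 0}" by auto
  then have fin: "finite (zcl ` {z. ?F z \<noteq> 0})" using FD_sch[of j] finite_subset unfolding sch_def by blast
  show S: "sch ?F" unfolding sch_def using fin per wR R.Zmult by blast
  show "psum ?F = 0"
    using w_nonzero by (intro psum_vanish[OF S] per) simp
qed

text \<open>Multiplying by \<open>Up (-1/z)\<close> on the left and \<open>Up y\<close> on the right
  does not change the value: the former reduces to the identity, the latter fixes the top vector of
  \<open>r\<close>. It turns \<open>Lo z h(w)^-j\<close> into the Weyl element times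
  \<open>h(w)^-(j+1)\<close> times a unit torus element, up to sign. So the value is a multiple of
  the Weyl translate of the top vector, which has top coordinate 0 unless the weight is
  trivial.\<close>

lemma FD_near:
  assumes j: "j \<ge> 0" and z: "z \<noteq> 0" "val z = - 1" and s: "s \<noteq> rz"
  shows "FD j z = 0"
proof -
  define y where "y = w powi (2 * j) * (- 1 / z)"
  define u where "u = w * z"
  have u: "u \<in> units" using z w_nonzero by (simp add: u_def unit_val val_mult val_w)
  have z1: "- 1 / z \<in> R" "red (- 1 / z) = 0"
  proof -
    have v: "val (- 1 / z) = 1" "- 1 / z \<noteq> 0" using z by (simp_all add: val_divide val_uminus val_1)
    then show "- 1 / z \<in> R" by (subst R_val) auto
    then show "red (- 1 / z) = 0" using red_eq_0_val v by simp
  qed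
  have yR: "y \<in> R"
    unfolding y_def using z1(1) j by (intro R.Zmult powi_R) simp_all
  define g where "g = Lo z \<otimes>\<^bsub>Mp\<^esub> Hw (- j)"
  have g: "g \<in> carrier Mp" by (simp add: g_def)
  have "D (Up (- 1 / z) \<otimes>\<^bsub>Mp\<^esub> (g \<otimes>\<^bsub>Mp\<^esub> Up y)) = sg s (Up (- 1 / z)) (D g)"
    using D_left[of "Up (- 1 / z)" "g \<otimes>\<^bsub>Mp\<^esub> Up y"] z1 g yR D_Up by simp
  also have "\<dots> = D g" by (rule sg_Up_small[OF ind_V[OF D_ind g] z1(2)])
  finally have 1: "D g = D (Up (- 1 / z) \<otimes>\<^bsub>Mp\<^esub> (g \<otimes>\<^bsub>Mp\<^esub> Up y))" ..
  \<comment> \<open>The shift by one comes from \<open>val z = -1\<close>: the lower left entry of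
    the product has valuation \<open>- (j + 1)\<close>.\<close>
  define J where "J = nat (j + 1)"
  have J: "int J = j + 1" using j by (simp add: J_def)
  define h where "h = We \<otimes>\<^bsub>Mp\<^esub> (Hw (- int J) \<otimes>\<^bsub>Mp\<^esub> Di u 1)"
  have u0: "u \<noteq> 0" using u units_nonzero by blast
  have hc: "h \<in> carrier Mp" using u0 by (simp add: h_def)
  note pa = power_int_add[OF disjI1[OF w_nonzero]]
  have pw: "w powi j * w powi (- j) = 1" "w powi (2 * j) = w powi j * w powi j"
    using w_nonzero by (simp_all only: mult_2 pa power_int_minus) (simp add: powi_w_nonzero)
  have pw': "w powi (- int J) * w = w powi (- j)" "w powi int J = w * w powi j"
    using pa[of "- int J" 1] pa[of 1 j] by (simp_all add: J add.commute)
  have "fst (Up (- 1 / z) \<otimes>\<^bsub>Mp\<^esub> (g \<otimes>\<^bsub>Mp\<^esub> Up y)) = fst h"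
  proof -
    have "fst h = mat2 0 (- (w powi int J * inverse u)) (w powi (- int J) * u) 0"
      using u0 by (simp add: h_def fst_mult fst_Hw We_def Di_def)
    also have "w powi int J * inverse u = w powi j / z" using pw'(2) w_nonzero by (simp add: u_def field_simps)
    also have "w powi (- int J) * u = w powi (- j) * z" using pw'(1) by (simp add: u_def flip: mult.assoc)
    finally have h': "fst h = mat2 0 (- (w powi j / z)) (w powi (- j) * z) 0" .
    have e: "w powi (- j) * y = - (w powi j / z)"
      unfolding y_def pw(2) using pw(1) by (simp add: mult.commute mult.left_commute)
    have e2: "w powi (- j) * z * y = - (w powi j)" using e z(1) by (simp add: field_simps)
    have "fst (Up (- 1 / z) \<otimes>\<^bsub>Mp\<^esub> (g \<otimes>\<^bsub>Mp\<^esub> Up y)) =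
        mat2 (w powi (- j) + - 1 / z * (z * w powi (- j))) (w powi (- j) * y + - 1 / z * (z * w powi (- j) * y + w powi j))
          (z * w powi (- j)) (z * w powi (- j) * y + w powi j)"
      using g by (simp add: fst_mult fst_Hw g_def Lo_def Up_def algebra_simps)
    also have "\<dots> = fst h" unfolding h' using e e2 z(1) by (simp add: mult.commute mult.left_commute)
    finally show ?thesis .
  qed
  then obtain e where e: "e = 1 \<or> e = - 1" "Up (- 1 / z) \<otimes>\<^bsub>Mp\<^esub> (g \<otimes>\<^bsub>Mp\<^esub> Up y) = h \<otimes>\<^bsub>Mp\<^esub> Di 1 e"
    using g hc by (elim same_fst[rotated 2]) auto
  have one: "1 \<in> units" using unit_val val_1 by simp
  have "D h = sg s We (vscale (of_int 1 * red u ^ wt p r) (D (Hw (- int J))))"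
    unfolding h_def using u u0 D_left[of We] D_Di[OF u, of 1 "Hw (- int J)"] by simp
  also have "D (Hw (- int J)) = vscale (if J = n then kap r s else 0) (vtop s)"
    by (rule ext) (simp add: D_Hw vscale_apply)
  finally have "D h s = 0"
  proof -
    assume *: "D h = sg s We (vscale (of_int 1 * red u ^ wt p r) (vscale (if J = n then kap r s else 0) (vtop s)))"
    have ls: "length s = f" using s_weights by (simp add: weights_def)
    have "sg s We (vtop s) s = 0" using s by (simp add: sg_We act_weyl_vtop ls vbase_def)
    then show ?thesis unfolding * by (simp only: sg_scale vscale_apply mult_zero_right)
  qed
  then have "D (h \<otimes>\<^bsub>Mp\<^esub> Di 1 e) s = 0" using D_Di[OF one e(1) hc] by (simp only: vscale_apply mult_zero_right)
  then show ?thesis using 1 e(2) by (simp add: g_def)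
qed

text \<open>Moving the unit \<open>e\<close> from \<open>Lo (e z)\<close> into the torus costs the sign \<open>(z, e)\<close>, which is
  \<open>-1\<close> here. For the linear group the corresponding sum over \<open>val z = -1\<close> does not vanish.\<close>

lemma FD_near_odd:
  assumes j: "j \<ge> 0" and z: "z \<noteq> 0" "val z = - 1" and s: "s = rz" and e: "e \<in> units" "leg e = - 1"
  shows "FD j (e * z) = - FD j z"
proof -
  have e0: "e \<noteq> 0" "val e = 0" "1 / e \<in> units" 
  proof -
    show e0: "e \<noteq> 0" "val e = 0" using e units_nonzero val_unit by blast+
    then show "1 / e \<in> units" unfolding unit_val by (simp add: val_divide val_1)
  qed
  have small: "x \<in> R \<and> red x = 0 \<and> w powi (2 * j) * x \<in> R" if "x = 0 \<or> val x = 1" for x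
  proof (cases "x = 0")
    case False
    then have "x \<in> R" "red x = 0" using that R_val red_eq_0_val by auto
    moreover have "w powi (2 * j) \<in> R" using j by (intro powi_R) simp
    ultimately show ?thesis using R.Zmult by blast
  qed (simp add: R.Z0 red_0)
  have v1: "val (1 / (e * z)) = 1" "val (- 1 / z) = 1"
    using z e0 by (simp_all add: val_divide val_mult val_uminus val_1)
  have sum_small: "x + y \<in> R \<and> red (x + y) = 0 \<and> c * (x + y) \<in> R"
    if "x \<in> R \<and> red x = 0 \<and> c * x \<in> R" "y \<in> R \<and> red y = 0 \<and> c * y \<in> R" for x y c
    using that R.Zadd by (simp add: red_add distrib_left)
  \<comment> \<open>The right-hand unipotent of \<open>Lo_scale_unit\<close>. Both summands have
    valuation 1, so \<open>x\<close> is integral with residue 0; moved across \<open>h(w)^-j\<close>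
    with \<open>j\<close> nonnegative it stays integral.\<close>
  define x where "x = - 1 / z + 1 / (e * z)"
  have sx: "x \<in> R" "red x = 0" "w powi (2 * j) * x \<in> R"
    unfolding x_def using sum_small[OF small[OF disjI2[OF v1(2)]] small[OF disjI2[OF v1(1)]]] by blast+
  define y where "y = w powi (2 * j) * x"
  define g where "g = Lo z \<otimes>\<^bsub>Mp\<^esub> Hw (- j)"
  have g: "g \<in> carrier Mp" by (simp add: g_def)
  have "w powi (2 * - j) * y = x"
    using w_nonzero by (simp add: y_def power_int_minus)
  then have HU: "Hw (- j) \<otimes>\<^bsub>Mp\<^esub> Up y = Up x \<otimes>\<^bsub>Mp\<^esub> Hw (- j)" using Hw_Up[of "- j" y] by simp
  have M: "(mat2 1 0 (e * z) 1, - 1) = Lo (e * z) \<otimes>\<^bsub>Mp\<^esub> Di 1 (- 1)"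
    by (simp add: Lo_def Di_1)
  have hz: "hilbert_symbol z e = - 1"
    using z e e0 by (simp add: hilbert_tame tame_def ang_unit)
  have carr: "Up a \<otimes>\<^bsub>Mp\<^esub> (Di (1 / e) 1 \<otimes>\<^bsub>Mp\<^esub> (Up b \<otimes>\<^bsub>Mp\<^esub> Lo z \<otimes>\<^bsub>Mp\<^esub> Up d)) \<otimes>\<^bsub>Mp\<^esub> Hw (- j) =
      Up a \<otimes>\<^bsub>Mp\<^esub> (Di (1 / e) 1 \<otimes>\<^bsub>Mp\<^esub> (Up b \<otimes>\<^bsub>Mp\<^esub> (Lo z \<otimes>\<^bsub>Mp\<^esub> (Up d \<otimes>\<^bsub>Mp\<^esub> Hw (- j)))))" for a b d
    using e0 by (simp add: Mp.m_assoc)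
  have LL: "Lo (e * z) \<otimes>\<^bsub>Mp\<^esub> Di 1 (- 1) =
      Up (1 / (e * z)) \<otimes>\<^bsub>Mp\<^esub> (Di (1 / e) 1 \<otimes>\<^bsub>Mp\<^esub> (Up (- 1 / z) \<otimes>\<^bsub>Mp\<^esub> Lo z \<otimes>\<^bsub>Mp\<^esub> Up x))"
    using Lo_scale_unit[OF z(1) e0(1)] unfolding hz x_def[symmetric] M by (rule sym)
  have "Lo (e * z) \<otimes>\<^bsub>Mp\<^esub> Hw (- j) \<otimes>\<^bsub>Mp\<^esub> Di 1 (- 1) = Lo (e * z) \<otimes>\<^bsub>Mp\<^esub> Di 1 (- 1) \<otimes>\<^bsub>Mp\<^esub> Hw (- j)"
    using Hw_Di_commute[of 1 "- j" "- 1"] by (simp add: Mp.m_assoc)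
  also have "\<dots> = Up (1 / (e * z)) \<otimes>\<^bsub>Mp\<^esub> (Di (1 / e) 1 \<otimes>\<^bsub>Mp\<^esub> (Up (- 1 / z) \<otimes>\<^bsub>Mp\<^esub> (g \<otimes>\<^bsub>Mp\<^esub> Up y)))"
    unfolding LL carr HU[symmetric] g_def by (simp add: Mp.m_assoc)
  finally have eq: "D (Lo (e * z) \<otimes>\<^bsub>Mp\<^esub> Hw (- j) \<otimes>\<^bsub>Mp\<^esub> Di 1 (- 1)) =
      D (Up (1 / (e * z)) \<otimes>\<^bsub>Mp\<^esub> (Di (1 / e) 1 \<otimes>\<^bsub>Mp\<^esub> (Up (- 1 / z) \<otimes>\<^bsub>Mp\<^esub> (g \<otimes>\<^bsub>Mp\<^esub> Up y))))" by simp
  have one: "1 \<in> units" using unit_val val_1 by simp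
  have "D (Lo (e * z) \<otimes>\<^bsub>Mp\<^esub> Hw (- j) \<otimes>\<^bsub>Mp\<^esub> Di 1 (- 1)) s = - FD j (e * z)"
    using D_Di[OF one, of "- 1" "Lo (e * z) \<otimes>\<^bsub>Mp\<^esub> Hw (- j)"] by (simp add: vscale_apply red_1)
  moreover have "D (Up (1 / (e * z)) \<otimes>\<^bsub>Mp\<^esub> (Di (1 / e) 1 \<otimes>\<^bsub>Mp\<^esub> (Up (- 1 / z) \<otimes>\<^bsub>Mp\<^esub> (g \<otimes>\<^bsub>Mp\<^esub> Up y)))) s = D g s"
  proof -
    have yR: "y \<in> R" using sx by (simp add: y_def)
    have small0: "red (1 / (e * z)) = 0" "red (- 1 / z) = 0" using small v1 by blast+
    have Dic: "Di (1 / e) 1 \<in> carrier Mp" "Di (1 / e) 1 \<in> KK" using e0 by auto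
    have a: "Up (1 / (e * z)) \<in> KK" "Up (- 1 / z) \<in> KK" using small v1 by auto
    have "D (Up (1 / (e * z)) \<otimes>\<^bsub>Mp\<^esub> (Di (1 / e) 1 \<otimes>\<^bsub>Mp\<^esub> (Up (- 1 / z) \<otimes>\<^bsub>Mp\<^esub> (g \<otimes>\<^bsub>Mp\<^esub> Up y)))) =
        sg s (Up (1 / (e * z))) (sg s (Di (1 / e) 1) (sg s (Up (- 1 / z)) (D g)))"
      using a Dic g yR by (simp only: D_left D_Up Mp.m_closed lifts_carrier)
    also have "\<dots> = sg s (Di (1 / e) 1) (D g)"
      by (simp only: sg_Up_small[OF sg_V small0(1)] sg_Up_small[OF ind_V[OF D_ind g] small0(2)])
    \<comment> \<open>The trivial weight has exponent 0, so the torus factor acts by 1 and only the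
      sign of the cocycle remains.\<close>
    finally show ?thesis using e0(3) s by (simp add: top_Di wt_def)
  qed
  ultimately show ?thesis using eq by (simp add: g_def minus_equation_iff)
qed

text \<open>For a nontrivial weight every term is 0. For the trivial weight the substitution of
  \<open>e z\<close> for \<open>z\<close>, with a nonsquare unit \<open>e\<close>, permutes the
  classes and negates every term; so twice the sum is 0, and 2 is invertible in
  \<open>E\<close>.\<close>

lemma FD_middle:
  assumes j: "j \<ge> 0"
  shows "sch (\<lambda>z. if z \<noteq> 0 \<and> val z = - 1 then FD j z else 0)" (is "sch ?F")
    and "psum (\<lambda>z. if z \<noteq> 0 \<and> val z = - 1 then FD j z else 0) = 0"
proof -
  have cond: "z + x \<noteq> 0 \<and> val (z + x) = - 1" if z: "z \<noteq> 0" "val z = - 1" and x: "x \<in> R" for z x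
  proof -
    have "inverse (w * z) \<in> R"
      using z w_nonzero by (subst R_val) (simp_all add: val_inverse val_mult val_w)
    then have "x * inverse (w * z) \<in> R" using x R.Zmult by blast
    moreover have "x = z * (w * (x * inverse (w * z)))" using z w_nonzero by (simp add: field_simps)
    ultimately obtain t where t: "t \<in> units" "z + x = z * t\<^sup>2" using add_small[OF z(1)] by blast
    show ?thesis unfolding t(2) using val_square_mult[OF z(1) t(1)] z(2) by simp
  qed
  have per: "?F (z + x) = ?F z" if x: "x \<in> R" for z x
  proof -
    have "z + x \<noteq> 0 \<and> val (z + x) = - 1 \<longleftrightarrow> z \<noteq> 0 \<and> val z = - 1"
      using cond[of z x] cond[of "z + x" "- x"] x R.Zuminus[of x] by auto
    moreover have "FD j (z + x) = FD j z" using FD_sch[of j] x unfolding sch_def by blast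
    ultimately show ?thesis by simp
  qed
  have "zcl ` {z. ?F z \<noteq> 0} \<subseteq> zcl ` {z. FD j z \<noteq> 0}" by auto
  then have fin: "finite (zcl ` {z. ?F z \<noteq> 0})" using FD_sch[of j] finite_subset unfolding sch_def by blast
  show S: "sch ?F" unfolding sch_def using fin per by blast
  show "psum ?F = 0"
  proof (cases "s = rz")
    case False
    then have "?F = (\<lambda>z. 0)" using FD_near[OF j] by auto
    then show ?thesis by (simp add: psum_def)
  next
    case True
    obtain e where e: "e \<in> units" "leg e = - 1" using ex_nonsquare by blast
    have e0: "e \<noteq> 0" "val e = 0" "inverse e \<in> R" "e \<in> R"
      using e units_nonzero val_unit unit_inv units_R by auto
    have odd: "?F (e * z) = - ?F z" for z
      using FD_near_odd[OF j _ _ True e, of z] e0 by (cases "z = 0") (simp_all add: val_mult)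
    have "psum (\<lambda>z. ?F (e * z)) = psum ?F"
    proof (rule psum_reindex[OF S, where h' = "\<lambda>z. inverse e * z"])
      fix z z'
      have 1: "inverse e * (e * z - e * z') = z - z'" using e0 by (simp add: field_simps)
      have 2: "e * (z - z') = e * z - e * z'" by (rule right_diff_distrib)
      show "e * z - e * z' \<in> R \<longleftrightarrow> z - z' \<in> R"
        using R.Zmult[OF e0(3), of "e * z - e * z'"] R.Zmult[OF e0(4), of "z - z'"] unfolding 1 2 by blast
    qed (use e0 in \<open>simp_all add: field_simps\<close>)
    moreover have "psum (\<lambda>z. ?F (e * z)) = - psum ?F"
    proof -
      have z: "sch (\<lambda>z. 0)" "psum (\<lambda>z. 0) = 0" by (simp_all add: sch_def psum_def)
      show ?thesis unfolding odd using sch_lin(2)[OF S z(1), of "- 1"] z(2) by simp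
    qed
    ultimately have "psum ?F + psum ?F = 0" by (simp add: eq_neg_iff_add_eq_0)
    then have "2 * psum ?F = 0" by (simp only: mult_2)
    moreover have "(2 :: 'e) \<noteq> 0" using minus_one_neq_one by (metis add_eq_0_iff one_add_one)
    ultimately show ?thesis by (simp only: mult_eq_0_iff) simp
  qed
qed

text \<open>For negative \<open>j\<close> the summand is already periodic under
  \<open>w^-1 R\<close>, so the sum vanishes. For the other \<open>j\<close> only the class of 0
  contributes, and there the value is prescribed by the kernel.\<close>

lemma Lam_D: "Lam s D (Hw (- j)) = (if j = int n then kap r s else 0)"
proof (cases "j \<ge> 0")
  case False
  have "FD j (z + a / w) = FD j z" if a: "a \<in> R" for z a
  proof -
    define y where "y = w powi (- (2 * j)) * (a / w)"
    \<comment> \<open>Moved to the right across \<open>h(w)^-j\<close>, the translation by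
      \<open>a / w\<close> becomes \<open>w^(-2j-1) a\<close>. For \<open>j\<close> at most -1 this
      is \<open>w\<close> times an integral element, and such a lower unipotent acts trivially on
      the top vector of \<open>r\<close>.\<close>
    define b where "b = w powi (- (2 * j) - 2) * a"
    have "w powi (- (2 * j) - 2) \<in> R" using False by (intro powi_R) simp
    then have b: "b \<in> R" using a R.Zmult by (simp add: b_def)
    have "w powi (- (2 * j)) = w powi (- (2 * j) - 2) * w\<^sup>2"
      using w_nonzero power_int_add[of w "- (2 * j) - 2" 2] by simp
    then have y: "y = w * b" using w_nonzero by (simp add: y_def b_def power2_eq_square)
    then have yR: "y \<in> R" "red y = 0" using b wR R.Zmult red_mult red_w by auto
    have "w powi (- 2 * - j) * y = a / w" using w_nonzero by (simp add: y_def power_int_minus)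
    then have "Hw (- j) \<otimes>\<^bsub>Mp\<^esub> Lo y = Lo (a / w) \<otimes>\<^bsub>Mp\<^esub> Hw (- j)" using Hw_Lo[of "- j" y] by simp
    then have "Lo (z + a / w) \<otimes>\<^bsub>Mp\<^esub> Hw (- j) = Lo z \<otimes>\<^bsub>Mp\<^esub> Hw (- j) \<otimes>\<^bsub>Mp\<^esub> Lo y"
      using Lo_Lo[of z "a / w", symmetric] by (simp add: Mp.m_assoc)
    then show ?thesis using D_Lo[OF yR, of "Lo z \<otimes>\<^bsub>Mp\<^esub> Hw (- j)"] by simp
  qed
  then have "psum (FD j) = 0" by (rule psum_vanish[OF FD_sch])
  then show ?thesis using False by (simp add: Lam_def)
next
  case True
  let ?F0 = "\<lambda>z. if z \<in> R then FD j 0 else 0"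
  let ?F1 = "\<lambda>z. if z \<noteq> 0 \<and> val z = - 1 then FD j z else 0"
  let ?F2 = "\<lambda>z. if z \<noteq> 0 \<and> val z \<le> - 2 then FD j z else 0"
  have "FD j z = 1 * ?F0 z + (1 * ?F1 z + ?F2 z)" for z
  proof (cases "z \<in> R")
    case zR: True
    have "FD j (0 + z) = FD j 0" using FD_sch[of j] zR unfolding sch_def by blast
    then show ?thesis using zR val_R[OF zR] by auto
  next
    case False
    have z0: "z \<noteq> 0" using False R.Z0 by blast
    then have "val z < 0" using R_val[OF z0] False by simp
    then show ?thesis using False z0 by auto
  qed
  then have "psum (FD j) = psum (\<lambda>z. 1 * ?F0 z + (1 * ?F1 z + ?F2 z))" by (simp only:)
  also have "\<dots> = 1 * psum ?F0 + (1 * psum ?F1 + psum ?F2)"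
    using sch_lin[OF FD_middle(1)[OF True] FD_far(1), of 1 j] sch_lin(2)[OF psum_R(1)] by (simp only:)
  also have "\<dots> = FD j 0" using psum_R(2) FD_middle(2)[OF True] FD_far(2) by simp
  also have "\<dots> = D (Hw (- int (nat j))) s" using True by (simp add: Lo_0)
  also have "\<dots> = (if j = int n then kap r s else 0)" unfolding D_Hw using True by (auto simp: vbase_def)
  finally show ?thesis by (simp add: Lam_def)
qed

end

lemma Lam_TT_top:
  assumes ad: "admissible r s n"
  shows "Lam s (TT r s n (delta r (vtop r))) (Hw j) = (if int n + j = 0 then kap r s else 0)"
proof (cases "n > 0")
  case True
  then show ?thesis using Lam_D[of r s n "- j"] ad by (auto simp: admissible_def)
next
  case False
  then have "r = s" "n = 0" "r \<in> weights p f" using ad by (auto simp: admissible_def compatible_def)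
  then show ?thesis
    using TT_0[of r] delta_ind[of r "vtop r"] Lam_delta[OF vtop_V, of r j]
    by (simp add: hecke_one_def kap_def vbase_def)
qed

text \<open>The formula extends from the top vector in three stages. As functionals of
  \<open>v\<close> the orbital sums are invariant under lower unipotents, hence proportional to the
  top coordinate. By the Iwasawa decomposition an arbitrary \<open>g\<close> differs from a power of
  \<open>h(w)\<close> by a lower unipotent, which is invisible, and by an element of
  \<open>K\<close>, which is moved to the vector. Additivity and translation then reach every
  function in \<open>ind r\<close>.\<close>

lemma Lam_TT:
  assumes ad: "admissible r s n" and f: "\<phi> \<in> ind r" and g: "g \<in> carrier Mp"
  shows "Lam s (TT r s n \<phi>) g = kap r s * Lam r \<phi> (Hw (int n) \<otimes>\<^bsub>Mp\<^esub> g)"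
proof -
  note T = TT_hecke[OF ad]
  have w: "r \<in> weights p f" "s \<in> weights p f" using ad by (auto simp: admissible_def compatible_def)
  have Ti: "TT r s n (delta r v) \<in> ind s" for v by (rule heckeD(1)[OF T delta_ind])
  have base: "Lam s (TT r s n (delta r v)) (Hw j) = (if int n + j = 0 then kap r s else 0) * v r"
    if v: "v \<in> V r" for v j
    unfolding Lam_TT_top[OF ad, symmetric]
  proof (rule Ubar_functional[OF w(1) _ _ v])
    fix a and v v' :: "'e tvec"
    show "Lam s (TT r s n (delta r (vscale a v + v'))) (Hw j) =
        a * Lam s (TT r s n (delta r v)) (Hw j) + Lam s (TT r s n (delta r v')) (Hw j)"
      unfolding delta_lin heckeD(2)[OF T delta_ind delta_ind] by (rule Lam_lin[OF Ti Ti Hw_carrier])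
  next
    fix a and v :: "'e tvec" assume "a \<in> kappa"
    then obtain x where x: "x \<in> R" "a = red x" unfolding kappa_def by blast
    then have "TT r s n (delta r (act r (ll a) v)) = translate (Lo x) (TT r s n (delta r v))"
      using translate_delta[of "Lo x" r v] heckeD(3)[OF T _ delta_ind, of "Lo x" v] by (simp add: sg_Lo)
    then show "Lam s (TT r s n (delta r (act r (ll a) v))) (Hw j) = Lam s (TT r s n (delta r v)) (Hw j)"
      by (simp add: Lam_translate Hw_Lo Lam_Lo[OF Ti])
  qed
  have single: "Lam s (TT r s n (delta r v)) g = kap r s * Lam r (delta r v) (Hw (int n) \<otimes>\<^bsub>Mp\<^esub> g)"
    if v: "v \<in> V r" and g: "g \<in> carrier Mp" for v g
  proof -
    obtain x j k where k: "k \<in> KK" "g = Lo x \<otimes>\<^bsub>Mp\<^esub> Hw j \<otimes>\<^bsub>Mp\<^esub> k" by (rule iwasawa[OF g])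
    have kc: "k \<in> carrier Mp" using k KK_carrier by blast
    have tr: "Lam r' \<psi> (Lo y \<otimes>\<^bsub>Mp\<^esub> Hw i \<otimes>\<^bsub>Mp\<^esub> k) = Lam r' (translate k \<psi>) (Hw i)" if "\<psi> \<in> ind r'" for r' \<psi> y i
      using that kc Lam_translate[of "Hw i" k] Lam_Lo[OF that, of "Hw i \<otimes>\<^bsub>Mp\<^esub> k" y] by (simp add: Mp.m_assoc)
    have "Hw (int n) \<otimes>\<^bsub>Mp\<^esub> g = Hw (int n) \<otimes>\<^bsub>Mp\<^esub> Lo x \<otimes>\<^bsub>Mp\<^esub> Hw j \<otimes>\<^bsub>Mp\<^esub> k"
      using kc by (simp add: k(2) Mp.m_assoc)
    also have "\<dots> = Lo (w powi (- 2 * int n) * x) \<otimes>\<^bsub>Mp\<^esub> Hw (int n + j) \<otimes>\<^bsub>Mp\<^esub> k"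
      using kc by (simp add: Hw_Lo Mp.m_assoc Hw_add)
    finally have "Lam r (delta r v) (Hw (int n) \<otimes>\<^bsub>Mp\<^esub> g) = Lam r (delta r (sg r k v)) (Hw (int n + j))"
      using tr[OF delta_ind] translate_delta[OF k(1)] by simp
    moreover have "Lam s (TT r s n (delta r v)) g = Lam s (TT r s n (delta r (sg r k v))) (Hw j)"
      unfolding k(2) tr[OF Ti] using translate_delta[OF k(1), of r v] heckeD(3)[OF T kc delta_ind, of v] by simp
    ultimately show ?thesis using base[OF sg_V] Lam_delta[OF sg_V] by simp
  qed
  from f show ?thesis
  proof (induction rule: ind_induct)
    case zero
    show ?case unfolding hecke_0[OF T] Lam_0 by simp
  next
    case (add \<phi> \<psi>)
    then show ?case
      using g by (simp only: hecke_add[OF T] Lam_add heckeD(1)[OF T] Mp.m_closed Hw_carrier distrib_left)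
  next
    case (translate y v)
    then show ?case
      using g single[of v "g \<otimes>\<^bsub>Mp\<^esub> y"] by (simp add: heckeD(3)[OF T _ delta_ind] Lam_translate Mp.m_assoc)
  qed
qed

end

section \<open>The Hecke modules\<close>

context hecke_setting
begin

section \<open>Linear structure, coordinates and composition\<close>

lemma operator_add_apply: "(A + B) \<phi> g = A \<phi> g + (B \<phi> g :: 'e tvec)" for A B :: "('f, 'e) operator"
  by simp

lemma oscale_apply: "oscale c A \<phi> g = vscale c (A \<phi> g)" for A :: "('f, 'e) operator"
  by (simp add: oscale_def)

lemma hecke_lin:
  assumes A: "A \<in> hecke r s" and B: "B \<in> hecke r s"
  shows "oscale c A + B \<in> hecke r s"
proof -
  have eq: "(oscale c A + B) \<phi> = (\<lambda>g. vscale c (A \<phi> g)) + B \<phi>" for \<phi>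
    by (rule ext) (simp only: operator_add_apply oscale_apply fun_plus)
  show ?thesis
    unfolding hecke_def eq
  proof (intro CollectI conjI ballI allI impI)
    fix \<phi> assume "\<phi> \<in> ind r"
    then show "(\<lambda>g. vscale c (A \<phi> g)) + B \<phi> \<in> ind s" using ind_lin heckeD(1)[OF A] heckeD(1)[OF B] by blast
  next
    fix a \<phi> \<psi> assume f: "\<phi> \<in> ind r" "\<psi> \<in> ind r"
    show "(\<lambda>g. vscale c (A ((\<lambda>g. vscale a (\<phi> g)) + \<psi>) g)) + B ((\<lambda>g. vscale a (\<phi> g)) + \<psi>) =
        (\<lambda>g. vscale a (((\<lambda>g. vscale c (A \<phi> g)) + B \<phi>) g)) + ((\<lambda>g. vscale c (A \<psi> g)) + B \<psi>)"
      unfolding heckeD(2)[OF A f] heckeD(2)[OF B f]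
      by (intro ext) (simp add: vscale_def algebra_simps)
  next
    fix y :: "'f mp" and \<phi> assume y: "y \<in> carrier Mp" and f: "\<phi> \<in> ind r"
    show "(\<lambda>g. vscale c (A (translate y \<phi>) g)) + B (translate y \<phi>) = translate y ((\<lambda>g. vscale c (A \<phi> g)) + B \<phi>)"
      unfolding heckeD(3)[OF A y f] heckeD(3)[OF B y f]
      by (intro ext) (simp add: translate_def vscale_def)
  next
    fix \<phi> assume "\<phi> \<notin> ind r"
    then show "(\<lambda>g. vscale c (A \<phi> g)) + B \<phi> = 0"
      using heckeD(4)[OF A] heckeD(4)[OF B] by (intro ext) (simp add: vscale_def)
  qed
qed

lemma hecke_zero: "0 \<in> hecke r s"
  unfolding hecke_def using ind_0[of s] by (auto simp: translate_def vscale_def fun_eq_iff zero_fun_def)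

lemma hecke_oscale: "A \<in> hecke r s \<Longrightarrow> oscale c A \<in> hecke r s"
  using hecke_lin[OF _ hecke_zero] by (simp only: add_0_right)

lemma hecke_plus: "A \<in> hecke r s \<Longrightarrow> B \<in> hecke r s \<Longrightarrow> A + B \<in> hecke r s"
  using hecke_lin[of A r s B 1] by (simp only: oscale_def vscale_simps)

lemma hecke_sum: "(\<And>i. i \<in> S \<Longrightarrow> B i \<in> hecke r s) \<Longrightarrow> sum B S \<in> hecke r s"
  by (induction S rule: infinite_finite_induct)
    (simp_all only: sum.infinite sum.empty sum.insert hecke_zero hecke_plus simp_thms insert_iff)

lemma hecke_comp:
  assumes A: "A \<in> hecke r s" and B: "B \<in> hecke s t"
  shows "B \<circ> A \<in> hecke r t"
  unfolding hecke_def comp_def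
  by (intro CollectI conjI ballI allI impI)
    (simp_all only: heckeD(1-3)[OF A] heckeD(1-3)[OF B] heckeD(4)[OF A] hecke_0[OF B] not_False_eq_True)

lemma coord_lin: "coord (oscale c A + B) r s n = c * coord A r s n + coord B r s n"
  unfolding coord_def operator_add_apply oscale_apply by (simp only: plus_fun_apply vscale_apply)

lemma coord_zero: "coord 0 r s n = 0"
  by (simp add: coord_def)

lemma coord_oscale: "coord (oscale c A) r s n = c * coord A r s n"
  unfolding coord_def oscale_apply by (simp only: vscale_apply)

lemma coord_plus: "coord (A + B) r s n = coord A r s n + coord B r s n"
  by (simp add: coord_def)

lemma coord_sum: "coord (sum B S) r s n = (\<Sum>i\<in>S. coord (B i) r s n)"
  by (induction S rule: infinite_finite_induct)
    (simp_all only: sum.infinite sum.empty sum.insert coord_zero coord_plus simp_thms)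

lemma coord_admissible:
  assumes "A \<in> hecke r s" "r \<in> weights p f" "s \<in> weights p f" "coord A r s n \<noteq> 0"
  shows "admissible r s n"
  using coord_compatible[OF assms] value_one(2)[OF assms(1-3) vtop_V] assms(4)
  unfolding admissible_def by (cases "n = 0") auto

text \<open>The \<open>n\<close>-th coordinate of \<open>T_n\<close> is \<open>kap r s\<close>
  rather than 1, hence the division.\<close>

lemma hecke_expand:
  assumes A: "A \<in> hecke r s" and r: "r \<in> weights p f" and s: "s \<in> weights p f"
  shows "A = (\<Sum>n\<in>{n. coord A r s n \<noteq> 0}. oscale (coord A r s n / kap r s) (TT r s n))"
    (is "A = sum ?B ?S")
proof (rule coord_eqI[OF A _ r s])
  have ad: "admissible r s n" if "n \<in> ?S" for n
    using coord_admissible[OF A r s] that by blast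
  then show "sum ?B ?S \<in> hecke r s" by (intro hecke_sum hecke_oscale TT_hecke)
  fix m
  have "coord (sum ?B ?S) r s m = (\<Sum>n\<in>?S. coord A r s n / kap r s * (if m = n then kap r s else 0))"
    unfolding coord_sum coord_oscale using coord_TT[OF ad] by (intro sum.cong) auto
  also have "\<dots> = (\<Sum>n\<in>?S. if m = n then coord A r s m else 0)"
    using kap_nonzero by (intro sum.cong) auto
  also have "\<dots> = coord A r s m" using coord_finite[OF A r s] by (simp add: sum.delta)
  finally show "coord A r s m = coord (sum ?B ?S) r s m" ..
qed

definition Lco :: "('f, 'e) operator \<Rightarrow> nat list \<Rightarrow> nat list \<Rightarrow> int \<Rightarrow> 'e" where
  "Lco A r s j = Lam s (A (delta r (vtop r))) (Hw j)"

lemma Lco_lin: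
  assumes "A \<in> hecke r s" "B \<in> hecke r s"
  shows "Lco (oscale c A + B) r s j = c * Lco A r s j + Lco B r s j"
proof -
  have "(oscale c A + B) (delta r (vtop r)) = (\<lambda>g. vscale c (A (delta r (vtop r)) g)) + B (delta r (vtop r))"
    by (rule ext) (simp only: operator_add_apply oscale_apply fun_plus)
  then show ?thesis
    unfolding Lco_def using assms by (simp only: Lam_lin heckeD(1)[OF _ delta_ind] Hw_carrier)
qed

lemma Lco_zero: "Lco 0 r s j = 0"
proof -
  have "(0 :: ('f, 'e) operator) (delta r (vtop r)) = 0" by (rule zero_fun_apply)
  then show ?thesis by (simp only: Lco_def Lam_0)
qed

text \<open>Both sides are linear in the operator and agree on each \<open>T_n\<close>, so the
  expansion in the \<open>T_n\<close> gives it for all operators. The Satake transform is thus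
  diagonal in these coordinates.\<close>

lemma Lco_coord:
  assumes A: "A \<in> hecke r s" and r: "r \<in> weights p f" and s: "s \<in> weights p f"
  shows "Lco A r s j = (if j \<le> 0 then coord A r s (nat (- j)) else 0)"
proof -
  have TT: "Lco (TT r s n) r s j = (if j \<le> 0 then coord (TT r s n) r s (nat (- j)) else 0)"
    if "admissible r s n" for n
    unfolding Lco_def Lam_TT_top[OF that] coord_TT[OF that] by auto
  have "Lco (\<Sum>n\<in>S. oscale (b n) (TT r s n)) r s j =
      (if j \<le> 0 then coord (\<Sum>n\<in>S. oscale (b n) (TT r s n)) r s (nat (- j)) else 0)"
    if "finite S" "\<And>n. n \<in> S \<Longrightarrow> admissible r s n" for S b
    using that
  proof (induction S)
    case empty
    show ?case by (simp only: sum.empty Lco_zero coord_zero if_cancel)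
  next
    case (insert n S)
    have ad: "admissible r s n" and H: "(\<Sum>n\<in>S. oscale (b n) (TT r s n)) \<in> hecke r s"
      using insert(4) by (auto intro!: hecke_sum hecke_oscale TT_hecke)
    have IH: "Lco (\<Sum>n\<in>S. oscale (b n) (TT r s n)) r s j =
        (if j \<le> 0 then coord (\<Sum>n\<in>S. oscale (b n) (TT r s n)) r s (nat (- j)) else 0)"
      using insert(3,4) by blast
    show ?case
      unfolding sum.insert[OF insert(1,2)] Lco_lin[OF TT_hecke[OF ad] H] coord_lin TT[OF ad] IH by simp
  qed
  from this[OF coord_finite[OF A r s], of "\<lambda>n. coord A r s n / kap r s"] coord_admissible[OF A r s]
  show ?thesis unfolding hecke_expand[OF A r s, symmetric] by blast
qed

text \<open>Coordinates of a composition are not accessible directly, since \<open>A\<close> spreads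
  the support over many cosets. They are computed as orbital sums, where composition with
  \<open>T_n\<close> is a translation by \<open>n\<close> and a factor.\<close>

lemma coord_comp:
  assumes A: "A \<in> hecke r s" and r: "r \<in> weights p f" and ad: "admissible s t n"
  shows "coord (TT s t n \<circ> A) r t m = (if n \<le> m then kap s t * coord A r s (m - n) else 0)"
proof -
  have w: "s \<in> weights p f" "t \<in> weights p f" using ad by (auto simp: admissible_def compatible_def)
  have i: "A (delta r (vtop r)) \<in> ind s" by (rule heckeD(1)[OF A delta_ind])
  have "coord (TT s t n \<circ> A) r t m = Lco (TT s t n \<circ> A) r t (- int m)"
    using Lco_coord[OF hecke_comp[OF A TT_hecke[OF ad]] r w(2), of "- int m"] by simp
  also have "\<dots> = kap s t * Lco A r s (int n - int m)"
    unfolding Lco_def comp_apply Lam_TT[OF ad i Hw_carrier] Hw_add by simp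
  also have "\<dots> = (if n \<le> m then kap s t * coord A r s (m - n) else 0)"
    unfolding Lco_coord[OF A r w(1)] by (auto simp: nat_diff_distrib)
  finally show ?thesis .
qed

lemma TT_comp:
  assumes a: "admissible r s m" and b: "admissible s t n"
  shows "TT s t n \<circ> TT r s m = TT r t (n + m)"
proof -
  have c: "compatible r s" "compatible s t" using a b by (auto simp: admissible_def)
  have ad: "admissible r t (n + m)" using a b kap_mult(2)[OF c] by (auto simp: admissible_def)
  have w: "r \<in> weights p f" "t \<in> weights p f" using c by (auto simp: compatible_def)
  show ?thesis
  proof (rule coord_eqI[OF hecke_comp[OF TT_hecke[OF a] TT_hecke[OF b]] TT_hecke[OF ad] w])
    fix N
    show "coord (TT s t n \<circ> TT r s m) r t N = coord (TT r t (n + m)) r t N"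
      unfolding coord_comp[OF TT_hecke[OF a] w(1) b] coord_TT[OF a] coord_TT[OF ad] kap_mult(1)[OF c, symmetric]
      by auto
  qed
qed

lemma kap_self: "kap r r = 1"
  by (simp add: kap_def)

lemma hecke_trivial:
  assumes "r \<in> weights p f" "s \<in> weights p f" "\<not> compatible r s"
  shows "hecke r s = {0}"
proof -
  have "A = 0" if A: "A \<in> hecke r s" for A
  proof (rule coord_eqI[OF A hecke_zero assms(1,2)])
    fix n
    show "coord A r s n = coord 0 r s n"
      unfolding coord_zero using coord_compatible[OF A assms(1,2)] assms(3) by blast
  qed
  then show ?thesis using hecke_zero by blast
qed

subsection \<open>The endomorphism algebra\<close>

text \<open>Defined by the \<open>T_i\<close> and not by powers of \<open>T_1\<close>, so that
  coordinates are literally coefficients. That it is substitution of \<open>T_1\<close> follows from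
  \<open>poly_op_pCons\<close>.\<close>

definition poly_op :: "nat list \<Rightarrow> 'e poly \<Rightarrow> ('f, 'e) operator" where
  "poly_op r P = (\<Sum>i\<le>degree P. oscale (coeff P i) (TT r r i))"

context
  fixes r
  assumes r: "r \<in> weights p f"
begin

lemma ad_self: "admissible r r n"
  using r by (simp add: admissible_def compatible_def)

lemma poly_op_hecke: "poly_op r P \<in> hecke r r"
  unfolding poly_op_def by (intro hecke_sum hecke_oscale TT_hecke ad_self)

lemma coord_poly_op: "coord (poly_op r P) r r n = coeff P n"
proof -
  have "coord (poly_op r P) r r n = (\<Sum>i\<le>degree P. coeff P i * (if n = i then 1 else 0))"
    unfolding poly_op_def coord_sum coord_oscale coord_TT[OF ad_self] kap_self ..
  also have "\<dots> = (\<Sum>i\<le>degree P. if n = i then coeff P n else 0)" by (intro sum.cong) auto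
  also have "\<dots> = coeff P n" using coeff_eq_0[of P n] by (auto simp: sum.delta not_le)
  finally show ?thesis .
qed

lemma coord_self: "coord (TT r r n) r r m = (if m = n then 1 else 0)"
  unfolding coord_TT[OF ad_self] by (simp add: kap_def)

lemma poly_op_eqI: "A \<in> hecke r r \<Longrightarrow> (\<And>n. coord A r r n = coeff P n) \<Longrightarrow> poly_op r P = A"
  by (rule coord_eqI[OF poly_op_hecke _ r r]) (simp_all add: coord_poly_op)

lemma poly_op_plus: "poly_op r (P + P') = poly_op r P + poly_op r P'"
  by (rule poly_op_eqI) (simp_all only: hecke_plus poly_op_hecke coord_plus coord_poly_op coeff_add)

lemma poly_op_smult: "poly_op r (Polynomial.smult c P) = oscale c (poly_op r P)"
  by (rule poly_op_eqI) (simp_all only: hecke_oscale poly_op_hecke coord_oscale coord_poly_op coeff_smult)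

lemma poly_op_1: "poly_op r 1 = hecke_one r"
  unfolding TT_0[OF r, symmetric] by (rule poly_op_eqI) (auto simp: TT_hecke ad_self coord_self)

lemma poly_op_X: "poly_op r [:0, 1:] = TT r r 1"
  by (rule poly_op_eqI) (auto simp: TT_hecke ad_self coord_self coeff_pCons split: nat.split)

text \<open>Horner's rule: composition with \<open>T_1\<close> shifts the coordinates by one, as
  multiplication by the variable shifts coefficients.\<close>

lemma poly_op_pCons: "poly_op r (pCons a P) = oscale a (hecke_one r) + (TT r r 1 \<circ> poly_op r P)"
  unfolding TT_0[OF r, symmetric]
proof (rule poly_op_eqI)
  show "oscale a (TT r r 0) + (TT r r 1 \<circ> poly_op r P) \<in> hecke r r"
    by (rule hecke_lin[OF TT_hecke[OF ad_self] hecke_comp[OF poly_op_hecke TT_hecke[OF ad_self]]])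
  show "coord (oscale a (TT r r 0) + (TT r r 1 \<circ> poly_op r P)) r r n = coeff (pCons a P) n" for n
    unfolding coord_lin coord_comp[OF poly_op_hecke r ad_self] coord_self coord_poly_op
    by (cases n) (auto simp: kap_def)
qed

lemma poly_op_mult: "poly_op r (P * P') = poly_op r P \<circ> poly_op r P'"
proof (induction P)
  case 0
  have "poly_op r 0 = 0" by (rule poly_op_eqI) (simp_all only: hecke_zero coord_zero coeff_0)
  then show ?case by (simp add: comp_def fun_eq_iff)
next
  case (pCons a P)
  have one: "hecke_one r (poly_op r P' \<phi>) = poly_op r P' \<phi>" for \<phi>
    using heckeD(1)[OF poly_op_hecke, of \<phi> P'] heckeD(4)[OF poly_op_hecke, of \<phi> P'] by (auto simp: hecke_one_def)
  have z: "oscale 0 B + C = C" for B C :: "('f, 'e) operator"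
    by (simp add: oscale_def fun_eq_iff)
  have "poly_op r (pCons a P * P') = oscale a (poly_op r P') + (TT r r 1 \<circ> (poly_op r P \<circ> poly_op r P'))"
    by (simp only: mult_pCons_left poly_op_plus poly_op_smult poly_op_pCons z pCons.IH)
  also have "\<dots> = poly_op r (pCons a P) \<circ> poly_op r P'"
    unfolding poly_op_pCons by (intro ext) (simp add: oscale_def one)
  finally show ?case .
qed

lemma poly_op_bij: "bij_betw (poly_op r) UNIV (hecke r r)"
proof (rule bij_betwI')
  show "poly_op r P = poly_op r P' \<longleftrightarrow> P = P'" for P P'
    using coord_poly_op by (metis poly_eqI)
  show "poly_op r P \<in> hecke r r" for P by (rule poly_op_hecke)
  fix A assume A: "A \<in> hecke r r"
  define P where "P = (\<Sum>n\<in>{n. coord A r r n \<noteq> 0}. monom (coord A r r n) n)"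
  have "coord A r r n = coeff P n" for n
    using coord_finite[OF A r r] by (auto simp: P_def coeff_sum sum.delta')
  then show "\<exists>P\<in>UNIV. A = poly_op r P" using poly_op_eqI[OF A] by blast
qed

end

subsection \<open>The exceptional pair of weights\<close>

context
  fixes r s
  assumes rs: "{r, s} = {rz, rm}"
begin

lemma rs_facts: "compatible r s" "r \<noteq> s" "r \<in> weights p f" "s \<in> weights p f" "compatible s r"
  using rs rz_weights rm_weights rz_neq_rm by (auto simp: compatible_def doubleton_eq_iff)

lemma ad_mixed: "n > 0 \<Longrightarrow> admissible r s n" "n > 0 \<Longrightarrow> admissible s r n"
  using rs_facts by (simp_all add: admissible_def)

lemma TT_inj: "inj_on (TT r s) {n. 0 < n}"
proof (rule inj_onI)
  fix m n assume mn: "m \<in> {n. 0 < n}" "n \<in> {n. 0 < n}" "TT r s m = TT r s n"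
  then have ad: "admissible r s m" "admissible r s n" using ad_mixed by auto
  from arg_cong[OF mn(3), of "\<lambda>A. coord A r s m"] show "m = n"
    unfolding coord_TT[OF ad(1)] coord_TT[OF ad(2)] using kap_nonzero[of r s] by (simp split: if_splits)
qed

interpretation op: vector_space "oscale :: 'e \<Rightarrow> ('f, 'e) operator \<Rightarrow> ('f, 'e) operator"
  by (rule vector_space_oscale)

text \<open>Up to the nonzero factor \<open>kap r s\<close>, the coordinates are the linear
  functionals dual to the operators \<open>T_n\<close>.\<close>

lemma TT_independent: "\<not> module.dependent oscale (TT r s ` {n. 0 < n})"
proof
  assume "module.dependent oscale (TT r s ` {n. 0 < n})"
  then obtain S u A where S: "S \<subseteq> TT r s ` {n. 0 < n}" "finite S" and z: "(\<Sum>v\<in>S. oscale (u v) v) = 0"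
    and A: "A \<in> S" and nz: "u A \<noteq> 0"
    unfolding op.dependent_explicit by (elim exE bexE conjE) (rule that)
  obtain n where n: "n > 0" "A = TT r s n" using S(1) A by blast
  have c: "coord v r s n = (if v = A then kap r s else 0)" if vS: "v \<in> S" for v
  proof -
    obtain m where m: "v = TT r s m" "m \<in> {n. 0 < n}" using subsetD[OF S(1) vS] by (rule imageE)
    have m': "m > 0" using m(2) by (simp only: mem_Collect_eq)
    have iff: "v = A \<longleftrightarrow> n = m"
    proof
      assume "v = A"
      then have "TT r s n = TT r s m" unfolding n(2) m(1) ..
      then show "n = m" by (rule inj_onD[OF TT_inj]) (simp_all only: mem_Collect_eq n(1) m')
    qed (simp only: n(2) m(1))
    show ?thesis unfolding iff unfolding m(1) by (rule coord_TT[OF ad_mixed(1)[OF m']])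
  qed
  have c': "u v * coord v r s n = (if v = A then u A * kap r s else 0)" if "v \<in> S" for v
    unfolding c[OF that] by (cases "v = A") (simp_all only: if_True if_False simp_thms mult_zero_right)
  have "0 = coord (\<Sum>v\<in>S. oscale (u v) v) r s n" unfolding z coord_zero ..
  also have "\<dots> = (\<Sum>v\<in>S. if v = A then u A * kap r s else 0)"
    unfolding coord_sum coord_oscale by (rule sum.cong[OF refl c'])
  also have "\<dots> = u A * kap r s" unfolding sum.delta[OF S(2)] using A by (rule if_P)
  finally have "u A * kap r s = 0" by (rule sym)
  then show False using nz kap_nonzero[of r s] unfolding mult_eq_0_iff by blast
qed

lemma TT_span: "module.span oscale (TT r s ` {n. 0 < n}) = hecke r s"
proof
  have "op.subspace (hecke r s)"
    unfolding op.subspace_def using hecke_zero hecke_plus hecke_oscale by blast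
  then show "op.span (TT r s ` {n. 0 < n}) \<subseteq> hecke r s"
    using TT_hecke[OF ad_mixed(1)] by (intro op.span_minimal) auto
  show "hecke r s \<subseteq> op.span (TT r s ` {n. 0 < n})"
  proof
    fix A assume A: "A \<in> hecke r s"
    have "n > 0" if "coord A r s n \<noteq> 0" for n
      using coord_admissible[OF A rs_facts(3,4) that] rs_facts(2) by (simp add: admissible_def)
    then have "(\<Sum>n\<in>{n. coord A r s n \<noteq> 0}. oscale (coord A r s n / kap r s) (TT r s n)) \<in> op.span (TT r s ` {n. 0 < n})"
      by (intro op.span_sum op.span_scale op.span_base) blast
    then show "A \<in> op.span (TT r s ` {n. 0 < n})" unfolding hecke_expand[OF A rs_facts(3,4), symmetric] .
  qed
qed

text \<open>A finite spanning set would bound the size of the independent family of the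
  \<open>T_n\<close>, which is infinite because they are pairwise distinct.\<close>

lemma hecke_infinite: "\<not> (\<exists>B. finite B \<and> module.span oscale B = hecke r s)"
proof
  assume "\<exists>B. finite B \<and> module.span oscale B = hecke r s"
  then obtain B where B: "finite B" "op.span B = hecke r s" by blast
  have "TT r s ` {n. 0 < n} \<subseteq> op.span B" unfolding B(2) TT_span[symmetric] by (rule op.span_superset)
  then have "finite (TT r s ` {n. 0 < n})"
    using op.independent_span_bound[OF B(1) TT_independent] by blast
  then have "finite {n :: nat. 0 < n}" using TT_inj by (rule finite_imageD)
  then show False using infinite_Ioi[of "0 :: nat"] by (simp add: greaterThan_def)
qed

end

end

theorem mainTheorem6:
  fixes p f :: nat
    and Q :: "'f::field_char_0 set"
    and av :: "'f \<Rightarrow> real"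
    and R :: "'f set"
    and w :: 'f
    and emb :: "'f set \<Rightarrow> 'e::alg_closed_field"
    and iota :: "'e tvec set \<Rightarrow> 'e tvec set"
  assumes "prime p" and "p \<noteq> 2"
    and "is_Qp p Q av"
    and "finite_extension Q"
    and "R = ring_of_integers Q av"
    and "is_uniformizer R w"
    and "card (carrier (residue_field R)) = p ^ f"
    and "CHAR('e) = p"
    and "emb \<in> ring_hom (residue_field R) ring_of_type_algebra"
    and "genuine_data.coinv_isomorphism p f R emb iota"
  shows
    "let z = replicate f 0; m = replicate f (p - 1);
         H = genuine_data.hecke p R emb;
         T = genuine_data.hecke_op p f R w emb iota
     in \<forall>r\<in>weights p f. \<forall>s\<in>weights p f.
       (r \<noteq> s \<and> {r, s} \<noteq> {z, m} \<longrightarrow> H r s = {0}) \<and>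
       (\<exists>\<Phi> :: 'e poly \<Rightarrow> ('f, 'e) operator.
          bij_betw \<Phi> UNIV (H r r) \<and>
          (\<forall>P P'. \<Phi> (P + P') = \<Phi> P + \<Phi> P') \<and>
          (\<forall>P P'. \<Phi> (P * P') = \<Phi> P \<circ> \<Phi> P') \<and>
          (\<forall>c P. \<Phi> (Polynomial.smult c P) = oscale c (\<Phi> P)) \<and>
          \<Phi> 1 = genuine_data.hecke_one p R emb r \<and>
          \<Phi> [:0, 1:] = T r r 1) \<and>
       ({r, s} = {z, m} \<longrightarrow>
          \<not> (\<exists>B. finite B \<and> module.span oscale B = H r s) \<and>
          inj_on (T r s) {n. 0 < n} \<and>
          \<not> module.dependent oscale (T r s ` {n. 0 < n}) \<and>
          module.span oscale (T r s ` {n. 0 < n}) = H r s \<and>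
          (\<forall>n m. 0 < n \<longrightarrow> T r s n \<circ> T r r m = T r s (n + m) \<and> T s s m \<circ> T r s n = T r s (n + m)) \<and>
          (\<forall>n m. 0 < n \<longrightarrow> 0 < m \<longrightarrow>
             T r s n \<circ> T s r m = T s s (n + m) \<and> T s r m \<circ> T r s n = T r r (n + m)))"
proof -
  interpret hecke_setting p f Q av R w emb iota
    by unfold_locales (fact assms)+
  have 1: "r \<noteq> s \<and> {r, s} \<noteq> {rz, rm} \<longrightarrow> hecke r s = {0}" if "r \<in> weights p f" "s \<in> weights p f" for r s
    using hecke_trivial[OF that] by (auto simp: compatible_def)
  have 2: "\<exists>\<Phi> :: 'e poly \<Rightarrow> ('f, 'e) operator.
      bij_betw \<Phi> UNIV (hecke r r) \<and>
      (\<forall>P P'. \<Phi> (P + P') = \<Phi> P + \<Phi> P') \<and>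
      (\<forall>P P'. \<Phi> (P * P') = \<Phi> P \<circ> \<Phi> P') \<and>
      (\<forall>c P. \<Phi> (Polynomial.smult c P) = oscale c (\<Phi> P)) \<and>
      \<Phi> 1 = hecke_one r \<and> \<Phi> [:0, 1:] = TT r r 1" if "r \<in> weights p f" for r
    using poly_op_bij[OF that] poly_op_plus[OF that] poly_op_mult[OF that] poly_op_smult[OF that]
      poly_op_1[OF that] poly_op_X[OF that]
    by (intro exI[of _ "poly_op r"] conjI allI)
  have 3: "\<not> (\<exists>B. finite B \<and> module.span oscale B = hecke r s) \<and>
      inj_on (TT r s) {n. 0 < n} \<and>
      \<not> module.dependent oscale (TT r s ` {n. 0 < n}) \<and>
      module.span oscale (TT r s ` {n. 0 < n}) = hecke r s \<and>
      (\<forall>n m. 0 < n \<longrightarrow> TT r s n \<circ> TT r r m = TT r s (n + m) \<and> TT s s m \<circ> TT r s n = TT r s (n + m)) \<and>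
      (\<forall>n m. 0 < n \<longrightarrow> 0 < m \<longrightarrow>
         TT r s n \<circ> TT s r m = TT s s (n + m) \<and> TT s r m \<circ> TT r s n = TT r r (n + m))"
    if rs: "{r, s} = {rz, rm}" for r s
  proof (intro conjI allI impI)
    fix n m :: nat assume n: "0 < n"
    note ad = ad_mixed(1)[OF rs n] ad_self[OF rs_facts(3)[OF rs]] ad_self[OF rs_facts(4)[OF rs]]
    show "TT r s n \<circ> TT r r m = TT r s (n + m)" by (rule TT_comp[OF ad(2,1)])
    show "TT s s m \<circ> TT r s n = TT r s (n + m)" using TT_comp[OF ad(1,3)] by (simp add: add.commute)
  next
    fix n m :: nat assume "0 < n" "0 < m"
    note ad = ad_mixed(1)[OF rs \<open>0 < n\<close>] ad_mixed(2)[OF rs \<open>0 < m\<close>]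
    show "TT r s n \<circ> TT s r m = TT s s (n + m)" by (rule TT_comp[OF ad(2,1)])
    show "TT s r m \<circ> TT r s n = TT r r (n + m)" using TT_comp[OF ad] by (simp add: add.commute)
  qed (fact hecke_infinite[OF rs] TT_inj[OF rs] TT_independent[OF rs] TT_span[OF rs])+
  show ?thesis
    unfolding Let_def by (intro ballI, rule conjI[OF 1 conjI[OF 2 impI[OF 3]]], assumption+)
qed

end
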